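(* Let $\mathbb P\curvearrowleft\mathbb G\to\mathbb X$ be a principal 2-bundle and let $(\theta,B)$ be a connective structure on it. If $(\theta,B)$ is weakly flat (respectively, flat), then the multiplicative horizontal lift $h=(h_c,h_m):\mathbb L(T\mathbb X)\to\mathbb L(\mathrm{At}(\mathbb P))$ defined by the 2-connection $\theta$ is a weak (respectively, strict) morphism of 2-term $L_\infty$-algebras.
   Context: Groupoids: a Lie groupoid is written $\mathbb X=(X_1\rightrightarrows X_0)$ with source $s$, target $t$, and $x*y$ (also $x\cdot y$) defined when $s(x)=t(y)$. A Lie 2-group $\mathbb G=(G_1\rightrightarrows G_0)$ is a (strict) group object in Lie groupoids. Its Lie 2-algebra is $\mathbb g=(\mathfrak g_1\rightrightarrows\mathfrak g_0)$; put $H=\ker(s:G_1\to G_0)$, $\mathfrak h=\mathrm{Lie}(H)=\ker(s_*:\mathfrak g_1\to\mathfrak g_0)$, $\partial=t_*|_{\mathfrak h}:\mathfrak h\to\mathfrak g_0$, so that $\mathfrak g_1=\mathfrak h\oplus\mathfrak g_0$ via the unit map. $\tau:G_0\to GL(\mathfrak h)$ is the representation $\tau_{g_0}=\mathrm{Ad}^{G_1}_{1_{g_0}}|_{\mathfrak h}$. A right action of $\mathbb G$ on a Lie groupoid $\mathbb P$ is a Lie groupoid morphism $\mathbb P\times\mathbb G\to\mathbb P$ that is a right Lie group action on arrows and on objects. A groupoid morphism $\pi:\mathbb P\to\mathbb X$ is a fibration if $\pi_0$ and $P_1\to X_1\times_{s,X_0,\pi_0}P_0$, $p\mapsto(\pi_1(p),s(p))$,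 are surjective submersions. A principal 2-bundle $\mathbb P\curvearrowleft\mathbb G\to\mathbb X$ is a fibration $\pi$ with a right action of $\mathbb G$ on $\mathbb P$ such that $(p,g)\mapsto(p,pg)$ is a Lie groupoid isomorphism $\mathbb P\times\mathbb G\to\mathbb P\times_{\mathbb X}\mathbb P$ (so $P_i\to X_i$ are principal $G_i$-bundles). A 2-connection $\theta$ is a pair of principal connection forms $\theta_i\in\Omega^1(P_i,\mathfrak g_i)$, $i=0,1$, such that $\theta_1:TP_1\to\mathfrak g_1\times P_1$ is a Lie groupoid morphism covering $\theta_0:TP_0\to\mathfrak g_0\times P_0$ (here $TP_1\rightrightarrows TP_0$ is the tangent groupoid). One writes $\theta_1=\bar\theta+s^*\theta_0$ with $\bar\theta\in\Omega^1(P_1,\mathfrak h)$. Its curvature is $\Omega=d\theta_1+\frac12[\theta_1,\theta_1]=\bar\Omega+s^*\Omega_0$ with $\bar\Omega\in\Omega^2(P_1,\mathfrak h)$ and $\Omega_0=d\theta_0+\frac12[\theta_0,\theta_0]\in\Omega^2(P_0,\mathfrak g_0)$. A curving for $\theta$ is a 2-form $B\in\Omega^2(P_0,\mathfrak h)$ that is basic (horizontal and $R_g^*B=\tau_{g^{-1}}B$ for $g\in G_0$) with $\Omega_0+\partial\circ B=0$ and $\bar\Omega+t^*B-s^*B=0$. A connective structure is a pair $(\theta,B)$ of a 2-connection and a curving for it. Its curvature 3-form is the covariant derivative $\nabla^c_{\theta_0}B\in\Omega^3(P_0,\mathfrak h)$, i.e. the horizontal part of $dB$ with respect to $\theta_0$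 (equal to $dB+\tau_*(\theta_0\wedge B)$). $(\theta,B)$ is weakly flat if $\nabla^c_{\theta_0}B=0$, and flat if $B=0$. Multiplicative vector fields: for a Lie groupoid $\mathbb X$, $\mathfrak X_{mult}(\mathbb X)$ is the Lie algebra of pairs $(\xi,u)$, $\xi\in\mathfrak X(X_1)$, $u\in\mathfrak X(X_0)$, with $\xi:\mathbb X\to T\mathbb X$ a groupoid morphism over $u$. $A_{\mathbb X}=\ker(ds)|_{X_0}$ is the Lie algebroid; for $a\in\Gamma(A_{\mathbb X})$, $a^r(x)=a_{t(x)}\cdot0_x$, $a^l(x)=-0_x\cdot(a_{s(x)})^{-1}$ (products and inverses in $T\mathbb X$). $\mathbb L(T\mathbb X)$ is the strict Lie 2-algebra of the crossed module $\delta:\Gamma(A_{\mathbb X})\to\mathfrak X_{mult}(\mathbb X)$, $\delta(a)=a^r-a^l$, with action $D_\xi a=[\xi,a^r]|_{X_0}$. $\mathbb L(\mathrm{At}(\mathbb P))$ is the strict Lie 2-algebra of multiplicative sections of the Atiyah LA-groupoid $T\mathbb P/\mathbb G$, i.e. of the crossed module $\delta:\Gamma(A_{\mathbb P})^{G_0}\to\mathfrak X_{mult}(\mathbb P)^{\mathbb G}$ of invariant objects with the same formulas for $\delta$ and $D$. The kernel of the projection $\mathbb L(\mathrm{At}(\mathbb P))\to\mathbb L(T\mathbb X)$ is identified, via fundamental vector fields, with $C^\infty(P_0,\mathfrak h)^{G_0}\to\mathrm{Hom}_{gpd}(\mathbb P,\mathbb g)^{\mathbb G}$ (equivariant functions/groupoid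 morphisms), $f\mapsto(t^*f-s^*f)+s^*(\partial\circ f)$. Horizontal lift: $h_m:\mathfrak X_{mult}(\mathbb X)\to\mathfrak X_{mult}(\mathbb P)^{\mathbb G}$ sends $(\xi,u)$ to $(\xi^h,u^h)$, the horizontal lifts with respect to $\theta_1,\theta_0$; $h_c:\Gamma(A_{\mathbb X})\to\Gamma(A_{\mathbb P})^{G_0}$ sends $a$ to its $\theta_1$-horizontal lift along the units of $\mathbb P$. One has $\delta h_c=h_m\delta$. $h=(h_c,h_m)$ is a weak morphism if there is a skew-symmetric bilinear map $\Omega_m:\wedge^2\mathfrak X_{mult}(\mathbb X)\to C^\infty(P_0,\mathfrak h)^{G_0}\subseteq\Gamma(A_{\mathbb P})^{G_0}$ such that for all $\xi_i\in\mathfrak X_{mult}(\mathbb X)$, $a\in\Gamma(A_{\mathbb X})$: (1) $h_m[\xi_1,\xi_2]-[h_m\xi_1,h_m\xi_2]=\delta\Omega_m(\xi_1,\xi_2)$; (2) $h_c(D_{\xi_1}a)-D_{h_m(\xi_1)}(h_c(a))=\Omega_m(\xi_1,\delta(a))$; (3) $\big(\Omega_m([\xi_1,\xi_2],\xi_3)-D_{h_m(\xi_1)}\Omega_m(\xi_2,\xi_3)\big)+\text{cyclic permutations}=0$. It is a strict morphism if these hold with $\Omega_m=0$. *)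

theory Defs
  imports "HOL-Analysis.Analysis" "HOL-Library.Function_Algebras"
begin

section \<open>Smooth manifolds\<close>

text \<open>
  Charts take values in a finite-dimensional real normed space. The class \<open>euclidean_space\<close>
  would force the dimension to be positive, so finite-dimensionality is a predicate
  (see \<open>manifold\<close> below), and the following instance provides the model space of the manifolds of
  dimension 0.
\<close>

instantiation unit :: real_normed_vector
begin

definition zero_unit :: unit where "zero_unit = ()"
definition plus_unit :: "unit \<Rightarrow> unit \<Rightarrow> unit" where "plus_unit x y = ()"
definition scaleR_unit :: "real \<Rightarrow> unit \<Rightarrow> unit" where "scaleR_unit r x = ()"
definition norm_unit :: "unit \<Rightarrow> real" where "norm_unit x = 0"
definition dist_unit :: "unit \<Rightarrow> unit \<Rightarrow> real" where "dist_unit x y = 0"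
definition sgn_unit :: "unit \<Rightarrow> unit" where "sgn_unit x = ()"
definition uniformity_unit :: "(unit \<times> unit) filter"
  where "uniformity_unit = (INF e\<in>{0 <..}. principal {(x, y). dist x y < e})"
definition open_unit :: "unit set \<Rightarrow> bool"
  where "open_unit U = (\<forall>x\<in>U. eventually (\<lambda>(x', y). x' = x \<longrightarrow> y \<in> U) uniformity)"

instance
  by standard (simp_all add: uniformity_unit_def open_unit_def norm_unit_def dist_unit_def)

end

lemma finite_span_unit: "\<exists>K :: unit set. finite K \<and> span K = UNIV"
  by (rule exI[of _ UNIV]) (auto intro: span_base)

primrec times_diff :: "nat \<Rightarrow> 'e set \<Rightarrow> ('e::real_normed_vector \<Rightarrow> 'f::real_normed_vector) \<Rightarrow> bool"
  where
    "times_diff 0 U f = continuous_on U f"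
  | "times_diff (Suc k) U f =
      ((\<forall>x\<in>U. f differentiable (at x)) \<and>
       (\<forall>v. times_diff k U (\<lambda>x. frechet_derivative f (at x) v)))"

text \<open>Used for open \<open>U\<close> only.\<close>

definition smooth_on :: "'e set \<Rightarrow> ('e::real_normed_vector \<Rightarrow> 'f::real_normed_vector) \<Rightarrow> bool"
  where "smooth_on U f \<longleftrightarrow> (\<forall>k. times_diff k U f)"

type_synonym ('a, 'e) atlas = "('a set \<times> ('a \<Rightarrow> 'e)) set"

text \<open>A manifold is a type (Hausdorff and second countable by its type classes) with an atlas,
  which need not be maximal.\<close>

definition manifold ::
  "('a::{t2_space,second_countable_topology}, 'e::real_normed_vector) atlas \<Rightarrow> bool"
  where "manifold A \<longleftrightarrow>
    (\<exists>K :: 'e set. finite K \<and> span K = UNIV) \<and>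
    \<Union> (fst ` A) = UNIV \<and>
    (\<forall>(U, \<phi>)\<in>A. open U \<and> open (\<phi> ` U) \<and> inj_on \<phi> U \<and>
        continuous_on U \<phi> \<and> continuous_on (\<phi> ` U) (inv_into U \<phi>)) \<and>
    (\<forall>(U, \<phi>)\<in>A. \<forall>(V, \<psi>)\<in>A. smooth_on (\<phi> ` (U \<inter> V)) (\<psi> \<circ> inv_into U \<phi>))"

definition real_atlas :: "(real, real) atlas"
  where "real_atlas = {(UNIV, id)}"

definition prod_atlas :: "('a, 'e) atlas \<Rightarrow> ('b, 'f) atlas \<Rightarrow> ('a \<times> 'b, 'e \<times> 'f) atlas"
  where "prod_atlas A B = {(U \<times> V, map_prod \<phi> \<psi>) | U \<phi> V \<psi>. (U, \<phi>) \<in> A \<and> (V, \<psi>) \<in> B}"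

text \<open>
  Smoothness of a map defined on a subset \<open>S\<close> of a manifold: locally, the map is the
  restriction to \<open>S\<close> of a smooth map defined on an open set. For an embedded submanifold \<open>S\<close>,
  such as the fibre products below, this is smoothness for the submanifold structure.
\<close>

definition smooth_map ::
  "('a::topological_space, 'e::real_normed_vector) atlas \<Rightarrow> 'a set \<Rightarrow>
   ('b, 'f::real_normed_vector) atlas \<Rightarrow> ('a \<Rightarrow> 'b) \<Rightarrow> bool"
  where "smooth_map A S B F \<longleftrightarrow>
    (\<forall>p\<in>S. \<exists>(U, \<phi>)\<in>A. \<exists>(V, \<psi>)\<in>B. \<exists>W G. open W \<and> p \<in> W \<and> W \<subseteq> U \<and>
       smooth_on (\<phi> ` W) G \<and> (\<forall>x\<in>S \<inter> W. F x \<in> V \<and> \<psi> (F x) = G (\<phi> x)))"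

text \<open>The algebra of smooth functions on a subset; the values outside \<open>S\<close> are unconstrained.\<close>

definition smooth_funs :: "('a::topological_space, 'e::real_normed_vector) atlas \<Rightarrow> 'a set \<Rightarrow> ('a \<Rightarrow> real) set"
  where "smooth_funs A S = {f. smooth_map A S real_atlas f}"


section \<open>Tangent vectors, vector fields, differential forms\<close>

text \<open>
  A tangent vector at \<open>p\<close> is a derivation at \<open>p\<close> of the algebra \<open>C\<close> of smooth functions, made
  unique as a HOL function by the value 0 outside \<open>C\<close>. Sums and differences of
  tangent vectors (and of fields of tangent vectors) are the pointwise ones of functions.
  If \<open>C\<close> is the algebra for a subset \<open>S\<close> and \<open>p \<in> S\<close>, then derivations ignore the values
  outside \<open>S\<close> by the Leibniz rule, so this is the tangent space of \<open>S\<close>.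
\<close>

type_synonym 'a tvec = "('a \<Rightarrow> real) \<Rightarrow> real"

definition tangent :: "('a \<Rightarrow> real) set \<Rightarrow> 'a \<Rightarrow> 'a tvec set"
  where "tangent C p = {v.
    (\<forall>f. f \<notin> C \<longrightarrow> v f = 0) \<and>
    (\<forall>f\<in>C. \<forall>g\<in>C. v (\<lambda>x. f x + g x) = v f + v g) \<and>
    (\<forall>c. \<forall>f\<in>C. v (\<lambda>x. c * f x) = c * v f) \<and>
    (\<forall>f\<in>C. \<forall>g\<in>C. v (\<lambda>x. f x * g x) = f p * v g + g p * v f)}"

definition vscale :: "real \<Rightarrow> 'a tvec \<Rightarrow> 'a tvec"
  where "vscale c v = (\<lambda>f. c * v f)"

text \<open>The differential of a map \<open>F\<close> into the manifold with function algebra \<open>D\<close>.\<close>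

definition tmap :: "('b \<Rightarrow> real) set \<Rightarrow> ('a \<Rightarrow> 'b) \<Rightarrow> 'a tvec \<Rightarrow> 'b tvec"
  where "tmap D F v = (\<lambda>g. if g \<in> D then v (g \<circ> F) else 0)"

definition submersion ::
  "'a set \<Rightarrow> ('a \<Rightarrow> real) set \<Rightarrow> ('b \<Rightarrow> real) set \<Rightarrow> ('a \<Rightarrow> 'b) \<Rightarrow> bool"
  where "submersion S C D F \<longleftrightarrow> (\<forall>p\<in>S. tmap D F ` tangent C p = tangent D (F p))"

definition vector_fields :: "('a \<Rightarrow> real) set \<Rightarrow> ('a \<Rightarrow> 'a tvec) set"
  where "vector_fields C = {X. (\<forall>p. X p \<in> tangent C p) \<and> (\<forall>f\<in>C. (\<lambda>p. X p f) \<in> C)}"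

definition vf_bracket :: "('a \<Rightarrow> real) set \<Rightarrow> ('a \<Rightarrow> 'a tvec) \<Rightarrow> ('a \<Rightarrow> 'a tvec) \<Rightarrow> 'a \<Rightarrow> 'a tvec"
  where "vf_bracket C X Y =
    (\<lambda>p f. if f \<in> C then X p (\<lambda>q. Y q f) - Y p (\<lambda>q. X q f) else 0)"

text \<open>
  Forms on the manifold with function algebra \<open>C\<close>, with values in a subspace \<open>V\<close> of a tangent
  space of the manifold with function algebra \<open>D\<close> (below: a Lie algebra, as the tangent space at
  the identity). The linear functionals on such a \<open>V\<close> are the evaluations at functions
  \<open>\<phi> \<in> D\<close>, whence the form of the smoothness condition.
\<close>

definition is_form1 ::
  "('a \<Rightarrow> real) set \<Rightarrow> ('b \<Rightarrow> real) set \<Rightarrow> 'b tvec set \<Rightarrow> ('a \<Rightarrow> 'a tvec \<Rightarrow> 'b tvec) \<Rightarrow> bool"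
  where "is_form1 C D V \<omega> \<longleftrightarrow>
    (\<forall>p. \<forall>v\<in>tangent C p. \<omega> p v \<in> V) \<and>
    (\<forall>p. \<forall>v\<in>tangent C p. \<forall>w\<in>tangent C p. \<omega> p (v + w) = \<omega> p v + \<omega> p w) \<and>
    (\<forall>p c. \<forall>v\<in>tangent C p. \<omega> p (vscale c v) = vscale c (\<omega> p v)) \<and>
    (\<forall>X\<in>vector_fields C. \<forall>\<phi>\<in>D. (\<lambda>p. \<omega> p (X p) \<phi>) \<in> C)"

definition is_form2 ::
  "('a \<Rightarrow> real) set \<Rightarrow> ('b \<Rightarrow> real) set \<Rightarrow> 'b tvec set \<Rightarrow> ('a \<Rightarrow> 'a tvec \<Rightarrow> 'a tvec \<Rightarrow> 'b tvec) \<Rightarrow> bool"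
  where "is_form2 C D V \<omega> \<longleftrightarrow>
    (\<forall>p. \<forall>v\<in>tangent C p. \<forall>w\<in>tangent C p. \<omega> p v w \<in> V \<and> \<omega> p w v = - \<omega> p v w) \<and>
    (\<forall>p. \<forall>u\<in>tangent C p. \<forall>v\<in>tangent C p. \<forall>w\<in>tangent C p.
        \<omega> p (u + v) w = \<omega> p u w + \<omega> p v w) \<and>
    (\<forall>p c. \<forall>v\<in>tangent C p. \<forall>w\<in>tangent C p. \<omega> p (vscale c v) w = vscale c (\<omega> p v w)) \<and>
    (\<forall>X\<in>vector_fields C. \<forall>Y\<in>vector_fields C. \<forall>\<phi>\<in>D. (\<lambda>p. \<omega> p (X p) (Y p) \<phi>) \<in> C)"

text \<open>
  Exterior derivatives by the invariant formula, evaluated at a point after extending the given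
  tangent vectors to vector fields; the choice of the extension is immaterial.
\<close>

definition extend_vec :: "('a \<Rightarrow> real) set \<Rightarrow> 'a \<Rightarrow> 'a tvec \<Rightarrow> 'a \<Rightarrow> 'a tvec"
  where "extend_vec C p v = (SOME X. X \<in> vector_fields C \<and> X p = v)"

definition ext_d1 ::
  "('a \<Rightarrow> real) set \<Rightarrow> ('a \<Rightarrow> 'a tvec \<Rightarrow> 'b tvec) \<Rightarrow> 'a \<Rightarrow> 'a tvec \<Rightarrow> 'a tvec \<Rightarrow> 'b tvec"
  where "ext_d1 C \<omega> p u v =
    (let X = extend_vec C p u; Y = extend_vec C p v in
     (\<lambda>\<phi>. X p (\<lambda>q. \<omega> q (Y q) \<phi>) - Y p (\<lambda>q. \<omega> q (X q) \<phi>) - \<omega> p (vf_bracket C X Y p) \<phi>))"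

definition ext_d2 ::
  "('a \<Rightarrow> real) set \<Rightarrow> ('a \<Rightarrow> 'a tvec \<Rightarrow> 'a tvec \<Rightarrow> 'b tvec) \<Rightarrow>
   'a \<Rightarrow> 'a tvec \<Rightarrow> 'a tvec \<Rightarrow> 'a tvec \<Rightarrow> 'b tvec"
  where "ext_d2 C \<omega> p u v w =
    (let X = extend_vec C p u; Y = extend_vec C p v; Z = extend_vec C p w in
     (\<lambda>\<phi>. X p (\<lambda>q. \<omega> q (Y q) (Z q) \<phi>) - Y p (\<lambda>q. \<omega> q (X q) (Z q) \<phi>)
          + Z p (\<lambda>q. \<omega> q (X q) (Y q) \<phi>)
          - \<omega> p (vf_bracket C X Y p) (Z p) \<phi> + \<omega> p (vf_bracket C X Z p) (Y p) \<phi>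
          - \<omega> p (vf_bracket C Y Z p) (X p) \<phi>))"


section \<open>Lie groupoids\<close>

text \<open>The product \<open>cmp \<X> x y\<close> is meaningful only if \<open>src \<X> x = tgt \<X> y\<close>.\<close>

record ('a, 'e, 'b, 'f) lie_gpd =
  arr_atlas :: "('a, 'e) atlas"
  obj_atlas :: "('b, 'f) atlas"
  src :: "'a \<Rightarrow> 'b"
  tgt :: "'a \<Rightarrow> 'b"
  ident :: "'b \<Rightarrow> 'a"
  cmp :: "'a \<Rightarrow> 'a \<Rightarrow> 'a"
  ginv :: "'a \<Rightarrow> 'a"

definition arr_funs where "arr_funs \<X> = smooth_funs (arr_atlas \<X>) UNIV"
definition obj_funs where "obj_funs \<X> = smooth_funs (obj_atlas \<X>) UNIV"

definition composable :: "('a, 'e, 'b, 'f, 'z) lie_gpd_scheme \<Rightarrow> ('a \<times> 'a) set"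
  where "composable \<X> = {(x, y). src \<X> x = tgt \<X> y}"

definition lie_groupoid ::
  "('a::{t2_space,second_countable_topology}, 'e::real_normed_vector,
    'b::{t2_space,second_countable_topology}, 'f::real_normed_vector, 'z) lie_gpd_scheme \<Rightarrow> bool"
  where "lie_groupoid \<X> \<longleftrightarrow>
    manifold (arr_atlas \<X>) \<and> manifold (obj_atlas \<X>) \<and>
    smooth_map (arr_atlas \<X>) UNIV (obj_atlas \<X>) (src \<X>) \<and>
    smooth_map (arr_atlas \<X>) UNIV (obj_atlas \<X>) (tgt \<X>) \<and>
    submersion UNIV (arr_funs \<X>) (obj_funs \<X>) (src \<X>) \<and>
    submersion UNIV (arr_funs \<X>) (obj_funs \<X>) (tgt \<X>) \<and>
    smooth_map (obj_atlas \<X>) UNIV (arr_atlas \<X>) (ident \<X>) \<and>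
    smooth_map (arr_atlas \<X>) UNIV (arr_atlas \<X>) (ginv \<X>) \<and>
    smooth_map (prod_atlas (arr_atlas \<X>) (arr_atlas \<X>)) (composable \<X>) (arr_atlas \<X>)
      (\<lambda>(x, y). cmp \<X> x y) \<and>
    (\<forall>u. src \<X> (ident \<X> u) = u \<and> tgt \<X> (ident \<X> u) = u) \<and>
    (\<forall>x y. src \<X> x = tgt \<X> y \<longrightarrow>
        src \<X> (cmp \<X> x y) = src \<X> y \<and> tgt \<X> (cmp \<X> x y) = tgt \<X> x) \<and>
    (\<forall>x y z. src \<X> x = tgt \<X> y \<and> src \<X> y = tgt \<X> z \<longrightarrow>
        cmp \<X> (cmp \<X> x y) z = cmp \<X> x (cmp \<X> y z)) \<and>
    (\<forall>x. cmp \<X> (ident \<X> (tgt \<X> x)) x = x \<and> cmp \<X> x (ident \<X> (src \<X> x)) = x) \<and>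
    (\<forall>x. src \<X> (ginv \<X> x) = tgt \<X> x \<and> tgt \<X> (ginv \<X> x) = src \<X> x \<and>
        cmp \<X> x (ginv \<X> x) = ident \<X> (tgt \<X> x) \<and> cmp \<X> (ginv \<X> x) x = ident \<X> (src \<X> x))"

definition prod_gpd ::
  "('a, 'e, 'b, 'f, 'z) lie_gpd_scheme \<Rightarrow> ('c, 'g, 'd, 'h, 'y) lie_gpd_scheme \<Rightarrow>
   ('a \<times> 'c, 'e \<times> 'g, 'b \<times> 'd, 'f \<times> 'h) lie_gpd"
  where "prod_gpd \<X> \<Y> = \<lparr>
    arr_atlas = prod_atlas (arr_atlas \<X>) (arr_atlas \<Y>),
    obj_atlas = prod_atlas (obj_atlas \<X>) (obj_atlas \<Y>),
    src = map_prod (src \<X>) (src \<Y>),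
    tgt = map_prod (tgt \<X>) (tgt \<Y>),
    ident = map_prod (ident \<X>) (ident \<Y>),
    cmp = (\<lambda>(x, y) (x', y'). (cmp \<X> x x', cmp \<Y> y y')),
    ginv = map_prod (ginv \<X>) (ginv \<Y>)\<rparr>"

definition lie_gpd_morphism ::
  "('a::topological_space, 'e::real_normed_vector, 'b::topological_space, 'f::real_normed_vector, 'z)
     lie_gpd_scheme \<Rightarrow>
   ('c, 'g::real_normed_vector, 'd, 'h::real_normed_vector, 'y) lie_gpd_scheme \<Rightarrow>
   ('a \<Rightarrow> 'c) \<Rightarrow> ('b \<Rightarrow> 'd) \<Rightarrow> bool"
  where "lie_gpd_morphism \<X> \<Y> F1 F0 \<longleftrightarrow>
    smooth_map (arr_atlas \<X>) UNIV (arr_atlas \<Y>) F1 \<and>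
    smooth_map (obj_atlas \<X>) UNIV (obj_atlas \<Y>) F0 \<and>
    (\<forall>x. src \<Y> (F1 x) = F0 (src \<X> x) \<and> tgt \<Y> (F1 x) = F0 (tgt \<X> x)) \<and>
    (\<forall>u. F1 (ident \<X> u) = ident \<Y> (F0 u)) \<and>
    (\<forall>x y. src \<X> x = tgt \<X> y \<longrightarrow> F1 (cmp \<X> x y) = cmp \<Y> (F1 x) (F1 y))"

subsection \<open>The tangent groupoid\<close>

abbreviation Tsrc where "Tsrc \<X> \<equiv> tmap (obj_funs \<X>) (src \<X>)"
abbreviation Ttgt where "Ttgt \<X> \<equiv> tmap (obj_funs \<X>) (tgt \<X>)"
abbreviation Tident where "Tident \<X> \<equiv> tmap (arr_funs \<X>) (ident \<X>)"
abbreviation Tginv where "Tginv \<X> \<equiv> tmap (arr_funs \<X>) (ginv \<X>)"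

text \<open>
  The product of \<open>v\<close> at \<open>x\<close> and \<open>w\<close> at \<open>y\<close> in the tangent groupoid, for composable \<open>x\<close>, \<open>y\<close> and
  \<open>Tsrc \<X> v = Ttgt \<X> w\<close>: the differential of the multiplication is applied to the
  tangent vector of the manifold of composable pairs with components \<open>v\<close> and \<open>w\<close>.
\<close>

definition Tcmp ::
  "('a::topological_space, 'e::real_normed_vector, 'b, 'f, 'z) lie_gpd_scheme \<Rightarrow>
   'a \<Rightarrow> 'a tvec \<Rightarrow> 'a \<Rightarrow> 'a tvec \<Rightarrow> 'a tvec"
  where "Tcmp \<X> x v y w = (THE u.
    \<exists>z\<in>tangent (smooth_funs (prod_atlas (arr_atlas \<X>) (arr_atlas \<X>)) (composable \<X>)) (x, y).
      tmap (arr_funs \<X>) fst z = v \<and> tmap (arr_funs \<X>) snd z = w \<and>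
      u = tmap (arr_funs \<X>) (\<lambda>(x, y). cmp \<X> x y) z)"

subsection \<open>Multiplicative vector fields and sections of the Lie algebroid\<close>

type_synonym ('a, 'b) fields = "('a \<Rightarrow> 'a tvec) \<times> ('b \<Rightarrow> 'b tvec)"

definition mult_fields ::
  "('a::topological_space, 'e::real_normed_vector, 'b::topological_space, 'f::real_normed_vector, 'z)
     lie_gpd_scheme \<Rightarrow> ('a, 'b) fields set"
  where "mult_fields \<X> = {(\<xi>, u).
    \<xi> \<in> vector_fields (arr_funs \<X>) \<and> u \<in> vector_fields (obj_funs \<X>) \<and>
    (\<forall>x. Tsrc \<X> (\<xi> x) = u (src \<X> x) \<and> Ttgt \<X> (\<xi> x) = u (tgt \<X> x)) \<and>
    (\<forall>m. \<xi> (ident \<X> m) = Tident \<X> (u m)) \<and>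
    (\<forall>x y. src \<X> x = tgt \<X> y \<longrightarrow> \<xi> (cmp \<X> x y) = Tcmp \<X> x (\<xi> x) y (\<xi> y))}"

definition algd_sections ::
  "('a::topological_space, 'e::real_normed_vector, 'b::topological_space, 'f::real_normed_vector, 'z)
     lie_gpd_scheme \<Rightarrow> ('b \<Rightarrow> 'a tvec) set"
  where "algd_sections \<X> = {a.
    (\<forall>m. a m \<in> tangent (arr_funs \<X>) (ident \<X> m) \<and> Tsrc \<X> (a m) = 0) \<and>
    (\<forall>f\<in>arr_funs \<X>. (\<lambda>m. a m f) \<in> obj_funs \<X>)}"

definition right_inv_field where
  "right_inv_field \<X> a = (\<lambda>x. Tcmp \<X> (ident \<X> (tgt \<X> x)) (a (tgt \<X> x)) x 0)"

definition left_inv_field where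
  "left_inv_field \<X> a = (\<lambda>x. - Tcmp \<X> x 0 (ident \<X> (src \<X> x)) (Tginv \<X> (a (src \<X> x))))"

text \<open>The second component is the field on objects over which \<open>a\<^sup>r - a\<^sup>l\<close> lies.\<close>

definition gpd_delta where
  "gpd_delta \<X> a =
    (\<lambda>x. right_inv_field \<X> a x - left_inv_field \<X> a x, \<lambda>m. Ttgt \<X> (a m))"

definition fields_bracket where
  "fields_bracket \<X> \<Xi> \<Xi>' =
    (vf_bracket (arr_funs \<X>) (fst \<Xi>) (fst \<Xi>'), vf_bracket (obj_funs \<X>) (snd \<Xi>) (snd \<Xi>'))"

definition fields_act where
  "fields_act \<X> \<Xi> a =
    (\<lambda>m. vf_bracket (arr_funs \<X>) (fst \<Xi>) (right_inv_field \<X> a) (ident \<X> m))"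


section \<open>Crossed modules of Lie algebras and their morphisms\<close>

text \<open>Underlying data of a strict Lie 2-algebra; addition is given by the type classes
  of \<open>'c\<close> and \<open>'m\<close>.\<close>

record ('c, 'm) xmod =
  xc :: "'c set"
  xm :: "'m set"
  scale_c :: "real \<Rightarrow> 'c \<Rightarrow> 'c"
  scale_m :: "real \<Rightarrow> 'm \<Rightarrow> 'm"
  xdelta :: "'c \<Rightarrow> 'm"
  xbr :: "'m \<Rightarrow> 'm \<Rightarrow> 'm"
  xact :: "'m \<Rightarrow> 'c \<Rightarrow> 'c"

definition linear_map_on ::
  "'v set \<Rightarrow> (real \<Rightarrow> 'v \<Rightarrow> 'v) \<Rightarrow> 'w set \<Rightarrow> (real \<Rightarrow> 'w \<Rightarrow> 'w) \<Rightarrow>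
   ('v::ab_group_add \<Rightarrow> 'w::ab_group_add) \<Rightarrow> bool"
  where "linear_map_on V sV W sW h \<longleftrightarrow>
    (\<forall>x\<in>V. h x \<in> W) \<and> (\<forall>x\<in>V. \<forall>y\<in>V. h (x + y) = h x + h y) \<and>
    (\<forall>c. \<forall>x\<in>V. h (sV c x) = sW c (h x))"

definition chain_map ::
  "('c::ab_group_add, 'm::ab_group_add) xmod \<Rightarrow> ('d::ab_group_add, 'n::ab_group_add) xmod \<Rightarrow>
   ('c \<Rightarrow> 'd) \<Rightarrow> ('m \<Rightarrow> 'n) \<Rightarrow> bool"
  where "chain_map L L' hc hm \<longleftrightarrow>
    linear_map_on (xc L) (scale_c L) (xc L') (scale_c L') hc \<and>
    linear_map_on (xm L) (scale_m L) (xm L') (scale_m L') hm \<and>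
    (\<forall>a\<in>xc L. hm (xdelta L a) = xdelta L' (hc a))"

definition skew_bilinear ::
  "('c::ab_group_add, 'm::ab_group_add) xmod \<Rightarrow> ('d::ab_group_add, 'n::ab_group_add) xmod \<Rightarrow>
   ('m \<Rightarrow> 'm \<Rightarrow> 'd) \<Rightarrow> bool"
  where "skew_bilinear L L' \<Omega>m \<longleftrightarrow>
    (\<forall>\<xi>\<in>xm L. linear_map_on (xm L) (scale_m L) (xc L') (scale_c L') (\<Omega>m \<xi>)) \<and>
    (\<forall>\<xi>\<in>xm L. \<forall>\<eta>\<in>xm L. \<Omega>m \<eta> \<xi> = - \<Omega>m \<xi> \<eta>)"

definition morphism_eqs ::
  "('c::ab_group_add, 'm::ab_group_add) xmod \<Rightarrow> ('d::ab_group_add, 'n::ab_group_add) xmod \<Rightarrow>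
   ('c \<Rightarrow> 'd) \<Rightarrow> ('m \<Rightarrow> 'n) \<Rightarrow> ('m \<Rightarrow> 'm \<Rightarrow> 'd) \<Rightarrow> bool"
  where "morphism_eqs L L' hc hm \<Omega>m \<longleftrightarrow>
    (\<forall>\<xi>1\<in>xm L. \<forall>\<xi>2\<in>xm L.
        hm (xbr L \<xi>1 \<xi>2) - xbr L' (hm \<xi>1) (hm \<xi>2) = xdelta L' (\<Omega>m \<xi>1 \<xi>2)) \<and>
    (\<forall>\<xi>\<in>xm L. \<forall>a\<in>xc L.
        hc (xact L \<xi> a) - xact L' (hm \<xi>) (hc a) = \<Omega>m \<xi> (xdelta L a)) \<and>
    (\<forall>\<xi>1\<in>xm L. \<forall>\<xi>2\<in>xm L. \<forall>\<xi>3\<in>xm L.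
        (\<Omega>m (xbr L \<xi>1 \<xi>2) \<xi>3 - xact L' (hm \<xi>1) (\<Omega>m \<xi>2 \<xi>3)) +
        (\<Omega>m (xbr L \<xi>2 \<xi>3) \<xi>1 - xact L' (hm \<xi>2) (\<Omega>m \<xi>3 \<xi>1)) +
        (\<Omega>m (xbr L \<xi>3 \<xi>1) \<xi>2 - xact L' (hm \<xi>3) (\<Omega>m \<xi>1 \<xi>2)) = 0)"

text \<open>\<open>K\<close> is the part of \<open>xc L'\<close> in which \<open>\<Omega>m\<close> is required to take its values.\<close>

definition weak_morphism where
  "weak_morphism L L' K hc hm \<longleftrightarrow>
    chain_map L L' hc hm \<and>
    (\<exists>\<Omega>m. skew_bilinear L L' \<Omega>m \<and> (\<forall>\<xi>\<in>xm L. \<forall>\<eta>\<in>xm L. \<Omega>m \<xi> \<eta> \<in> K) \<and>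
      morphism_eqs L L' hc hm \<Omega>m)"

definition strict_morphism where
  "strict_morphism L L' hc hm \<longleftrightarrow> chain_map L L' hc hm \<and> morphism_eqs L L' hc hm (\<lambda>_ _. 0)"

definition section_scale :: "real \<Rightarrow> ('b \<Rightarrow> 'a tvec) \<Rightarrow> 'b \<Rightarrow> 'a tvec"
  where "section_scale c a = (\<lambda>m. vscale c (a m))"

text \<open>The strict Lie 2-algebra of multiplicative sections of the tangent groupoid.\<close>

definition LTan where
  "LTan \<X> = \<lparr>
    xc = algd_sections \<X>,
    xm = mult_fields \<X>,
    scale_c = section_scale,
    scale_m = (\<lambda>c. map_prod (section_scale c) (section_scale c)),
    xdelta = gpd_delta \<X>,
    xbr = fields_bracket \<X>,
    xact = fields_act \<X>\<rparr>"


section \<open>Lie 2-groups\<close>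

record ('a, 'e, 'b, 'f) lie_2gp = "('a, 'e, 'b, 'f) lie_gpd" +
  mul1 :: "'a \<Rightarrow> 'a \<Rightarrow> 'a"
  one1 :: 'a
  inv1 :: "'a \<Rightarrow> 'a"
  mul0 :: "'b \<Rightarrow> 'b \<Rightarrow> 'b"
  one0 :: 'b
  inv0 :: "'b \<Rightarrow> 'b"

definition group_laws :: "('a \<Rightarrow> 'a \<Rightarrow> 'a) \<Rightarrow> 'a \<Rightarrow> ('a \<Rightarrow> 'a) \<Rightarrow> bool"
  where "group_laws m e i \<longleftrightarrow>
    (\<forall>x y z. m (m x y) z = m x (m y z)) \<and> (\<forall>x. m e x = x \<and> m x e = x) \<and>
    (\<forall>x. m (i x) x = e \<and> m x (i x) = e)"

definition lie_2group ::
  "('a::{t2_space,second_countable_topology}, 'e::real_normed_vector,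
    'b::{t2_space,second_countable_topology}, 'f::real_normed_vector) lie_2gp \<Rightarrow> bool"
  where "lie_2group \<G> \<longleftrightarrow>
    lie_groupoid \<G> \<and>
    group_laws (mul1 \<G>) (one1 \<G>) (inv1 \<G>) \<and> group_laws (mul0 \<G>) (one0 \<G>) (inv0 \<G>) \<and>
    lie_gpd_morphism (prod_gpd \<G> \<G>) \<G> (\<lambda>(g, h). mul1 \<G> g h) (\<lambda>(g, h). mul0 \<G> g h) \<and>
    one1 \<G> = ident \<G> (one0 \<G>) \<and>
    lie_gpd_morphism \<G> \<G> (inv1 \<G>) (inv0 \<G>)"

text \<open>The Lie algebra of a Lie group with function algebra \<open>C\<close> and multiplication \<open>m\<close>: the tangent
  space at the identity, with the bracket of the left invariant vector fields
  \<open>v\<^sup>L g = (\<lambda>f. v (\<lambda>h. f (m g h)))\<close>.\<close>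

definition lie_bracket :: "('a \<Rightarrow> real) set \<Rightarrow> ('a \<Rightarrow> 'a \<Rightarrow> 'a) \<Rightarrow> 'a tvec \<Rightarrow> 'a tvec \<Rightarrow> 'a tvec"
  where "lie_bracket C m u v = (\<lambda>f. if f \<in> C
    then u (\<lambda>g. v (\<lambda>h. f (m g h))) - v (\<lambda>g. u (\<lambda>h. f (m g h))) else 0)"

definition adj :: "('a \<Rightarrow> real) set \<Rightarrow> ('a \<Rightarrow> 'a \<Rightarrow> 'a) \<Rightarrow> ('a \<Rightarrow> 'a) \<Rightarrow> 'a \<Rightarrow> 'a tvec \<Rightarrow> 'a tvec"
  where "adj C m i g = tmap C (\<lambda>h. m (m g h) (i g))"

definition g1_alg where "g1_alg \<G> = tangent (arr_funs \<G>) (one1 \<G>)"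
definition g0_alg where "g0_alg \<G> = tangent (obj_funs \<G>) (one0 \<G>)"
definition h_alg where "h_alg \<G> = {v \<in> g1_alg \<G>. Tsrc \<G> v = 0}"

definition bracket1 where "bracket1 \<G> = lie_bracket (arr_funs \<G>) (mul1 \<G>)"
definition bracket0 where "bracket0 \<G> = lie_bracket (obj_funs \<G>) (mul0 \<G>)"
definition Ad1 where "Ad1 \<G> = adj (arr_funs \<G>) (mul1 \<G>) (inv1 \<G>)"
definition Ad0 where "Ad0 \<G> = adj (obj_funs \<G>) (mul0 \<G>) (inv0 \<G>)"
definition tau where "tau \<G> g = Ad1 \<G> (ident \<G> g)"


section \<open>Principal 2-bundles\<close>

record ('p1, 'ep1, 'p0, 'ep0, 'x1, 'ex1, 'x0, 'ex0, 'g1, 'eg1, 'g0, 'eg0) bundle2 =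
  tot :: "('p1, 'ep1, 'p0, 'ep0) lie_gpd"
  base :: "('x1, 'ex1, 'x0, 'ex0) lie_gpd"
  grp :: "('g1, 'eg1, 'g0, 'eg0) lie_2gp"
  pr1 :: "'p1 \<Rightarrow> 'x1"
  pr0 :: "'p0 \<Rightarrow> 'x0"
  act1 :: "'p1 \<Rightarrow> 'g1 \<Rightarrow> 'p1"
  act0 :: "'p0 \<Rightarrow> 'g0 \<Rightarrow> 'p0"

definition right_action_laws :: "('g \<Rightarrow> 'g \<Rightarrow> 'g) \<Rightarrow> 'g \<Rightarrow> ('p \<Rightarrow> 'g \<Rightarrow> 'p) \<Rightarrow> bool"
  where "right_action_laws m e \<rho> \<longleftrightarrow>
    (\<forall>p. \<rho> p e = p) \<and> (\<forall>p g h. \<rho> (\<rho> p g) h = \<rho> p (m g h))"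

definition gpd_fibration where
  "gpd_fibration \<P> \<X> \<pi>1 \<pi>0 \<longleftrightarrow>
    lie_gpd_morphism \<P> \<X> \<pi>1 \<pi>0 \<and>
    surj \<pi>0 \<and> submersion UNIV (obj_funs \<P>) (obj_funs \<X>) \<pi>0 \<and>
    (let Q = {(x, p). src \<X> x = \<pi>0 p} in
      (\<lambda>p. (\<pi>1 p, src \<P> p)) ` UNIV = Q \<and>
      submersion UNIV (arr_funs \<P>) (smooth_funs (prod_atlas (arr_atlas \<X>) (obj_atlas \<P>)) Q)
        (\<lambda>p. (\<pi>1 p, src \<P> p)))"

definition diffeo_onto_subset ::
  "('a::topological_space, 'e::real_normed_vector) atlas \<Rightarrow>
   ('b::topological_space, 'f::real_normed_vector) atlas \<Rightarrow> 'b set \<Rightarrow> ('a \<Rightarrow> 'b) \<Rightarrow> bool"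
  where "diffeo_onto_subset A B S F \<longleftrightarrow>
    bij_betw F UNIV S \<and> smooth_map A UNIV B F \<and> smooth_map B S A (inv_into UNIV F)"

text \<open>
  In the last clause, the fibre product \<open>\<P> \<times>\<^bsub>\<X>\<^esub> \<P>\<close> is a subgroupoid of \<open>\<P> \<times> \<P>\<close>, and a
  morphism into \<open>\<P> \<times> \<P>\<close> that restricts to diffeomorphisms onto the arrows and the objects
  of the fibre product is an isomorphism of Lie groupoids onto it.
\<close>

definition principal_2bundle ::
  "('p1::{t2_space,second_countable_topology}, 'ep1::real_normed_vector,
    'p0::{t2_space,second_countable_topology}, 'ep0::real_normed_vector,
    'x1::{t2_space,second_countable_topology}, 'ex1::real_normed_vector,
    'x0::{t2_space,second_countable_topology}, 'ex0::real_normed_vector,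
    'g1::{t2_space,second_countable_topology}, 'eg1::real_normed_vector,
    'g0::{t2_space,second_countable_topology}, 'eg0::real_normed_vector) bundle2 \<Rightarrow> bool"
  where "principal_2bundle Q \<longleftrightarrow>
    lie_groupoid (tot Q) \<and> lie_groupoid (base Q) \<and> lie_2group (grp Q) \<and>
    gpd_fibration (tot Q) (base Q) (pr1 Q) (pr0 Q) \<and>
    lie_gpd_morphism (prod_gpd (tot Q) (grp Q)) (tot Q)
      (\<lambda>(p, g). act1 Q p g) (\<lambda>(p, g). act0 Q p g) \<and>
    right_action_laws (mul1 (grp Q)) (one1 (grp Q)) (act1 Q) \<and>
    right_action_laws (mul0 (grp Q)) (one0 (grp Q)) (act0 Q) \<and>
    lie_gpd_morphism (prod_gpd (tot Q) (grp Q)) (prod_gpd (tot Q) (tot Q))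
      (\<lambda>(p, g). (p, act1 Q p g)) (\<lambda>(p, g). (p, act0 Q p g)) \<and>
    diffeo_onto_subset (prod_atlas (arr_atlas (tot Q)) (arr_atlas (grp Q)))
      (prod_atlas (arr_atlas (tot Q)) (arr_atlas (tot Q)))
      {(p, q). pr1 Q p = pr1 Q q} (\<lambda>(p, g). (p, act1 Q p g)) \<and>
    diffeo_onto_subset (prod_atlas (obj_atlas (tot Q)) (obj_atlas (grp Q)))
      (prod_atlas (obj_atlas (tot Q)) (obj_atlas (tot Q)))
      {(p, q). pr0 Q p = pr0 Q q} (\<lambda>(p, g). (p, act0 Q p g))"

text \<open>Values at \<open>p\<close> of the fundamental vector fields, and differentials of right translations.\<close>

definition fund1 where "fund1 Q p a = tmap (arr_funs (tot Q)) (act1 Q p) a"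
definition fund0 where "fund0 Q p a = tmap (obj_funs (tot Q)) (act0 Q p) a"
definition Tright1 where "Tright1 Q g = tmap (arr_funs (tot Q)) (\<lambda>p. act1 Q p g)"
definition Tright0 where "Tright0 Q g = tmap (obj_funs (tot Q)) (\<lambda>p. act0 Q p g)"

text \<open>The strict Lie 2-algebra of multiplicative sections of the Atiyah LA-groupoid.\<close>

definition LAt where
  "LAt Q = (LTan (tot Q))
    \<lparr>xc := {a \<in> algd_sections (tot Q).
        \<forall>p g. a (act0 Q p g) = Tright1 Q (ident (grp Q) g) (a p)},
     xm := {(\<xi>, u) \<in> mult_fields (tot Q).
        (\<forall>p g. \<xi> (act1 Q p g) = Tright1 Q g (\<xi> p)) \<and>
        (\<forall>p g. u (act0 Q p g) = Tright0 Q g (u p))}\<rparr>"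

definition equiv_h_funs where
  "equiv_h_funs Q = {f.
    (\<forall>p. f p \<in> h_alg (grp Q)) \<and>
    (\<forall>\<phi>\<in>arr_funs (grp Q). (\<lambda>p. f p \<phi>) \<in> obj_funs (tot Q)) \<and>
    (\<forall>p g. f (act0 Q p g) = tau (grp Q) (inv0 (grp Q) g) (f p))}"

text \<open>The equivariant functions \<open>P\<^sub>0 \<rightarrow> \<hh>\<close>, regarded as sections of the Lie algebroid of
  \<open>\<P>\<close> by means of fundamental vector fields.\<close>

definition vertical_sections where
  "vertical_sections Q = {(\<lambda>p. fund1 Q (ident (tot Q) p) (f p)) | f. f \<in> equiv_h_funs Q}"


section \<open>Connective structures\<close>

definition connection_form1 where
  "connection_form1 Q \<theta> \<longleftrightarrow>
    is_form1 (arr_funs (tot Q)) (arr_funs (grp Q)) (g1_alg (grp Q)) \<theta> \<and>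
    (\<forall>p g. \<forall>v\<in>tangent (arr_funs (tot Q)) p.
        \<theta> (act1 Q p g) (Tright1 Q g v) = Ad1 (grp Q) (inv1 (grp Q) g) (\<theta> p v)) \<and>
    (\<forall>p. \<forall>a\<in>g1_alg (grp Q). \<theta> p (fund1 Q p a) = a)"

definition connection_form0 where
  "connection_form0 Q \<theta> \<longleftrightarrow>
    is_form1 (obj_funs (tot Q)) (obj_funs (grp Q)) (g0_alg (grp Q)) \<theta> \<and>
    (\<forall>p g. \<forall>v\<in>tangent (obj_funs (tot Q)) p.
        \<theta> (act0 Q p g) (Tright0 Q g v) = Ad0 (grp Q) (inv0 (grp Q) g) (\<theta> p v)) \<and>
    (\<forall>p. \<forall>a\<in>g0_alg (grp Q). \<theta> p (fund0 Q p a) = a)"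

text \<open>
  The structure maps of the Lie 2-algebra \<open>\<gg>\<^sub>1 \<rightrightarrows> \<gg>\<^sub>0\<close> are those of the tangent groupoid of the
  Lie 2-group, restricted to the identity elements.
\<close>

definition two_connection where
  "two_connection Q \<theta>1 \<theta>0 \<longleftrightarrow>
    connection_form1 Q \<theta>1 \<and> connection_form0 Q \<theta>0 \<and>
    (\<forall>p. \<forall>v\<in>tangent (arr_funs (tot Q)) p.
        Tsrc (grp Q) (\<theta>1 p v) = \<theta>0 (src (tot Q) p) (Tsrc (tot Q) v) \<and>
        Ttgt (grp Q) (\<theta>1 p v) = \<theta>0 (tgt (tot Q) p) (Ttgt (tot Q) v)) \<and>
    (\<forall>p. \<forall>v\<in>tangent (obj_funs (tot Q)) p.
        \<theta>1 (ident (tot Q) p) (Tident (tot Q) v) = Tident (grp Q) (\<theta>0 p v)) \<and>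
    (\<forall>p q. \<forall>v\<in>tangent (arr_funs (tot Q)) p. \<forall>w\<in>tangent (arr_funs (tot Q)) q.
        src (tot Q) p = tgt (tot Q) q \<and> Tsrc (tot Q) v = Ttgt (tot Q) w \<longrightarrow>
        \<theta>1 (cmp (tot Q) p q) (Tcmp (tot Q) p v q w) =
          Tcmp (grp Q) (one1 (grp Q)) (\<theta>1 p v) (one1 (grp Q)) (\<theta>1 q w))"

text \<open>Here \<open>d\<theta> + (1/2) [\<theta>, \<theta>]\<close> is evaluated with \<open>[\<theta>, \<theta>](v, w) = 2 [\<theta> v, \<theta> w]\<close>.\<close>

definition curv1 where
  "curv1 Q \<theta>1 p v w = ext_d1 (arr_funs (tot Q)) \<theta>1 p v w + bracket1 (grp Q) (\<theta>1 p v) (\<theta>1 p w)"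

definition curv0 where
  "curv0 Q \<theta>0 p v w = ext_d1 (obj_funs (tot Q)) \<theta>0 p v w + bracket0 (grp Q) (\<theta>0 p v) (\<theta>0 p w)"

text \<open>The \<open>\<hh>\<close>-component of the curvature for \<open>\<gg>\<^sub>1 = \<hh> \<oplus> \<gg>\<^sub>0\<close>.\<close>

definition curv_h where
  "curv_h Q \<theta>1 \<theta>0 p v w = curv1 Q \<theta>1 p v w
    - Tident (grp Q) (curv0 Q \<theta>0 (src (tot Q) p) (Tsrc (tot Q) v) (Tsrc (tot Q) w))"

definition curving where
  "curving Q \<theta>1 \<theta>0 B \<longleftrightarrow>
    is_form2 (obj_funs (tot Q)) (arr_funs (grp Q)) (h_alg (grp Q)) B \<and>
    (\<forall>p. \<forall>v\<in>tangent (obj_funs (tot Q)) p. \<forall>w\<in>tangent (obj_funs (tot Q)) p.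
        tmap (obj_funs (base Q)) (pr0 Q) v = 0 \<longrightarrow> B p v w = 0) \<and>
    (\<forall>p g. \<forall>v\<in>tangent (obj_funs (tot Q)) p. \<forall>w\<in>tangent (obj_funs (tot Q)) p.
        B (act0 Q p g) (Tright0 Q g v) (Tright0 Q g w) =
          tau (grp Q) (inv0 (grp Q) g) (B p v w)) \<and>
    (\<forall>p. \<forall>v\<in>tangent (obj_funs (tot Q)) p. \<forall>w\<in>tangent (obj_funs (tot Q)) p.
        curv0 Q \<theta>0 p v w + Ttgt (grp Q) (B p v w) = 0) \<and>
    (\<forall>p. \<forall>v\<in>tangent (arr_funs (tot Q)) p. \<forall>w\<in>tangent (arr_funs (tot Q)) p.
        curv_h Q \<theta>1 \<theta>0 p v w
        + B (tgt (tot Q) p) (Ttgt (tot Q) v) (Ttgt (tot Q) w)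
        - B (src (tot Q) p) (Tsrc (tot Q) v) (Tsrc (tot Q) w) = 0)"

definition connective_structure where
  "connective_structure Q \<theta>1 \<theta>0 B \<longleftrightarrow> two_connection Q \<theta>1 \<theta>0 \<and> curving Q \<theta>1 \<theta>0 B"

definition hor0 where "hor0 Q \<theta>0 p v = v - fund0 Q p (\<theta>0 p v)"

definition curv_3form where
  "curv_3form Q \<theta>0 B p u v w =
    ext_d2 (obj_funs (tot Q)) B p (hor0 Q \<theta>0 p u) (hor0 Q \<theta>0 p v) (hor0 Q \<theta>0 p w)"

definition weakly_flat where
  "weakly_flat Q \<theta>0 B \<longleftrightarrow>
    (\<forall>p. \<forall>u\<in>tangent (obj_funs (tot Q)) p. \<forall>v\<in>tangent (obj_funs (tot Q)) p.
      \<forall>w\<in>tangent (obj_funs (tot Q)) p. curv_3form Q \<theta>0 B p u v w = 0)"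

definition flat where
  "flat Q B \<longleftrightarrow>
    (\<forall>p. \<forall>v\<in>tangent (obj_funs (tot Q)) p. \<forall>w\<in>tangent (obj_funs (tot Q)) p. B p v w = 0)"


section \<open>The multiplicative horizontal lift\<close>

definition lift1 where
  "lift1 Q \<theta>1 p v = (THE w. w \<in> tangent (arr_funs (tot Q)) p \<and>
     tmap (arr_funs (base Q)) (pr1 Q) w = v \<and> \<theta>1 p w = 0)"

definition lift0 where
  "lift0 Q \<theta>0 p v = (THE w. w \<in> tangent (obj_funs (tot Q)) p \<and>
     tmap (obj_funs (base Q)) (pr0 Q) w = v \<and> \<theta>0 p w = 0)"

definition hlift_m where
  "hlift_m Q \<theta>1 \<theta>0 = (\<lambda>(\<xi>, u). (\<lambda>p. lift1 Q \<theta>1 p (\<xi> (pr1 Q p)), \<lambda>p. lift0 Q \<theta>0 p (u (pr0 Q p))))"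

definition hlift_c where
  "hlift_c Q \<theta>1 a = (\<lambda>p. lift1 Q \<theta>1 (ident (tot Q) p) (a (pr0 Q p)))"

end

theory Submission
  imports Defs
begin

text \<open>
  A tangent vector of a principal bundle is determined by its projection and its value under the
  connection form. Since \<open>\<theta>\<^sub>1\<close> and \<open>\<pi>\<close> are compatible with the tangent groupoids, every identity
  between products, inverses and brackets of horizontal lifts reduces to one in the base and one in
  the Lie 2-algebra. In particular \<open>[\<xi>, \<eta>]\<^sup>h - [\<xi>\<^sup>h, \<eta>\<^sup>h]\<close> is the fundamental field of the curvature
  \<open>\<Omega>(\<xi>\<^sup>h, \<eta>\<^sup>h)\<close>, and the equations of a curving give \<open>\<Omega> = s\<^sup>*B - t\<^sup>*B - s\<^sup>*(\<partial> \<circ> B)\<close>, which is \<open>\<delta>(- B)\<close>.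
  Hence \<open>\<Omega>\<^sub>m((\<xi>, u), (\<eta>, w)) = - B(u\<^sup>h, w\<^sup>h)\<close> satisfies the first two equations of a weak morphism, and
  the third says that the horizontal part of \<open>dB\<close> vanishes.

  With tangent vectors as derivations, the geometry needed is that a derivation is a directional
  derivative in a chart (Hadamard's lemma), and that a pair of vectors with the same image is tangent
  to the fibre product of a submersion with a smooth map.
\<close>

section \<open>Smooth maps between normed spaces\<close>

text \<open>Two obstacles shape the development. The product \<open>Tcmp\<close> is a definite
  description over tangent vectors of the set of composable pairs, so nothing can be computed with
  it before such vectors are known to exist and to be unique. And smoothness has to be tested on
  globally smooth functions, while the definition of a bundle supplies no local trivialisations:
  local objects are therefore cut off by bump functions, an identity is first proved up to a smooth
  factor that equals 1 at the point, and the factor is divided out afterwards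
  (\<open>cfuns_divide_local\<close>). This is why frames carry a factor \<open>\<rho>\<close> and
  why linear systems are solved only up to a multiplier. The link to the Lie 2-algebra is that
  \<open>Tcmp\<close> at a unit is the affine expression
  \<open>v + w - Tident \<X> (Tsrc \<X> v)\<close>, so that \<open>\<theta>1\<close> turns products
  of tangent vectors into sums. Arrows and objects of the bundle are two instances of one locale of
  principal bundles with connection. The strict case is the weak one for \<open>B = 0\<close>, where
  the homotopy vanishes.\<close>

lemma times_diff_SucI:
  fixes f :: "'e::real_normed_vector \<Rightarrow> 'f::real_normed_vector"
  assumes "\<And>x. x \<in> U \<Longrightarrow> (f has_derivative f' x) (at x)"
    and "open U" and "\<And>v. times_diff k U (\<lambda>x. f' x v)"
    and cong: "\<And>g h :: 'e \<Rightarrow> 'f. (\<And>x. x \<in> U \<Longrightarrow> g x = h x) \<Longrightarrow> times_diff k U g \<Longrightarrow> times_diff k U h"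
  shows "times_diff (Suc k) U f"
proof -
  have eq: "frechet_derivative f (at x) = f' x" if "x \<in> U" for x
    using frechet_derivative_at[OF assms(1)[OF that]] by simp
  have "times_diff k U (\<lambda>x. frechet_derivative f (at x) v)" for v
    by (rule cong[OF _ assms(3)]) (simp add: eq)
  then show ?thesis
    using assms(1) by (auto simp: differentiable_def)
qed

lemma times_diff_cong:
  assumes "open U" and "\<And>x. x \<in> U \<Longrightarrow> f x = g x" and "times_diff k U f"
  shows "times_diff k U g"
  using assms(2,3)
proof (induction k arbitrary: f g)
  case 0
  then show ?case using continuous_on_cong[of U U f g] by auto
next
  case (Suc k)
  have d: "(g has_derivative frechet_derivative f (at x)) (at x)" if "x \<in> U" for x
    using Suc.prems that \<open>open U\<close>
    by (auto intro: has_derivative_transform_within_open simp: frechet_derivative_works)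
  show ?case
    by (rule times_diff_SucI[OF d \<open>open U\<close>]) (use Suc in auto)
qed

text \<open>The congruence premise is discharged only now. It had to stay a premise of
  \<open>times_diff_SucI\<close> because the proof of \<open>times_diff_cong\<close> applies that
  lemma with its induction hypothesis in this place.\<close>

lemmas times_diff_Suc = times_diff_SucI[OF _ _ _ times_diff_cong]

lemma times_diff_mono: "times_diff k U f \<Longrightarrow> V \<subseteq> U \<Longrightarrow> times_diff k V f"
  by (induction k arbitrary: f) (auto intro: continuous_on_subset)

lemma times_diff_continuous: "times_diff k U f \<Longrightarrow> continuous_on U f"
  by (cases k) (auto intro!: differentiable_imp_continuous_on
      simp: differentiable_on_def differentiable_at_withinI)

lemma times_diff_SucD: "times_diff (Suc k) U f \<Longrightarrow> times_diff k U f"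
proof (induction k arbitrary: f)
  case 0
  then show ?case using times_diff_continuous by (metis times_diff.simps(1))
next
  case (Suc k)
  then show ?case by (metis times_diff.simps(2))
qed

lemma times_diff_local:
  assumes "\<And>x. x \<in> U \<Longrightarrow> \<exists>V. open V \<and> x \<in> V \<and> times_diff k V f"
  shows "times_diff k U f"
  using assms
proof (induction k arbitrary: f)
  case 0
  then show ?case
    by (auto intro!: continuous_at_imp_continuous_on simp: continuous_on_eq_continuous_at) (metis continuous_on_eq_continuous_at)
next
  case (Suc k)
  then show ?case by simp metis
qed

lemma times_diff_const: "open U \<Longrightarrow> times_diff k U (\<lambda>x. c)"
proof (induction k arbitrary: c)
  case (Suc k)
  show ?case by (rule times_diff_Suc[where f'="\<lambda>_ _. 0"]) (use Suc in auto)
qed auto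

lemma times_diff_bounded_linear:
  assumes "bounded_linear f" "open U"
  shows "times_diff k U f"
proof (cases k)
  case 0
  then show ?thesis using assms linear_continuous_on by auto
next
  case (Suc k)
  show ?thesis unfolding Suc
    by (rule times_diff_Suc[where f'="\<lambda>_. f"])
      (use assms times_diff_const in \<open>auto intro: bounded_linear_imp_has_derivative\<close>)
qed

lemma times_diff_compose_linear:
  assumes "bounded_linear l" "times_diff k U f" "open U"
  shows "times_diff k U (\<lambda>x. l (f x))"
  using assms(2)
proof (induction k arbitrary: f)
  case 0
  then show ?case using assms(1) by (auto intro: bounded_linear.continuous_on)
next
  case (Suc k)
  show ?case
    by (rule times_diff_Suc[where f'="\<lambda>x v. l (frechet_derivative f (at x) v)"])
      (use Suc assms in \<open>auto intro: bounded_linear.has_derivative simp: frechet_derivative_works\<close>)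
qed

lemma times_diff_add:
  assumes "open U" "times_diff k U f" "times_diff k U g"
  shows "times_diff k U (\<lambda>x. f x + g x)"
  using assms(2,3)
proof (induction k arbitrary: f g)
  case 0
  then show ?case by (auto intro: continuous_intros)
next
  case (Suc k)
  show ?case
    by (rule times_diff_Suc[where f'="\<lambda>x v. frechet_derivative f (at x) v + frechet_derivative g (at x) v"])
      (use Suc assms in \<open>auto intro: has_derivative_add simp: frechet_derivative_works\<close>)
qed

lemma times_diff_sum:
  assumes "open U" "\<And>i. i \<in> I \<Longrightarrow> times_diff k U (f i)"
  shows "times_diff k U (\<lambda>x. \<Sum>i\<in>I. f i x)"
  using assms(2)
  by (induction I rule: infinite_finite_induct) (auto intro: times_diff_const[OF assms(1)] times_diff_add[OF assms(1)])

lemma times_diff_bilinear: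
  assumes "bounded_bilinear b" "open U" "times_diff k U f" "times_diff k U g"
  shows "times_diff k U (\<lambda>x. b (f x) (g x))"
  using assms(3,4)
proof (induction k arbitrary: f g)
  case 0
  then show ?case using bounded_bilinear.continuous_on[OF assms(1)] by auto
next
  case (Suc k)
  have k: "times_diff k U f" "times_diff k U g"
    using Suc.prems times_diff_SucD by blast+
  show ?case
    by (rule times_diff_Suc[where f'="\<lambda>x v. b (f x) (frechet_derivative g (at x) v) + b (frechet_derivative f (at x) v) (g x)"])
      (use Suc assms k in \<open>auto intro!: times_diff_add bounded_bilinear.FDERIV[OF assms(1)] simp: frechet_derivative_works\<close>)
qed

lemma smooth_on_cong: "open U \<Longrightarrow> (\<And>x. x \<in> U \<Longrightarrow> f x = g x) \<Longrightarrow> smooth_on U f \<Longrightarrow> smooth_on U g"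
  unfolding smooth_on_def using times_diff_cong by blast

lemma smooth_on_subset: "smooth_on U f \<Longrightarrow> V \<subseteq> U \<Longrightarrow> smooth_on V f"
  unfolding smooth_on_def using times_diff_mono by blast

lemma smooth_on_local:
  "(\<And>x. x \<in> U \<Longrightarrow> \<exists>V. open V \<and> x \<in> V \<and> smooth_on V f) \<Longrightarrow> smooth_on U f"
  unfolding smooth_on_def by (metis times_diff_local)

lemma smooth_on_const: "open U \<Longrightarrow> smooth_on U (\<lambda>x. c)"
  unfolding smooth_on_def by (simp add: times_diff_const)

lemma smooth_on_bounded_linear: "bounded_linear f \<Longrightarrow> open U \<Longrightarrow> smooth_on U f"
  unfolding smooth_on_def by (simp add: times_diff_bounded_linear)

lemma smooth_on_compose_linear:
  "bounded_linear l \<Longrightarrow> smooth_on U f \<Longrightarrow> open U \<Longrightarrow> smooth_on U (\<lambda>x. l (f x))"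
  unfolding smooth_on_def by (simp add: times_diff_compose_linear)

lemma smooth_on_add: "open U \<Longrightarrow> smooth_on U f \<Longrightarrow> smooth_on U g \<Longrightarrow> smooth_on U (\<lambda>x. f x + g x)"
  unfolding smooth_on_def by (simp add: times_diff_add)

lemma smooth_on_bilinear:
  "bounded_bilinear b \<Longrightarrow> open U \<Longrightarrow> smooth_on U f \<Longrightarrow> smooth_on U g \<Longrightarrow> smooth_on U (\<lambda>x. b (f x) (g x))"
  unfolding smooth_on_def by (simp add: times_diff_bilinear)

lemmas smooth_on_mult = smooth_on_bilinear[OF bounded_bilinear_mult]

lemma smooth_on_Pair:
  assumes "open U" "smooth_on U f" "smooth_on U g"
  shows "smooth_on U (\<lambda>x. (f x, g x))"
proof -
  have "bounded_linear (\<lambda>x. (x, 0))" "bounded_linear (\<lambda>x. (0, x))"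
    by (auto intro: bounded_linear_Pair bounded_linear_ident bounded_linear_zero)
  from smooth_on_add[OF assms(1) smooth_on_compose_linear[OF this(1) assms(2,1)]
      smooth_on_compose_linear[OF this(2) assms(3,1)]]
  show ?thesis by simp
qed

lemma smooth_on_continuous: "smooth_on U f \<Longrightarrow> continuous_on U f"
  unfolding smooth_on_def using times_diff_continuous by blast

lemma smooth_on_has_derivative:
  assumes "smooth_on U f" "x \<in> U"
  shows "(f has_derivative frechet_derivative f (at x)) (at x)"
proof -
  have "times_diff (Suc 0) U f" using assms(1) unfolding smooth_on_def by blast
  then show ?thesis using assms(2) by (simp add: frechet_derivative_works)
qed

lemma smooth_on_frechet_derivative:
  assumes "smooth_on U f"
  shows "smooth_on U (\<lambda>x. frechet_derivative f (at x) v)"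
  unfolding smooth_on_def
proof
  fix k
  have "times_diff (Suc k) U f" using assms unfolding smooth_on_def by blast
  then show "times_diff k U (\<lambda>x. frechet_derivative f (at x) v)" by simp
qed

section \<open>Finite-dimensional normed spaces\<close>

definition findim :: "'e::real_normed_vector itself \<Rightarrow> bool"
  where "findim T \<longleftrightarrow> (\<exists>K :: 'e set. finite K \<and> span K = UNIV)"

definition fbasis :: "'e::real_normed_vector set"
  where "fbasis = (SOME K. finite K \<and> independent K \<and> span K = UNIV)"

lemma fbasis:
  assumes "findim TYPE('e::real_normed_vector)"
  shows "finite (fbasis :: 'e set)" "independent (fbasis :: 'e set)" "span (fbasis :: 'e set) = UNIV"
proof -
  obtain K :: "'e set" where K: "finite K" "span K = UNIV"
    using assms unfolding findim_def by auto
  obtain L :: "'e set" where L: "independent L" "UNIV \<subseteq> span L"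
    using basis_exists[of "UNIV :: 'e set"] by auto
  have "finite L" using independent_span_bound[OF K(1) L(1)] K(2) by auto
  then have "\<exists>K :: 'e set. finite K \<and> independent K \<and> span K = UNIV" using L by blast
  from someI_ex[OF this] show "finite (fbasis :: 'e set)" "independent (fbasis :: 'e set)" "span (fbasis :: 'e set) = UNIV"
    unfolding fbasis_def by auto
qed

text \<open>A finite index type large enough for a Euclidean space \<open>real ^ 'e idx\<close> that projects onto
  \<open>'e\<close>. The redundant index 0 makes the type nonempty when \<open>'e\<close> has dimension 0.\<close>

typedef (overloaded) ('e::real_normed_vector) idx =
  "if findim TYPE('e) then insert 0 fbasis else {0 :: 'e}"
  by (auto split: if_splits)

instance idx :: (real_normed_vector) finite
proof
  have "UNIV = (Abs_idx :: 'a \<Rightarrow> 'a idx) ` (if findim TYPE('a) then insert 0 fbasis else {0})"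
    using type_definition.Abs_image[OF type_definition_idx, where ?'e1='a] by metis
  moreover have "finite (if findim TYPE('a) then insert 0 fbasis else {0 :: 'a})"
    using fbasis(1) by auto
  ultimately show "finite (UNIV :: 'a idx set)" by (metis finite_imageI)
qed

definition from_eucl :: "real ^ ('e::real_normed_vector) idx \<Rightarrow> 'e"
  where "from_eucl z = (\<Sum>i\<in>UNIV. (z $ i) *\<^sub>R Rep_idx i)"

text \<open>A linear section of \<open>from_eucl\<close>. The coordinate at the redundant index is
  set to 0, so its range is the subspace on which \<open>to_from_eucl\<close> holds.\<close>

definition to_eucl :: "'e::real_normed_vector \<Rightarrow> real ^ 'e idx"
  where "to_eucl x = (\<chi> i. if Rep_idx i \<in> fbasis then representation fbasis x (Rep_idx i) else 0)"

lemma bounded_linear_from_eucl: "bounded_linear (from_eucl :: _ \<Rightarrow> 'e::real_normed_vector)"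
  unfolding from_eucl_def[abs_def]
  by (intro bounded_linear_sum bounded_linear_scaleR_left[THEN bounded_linear_compose] bounded_linear_vec_nth)

lemma sum_representation:
  assumes "findim TYPE('e::real_normed_vector)"
  shows "(\<Sum>b\<in>fbasis. representation fbasis x b *\<^sub>R b) = (x :: 'e)"
  using sum_representation_eq[OF fbasis(2)[OF assms] _ fbasis(1)[OF assms] order_refl, of x] fbasis(3)[OF assms] by auto

lemma from_to_eucl:
  assumes "findim TYPE('e::real_normed_vector)"
  shows "from_eucl (to_eucl x) = (x :: 'e)"
proof -
  let ?K = "fbasis :: 'e set"
  have r: "range (Rep_idx :: 'e idx \<Rightarrow> 'e) = insert 0 ?K"
    using type_definition.Rep_range[OF type_definition_idx, where ?'e1='e] assms by simp
  have inj: "inj (Rep_idx :: 'e idx \<Rightarrow> 'e)" by (meson Rep_idx_inject injI)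
  have "0 \<notin> ?K" using fbasis(2)[OF assms] dependent_zero by blast
  have "from_eucl (to_eucl x) = (\<Sum>i\<in>UNIV. (\<lambda>b. (if b \<in> ?K then representation ?K x b else 0) *\<^sub>R b) (Rep_idx i))"
    unfolding from_eucl_def to_eucl_def by simp
  also have "\<dots> = (\<Sum>b\<in>insert 0 ?K. (if b \<in> ?K then representation ?K x b else 0) *\<^sub>R b)"
    unfolding r[symmetric] by (rule sum.reindex[OF inj, symmetric, unfolded o_def])
  also have "\<dots> = (\<Sum>b\<in>?K. representation ?K x b *\<^sub>R b)"
    using fbasis(1)[OF assms] \<open>0 \<notin> ?K\<close> by (simp add: sum.insert)
  finally show ?thesis using sum_representation[OF assms] by simp
qed

lemma linear_to_eucl:
  assumes "findim TYPE('e::real_normed_vector)"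
  shows "linear (to_eucl :: 'e \<Rightarrow> _)"
  using representation_add[OF fbasis(2)[OF assms]] representation_scale[OF fbasis(2)[OF assms]] fbasis(3)[OF assms]
  by (intro linearI) (auto simp: to_eucl_def vec_eq_iff)

lemma to_from_eucl:
  assumes "findim TYPE('e::real_normed_vector)" "\<And>i. Rep_idx i \<notin> (fbasis :: 'e set) \<Longrightarrow> z $ i = 0"
  shows "to_eucl (from_eucl z :: 'e) = z"
proof -
  let ?K = "fbasis :: 'e set"
  interpret linear "to_eucl :: 'e \<Rightarrow> _" by (rule linear_to_eucl[OF assms(1)])
  have "z $ i *\<^sub>R to_eucl (Rep_idx i :: 'e) = z $ i *\<^sub>R axis i 1" for i
  proof (cases "Rep_idx i \<in> ?K")
    case True
    then show ?thesis
      using representation_basis[OF fbasis(2)[OF assms(1)] True]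
      by (auto simp: vec_eq_iff to_eucl_def axis_def Rep_idx_inject)
  qed (simp add: assms(2))
  then have "to_eucl (from_eucl z :: 'e) = (\<Sum>i\<in>UNIV. z $ i *\<^sub>R axis i 1)"
    by (simp only: from_eucl_def sum scale)
  also have "\<dots> = z" by (simp add: vec_eq_iff axis_def if_distrib sum.delta cong: if_cong)
  finally show ?thesis .
qed

text \<open>Equivalence of norms by compactness: on the unit sphere of the coordinate subspace
  \<open>S\<close> the norm of \<open>from_eucl z\<close> attains a minimum, which is positive
  because \<open>from_eucl\<close> is injective on \<open>S\<close>. Its inverse bounds the
  coordinates.\<close>

lemma bounded_linear_to_eucl:
  assumes "findim TYPE('e::real_normed_vector)"
  shows "bounded_linear (to_eucl :: 'e \<Rightarrow> _)"
proof -
  let ?K = "fbasis :: 'e set"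
  define S where "S = {z :: real ^ 'e idx. \<forall>i. Rep_idx i \<notin> ?K \<longrightarrow> z $ i = 0}"
  have S: "to_eucl x \<in> S" for x :: 'e by (auto simp: S_def to_eucl_def)
  have cS: "closed S" unfolding S_def
    by (intro closed_Collect_all closed_Collect_imp open_Collect_const closed_Collect_eq continuous_intros)
  have cp: "compact (sphere 0 1 \<inter> S)" by (rule compact_Int_closed[OF compact_sphere cS])
  have cont: "continuous_on T (\<lambda>z. norm (from_eucl z :: 'e))" for T
    by (intro continuous_on_norm linear_continuous_on bounded_linear_from_eucl)
  \<comment> \<open>In dimension 0 the subspace is trivial and the sphere in it is empty; any
    positive \<open>m\<close> then serves.\<close>
  have "\<exists>m>0. \<forall>z \<in> sphere 0 1 \<inter> S. m \<le> norm (from_eucl z :: 'e)"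
  proof (cases "sphere 0 1 \<inter> S = {}")
    case False
    obtain w where w: "w \<in> sphere 0 1 \<inter> S" "\<And>z. z \<in> sphere 0 1 \<inter> S \<Longrightarrow> norm (from_eucl w :: 'e) \<le> norm (from_eucl z :: 'e)"
      using continuous_attains_inf[OF cp False cont] by blast
    have "from_eucl w \<noteq> (0 :: 'e)"
    proof
      assume "from_eucl w = (0 :: 'e)"
      then have "w = to_eucl (0 :: 'e)" using to_from_eucl[OF assms, of w] w(1) by (simp add: S_def)
      then have "w = 0" using linear_0[OF linear_to_eucl[OF assms]] by simp
      then show False using w(1) by simp
    qed
    then show ?thesis using w(2) by (intro exI[of _ "norm (from_eucl w :: 'e)"]) auto
  qed (auto intro: exI[of _ 1])
  then obtain m where m: "m > 0" "\<And>z. z \<in> sphere 0 1 \<inter> S \<Longrightarrow> m \<le> norm (from_eucl z :: 'e)" by blast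
  interpret l: linear "to_eucl :: 'e \<Rightarrow> _" by (rule linear_to_eucl[OF assms])
  interpret J: bounded_linear "from_eucl :: _ \<Rightarrow> 'e" by (rule bounded_linear_from_eucl)
  have "norm (to_eucl x) \<le> norm x * (1 / m)" for x :: 'e
  proof (cases "to_eucl x = 0")
    case False
    let ?z = "to_eucl x /\<^sub>R norm (to_eucl x)"
    have "?z \<in> sphere 0 1 \<inter> S" using S[of x] False by (auto simp: S_def)
    from m(2)[OF this] have "m \<le> norm x / norm (to_eucl x)"
      by (simp add: J.scaleR from_to_eucl[OF assms] divide_inverse mult.commute)
    then show ?thesis using False m(1) by (simp add: field_simps)
  qed (use m in auto)
  then show ?thesis
    using l.add l.scale by (intro bounded_linear_intro[where K="1 / m"]) auto
qed

lemma bounded_linear_findim: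
  assumes "findim TYPE('e::real_normed_vector)" and "linear (f :: 'e \<Rightarrow> 'f::real_normed_vector)"
  shows "bounded_linear f"
proof -
  have "linear (f \<circ> from_eucl)"
    using assms(2) bounded_linear.linear[OF bounded_linear_from_eucl] linear_compose by blast
  then have "bounded_linear (f \<circ> from_eucl)" using linear_conv_bounded_linear by blast
  then have "bounded_linear (\<lambda>x. (f \<circ> from_eucl) (to_eucl x))"
    by (rule bounded_linear_compose[OF _ bounded_linear_to_eucl[OF assms(1)]])
  then show ?thesis by (simp add: o_def from_to_eucl[OF assms(1)])
qed

abbreviation coord :: "'e::real_normed_vector \<Rightarrow> 'e \<Rightarrow> real"
  where "coord b x \<equiv> representation fbasis x b"

lemma bounded_linear_coord:
  assumes "findim TYPE('e::real_normed_vector)"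
  shows "bounded_linear (coord (b :: 'e))"
  using representation_add[OF fbasis(2)[OF assms]] representation_scale[OF fbasis(2)[OF assms]] fbasis(3)[OF assms]
  by (intro bounded_linear_findim[OF assms] linearI) auto

lemma findim_prod:
  assumes "findim TYPE('e::real_normed_vector)" "findim TYPE('f::real_normed_vector)"
  shows "findim TYPE('e \<times> 'f)"
proof -
  obtain K :: "'e set" and L :: "'f set" where K: "finite K" "span K = UNIV" and L: "finite L" "span L = UNIV"
    using assms unfolding findim_def by auto
  let ?M = "(\<lambda>x. (x, 0)) ` K \<union> (\<lambda>y. (0, y)) ` L"
  have 1: "linear (\<lambda>x::'e. (x, 0::'f))" "linear (\<lambda>y::'f. (0::'e, y))"
    by (auto intro!: linearI)
  have "(x, 0) \<in> span ?M" "(0, y) \<in> span ?M" for x y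
    using span_mono[of "(\<lambda>x. (x, 0)) ` K" ?M] span_mono[of "(\<lambda>y. (0, y)) ` L" ?M]
      linear_span_image[OF 1(1), of K] linear_span_image[OF 1(2), of L] K(2) L(2) by auto
  then have "(x, 0) + (0, y) \<in> span ?M" for x y using span_add by blast
  then have "span ?M = UNIV" by auto
  then show ?thesis unfolding findim_def using K(1) L(1) by (intro exI[of _ ?M]) auto
qed

lemma findim_euclidean: "findim TYPE('n::euclidean_space)"
  unfolding findim_def using span_Basis finite_Basis by blast

text \<open>The induction runs over all smooth \<open>g\<close> at once. The derivative of the
  composite is \<open>g'\<close> at \<open>f x\<close> applied to \<open>f' x v\<close>; expanding
  \<open>f' x v\<close> in a finite basis turns it into a sum of products of smooth coefficients
  with the composites of \<open>f\<close> and the functions \<open>y \<mapsto> g' y b\<close>, to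
  which the induction hypothesis applies. The finite expansion is the reason for finite dimension of
  the middle space.\<close>

lemma smooth_on_o:
  fixes f :: "'e::real_normed_vector \<Rightarrow> 'f::real_normed_vector" and g :: "'f \<Rightarrow> 'h::real_normed_vector"
  assumes "findim TYPE('f)" "open U" "open V" "smooth_on U f" "smooth_on V g" "f ` U \<subseteq> V"
  shows "smooth_on U (\<lambda>x. g (f x))"
proof -
  have "times_diff k U (\<lambda>x. g (f x))" if "smooth_on V g" for k and g :: "'f \<Rightarrow> 'h"
    using that
  proof (induction k arbitrary: g)
    case 0
    then show ?case
      using continuous_on_compose2[OF smooth_on_continuous[OF 0] smooth_on_continuous[OF assms(4)] assms(6)] by simp
  next
    case (Suc k)
    let ?f' = "\<lambda>x. frechet_derivative f (at x)" and ?g' = "\<lambda>y. frechet_derivative g (at y)"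
    have eq: "?g' (f x) (?f' x v) = (\<Sum>b\<in>fbasis. coord b (?f' x v) *\<^sub>R ?g' (f x) b)" if "x \<in> U" for x v
    proof -
      interpret g': bounded_linear "?g' (f x)"
        using smooth_on_has_derivative[OF Suc.prems, of "f x"] that assms(6) has_derivative_bounded_linear by blast
      show ?thesis
        using sum_representation[OF assms(1), of "?f' x v"] by (metis (no_types, lifting) g'.sum g'.scaleR sum.cong)
    qed
    have "times_diff k U (\<lambda>x. ?g' (f x) (?f' x v))" for v
    proof (rule times_diff_cong[OF assms(2)])
      show "times_diff k U (\<lambda>x. \<Sum>b\<in>fbasis. coord b (?f' x v) *\<^sub>R ?g' (f x) b)"
        using smooth_on_frechet_derivative[OF assms(4), of v]
        by (intro times_diff_sum times_diff_bilinear[OF bounded_bilinear_scaleR] assms(2)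
            times_diff_compose_linear[OF bounded_linear_coord[OF assms(1)]] Suc.IH
            smooth_on_frechet_derivative Suc.prems) (auto simp: smooth_on_def)
    qed (simp add: eq)
    moreover have "((\<lambda>x. g (f x)) has_derivative (\<lambda>v. ?g' (f x) (?f' x v))) (at x)" if "x \<in> U" for x
      using has_derivative_compose[OF smooth_on_has_derivative[OF assms(4) that] smooth_on_has_derivative[OF Suc.prems, of "f x"]]
        that assms(6) by blast
    ultimately show ?case
      by (intro times_diff_Suc[where f'="\<lambda>x v. ?g' (f x) (?f' x v)"] assms(2))
  qed
  then show ?thesis using assms(5) unfolding smooth_on_def by blast
qed

lemma smooth_on_inverse: "smooth_on (- {0}) (inverse :: real \<Rightarrow> real)"
  unfolding smooth_on_def
proof
  fix k
  show "times_diff k (- {0}) (inverse :: real \<Rightarrow> real)"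
  proof (induction k)
    case 0
    then show ?case by (auto intro!: continuous_intros)
  next
    case (Suc k)
    show ?case
      by (rule times_diff_Suc[where f'="\<lambda>x v. - (inverse x * v * inverse x)"])
        (auto intro!: has_derivative_inverse' times_diff_bilinear[OF bounded_bilinear_mult] Suc times_diff_const
          times_diff_compose_linear[OF bounded_linear_minus[OF bounded_linear_ident]])
  qed
qed

section \<open>Hadamard's lemma and bump functions\<close>

text \<open>Differentiation under the integral sign. The chain rule brings out a factor
  \<open>t\<close>; carrying the power \<open>t ^ m\<close> makes this family of integrals closed
  under differentiation, so that smoothness follows by induction.\<close>

lemma has_derivative_integral_ball:
  fixes f :: "'n::euclidean_space \<Rightarrow> real"
  assumes f: "smooth_on (ball 0 r) f" and x: "x \<in> ball 0 r"
  shows "((\<lambda>x. integral {0..1} (\<lambda>t. t ^ m * f (t *\<^sub>R x))) has_derivative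
      (\<lambda>v. integral {0..1} (\<lambda>t. t ^ Suc m * frechet_derivative f (at (t *\<^sub>R x)) v))) (at x)"
proof -
  let ?B = "ball (0 :: 'n) r"
  let ?D = "\<lambda>x t v. t ^ Suc m * frechet_derivative f (at (t *\<^sub>R x)) v"
  have tx: "t *\<^sub>R y \<in> ?B" if "y \<in> ?B" "t \<in> {0..1}" for y t
  proof -
    have "norm (t *\<^sub>R y) \<le> 1 * norm y" using that(2) by (simp add: mult_left_le_one_le)
    then show ?thesis using that(1) by simp
  qed
  have bl: "bounded_linear (?D y t)" if "y \<in> ?B" "t \<in> {0..1}" for y t
    using has_derivative_bounded_linear[OF smooth_on_has_derivative[OF f tx[OF that]]]
    by (intro bounded_linear_const_mult)
  have 1: "((\<lambda>y. t ^ m * f (t *\<^sub>R y)) has_derivative blinfun_apply (Blinfun (?D y t))) (at y within ?B)"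
    if "y \<in> ?B" "t \<in> cbox 0 1" for y t
  proof -
    have "t \<in> {0..1}" using that(2) by simp
    note d = smooth_on_has_derivative[OF f tx[OF that(1) this]]
    have "((\<lambda>y. f (t *\<^sub>R y)) has_derivative (\<lambda>v. frechet_derivative f (at (t *\<^sub>R y)) (t *\<^sub>R v))) (at y)"
      by (rule has_derivative_compose[where f="\<lambda>y. t *\<^sub>R y" and g=f and x=y, OF _ d]) (intro derivative_intros)
    then have "((\<lambda>y. t ^ m * f (t *\<^sub>R y)) has_derivative (\<lambda>v. t ^ m * frechet_derivative f (at (t *\<^sub>R y)) (t *\<^sub>R v))) (at y)"
      by (rule has_derivative_mult_right)
    moreover have "t ^ m * frechet_derivative f (at (t *\<^sub>R y)) (t *\<^sub>R v) = ?D y t v" for v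
      using linear_scale[OF bounded_linear.linear[OF has_derivative_bounded_linear[OF d]]] by simp
    ultimately show ?thesis
      using bounded_linear_Blinfun_apply[OF bl[OF that(1) \<open>t \<in> {0..1}\<close>]]
      by (simp add: has_derivative_at_withinI)
  qed
  have c: "continuous_on (?B \<times> cbox 0 1) (\<lambda>z. g (snd z *\<^sub>R fst z))" if "continuous_on ?B g" for g :: "'n \<Rightarrow> real"
    by (rule continuous_on_compose2[OF that]) (use tx in \<open>auto intro!: continuous_intros\<close>)
  have 2: "(\<lambda>t. t ^ m * f (t *\<^sub>R y)) integrable_on cbox 0 1" if "y \<in> ?B" for y
    by (intro integrable_continuous continuous_on_mult continuous_intros
        continuous_on_compose2[OF smooth_on_continuous[OF f]]) (use tx[OF that] in auto)
  \<comment> \<open>The Leibniz rule asks for the derivative as a continuous family of bounded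
    linear maps; in finite dimension continuity may be checked on basis vectors.\<close>
  have 3: "continuous_on (?B \<times> cbox 0 1) (\<lambda>(x, t). Blinfun (?D x t))"
  proof (rule continuous_on_blinfun_componentwise)
    fix i :: 'n
    have "continuous_on (?B \<times> cbox 0 1) (\<lambda>z. snd z ^ Suc m * frechet_derivative f (at (snd z *\<^sub>R fst z)) i)"
      by (intro continuous_on_mult continuous_intros c smooth_on_continuous smooth_on_frechet_derivative f)
    then show "continuous_on (?B \<times> cbox 0 1) (\<lambda>z. blinfun_apply (case z of (x, t) \<Rightarrow> Blinfun (?D x t)) i)"
      by (rule continuous_on_eq) (auto simp: bounded_linear_Blinfun_apply bl simp del: power_Suc)
  qed
  have int: "(\<lambda>t. Blinfun (?D x t)) integrable_on cbox 0 1"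
  proof (rule integrable_continuous)
    have "continuous_on (cbox (0::real) 1) (\<lambda>t. (x, t))" by (intro continuous_intros)
    from continuous_on_compose2[OF 3 this] show "continuous_on (cbox 0 1) (\<lambda>t. Blinfun (?D x t))"
      using x by (simp add: image_subset_iff)
  qed
  have "((\<lambda>x. integral (cbox 0 1) (\<lambda>t. t ^ m * f (t *\<^sub>R x))) has_derivative
      blinfun_apply (integral (cbox 0 1) (\<lambda>t. Blinfun (?D x t)))) (at x within ?B)"
    by (rule leibniz_rule[OF 1 2 3 x]) auto
  moreover have "blinfun_apply (integral (cbox 0 1) (\<lambda>t. Blinfun (?D x t))) = (\<lambda>v. integral (cbox 0 1) (\<lambda>t. ?D x t v))"
    unfolding fun_eq_iff blinfun_apply_integral[OF int]
    by (intro allI integral_cong) (use x in \<open>auto simp: bounded_linear_Blinfun_apply bl simp del: power_Suc\<close>)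
  ultimately show ?thesis by (simp only: at_within_open[OF x open_ball] cbox_interval)
qed

lemma smooth_on_integral_ball:
  fixes f :: "'n::euclidean_space \<Rightarrow> real"
  assumes "smooth_on (ball 0 r) f"
  shows "smooth_on (ball 0 r) (\<lambda>x. integral {0..1} (\<lambda>t. t ^ m * f (t *\<^sub>R x)))"
  unfolding smooth_on_def
proof
  fix k
  show "times_diff k (ball 0 r) (\<lambda>x. integral {0..1} (\<lambda>t. t ^ m * f (t *\<^sub>R x)))"
    using assms
  proof (induction k arbitrary: f m)
    case 0
    then show ?case
      by (auto intro!: continuous_at_imp_continuous_on has_derivative_continuous[OF has_derivative_integral_ball])
  next
    case (Suc k)
    show ?case
      by (rule times_diff_Suc[OF has_derivative_integral_ball[OF Suc.prems]])
        (auto intro!: Suc.IH smooth_on_frechet_derivative Suc.prems simp del: power_Suc)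
  qed
qed

text \<open>The fundamental theorem of calculus along the segment from 0 to \<open>x\<close>: the
  derivative of \<open>t \<mapsto> f (t x)\<close> is linear in \<open>x\<close>, and integrating
  its components gives the functions \<open>h i\<close>.\<close>

lemma hadamard_euclidean:
  fixes f :: "'n::euclidean_space \<Rightarrow> real"
  assumes f: "smooth_on (ball 0 r) f"
  obtains h where "\<And>i. i \<in> Basis \<Longrightarrow> smooth_on (ball 0 r) (h i)"
    and "\<And>x. x \<in> ball 0 r \<Longrightarrow> f x = f 0 + (\<Sum>i\<in>Basis. (x \<bullet> i) * h i x)"
proof
  let ?h = "\<lambda>i x. integral {0..1} (\<lambda>t. t ^ 0 * frechet_derivative f (at (t *\<^sub>R x)) i)"
  show "smooth_on (ball 0 r) (?h i)" for i
    by (intro smooth_on_integral_ball smooth_on_frechet_derivative f)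
  fix x :: 'n assume x: "x \<in> ball 0 r"
  have tx: "t *\<^sub>R x \<in> ball 0 r" if "t \<in> {0..1}" for t
  proof -
    have "norm (t *\<^sub>R x) \<le> 1 * norm x" using that by (simp add: mult_left_le_one_le)
    then show ?thesis using x by simp
  qed
  note d = smooth_on_has_derivative[OF f tx]
  have "((\<lambda>t. f (t *\<^sub>R x)) has_vector_derivative frechet_derivative f (at (t *\<^sub>R x)) x) (at t within {0..1})"
    if "t \<in> {0..1}" for t
  proof -
    have "((\<lambda>t. t *\<^sub>R x) has_derivative (\<lambda>s. s *\<^sub>R x)) (at t within {0..1})" by (intro derivative_intros)
    from has_derivative_compose[OF this d[OF that]]
    show ?thesis
      unfolding has_vector_derivative_def
      using linear_scale[OF bounded_linear.linear[OF has_derivative_bounded_linear[OF d[OF that]]]] by simp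
  qed
  then have "((\<lambda>t. frechet_derivative f (at (t *\<^sub>R x)) x) has_integral f (1 *\<^sub>R x) - f (0 *\<^sub>R x)) {0..1}"
    by (intro fundamental_theorem_of_calculus) auto
  then have *: "integral {0..1} (\<lambda>t. frechet_derivative f (at (t *\<^sub>R x)) x) = f x - f 0"
    by (simp add: integral_unique)
  have int: "(\<lambda>t. (x \<bullet> i) * frechet_derivative f (at (t *\<^sub>R x)) i) integrable_on {0..1}" for i
    by (intro integrable_continuous_real continuous_on_mult continuous_intros
        continuous_on_compose2[OF smooth_on_continuous[OF smooth_on_frechet_derivative[OF f]]]) (use tx in auto)
  have "integral {0..1} (\<lambda>t. frechet_derivative f (at (t *\<^sub>R x)) x) =
      integral {0..1} (\<lambda>t. \<Sum>i\<in>Basis. (x \<bullet> i) * frechet_derivative f (at (t *\<^sub>R x)) i)"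
  proof (rule integral_cong)
    fix t :: real assume t: "t \<in> {0..1}"
    interpret bounded_linear "frechet_derivative f (at (t *\<^sub>R x))"
      using has_derivative_bounded_linear[OF d[OF t]] .
    show "frechet_derivative f (at (t *\<^sub>R x)) x = (\<Sum>i\<in>Basis. (x \<bullet> i) * frechet_derivative f (at (t *\<^sub>R x)) i)"
      by (subst euclidean_representation[of x, symmetric]) (simp only: sum scaleR real_scaleR_def)
  qed
  also have "\<dots> = (\<Sum>i\<in>Basis. (x \<bullet> i) * ?h i x)"
    by (subst integral_sum) (use int in auto)
  finally show "f x = f 0 + (\<Sum>i\<in>Basis. (x \<bullet> i) * ?h i x)" using * by simp
qed

text \<open>The Euclidean case is applied to \<open>z \<mapsto> f (from_eucl z + a)\<close> and read
  off at \<open>z = to_eucl (x - a)\<close>. Hence the summation runs over the basis of the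
  Euclidean space, and \<open>l i\<close> is the corresponding coordinate of
  \<open>to_eucl\<close>.\<close>

lemma hadamard:
  fixes f :: "'e::real_normed_vector \<Rightarrow> real"
  assumes fd: "findim TYPE('e)" and f: "smooth_on U f" "open U" "a \<in> U"
  obtains V h l where "open V" "a \<in> V" "V \<subseteq> U"
    "\<And>i :: real ^ 'e idx. i \<in> Basis \<Longrightarrow> smooth_on V (h i)"
    "\<And>i :: real ^ 'e idx. i \<in> Basis \<Longrightarrow> bounded_linear (l i)"
    "\<And>x. x \<in> V \<Longrightarrow> f x = f a + (\<Sum>i\<in>(Basis :: (real ^ 'e idx) set). l i (x - a) * h i x)"
proof -
  let ?J = "from_eucl :: real ^ 'e idx \<Rightarrow> 'e" and ?c = "to_eucl :: 'e \<Rightarrow> real ^ 'e idx"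
  have J: "bounded_linear ?J" and c: "bounded_linear ?c"
    using bounded_linear_from_eucl bounded_linear_to_eucl[OF fd] by auto
  let ?g = "\<lambda>z. f (?J z + a)"
  have oJ: "open ((\<lambda>z. ?J z + a) -` U)"
    by (intro open_vimage[OF f(2)] continuous_intros linear_continuous_on[OF J])
  moreover have "0 \<in> (\<lambda>z. ?J z + a) -` U" using f(3) linear_0[OF bounded_linear.linear[OF J]] by simp
  ultimately obtain r where r: "r > 0" "ball 0 r \<subseteq> (\<lambda>z. ?J z + a) -` U"
    using openE by blast
  have "smooth_on (ball 0 r) ?g"
    by (rule smooth_on_o[OF fd _ f(2) _ f(1)])
      (use r in \<open>auto intro!: smooth_on_add[OF _ smooth_on_bounded_linear[OF J]] smooth_on_const\<close>)
  then obtain h where h: "\<And>i. i \<in> Basis \<Longrightarrow> smooth_on (ball 0 r) (h i)"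
    "\<And>x. x \<in> ball 0 r \<Longrightarrow> ?g x = ?g 0 + (\<Sum>i\<in>Basis. (x \<bullet> i) * h i x)"
    using hadamard_euclidean by blast
  define V where "V = (\<lambda>x. ?c (x - a)) -` ball 0 r"
  have cont: "continuous_on UNIV (\<lambda>x. ?c (x - a))"
    by (intro continuous_on_compose2[OF linear_continuous_on[OF c]] continuous_intros) auto
  have oV: "open V" unfolding V_def by (intro open_vimage cont) auto
  have V: "x \<in> U" if "x \<in> V" for x
    using that r(2) from_to_eucl[OF fd, of "x - a"] by (auto simp: V_def)
  show thesis
  proof (rule that[of V "\<lambda>i x. h i (?c (x - a))" "\<lambda>i x. ?c x \<bullet> i"])
    show "a \<in> V" using r(1) linear_0[OF bounded_linear.linear[OF c]] by (simp add: V_def)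
    show "smooth_on V (\<lambda>x. h i (?c (x - a)))" if "i \<in> Basis" for i
    proof (rule smooth_on_o[OF findim_euclidean oV open_ball _ h(1)[OF that]])
      have "smooth_on V (\<lambda>x. ?c x + ?c (- a))"
        by (intro smooth_on_add smooth_on_const smooth_on_bounded_linear c oV)
      then show "smooth_on V (\<lambda>x. ?c (x - a))"
        using linear_add[OF bounded_linear.linear[OF c], of _ "- a"] by simp
    qed (auto simp: V_def)
    show "f x = f a + (\<Sum>i\<in>Basis. ?c (x - a) \<bullet> i * h i (?c (x - a)))" if "x \<in> V" for x
      using h(2)[of "?c (x - a)"] that from_to_eucl[OF fd, of "x - a"] linear_0[OF bounded_linear.linear[OF J]]
      by (simp add: V_def)
  qed (use oV V in \<open>auto intro: bounded_linear_compose[OF bounded_linear_inner_left c]\<close>)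
qed

section \<open>Bump functions on finite-dimensional normed spaces\<close>

definition flat_exp :: "nat \<Rightarrow> real \<Rightarrow> real"
  where "flat_exp n t = (if t > 0 then (1 / t) ^ n * exp (- (1 / t)) else 0)"

text \<open>The case \<open>n = 0\<close> is the usual flat function \<open>exp (- 1 / t)\<close>;
  the powers of \<open>1 / t\<close> are there because they make the family closed, up to linear
  combinations, under differentiation.\<close>

lemma flat_exp_has_derivative:
  "(flat_exp n has_derivative (\<lambda>v. (- real n * flat_exp (Suc n) t + flat_exp (n + 2) t) * v)) (at t)"
proof (cases t "0 :: real" rule: linorder_cases)
  case less
  have "((\<lambda>_. 0) has_derivative (\<lambda>v. (- real n * flat_exp (Suc n) t + flat_exp (n + 2) t) * v)) (at t)"
    using less by (auto simp: flat_exp_def)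
  then show ?thesis
    by (rule has_derivative_transform_within_open[of _ _ _ _ "{..<0}"]) (use less in \<open>auto simp: flat_exp_def\<close>)
next
  case greater
  have "((\<lambda>t. (1 / t) ^ n * exp (- (1 / t))) has_real_derivative
      (- real n * flat_exp (Suc n) t + flat_exp (n + 2) t)) (at t)"
  proof -
    have inv: "((\<lambda>t. 1 / t) has_real_derivative - ((1 / t)\<^sup>2)) (at t)"
      using greater by (auto intro!: derivative_eq_intros simp: power2_eq_square field_simps)
    have "((\<lambda>t. (1 / t) ^ n) has_real_derivative - real n * (1 / t) ^ Suc n) (at t)"
    proof (cases n)
      case (Suc k)
      show ?thesis unfolding Suc
        by (rule DERIV_cong[OF DERIV_power_Suc[OF inv]]) (simp add: power2_eq_square algebra_simps diff_divide_distrib add_divide_distrib)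
    qed simp
    moreover have "((\<lambda>t. exp (- (1 / t))) has_real_derivative exp (- (1 / t)) * (1 / t)\<^sup>2) (at t)"
      using DERIV_chain2[OF DERIV_exp DERIV_minus[OF inv]] by simp
    ultimately show ?thesis
      by (rule DERIV_cong[OF DERIV_mult]) (use greater in \<open>simp add: flat_exp_def power2_eq_square algebra_simps\<close>)
  qed
  then have "((\<lambda>t. (1 / t) ^ n * exp (- (1 / t))) has_derivative
      (\<lambda>v. (- real n * flat_exp (Suc n) t + flat_exp (n + 2) t) * v)) (at t)"
    by (simp add: has_field_derivative_def mult.commute[of _ "- real n * _ + _"])
  then show ?thesis
    by (rule has_derivative_transform_within_open[of _ _ _ _ "{0<..}"]) (use greater in \<open>auto simp: flat_exp_def\<close>)
next
  case equal
  \<comment> \<open>The difference quotient at 0: from the right it is a power of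
    \<open>1 / t\<close> divided by \<open>exp (1 / t)\<close>, which tends to 0, and from the left
    it is constantly 0.\<close>
  have "((\<lambda>y. flat_exp n y / y) \<longlongrightarrow> 0) (at 0)"
  proof -
    have "filterlim (\<lambda>t::real. 1 / t) at_top (at_right 0)"
      using filterlim_inverse_at_top_right by (simp add: inverse_eq_divide)
    then have "((\<lambda>t::real. (1 / t) ^ Suc n / exp (1 / t)) \<longlongrightarrow> 0) (at_right 0)"
      using tendsto_power_div_exp_0 filterlim_compose by blast
    moreover have "eventually (\<lambda>t. (1 / t) ^ Suc n / exp (1 / t) = flat_exp n t / t) (at_right 0)"
      by (auto simp: eventually_at_filter flat_exp_def exp_minus field_simps)
    ultimately have "((\<lambda>y. flat_exp n y / y) \<longlongrightarrow> 0) (at_right 0)"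
      by (rule Lim_transform_eventually)
    moreover have "((\<lambda>y. flat_exp n y / y) \<longlongrightarrow> 0) (at_left 0)"
      by (rule Lim_transform_eventually[OF tendsto_const]) (auto simp: eventually_at_filter flat_exp_def)
    ultimately show ?thesis by (simp add: filterlim_split_at)
  qed
  then have "(flat_exp n has_real_derivative 0) (at 0)"
    by (simp add: has_field_derivative_iff flat_exp_def[of _ 0])
  then show ?thesis using equal by (simp add: has_field_derivative_def flat_exp_def[of _ 0] flip: lambda_zero)
qed

lemma smooth_on_flat_exp: "smooth_on UNIV (flat_exp n)"
  unfolding smooth_on_def
proof
  fix k show "times_diff k UNIV (flat_exp n)"
  proof (induction k arbitrary: n)
    case 0
    then show ?case
      by (auto intro!: continuous_at_imp_continuous_on has_derivative_continuous[OF flat_exp_has_derivative])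
  next
    case (Suc k)
    have "times_diff k UNIV (\<lambda>t. (- real n * flat_exp (Suc n) t + flat_exp (n + 2) t) * v)" for v
      by (intro times_diff_add times_diff_bilinear[OF bounded_bilinear_mult] times_diff_const Suc open_UNIV)
    then show ?case
      by (intro times_diff_Suc[OF flat_exp_has_derivative] open_UNIV)
  qed
qed

definition smooth_step :: "real \<Rightarrow> real"
  where "smooth_step t = flat_exp 0 t * inverse (flat_exp 0 t + flat_exp 0 (1 - t))"

lemma smooth_on_smooth_step: "smooth_on UNIV smooth_step"
proof -
  have pos: "flat_exp 0 t + flat_exp 0 (1 - t) \<noteq> 0" for t
    using add_pos_pos[OF exp_gt_zero exp_gt_zero, of "- (1 / t)" "- (1 / (1 - t))"]
    by (auto simp: flat_exp_def)
  have 1: "smooth_on UNIV (\<lambda>t. flat_exp 0 (1 - t))"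
    by (rule smooth_on_o[OF findim_euclidean open_UNIV open_UNIV _ smooth_on_flat_exp])
      (auto intro!: smooth_on_add smooth_on_const smooth_on_bounded_linear[OF bounded_linear_minus[OF bounded_linear_ident]]
        simp: diff_conv_add_uminus simp del: add_uminus_conv_diff)
  have "smooth_on UNIV (\<lambda>t. inverse (flat_exp 0 t + flat_exp 0 (1 - t)))"
    by (rule smooth_on_o[OF findim_euclidean open_UNIV _ _ smooth_on_inverse])
      (use pos in \<open>auto intro!: smooth_on_add smooth_on_flat_exp 1\<close>)
  then show ?thesis
    unfolding smooth_step_def[abs_def] by (intro smooth_on_mult smooth_on_flat_exp) auto
qed

lemma smooth_step_eq: "t \<le> 0 \<Longrightarrow> smooth_step t = 0" "t \<ge> 1 \<Longrightarrow> smooth_step t = 1"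
  by (auto simp: smooth_step_def flat_exp_def)

lemma bump_findim:
  fixes a :: "'e::real_normed_vector"
  assumes fd: "findim TYPE('e)" and U: "open U" "a \<in> U"
  obtains \<beta> :: "'e \<Rightarrow> real" and V K where "smooth_on UNIV \<beta>" "open V" "a \<in> V" "V \<subseteq> K" "compact K" "K \<subseteq> U"
    "\<And>x. x \<in> V \<Longrightarrow> \<beta> x = 1" "\<And>x. x \<notin> K \<Longrightarrow> \<beta> x = 0"
proof -
  let ?J = "from_eucl :: real ^ 'e idx \<Rightarrow> 'e" and ?c = "to_eucl :: 'e \<Rightarrow> real ^ 'e idx"
  have J: "bounded_linear ?J" and c: "bounded_linear ?c"
    using bounded_linear_from_eucl bounded_linear_to_eucl[OF fd] by auto
  have "open ((\<lambda>z. ?J z + a) -` U)"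
    by (intro open_vimage[OF U(1)] continuous_intros linear_continuous_on[OF J])
  moreover have "0 \<in> (\<lambda>z. ?J z + a) -` U" using U(2) linear_0[OF bounded_linear.linear[OF J]] by simp
  ultimately obtain r where r: "r > 0" "cball 0 r \<subseteq> (\<lambda>z. ?J z + a) -` U"
    using open_contains_cball by blast
  \<comment> \<open>The squared distance from \<open>a\<close> in Euclidean coordinates, in units of
    \<open>r\<close>. The argument \<open>2 - 2 * ?n x\<close> of the step is at least 1 for
    \<open>?n x \<le> 1 / 2\<close> and at most 0 for \<open>?n x \<ge> 1\<close>; so
    \<open>?V\<close> is the open set \<open>?n x < 1 / 2\<close>, and \<open>?K\<close> is a
    compact set containing all \<open>x\<close> with \<open>?n x \<le> 1\<close>.\<close>
  let ?n = "\<lambda>x. ?c (x - a) \<bullet> ?c (x - a) / r\<^sup>2"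
  let ?K = "(\<lambda>z. ?J z + a) ` cball 0 r"
  have sc: "smooth_on UNIV (\<lambda>x. ?c (x - a))"
  proof -
    have "smooth_on UNIV (\<lambda>x. ?c x + ?c (- a))"
      by (intro smooth_on_add smooth_on_const smooth_on_bounded_linear c) auto
    then show ?thesis using linear_add[OF bounded_linear.linear[OF c], of _ "- a"] by simp
  qed
  have "smooth_on UNIV (\<lambda>x. (- 2 / r\<^sup>2) * (?c (x - a) \<bullet> ?c (x - a)) + 2)"
    by (intro smooth_on_add smooth_on_mult smooth_on_const smooth_on_bilinear[OF bounded_bilinear_inner] sc) auto
  then have s: "smooth_on UNIV (\<lambda>x. 2 - 2 * ?n x)" by (simp add: algebra_simps)
  let ?V = "(\<lambda>x. 2 - 2 * ?n x) -` {1<..}"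
  have K: "x \<in> ?K" if "?n x \<le> 1" for x
  proof -
    have "(norm (?c (x - a)))\<^sup>2 \<le> r\<^sup>2" using that r(1) by (simp add: power2_norm_eq_inner field_simps)
    then have "norm (?c (x - a)) \<le> r" using r(1) by (auto intro: power2_le_imp_le)
    then have "?c (x - a) \<in> cball 0 r" by (simp only: mem_cball dist_0_norm)
    moreover have "x = ?J (?c (x - a)) + a" using from_to_eucl[OF fd, of "x - a"] by simp
    ultimately show ?thesis by (intro image_eqI)
  qed
  show thesis
  proof (rule that[of "\<lambda>x. smooth_step (2 - 2 * ?n x)" ?V ?K])
    show "smooth_on UNIV (\<lambda>x. smooth_step (2 - 2 * ?n x))"
      by (rule smooth_on_o[OF findim_euclidean open_UNIV open_UNIV s smooth_on_smooth_step]) auto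
    show "open ?V" by (rule open_vimage[OF _ smooth_on_continuous[OF s]]) auto
    show "compact ?K"
      by (intro compact_continuous_image compact_cball continuous_intros linear_continuous_on[OF J])
    show "smooth_step (2 - 2 * ?n x) = 0" if "x \<notin> ?K" for x
      using K[of x] that by (intro smooth_step_eq) linarith
    show "?V \<subseteq> ?K"
    proof
      fix x assume "x \<in> ?V"
      then show "x \<in> ?K" by (intro K) simp
    qed
  qed (use r in \<open>auto intro: smooth_step_eq simp: linear_0[OF bounded_linear.linear[OF c]]\<close>)
qed

section \<open>Manifolds and smooth maps\<close>

lemma manifold_findim:
  "manifold (A :: ('a::{t2_space,second_countable_topology}, 'e::real_normed_vector) atlas) \<Longrightarrow> findim TYPE('e)"
  unfolding manifold_def findim_def by blast

lemma manifold_cover: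
  assumes "manifold A"
  obtains U \<phi> where "(U, \<phi>) \<in> A" "p \<in> U"
proof -
  have "p \<in> \<Union> (fst ` A)" using assms unfolding manifold_def by simp
  then show ?thesis using that by auto
qed

lemma manifold_chart:
  assumes "manifold A" "(U, \<phi>) \<in> A"
  shows "open U" "open (\<phi> ` U)" "inj_on \<phi> U" "continuous_on U \<phi>" "continuous_on (\<phi> ` U) (inv_into U \<phi>)"
  using assms unfolding manifold_def by blast+

lemma manifold_transition:
  assumes "manifold A" "(U, \<phi>) \<in> A" "(V, \<psi>) \<in> A"
  shows "smooth_on (\<phi> ` (U \<inter> V)) (\<lambda>y. \<psi> (inv_into U \<phi> y))"
  using assms unfolding manifold_def o_def by blast

lemma chart_open_image:
  assumes "manifold A" "(U, \<phi>) \<in> A" "open W" "W \<subseteq> U"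
  shows "open (\<phi> ` W)"
proof -
  note c = manifold_chart[OF assms(1,2)]
  have "\<phi> ` W = \<phi> ` U \<inter> inv_into U \<phi> -` W"
    using assms(4) c(3) by (auto simp: inv_into_f_f subset_iff)
  then show ?thesis using continuous_open_preimage[OF c(5,2) assms(3)] by simp
qed

lemma chart_inv [simp]:
  "manifold A \<Longrightarrow> (U, \<phi>) \<in> A \<Longrightarrow> q \<in> U \<Longrightarrow> inv_into U \<phi> (\<phi> q) = q"
  using manifold_chart(3) inv_into_f_f by metis

lemma smooth_map_iff:
  "smooth_map A S B F \<longleftrightarrow> (\<forall>p\<in>S. \<exists>U \<phi> V \<psi> W G. (U, \<phi>) \<in> A \<and> (V, \<psi>) \<in> B \<and> open W \<and> p \<in> W \<and> W \<subseteq> U \<and>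
       smooth_on (\<phi> ` W) G \<and> (\<forall>x. x \<in> S \<longrightarrow> x \<in> W \<longrightarrow> F x \<in> V \<and> \<psi> (F x) = G (\<phi> x)))"
  unfolding smooth_map_def Bex_def by (simp add: split_paired_Ex Ball_def imp_conjL)

text \<open>Smoothness is defined by some pair of charts at each point; composition with transition
  maps on both sides moves the local representative to the prescribed pair. The control of the image
  of \<open>G\<close> makes it composable with functions on the target chart.\<close>

lemma smooth_map_in_charts:
  assumes A: "manifold A" and B: "manifold B" and F: "smooth_map A S B F" and p: "p \<in> S"
    and U: "(U, \<phi>) \<in> A" "p \<in> U" and V: "(V, \<psi>) \<in> B" "F p \<in> V"
  obtains W G where "open W" "p \<in> W" "W \<subseteq> U" "smooth_on (\<phi> ` W) G" "G ` \<phi> ` W \<subseteq> \<psi> ` V"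
    "\<And>x. x \<in> S \<Longrightarrow> x \<in> W \<Longrightarrow> F x \<in> V" "\<And>x. x \<in> S \<Longrightarrow> x \<in> W \<Longrightarrow> \<psi> (F x) = G (\<phi> x)"
proof -
  obtain U' \<phi>' V' \<psi>' W' G' where 1: "(U', \<phi>') \<in> A" "(V', \<psi>') \<in> B" "open W'" "p \<in> W'" "W' \<subseteq> U'"
    "smooth_on (\<phi>' ` W') G'" "\<And>x. x \<in> S \<Longrightarrow> x \<in> W' \<Longrightarrow> F x \<in> V' \<and> \<psi>' (F x) = G' (\<phi>' x)"
    using bspec[OF F[unfolded smooth_map_iff] p] by (elim exE conjE) blast
  let ?T = "\<psi>' ` (V' \<inter> V)"
  \<comment> \<open>\<open>G'\<close> agrees with \<open>F\<close> only at points of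
    \<open>S\<close>; elsewhere its values may leave the target chart. \<open>W\<close> is cut down
    to the points where they stay in the overlap \<open>?T\<close>.\<close>
  define W where "W = (W' \<inter> (\<lambda>x. G' (\<phi>' x)) -` ?T) \<inter> U"
  have oT: "open ?T"
    by (rule chart_open_image[OF B 1(2)]) (auto intro: manifold_chart(1)[OF B 1(2)] manifold_chart(1)[OF B V(1)])
  have "continuous_on W' (\<lambda>x. G' (\<phi>' x))"
    by (rule continuous_on_compose2[OF smooth_on_continuous[OF 1(6)] continuous_on_subset[OF manifold_chart(4)[OF A 1(1)] 1(5)]]) auto
  then have oW: "open W"
    unfolding W_def by (intro open_Int continuous_open_preimage 1(3) oT manifold_chart(1)[OF A U(1)])
  let ?G = "\<lambda>y. \<psi> (inv_into V' \<psi>' (G' (\<phi>' (inv_into U \<phi> y))))"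
  show thesis
  proof (rule that[of W ?G])
    show "p \<in> W" using 1(4) U(2) 1(7)[OF p 1(4)] V(2) imageI[of "F p" "V' \<inter> V" \<psi>'] by (simp add: W_def)
    show "W \<subseteq> U" by (auto simp: W_def)
    have WU: "W \<subseteq> U \<inter> U'" "W \<subseteq> W'" using 1(5) by (auto simp: W_def)
    have oimg: "open (\<phi> ` W)" by (rule chart_open_image[OF A U(1) oW \<open>W \<subseteq> U\<close>])
    have s1: "smooth_on (\<phi> ` W) (\<lambda>y. \<phi>' (inv_into U \<phi> y))"
      by (rule smooth_on_subset[OF manifold_transition[OF A U(1) 1(1)]]) (use WU in auto)
    have s2: "smooth_on (\<phi> ` W) (\<lambda>y. G' (\<phi>' (inv_into U \<phi> y)))"
      by (rule smooth_on_o[OF manifold_findim[OF A] oimg _ s1 1(6)])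
        (use WU chart_open_image[OF A 1(1,3,5)] in \<open>auto simp: chart_inv[OF A U(1)] subset_iff\<close>)
    show "smooth_on (\<phi> ` W) ?G"
      by (rule smooth_on_o[OF manifold_findim[OF B] oimg oT s2 manifold_transition[OF B 1(2) V(1)]])
        (use WU in \<open>auto simp: W_def chart_inv[OF A U(1)] subset_iff\<close>)
    show "?G ` \<phi> ` W \<subseteq> \<psi> ` V"
      by (auto simp: W_def chart_inv[OF A U(1)] chart_inv[OF B 1(2)])
    fix x assume x: "x \<in> S" "x \<in> W"
    then have *: "F x \<in> V'" "\<psi>' (F x) = G' (\<phi>' x)" using 1(7)[of x] WU by auto
    moreover have "G' (\<phi>' x) \<in> ?T" using x(2) by (simp add: W_def)
    ultimately show "F x \<in> V" using inj_onD[OF manifold_chart(3)[OF B 1(2)], of "F x"] by auto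
    show "\<psi> (F x) = ?G (\<phi> x)"
      using x(2) * WU by (auto simp: chart_inv[OF A U(1)] chart_inv[OF B 1(2)] simp flip: *(2))
  qed (rule oW)
qed

lemma smooth_map_compose:
  assumes A: "manifold A" and B: "manifold B" and F: "smooth_map A S B F" and G: "smooth_map B T D G"
    and ST: "F ` S \<subseteq> T"
  shows "smooth_map A S D (\<lambda>x. G (F x))"
  unfolding smooth_map_iff
proof
  fix p assume p: "p \<in> S"
  obtain V \<psi> Y \<eta> W2 G2 where 2: "(V, \<psi>) \<in> B" "(Y, \<eta>) \<in> D" "open W2" "F p \<in> W2" "W2 \<subseteq> V"
    "smooth_on (\<psi> ` W2) G2" "\<And>y. y \<in> T \<Longrightarrow> y \<in> W2 \<Longrightarrow> G y \<in> Y \<and> \<eta> (G y) = G2 (\<psi> y)"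
    using bspec[OF G[unfolded smooth_map_iff] subsetD[OF ST imageI[OF p]]] by (elim exE conjE) blast
  obtain U \<phi> where U: "(U, \<phi>) \<in> A" "p \<in> U" using manifold_cover[OF A] .
  obtain W1 G1 where 1: "open W1" "p \<in> W1" "W1 \<subseteq> U" "smooth_on (\<phi> ` W1) G1" "G1 ` \<phi> ` W1 \<subseteq> \<psi> ` V"
    "\<And>x. x \<in> S \<Longrightarrow> x \<in> W1 \<Longrightarrow> F x \<in> V" "\<And>x. x \<in> S \<Longrightarrow> x \<in> W1 \<Longrightarrow> \<psi> (F x) = G1 (\<phi> x)"
    using smooth_map_in_charts[OF A B F p U 2(1)] 2(4,5) by blast
  define W where "W = W1 \<inter> (\<lambda>x. G1 (\<phi> x)) -` \<psi> ` W2"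
  have oT: "open (\<psi> ` W2)" by (rule chart_open_image[OF B 2(1,3,5)])
  have "continuous_on W1 (\<lambda>x. G1 (\<phi> x))"
    by (rule continuous_on_compose2[OF smooth_on_continuous[OF 1(4)] continuous_on_subset[OF manifold_chart(4)[OF A U(1)] 1(3)]]) auto
  then have oW: "open W" unfolding W_def by (intro continuous_open_preimage 1(1) oT)
  have "smooth_on (\<phi> ` W) (\<lambda>y. G2 (G1 y))"
    by (rule smooth_on_o[OF manifold_findim[OF B] _ oT smooth_on_subset[OF 1(4)] 2(6)])
      (use 1(3) in \<open>auto simp: W_def intro!: chart_open_image[OF A U(1)] oW[unfolded W_def]\<close>)
  moreover have "G (F x) \<in> Y \<and> \<eta> (G (F x)) = G2 (G1 (\<phi> x))" if "x \<in> S" "x \<in> W" for x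
  proof -
    have x: "\<psi> (F x) = G1 (\<phi> x)" "F x \<in> V" "G1 (\<phi> x) \<in> \<psi> ` W2" using that 1(6,7) by (auto simp: W_def)
    then have "F x \<in> W2"
      using manifold_chart(3)[OF B 2(1)] 2(5) by (metis image_iff inj_onD subsetD)
    then show ?thesis using 2(7)[of "F x"] ST that x(1) by auto
  qed
  moreover have "p \<in> W" using 1(2) imageI[OF 2(4), of \<psi>] 1(7)[OF p 1(2)] by (simp add: W_def)
  moreover have "W \<subseteq> U" using 1(3) by (auto simp: W_def)
  ultimately show "\<exists>U \<phi> V \<psi> W Ga. (U, \<phi>) \<in> A \<and> (V, \<psi>) \<in> D \<and> open W \<and> p \<in> W \<and> W \<subseteq> U \<and>
       smooth_on (\<phi> ` W) Ga \<and> (\<forall>x. x \<in> S \<longrightarrow> x \<in> W \<longrightarrow> G (F x) \<in> V \<and> \<psi> (G (F x)) = Ga (\<phi> x))"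
    using U(1) 2(2) oW by blast
qed

lemma smooth_map_subset: "smooth_map A S B F \<Longrightarrow> T \<subseteq> S \<Longrightarrow> smooth_map A T B F"
  unfolding smooth_map_iff by (meson subsetD)

lemma smooth_map_cong: "smooth_map A S B F \<Longrightarrow> (\<And>x. x \<in> S \<Longrightarrow> F x = G x) \<Longrightarrow> smooth_map A S B G"
  unfolding smooth_map_iff by simp

lemma smooth_mapI:
  assumes "manifold A"
    and "\<And>p U \<phi>. p \<in> S \<Longrightarrow> (U, \<phi>) \<in> A \<Longrightarrow> p \<in> U \<Longrightarrow> \<exists>V \<psi> W G. (V, \<psi>) \<in> B \<and> open W \<and> p \<in> W \<and> W \<subseteq> U \<and>
       smooth_on (\<phi> ` W) G \<and> (\<forall>x. x \<in> S \<longrightarrow> x \<in> W \<longrightarrow> F x \<in> V \<and> \<psi> (F x) = G (\<phi> x))"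
  shows "smooth_map A S B F"
  unfolding smooth_map_iff
proof
  fix p assume p: "p \<in> S"
  obtain U \<phi> where U: "(U, \<phi>) \<in> A" "p \<in> U" using manifold_cover[OF assms(1)] .
  from assms(2)[OF p U] obtain V \<psi> W G where "(V, \<psi>) \<in> B \<and> open W \<and> p \<in> W \<and> W \<subseteq> U \<and>
       smooth_on (\<phi> ` W) G \<and> (\<forall>x. x \<in> S \<longrightarrow> x \<in> W \<longrightarrow> F x \<in> V \<and> \<psi> (F x) = G (\<phi> x))"
    by (elim exE) (rule that)
  with U(1) show "\<exists>U \<phi> V \<psi> W G. (U, \<phi>) \<in> A \<and> (V, \<psi>) \<in> B \<and> open W \<and> p \<in> W \<and> W \<subseteq> U \<and>
       smooth_on (\<phi> ` W) G \<and> (\<forall>x. x \<in> S \<longrightarrow> x \<in> W \<longrightarrow> F x \<in> V \<and> \<psi> (F x) = G (\<phi> x))"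
    by (intro exI[of _ U] exI[of _ \<phi>] exI[of _ V] exI[of _ \<psi>] exI[of _ W] exI[of _ G]) simp
qed

lemma smooth_map_continuous:
  assumes A: "manifold A" and B: "manifold B" and F: "smooth_map A UNIV B F"
  shows "continuous_on UNIV F"
proof (rule continuous_at_imp_continuous_on, rule ballI)
  fix p :: 'a
  obtain U \<phi> V \<psi> where U: "(U, \<phi>) \<in> A" "p \<in> U" and V: "(V, \<psi>) \<in> B" "F p \<in> V"
    using manifold_cover[OF A] manifold_cover[OF B] by metis
  obtain W G where W: "open W" "p \<in> W" "W \<subseteq> U" "smooth_on (\<phi> ` W) G" "G ` \<phi> ` W \<subseteq> \<psi> ` V"
    "\<And>x. x \<in> UNIV \<Longrightarrow> x \<in> W \<Longrightarrow> F x \<in> V" "\<And>x. x \<in> UNIV \<Longrightarrow> x \<in> W \<Longrightarrow> \<psi> (F x) = G (\<phi> x)"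
    by (rule smooth_map_in_charts[OF A B F UNIV_I U V]) (rule that)
  have "continuous_on W (\<lambda>x. inv_into V \<psi> (G (\<phi> x)))"
    by (rule continuous_on_compose2[OF manifold_chart(5)[OF B V(1)]
          continuous_on_compose2[OF smooth_on_continuous[OF W(4)] continuous_on_subset[OF manifold_chart(4)[OF A U(1)] W(3)]]])
      (use W(5) in auto)
  then have "continuous_on W F"
    by (rule continuous_on_eq) (use W(6,7) in \<open>simp add: chart_inv[OF B V(1)] flip: W(7)\<close>)
  then show "isCont F p" using continuous_on_eq_continuous_at[OF W(1)] W(2) by blast
qed

lemma smooth_map_ident: "manifold A \<Longrightarrow> smooth_map A S A (\<lambda>x. x)"
proof (rule smooth_mapI)
  fix p U \<phi> assume "manifold A" "(U, \<phi>) \<in> A" "p \<in> U"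
  then show "\<exists>V \<psi> W G. (V, \<psi>) \<in> A \<and> open W \<and> p \<in> W \<and> W \<subseteq> U \<and>
       smooth_on (\<phi> ` W) G \<and> (\<forall>x. x \<in> S \<longrightarrow> x \<in> W \<longrightarrow> x \<in> V \<and> \<psi> x = G (\<phi> x))"
    using manifold_chart(1,2)[of A U \<phi>] smooth_on_bounded_linear[OF bounded_linear_ident, of "\<phi> ` U"]
    by (intro exI[of _ U] exI[of _ \<phi>] exI[of _ "\<lambda>y. y"]) auto
qed

lemma smooth_map_const:
  assumes "manifold A" "manifold B"
  shows "smooth_map A S B (\<lambda>x. c)"
proof (rule smooth_mapI[OF assms(1)])
  fix p U \<phi> assume "(U, \<phi>) \<in> A" "p \<in> U"
  moreover obtain V \<psi> where "(V, \<psi>) \<in> B" "c \<in> V" using manifold_cover[OF assms(2)] .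
  ultimately show "\<exists>V \<psi> W G. (V, \<psi>) \<in> B \<and> open W \<and> p \<in> W \<and> W \<subseteq> U \<and>
       smooth_on (\<phi> ` W) G \<and> (\<forall>x. x \<in> S \<longrightarrow> x \<in> W \<longrightarrow> c \<in> V \<and> \<psi> c = G (\<phi> x))"
    using manifold_chart(1,2)[OF assms(1)] smooth_on_const[of "\<phi> ` U" "\<psi> c"]
    by (intro exI[of _ V] exI[of _ \<psi>] exI[of _ U] exI[of _ "\<lambda>_. \<psi> c"]) auto
qed

subsection \<open>Products\<close>

lemma prod_atlasI: "(U, \<phi>) \<in> A \<Longrightarrow> (V, \<psi>) \<in> B \<Longrightarrow> (U \<times> V, map_prod \<phi> \<psi>) \<in> prod_atlas A B"
  unfolding prod_atlas_def by blast

lemma prod_atlasE: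
  assumes "(Y, \<eta>) \<in> prod_atlas A B"
  obtains U \<phi> V \<psi> where "Y = U \<times> V" "\<eta> = map_prod \<phi> \<psi>" "(U, \<phi>) \<in> A" "(V, \<psi>) \<in> B"
  using assms unfolding prod_atlas_def by blast

lemma inv_into_map_prod:
  assumes "inj_on f S" "inj_on g T" "z \<in> map_prod f g ` (S \<times> T)"
  shows "inv_into (S \<times> T) (map_prod f g) z = (inv_into S f (fst z), inv_into T g (snd z))"
proof -
  have "inj_on (map_prod f g) (S \<times> T)" using assms(1,2) by (auto simp: inj_on_def)
  from inv_into_f_f[OF this] show ?thesis using assms by fastforce
qed

lemma smooth_on_fst: "open U \<Longrightarrow> smooth_on U fst" and smooth_on_snd: "open U \<Longrightarrow> smooth_on U snd"
  by (auto intro: smooth_on_bounded_linear bounded_linear_fst bounded_linear_snd)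

lemma manifold_prod:
  assumes A: "manifold (A :: ('a::{t2_space,second_countable_topology}, 'e::real_normed_vector) atlas)"
    and B: "manifold (B :: ('b::{t2_space,second_countable_topology}, 'f::real_normed_vector) atlas)"
  shows "manifold (prod_atlas A B)"
  unfolding manifold_def
proof (intro conjI)
  show "\<exists>K::('e \<times> 'f) set. finite K \<and> span K = UNIV"
    using findim_prod[OF manifold_findim[OF A] manifold_findim[OF B]] unfolding findim_def .
  have "\<exists>Y\<in>fst ` prod_atlas A B. z \<in> Y" for z
  proof -
    obtain U \<phi> V \<psi> where "(U, \<phi>) \<in> A" "fst z \<in> U" "(V, \<psi>) \<in> B" "snd z \<in> V"
      using manifold_cover[OF A] manifold_cover[OF B] by metis
    then show ?thesis using prod_atlasI[of U \<phi> A V \<psi> B] by (force simp: mem_Times_iff)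
  qed
  then show "\<Union> (fst ` prod_atlas A B) = UNIV" by auto
  have "open Y \<and> open (\<eta> ` Y) \<and> inj_on \<eta> Y \<and> continuous_on Y \<eta> \<and> continuous_on (\<eta> ` Y) (inv_into Y \<eta>)"
    if Y: "(Y, \<eta>) \<in> prod_atlas A B" for Y \<eta>
  proof -
    obtain U \<phi> V \<psi> where *: "Y = U \<times> V" "\<eta> = map_prod \<phi> \<psi>" "(U, \<phi>) \<in> A" "(V, \<psi>) \<in> B"
      using prod_atlasE[OF Y] .
    note c = manifold_chart[OF A *(3)] and d = manifold_chart[OF B *(4)]
    have "continuous_on (\<eta> ` Y) (\<lambda>z. (inv_into U \<phi> (fst z), inv_into V \<psi> (snd z)))"
      unfolding * by (intro continuous_intros continuous_on_compose2[OF c(5)] continuous_on_compose2[OF d(5)]) auto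
    then have "continuous_on (\<eta> ` Y) (inv_into Y \<eta>)"
      by (rule continuous_on_eq) (simp add: * inv_into_map_prod[OF c(3) d(3)])
    moreover have "continuous_on Y (\<lambda>z. (\<phi> (fst z), \<psi> (snd z)))"
      unfolding * by (intro continuous_intros continuous_on_compose2[OF c(4)] continuous_on_compose2[OF d(4)]) auto
    then have "continuous_on Y \<eta>" by (simp add: * map_prod_def split_beta)
    moreover have "\<eta> ` Y = \<phi> ` U \<times> \<psi> ` V" by (auto simp: *)
    ultimately show ?thesis using c d by (auto simp: * intro: open_Times map_prod_inj_on)
  qed
  then show "\<forall>(Y, \<eta>)\<in>prod_atlas A B. open Y \<and> open (\<eta> ` Y) \<and> inj_on \<eta> Y \<and>
      continuous_on Y \<eta> \<and> continuous_on (\<eta> ` Y) (inv_into Y \<eta>)" by blast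
  have "smooth_on (\<eta> ` (Y \<inter> Y')) (\<eta>' \<circ> inv_into Y \<eta>)"
    if Y: "(Y, \<eta>) \<in> prod_atlas A B" "(Y', \<eta>') \<in> prod_atlas A B" for Y \<eta> Y' \<eta>'
  proof -
    obtain U \<phi> V \<psi> where *: "Y = U \<times> V" "\<eta> = map_prod \<phi> \<psi>" "(U, \<phi>) \<in> A" "(V, \<psi>) \<in> B"
      using prod_atlasE[OF Y(1)] .
    obtain U' \<phi>' V' \<psi>' where **: "Y' = U' \<times> V'" "\<eta>' = map_prod \<phi>' \<psi>'" "(U', \<phi>') \<in> A" "(V', \<psi>') \<in> B"
      using prod_atlasE[OF Y(2)] .
    have o: "open (\<phi> ` (U \<inter> U'))" "open (\<psi> ` (V \<inter> V'))"
      by (rule chart_open_image[OF A *(3)] chart_open_image[OF B *(4)],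
          auto intro: manifold_chart(1)[OF A *(3)] manifold_chart(1)[OF A **(3)]
            manifold_chart(1)[OF B *(4)] manifold_chart(1)[OF B **(4)])+
    have img: "\<eta> ` (Y \<inter> Y') = \<phi> ` (U \<inter> U') \<times> \<psi> ` (V \<inter> V')"
    proof (intro equalityI subsetI)
      fix z assume "z \<in> \<phi> ` (U \<inter> U') \<times> \<psi> ` (V \<inter> V')"
      then obtain x y where "z = (\<phi> x, \<psi> y)" "x \<in> U \<inter> U'" "y \<in> V \<inter> V'" by blast
      then show "z \<in> \<eta> ` (Y \<inter> Y')" by (intro image_eqI[of _ _ "(x, y)"]) (auto simp: * **)
    qed (auto simp: * **)
    have oo: "open (\<phi> ` (U \<inter> U') \<times> \<psi> ` (V \<inter> V'))" by (intro open_Times o)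
    have "smooth_on (\<phi> ` (U \<inter> U') \<times> \<psi> ` (V \<inter> V')) (\<lambda>z. (\<phi>' (inv_into U \<phi> (fst z)), \<psi>' (inv_into V \<psi> (snd z))))"
      by (intro smooth_on_Pair oo
          smooth_on_o[OF manifold_findim[OF A] oo o(1) smooth_on_fst[OF oo] manifold_transition[OF A *(3) **(3)]]
          smooth_on_o[OF manifold_findim[OF B] oo o(2) smooth_on_snd[OF oo] manifold_transition[OF B *(4) **(4)]]) auto
    then show ?thesis unfolding img
    proof (rule smooth_on_cong[OF oo, rotated])
      fix z assume "z \<in> \<phi> ` (U \<inter> U') \<times> \<psi> ` (V \<inter> V')"
      then have "z \<in> map_prod \<phi> \<psi> ` (U \<times> V)" unfolding img[symmetric] * by blast
      then show "(\<phi>' (inv_into U \<phi> (fst z)), \<psi>' (inv_into V \<psi> (snd z))) = (\<eta>' \<circ> inv_into Y \<eta>) z"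
        by (simp add: ** *(1,2) inv_into_map_prod[OF manifold_chart(3)[OF A *(3)] manifold_chart(3)[OF B *(4)]])
    qed
  qed
  then show "\<forall>(Y, \<eta>)\<in>prod_atlas A B. \<forall>(Y', \<eta>')\<in>prod_atlas A B. smooth_on (\<eta> ` (Y \<inter> Y')) (\<eta>' \<circ> inv_into Y \<eta>)"
    by blast
qed

lemma smooth_map_fst:
  assumes A: "manifold A" and B: "manifold B"
  shows "smooth_map (prod_atlas A B) S A fst"
proof (rule smooth_mapI[OF manifold_prod[OF A B]])
  fix p Y \<eta> assume Y: "(Y, \<eta>) \<in> prod_atlas A B" "p \<in> Y"
  obtain U \<phi> V \<psi> where *: "Y = U \<times> V" "\<eta> = map_prod \<phi> \<psi>" "(U, \<phi>) \<in> A" "(V, \<psi>) \<in> B"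
    using prod_atlasE[OF Y(1)] .
  show "\<exists>V \<psi> W G. (V, \<psi>) \<in> A \<and> open W \<and> p \<in> W \<and> W \<subseteq> Y \<and> smooth_on (\<eta> ` W) G \<and> (\<forall>x. x \<in> S \<longrightarrow> x \<in> W \<longrightarrow> fst x \<in> V \<and> \<psi> (fst x) = G (\<eta> x))"
    using Y *(3) manifold_chart(1,2)[OF manifold_prod[OF A B] Y(1)] smooth_on_fst[of "\<eta> ` Y"]
    by (intro exI[of _ U] exI[of _ \<phi>] exI[of _ Y] exI[of _ fst]) (auto simp: *(1,2))
qed

lemma smooth_map_snd:
  assumes A: "manifold A" and B: "manifold B"
  shows "smooth_map (prod_atlas A B) S B snd"
proof (rule smooth_mapI[OF manifold_prod[OF A B]])
  fix p Y \<eta> assume Y: "(Y, \<eta>) \<in> prod_atlas A B" "p \<in> Y"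
  obtain U \<phi> V \<psi> where *: "Y = U \<times> V" "\<eta> = map_prod \<phi> \<psi>" "(U, \<phi>) \<in> A" "(V, \<psi>) \<in> B"
    using prod_atlasE[OF Y(1)] .
  show "\<exists>V \<psi> W G. (V, \<psi>) \<in> B \<and> open W \<and> p \<in> W \<and> W \<subseteq> Y \<and> smooth_on (\<eta> ` W) G \<and> (\<forall>x. x \<in> S \<longrightarrow> x \<in> W \<longrightarrow> snd x \<in> V \<and> \<psi> (snd x) = G (\<eta> x))"
    using Y *(4) manifold_chart(1,2)[OF manifold_prod[OF A B] Y(1)] smooth_on_snd[of "\<eta> ` Y"]
    by (intro exI[of _ V] exI[of _ \<psi>] exI[of _ Y] exI[of _ snd]) (auto simp: *(1,2))
qed

lemma smooth_map_Pair:
  assumes A: "manifold A" and B: "manifold B" and D: "manifold D"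
    and f: "smooth_map A S B f" and g: "smooth_map A S D g"
  shows "smooth_map A S (prod_atlas B D) (\<lambda>x. (f x, g x))"
proof (rule smooth_mapI[OF A])
  fix p U \<phi> assume p: "p \<in> S" and U: "(U, \<phi>) \<in> A" "p \<in> U"
  obtain V \<psi> Y \<eta> where V: "(V, \<psi>) \<in> B" "f p \<in> V" and Y: "(Y, \<eta>) \<in> D" "g p \<in> Y"
    using manifold_cover[OF B] manifold_cover[OF D] by metis
  obtain W1 G1 where 1: "open W1" "p \<in> W1" "W1 \<subseteq> U" "smooth_on (\<phi> ` W1) G1" "G1 ` \<phi> ` W1 \<subseteq> \<psi> ` V"
    "\<And>x. x \<in> S \<Longrightarrow> x \<in> W1 \<Longrightarrow> f x \<in> V" "\<And>x. x \<in> S \<Longrightarrow> x \<in> W1 \<Longrightarrow> \<psi> (f x) = G1 (\<phi> x)"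
    using smooth_map_in_charts[OF A B f p U V] by blast
  obtain W2 G2 where 2: "open W2" "p \<in> W2" "W2 \<subseteq> U" "smooth_on (\<phi> ` W2) G2" "G2 ` \<phi> ` W2 \<subseteq> \<eta> ` Y"
    "\<And>x. x \<in> S \<Longrightarrow> x \<in> W2 \<Longrightarrow> g x \<in> Y" "\<And>x. x \<in> S \<Longrightarrow> x \<in> W2 \<Longrightarrow> \<eta> (g x) = G2 (\<phi> x)"
    using smooth_map_in_charts[OF A D g p U Y] by blast
  have o: "open (\<phi> ` (W1 \<inter> W2))" using chart_open_image[OF A U(1)] 1(1,3) 2(1) by blast
  have "smooth_on (\<phi> ` (W1 \<inter> W2)) (\<lambda>y. (G1 y, G2 y))"
    by (intro smooth_on_Pair o smooth_on_subset[OF 1(4)] smooth_on_subset[OF 2(4)]) auto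
  then show "\<exists>V \<psi> W G. (V, \<psi>) \<in> prod_atlas B D \<and> open W \<and> p \<in> W \<and> W \<subseteq> U \<and>
       smooth_on (\<phi> ` W) G \<and> (\<forall>x. x \<in> S \<longrightarrow> x \<in> W \<longrightarrow> (f x, g x) \<in> V \<and> \<psi> (f x, g x) = G (\<phi> x))"
    using 1 2 by (intro exI[of _ "V \<times> Y"] exI[of _ "map_prod \<psi> \<eta>"] exI[of _ "W1 \<inter> W2"] exI[of _ "\<lambda>y. (G1 y, G2 y)"]) (auto intro: prod_atlasI V(1) Y(1))
qed

subsection \<open>The algebra of smooth functions\<close>

lemma manifold_real: "manifold real_atlas"
proof -
  have "finite {1 :: real} \<and> span {1 :: real} = UNIV"
    using span_Basis[where 'a=real] by simp
  then show ?thesis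
    unfolding manifold_def real_atlas_def
    by (auto intro!: exI[of _ "{1 :: real}"] smooth_on_cong[OF _ _ smooth_on_bounded_linear[OF bounded_linear_ident]] continuous_on_id
        simp: inv_into_f_f[OF inj_on_id, simplified] id_def)
qed

abbreviation "cfuns A \<equiv> smooth_funs A UNIV"

lemma smooth_funs_compose:
  "manifold A \<Longrightarrow> manifold B \<Longrightarrow> smooth_map A S B F \<Longrightarrow> f \<in> smooth_funs B T \<Longrightarrow> F ` S \<subseteq> T \<Longrightarrow> (\<lambda>x. f (F x)) \<in> smooth_funs A S"
  unfolding smooth_funs_def using smooth_map_compose by blast

lemma smooth_funs_iff:
  "f \<in> smooth_funs A S \<longleftrightarrow>
    (\<forall>p\<in>S. \<exists>U \<phi> W G. (U, \<phi>) \<in> A \<and> open W \<and> p \<in> W \<and> W \<subseteq> U \<and> smooth_on (\<phi> ` W) G \<and> (\<forall>x. x \<in> S \<longrightarrow> x \<in> W \<longrightarrow> f x = G (\<phi> x)))"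
  unfolding smooth_funs_def smooth_map_iff real_atlas_def by simp

lemma smooth_funs_chart:
  assumes A: "manifold A" and f: "f \<in> cfuns A" and U: "(U, \<phi>) \<in> A"
  shows "smooth_on (\<phi> ` U) (\<lambda>y. f (inv_into U \<phi> y))"
proof (rule smooth_on_local)
  fix y assume "y \<in> \<phi> ` U"
  then obtain p where p: "p \<in> U" "y = \<phi> p" by blast
  have V: "(UNIV, id) \<in> real_atlas" by (simp add: real_atlas_def)
  obtain W G where W: "open W" "p \<in> W" "W \<subseteq> U" "smooth_on (\<phi> ` W) G" "\<And>x. x \<in> W \<Longrightarrow> f x = G (\<phi> x)"
    using smooth_map_in_charts[OF A manifold_real _ _ U p(1) V, of UNIV f] f unfolding smooth_funs_def by auto
  have o: "open (\<phi> ` W)" by (rule chart_open_image[OF A U W(1,3)])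
  have "smooth_on (\<phi> ` W) (\<lambda>y. f (inv_into U \<phi> y))"
    by (rule smooth_on_cong[OF o _ W(4)]) (use W(3,5) in \<open>auto simp: chart_inv[OF A U] subset_iff\<close>)
  then show "\<exists>V. open V \<and> y \<in> V \<and> smooth_on V (\<lambda>y. f (inv_into U \<phi> y))" using o W(2) p by blast
qed

text \<open>Multiplication by a bump function supported in the image of \<open>W\<close>, followed
  by extension by zero, turns a local expression into a globally smooth function with the same germ
  at \<open>p\<close>.\<close>

lemma smooth_funs_extend:
  assumes A: "manifold (A :: ('a::{t2_space,second_countable_topology}, 'e::real_normed_vector) atlas)"
    and U: "(U, \<phi>) \<in> A" and W: "open W" "p \<in> W" "W \<subseteq> U" and G: "smooth_on (\<phi> ` W) G"
  obtains f V K where "f \<in> cfuns A" "open V" "p \<in> V" "V \<subseteq> K" "closed K" "K \<subseteq> W" "\<And>x. x \<in> V \<Longrightarrow> f x = G (\<phi> x)" "\<And>x. x \<notin> K \<Longrightarrow> f x = 0"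
proof -
  note c = manifold_chart[OF A U]
  have o: "open (\<phi> ` W)" by (rule chart_open_image[OF A U W(1,3)])
  obtain \<beta> V K where b: "smooth_on UNIV \<beta>" "open V" "\<phi> p \<in> V" "V \<subseteq> K" "compact K" "K \<subseteq> \<phi> ` W"
    "\<And>x. x \<in> V \<Longrightarrow> \<beta> x = 1" "\<And>x. x \<notin> K \<Longrightarrow> \<beta> x = (0 :: real)"
    using bump_findim[OF manifold_findim[OF A] o] W(2) by (metis imageI)
  define f where "f x = (if x \<in> W then \<beta> (\<phi> x) * G (\<phi> x) else 0)" for x
  let ?K = "inv_into U \<phi> ` K"
  have KU: "K \<subseteq> \<phi> ` U" using b(6) W(3) by blast
  \<comment> \<open>The support is compact in the chart, hence closed in the Hausdorff manifold. Its
    complement is therefore an open set on which the extension is constantly 0, which covers the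
    points outside \<open>W\<close>.\<close>
  have "compact ?K" by (rule compact_continuous_image[OF continuous_on_subset[OF c(5) KU] b(5)])
  then have cK: "closed ?K" by (rule compact_imp_closed)
  have KW: "?K \<subseteq> W" using b(6) W(3) chart_inv[OF A U] by (auto simp: subset_iff)
  have f0: "f x = 0" if "x \<notin> ?K" for x
  proof (cases "x \<in> W")
    case True
    then have "\<phi> x \<notin> K" using that chart_inv[OF A U, of x] W(3) by (metis image_eqI subsetD)
    then show ?thesis using b(8) by (simp add: f_def)
  qed (simp add: f_def)
  have 1: "\<exists>U \<phi> W G. (U, \<phi>) \<in> A \<and> open W \<and> q \<in> W \<and> W \<subseteq> U \<and> smooth_on (\<phi> ` W) G \<and> (\<forall>x. x \<in> UNIV \<longrightarrow> x \<in> W \<longrightarrow> f x = G (\<phi> x))" for q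
  proof (cases "q \<in> W")
    case True
    have "smooth_on (\<phi> ` W) (\<lambda>y. \<beta> y * G y)"
      by (intro smooth_on_mult o smooth_on_subset[OF b(1)] G) auto
    then show ?thesis using True W U by (intro exI[of _ U] exI[of _ \<phi>] exI[of _ W] exI[of _ "\<lambda>y. \<beta> y * G y"]) (auto simp: f_def)
  next
    case False
    obtain Y \<psi> where Y: "(Y, \<psi>) \<in> A" "q \<in> Y" using manifold_cover[OF A] .
    have oY: "open (Y - ?K)" using manifold_chart(1)[OF A Y(1)] cK by blast
    have "smooth_on (\<psi> ` (Y - ?K)) (\<lambda>_. 0 :: real)"
      by (intro smooth_on_const chart_open_image[OF A Y(1) oY]) auto
    then show ?thesis using False KW Y oY f0
      by (intro exI[of _ Y] exI[of _ \<psi>] exI[of _ "Y - ?K"] exI[of _ "\<lambda>_. 0"]) auto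
  qed
  have V': "open (U \<inter> \<phi> -` V)" by (rule continuous_open_preimage[OF c(4,1) b(2)])
  have VK: "U \<inter> \<phi> -` V \<subseteq> ?K"
    using b(4) chart_inv[OF A U] by (auto intro!: rev_image_eqI)
  show thesis
  proof (rule that[of f "U \<inter> \<phi> -` V" ?K])
    show "f \<in> cfuns A" unfolding smooth_funs_iff using 1 by blast
    show "f x = G (\<phi> x)" if "x \<in> U \<inter> \<phi> -` V" for x using that VK KW b(7) by (auto simp: f_def)
  qed (use V' VK KW W b(3) cK f0 in auto)
qed

lemma bump:
  assumes A: "manifold A" and W: "open W" "p \<in> W"
  obtains \<beta> V K where "\<beta> \<in> cfuns A" "open V" "p \<in> V" "V \<subseteq> K" "closed K" "K \<subseteq> W" "\<And>x. x \<in> V \<Longrightarrow> \<beta> x = 1" "\<And>x. x \<notin> K \<Longrightarrow> \<beta> x = 0"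
proof -
  obtain U \<phi> where U: "(U, \<phi>) \<in> A" "p \<in> U" using manifold_cover[OF A] .
  have UW: "open (U \<inter> W)" using manifold_chart(1)[OF A U(1)] W by blast
  have "smooth_on (\<phi> ` (U \<inter> W)) (\<lambda>_. 1 :: real)"
    by (intro smooth_on_const chart_open_image[OF A U(1) UW]) auto
  from smooth_funs_extend[OF A U(1) UW _ _ this, of p] obtain \<beta> V K where
    "\<beta> \<in> cfuns A" "open V" "p \<in> V" "V \<subseteq> K" "closed K" "K \<subseteq> U \<inter> W" "\<And>x. x \<in> V \<Longrightarrow> \<beta> x = 1" "\<And>x. x \<notin> K \<Longrightarrow> \<beta> x = 0"
    using U(2) W(2) by auto
  then show ?thesis using that by auto
qed

text \<open>The definition offers a smooth extension on an open piece of a chart only; a cutoff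
  makes it global without changing it near \<open>p\<close>. From here on charts are no longer
  needed to speak of functions on subsets.\<close>

lemma smooth_funs_subset_iff:
  assumes A: "manifold A"
  shows "f \<in> smooth_funs A S \<longleftrightarrow> (\<forall>p\<in>S. \<exists>F\<in>cfuns A. \<exists>W. open W \<and> p \<in> W \<and> (\<forall>x. x \<in> S \<longrightarrow> x \<in> W \<longrightarrow> f x = F x))"
proof
  assume f: "f \<in> smooth_funs A S"
  show "\<forall>p\<in>S. \<exists>F\<in>cfuns A. \<exists>W. open W \<and> p \<in> W \<and> (\<forall>x. x \<in> S \<longrightarrow> x \<in> W \<longrightarrow> f x = F x)"
  proof
    fix p assume "p \<in> S"
    then obtain U \<phi> W G where 1: "(U, \<phi>) \<in> A" "open W" "p \<in> W" "W \<subseteq> U" "smooth_on (\<phi> ` W) G" "\<And>x. x \<in> S \<inter> W \<Longrightarrow> f x = G (\<phi> x)"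
      using f unfolding smooth_funs_iff by fast
    obtain F V K where "F \<in> cfuns A" "open V" "p \<in> V" "V \<subseteq> K" "K \<subseteq> W" "\<And>x. x \<in> V \<Longrightarrow> F x = G (\<phi> x)"
      using smooth_funs_extend[OF A 1(1-5)] by metis
    then show "\<exists>F\<in>cfuns A. \<exists>W. open W \<and> p \<in> W \<and> (\<forall>x. x \<in> S \<longrightarrow> x \<in> W \<longrightarrow> f x = F x)" using 1(6) by (metis Int_iff subsetD)
  qed
next
  assume f: "\<forall>p\<in>S. \<exists>F\<in>cfuns A. \<exists>W. open W \<and> p \<in> W \<and> (\<forall>x. x \<in> S \<longrightarrow> x \<in> W \<longrightarrow> f x = F x)"
  show "f \<in> smooth_funs A S"
    unfolding smooth_funs_iff
  proof
    fix p assume "p \<in> S"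
    from bspec[OF f this] obtain F W where F: "F \<in> cfuns A" "open W" "p \<in> W" "\<And>x. x \<in> S \<inter> W \<Longrightarrow> f x = F x"
      by (elim bexE exE conjE) (rule that, assumption, assumption, assumption, blast)
    obtain U \<phi> where U: "(U, \<phi>) \<in> A" "p \<in> U" using manifold_cover[OF A] .
    have "smooth_on (\<phi> ` (U \<inter> W)) (\<lambda>y. F (inv_into U \<phi> y))"
      by (rule smooth_on_subset[OF smooth_funs_chart[OF A F(1) U(1)]]) auto
    then show "\<exists>U \<phi> W G. (U, \<phi>) \<in> A \<and> open W \<and> p \<in> W \<and> W \<subseteq> U \<and> smooth_on (\<phi> ` W) G \<and> (\<forall>x. x \<in> S \<longrightarrow> x \<in> W \<longrightarrow> f x = G (\<phi> x))"
      using U F(2-4) manifold_chart(1)[OF A U(1)]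
      by (intro exI[of _ U] exI[of _ \<phi>] exI[of _ "U \<inter> W"] exI[of _ "\<lambda>y. F (inv_into U \<phi> y)"]) (auto simp: chart_inv[OF A])
  qed
qed

lemma cfuns_local:
  assumes "manifold A" "\<And>p. \<exists>F\<in>cfuns A. \<exists>W. open W \<and> p \<in> W \<and> (\<forall>x\<in>W. f x = F x)"
  shows "f \<in> cfuns A"
  using smooth_funs_subset_iff[OF assms(1), of f UNIV] assms(2) by (simp add: Ball_def)

lemma cfunsI:
  assumes A: "manifold A" and "\<And>U \<phi>. (U, \<phi>) \<in> A \<Longrightarrow> smooth_on (\<phi> ` U) (\<lambda>y. f (inv_into U \<phi> y))"
  shows "f \<in> cfuns A"
  unfolding smooth_funs_iff
proof
  fix p :: 'a assume "p \<in> UNIV"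
  obtain U \<phi> where U: "(U, \<phi>) \<in> A" "p \<in> U" using manifold_cover[OF A] .
  then show "\<exists>U \<phi> W G. (U, \<phi>) \<in> A \<and> open W \<and> p \<in> W \<and> W \<subseteq> U \<and> smooth_on (\<phi> ` W) G \<and> (\<forall>x. x \<in> UNIV \<longrightarrow> x \<in> W \<longrightarrow> f x = G (\<phi> x))"
    using assms(2)[OF U(1)] manifold_chart(1)[OF A U(1)]
    by (intro exI[of _ U] exI[of _ \<phi>] exI[of _ U] exI[of _ "\<lambda>y. f (inv_into U \<phi> y)"]) (auto simp: chart_inv[OF A])
qed

context
  fixes A :: "('a::{t2_space,second_countable_topology}, 'e::real_normed_vector) atlas"
  assumes A: "manifold A"
begin

lemma cfuns_const: "(\<lambda>x. c) \<in> cfuns A"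
  by (intro cfunsI[OF A] smooth_on_const manifold_chart(2)[OF A])

lemma cfuns_add: "f \<in> cfuns A \<Longrightarrow> g \<in> cfuns A \<Longrightarrow> (\<lambda>x. f x + g x) \<in> cfuns A"
  by (rule cfunsI[OF A], rule smooth_on_add) (auto intro: manifold_chart(2)[OF A] smooth_funs_chart[OF A])

lemma cfuns_mult: "f \<in> cfuns A \<Longrightarrow> g \<in> cfuns A \<Longrightarrow> (\<lambda>x. f x * g x) \<in> cfuns A"
  by (rule cfunsI[OF A], rule smooth_on_mult) (auto intro: manifold_chart(2)[OF A] smooth_funs_chart[OF A])

lemma cfuns_minus: "f \<in> cfuns A \<Longrightarrow> (\<lambda>x. - f x) \<in> cfuns A"
  using cfuns_mult[OF cfuns_const[of "-1"]] by simp

lemma cfuns_diff: "f \<in> cfuns A \<Longrightarrow> g \<in> cfuns A \<Longrightarrow> (\<lambda>x. f x - g x) \<in> cfuns A"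
  using cfuns_add[OF _ cfuns_minus] by simp

lemma cfuns_sum: "(\<And>i. i \<in> I \<Longrightarrow> f i \<in> cfuns A) \<Longrightarrow> (\<lambda>x. \<Sum>i\<in>I. f i x) \<in> cfuns A"
  by (induction I rule: infinite_finite_induct) (auto intro: cfuns_const cfuns_add)

lemma cfuns_continuous: 
  assumes "f \<in> cfuns A" 
  shows "continuous_on UNIV f"
proof (rule continuous_at_imp_continuous_on, rule ballI)
  fix p :: 'a
  obtain U \<phi> where U: "(U, \<phi>) \<in> A" "p \<in> U" using manifold_cover[OF A] .
  have "continuous_on U (\<lambda>x. f (inv_into U \<phi> (\<phi> x)))"
    by (rule continuous_on_compose2[OF smooth_on_continuous[OF smooth_funs_chart[OF A assms U(1)]] manifold_chart(4)[OF A U(1)]]) auto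
  then have "continuous_on U f"
    by (rule continuous_on_eq) (simp add: chart_inv[OF A U(1)])
  then show "isCont f p" using continuous_on_eq_continuous_at[OF manifold_chart(1)[OF A U(1)]] U(2) by blast
qed

text \<open>The last step in the smoothness proofs for right invariant fields and horizontal lifts:
  there only a multiple of the wanted function is expressed through known smooth functions, with a
  factor that is nonzero at the chosen point.\<close>

lemma cfuns_divide_local:
  assumes "\<And>p. \<exists>\<eta>\<in>cfuns A. \<eta> p \<noteq> 0 \<and> (\<lambda>x. \<eta> x * f x) \<in> cfuns A"
  shows "f \<in> cfuns A"
proof (rule cfuns_local[OF A])
  fix p
  obtain \<eta> where \<eta>: "\<eta> \<in> cfuns A" "\<eta> p \<noteq> 0" "(\<lambda>x. \<eta> x * f x) \<in> cfuns A" using assms by blast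
  obtain U \<phi> where U: "(U, \<phi>) \<in> A" "p \<in> U" using manifold_cover[OF A] .
  define W where "W = U \<inter> \<eta> -` (- {0})"
  have oW: "open W" unfolding W_def
    by (intro continuous_open_preimage continuous_on_subset[OF cfuns_continuous[OF \<eta>(1)]] manifold_chart(1)[OF A U(1)]) auto
  have WU: "W \<subseteq> U" by (auto simp: W_def)
  have o: "open (\<phi> ` W)" by (rule chart_open_image[OF A U(1) oW WU])
  have s: "smooth_on (\<phi> ` W) (\<lambda>y. \<eta> (inv_into U \<phi> y))" "smooth_on (\<phi> ` W) (\<lambda>y. \<eta> (inv_into U \<phi> y) * f (inv_into U \<phi> y))"
    using smooth_on_subset[OF smooth_funs_chart[OF A \<eta>(1) U(1)] image_mono[OF WU]]
      smooth_on_subset[OF smooth_funs_chart[OF A \<eta>(3) U(1)] image_mono[OF WU]] by auto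
  have "smooth_on (\<phi> ` W) (\<lambda>y. inverse (\<eta> (inv_into U \<phi> y)))"
    by (rule smooth_on_o[OF findim_euclidean o _ s(1) smooth_on_inverse]) (auto simp: W_def chart_inv[OF A U(1)])
  from smooth_on_mult[OF o s(2) this]
  have "smooth_on (\<phi> ` W) (\<lambda>y. f (inv_into U \<phi> y))"
    by (rule smooth_on_cong[OF o, rotated]) (auto simp: W_def chart_inv[OF A U(1)])
  moreover have "p \<in> W" using U \<eta> by (simp add: W_def)
  ultimately obtain F V K where "F \<in> cfuns A" "open V" "p \<in> V" "V \<subseteq> K" "K \<subseteq> W" "\<And>x. x \<in> V \<Longrightarrow> F x = f (inv_into U \<phi> (\<phi> x))"
    using smooth_funs_extend[OF A U(1) oW _ WU] by metis
  then show "\<exists>F\<in>cfuns A. \<exists>W. open W \<and> p \<in> W \<and> (\<forall>x\<in>W. f x = F x)"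
    using WU chart_inv[OF A U(1)] by (metis subsetD)
qed

end

section \<open>Tangent vectors\<close>

lemma tangentD:
  assumes "v \<in> tangent C p"
  shows "f \<notin> C \<Longrightarrow> v f = 0"
    and "f \<in> C \<Longrightarrow> g \<in> C \<Longrightarrow> v (\<lambda>x. f x + g x) = v f + v g"
    and "f \<in> C \<Longrightarrow> v (\<lambda>x. c * f x) = c * v f"
    and "f \<in> C \<Longrightarrow> g \<in> C \<Longrightarrow> v (\<lambda>x. f x * g x) = f p * v g + g p * v f"
  using assms unfolding tangent_def by auto

lemma tangentI:
  assumes "\<And>f. f \<notin> C \<Longrightarrow> v f = 0"
    and "\<And>f g. f \<in> C \<Longrightarrow> g \<in> C \<Longrightarrow> v (\<lambda>x. f x + g x) = v f + v g"
    and "\<And>c f. f \<in> C \<Longrightarrow> v (\<lambda>x. c * f x) = c * v f"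
    and "\<And>f g. f \<in> C \<Longrightarrow> g \<in> C \<Longrightarrow> v (\<lambda>x. f x * g x) = f p * v g + g p * v f"
  shows "v \<in> tangent C p"
  using assms unfolding tangent_def by auto

lemma vscale_apply [simp]: "vscale c v f = c * v f"
  by (simp add: vscale_def)

lemma vscale_0 [simp]: "vscale c 0 = 0" "vscale 0 v = 0" and vscale_one [simp]: "vscale 1 v = v"
  and vscale_minus_1: "vscale (- 1) v = - v"
  by (auto simp: fun_eq_iff)

lemma vscale_uminus: "vscale c (- v) = - vscale c v"
  by (simp add: fun_eq_iff)

lemma tangent_0 [intro]: "0 \<in> tangent C p"
  by (rule tangentI) auto

lemma tangent_add [intro]: "v \<in> tangent C p \<Longrightarrow> w \<in> tangent C p \<Longrightarrow> v + w \<in> tangent C p"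
  by (rule tangentI) (auto simp: tangentD algebra_simps)

lemma tangent_vscale [intro]: "v \<in> tangent C p \<Longrightarrow> vscale c v \<in> tangent C p"
  by (rule tangentI) (auto simp: tangentD algebra_simps)

lemma tangent_uminus [intro]: "v \<in> tangent C p \<Longrightarrow> - v \<in> tangent C p"
  using tangent_vscale[of v C p "-1"] by (simp add: vscale_minus_1)

lemma tangent_diff [intro]: "v \<in> tangent C p \<Longrightarrow> w \<in> tangent C p \<Longrightarrow> v - w \<in> tangent C p"
  using tangent_add[of v C p "- w"] by auto

lemma tangent_sum:
  assumes "\<And>i. i \<in> I \<Longrightarrow> v i \<in> tangent C p"
  shows "(\<lambda>f. \<Sum>i\<in>I. v i f) \<in> tangent C p"
  by (rule tangentI) (simp_all add: tangentD[OF assms] sum.distrib sum_distrib_left cong: sum.cong)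

lemma tmap_apply: "tmap D F v g = (if g \<in> D then v (\<lambda>x. g (F x)) else 0)"
  by (simp add: tmap_def o_def)

lemma tmap_linear [simp]:
  "tmap D F (v + w) = tmap D F v + tmap D F w" "tmap D F (v - w) = tmap D F v - tmap D F w"
  "tmap D F (- v) = - tmap D F v" "tmap D F 0 = 0" "tmap D F (vscale c v) = vscale c (tmap D F v)"
  by (auto simp: fun_eq_iff tmap_apply)

context
  fixes A :: "('a::{t2_space,second_countable_topology}, 'e::real_normed_vector) atlas"
  assumes A: "manifold A"
begin

lemma smooth_funs_subset: "f \<in> smooth_funs A S \<Longrightarrow> T \<subseteq> S \<Longrightarrow> f \<in> smooth_funs A T"
  unfolding smooth_funs_def using smooth_map_subset by blast

lemma smooth_funsE:
  assumes "f \<in> smooth_funs A S" "p \<in> S"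
  obtains F W where "F \<in> cfuns A" "open W" "p \<in> W" "\<And>x. x \<in> S \<Longrightarrow> x \<in> W \<Longrightarrow> f x = F x"
  using bspec[OF iffD1[OF smooth_funs_subset_iff[OF A] assms(1)] assms(2)]
  by (elim bexE exE conjE) (rule that, assumption, assumption, assumption, blast)

lemma smooth_funsI:
  assumes "\<And>p. p \<in> S \<Longrightarrow> \<exists>F\<in>cfuns A. \<exists>W. open W \<and> p \<in> W \<and> (\<forall>x. x \<in> S \<longrightarrow> x \<in> W \<longrightarrow> f x = F x)"
  shows "f \<in> smooth_funs A S"
  by (rule iffD2[OF smooth_funs_subset_iff[OF A]], rule ballI, rule assms)

lemma smooth_funs_add:
  assumes "f \<in> smooth_funs A S" "g \<in> smooth_funs A S"
  shows "(\<lambda>x. f x + g x) \<in> smooth_funs A S"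
proof (rule smooth_funsI)
  fix p assume p: "p \<in> S"
  obtain F W where 1: "F \<in> cfuns A" "open W" "p \<in> W" "\<And>x. x \<in> S \<Longrightarrow> x \<in> W \<Longrightarrow> f x = F x"
    using smooth_funsE[OF assms(1) p] by metis
  obtain G V where 2: "G \<in> cfuns A" "open V" "p \<in> V" "\<And>x. x \<in> S \<Longrightarrow> x \<in> V \<Longrightarrow> g x = G x"
    using smooth_funsE[OF assms(2) p] by metis
  show "\<exists>F\<in>cfuns A. \<exists>W. open W \<and> p \<in> W \<and> (\<forall>x. x \<in> S \<longrightarrow> x \<in> W \<longrightarrow> f x + g x = F x)"
    using 1 2 by (intro bexI[of _ "\<lambda>x. F x + G x"] exI[of _ "W \<inter> V"] cfuns_add[OF A]) auto
qed

lemma smooth_funs_mult: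
  assumes "f \<in> smooth_funs A S" "g \<in> smooth_funs A S"
  shows "(\<lambda>x. f x * g x) \<in> smooth_funs A S"
proof (rule smooth_funsI)
  fix p assume p: "p \<in> S"
  obtain F W where 1: "F \<in> cfuns A" "open W" "p \<in> W" "\<And>x. x \<in> S \<Longrightarrow> x \<in> W \<Longrightarrow> f x = F x"
    using smooth_funsE[OF assms(1) p] by metis
  obtain G V where 2: "G \<in> cfuns A" "open V" "p \<in> V" "\<And>x. x \<in> S \<Longrightarrow> x \<in> V \<Longrightarrow> g x = G x"
    using smooth_funsE[OF assms(2) p] by metis
  show "\<exists>F\<in>cfuns A. \<exists>W. open W \<and> p \<in> W \<and> (\<forall>x. x \<in> S \<longrightarrow> x \<in> W \<longrightarrow> f x * g x = F x)"
    using 1 2 by (intro bexI[of _ "\<lambda>x. F x * G x"] exI[of _ "W \<inter> V"] cfuns_mult[OF A]) auto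
qed

lemma smooth_funs_const_on: "(\<And>x. x \<in> S \<Longrightarrow> f x = c) \<Longrightarrow> f \<in> smooth_funs A S"
  by (rule smooth_funsI) (auto intro!: bexI[of _ "\<lambda>x. c"] cfuns_const[OF A] exI[of _ UNIV])

lemma cfuns_subset: "f \<in> cfuns A \<Longrightarrow> f \<in> smooth_funs A S"
  using smooth_funs_subset by blast

text \<open>The indicator \<open>?u\<close> of the complement of \<open>S\<close> counts as smooth
  on \<open>S\<close>, being constantly 0 there, and \<open>f = f * ?u\<close>. Both factors vanish
  at \<open>p\<close>, so the Leibniz rule gives 0.\<close>

lemma tangent_vanishing:
  assumes v: "v \<in> tangent (smooth_funs A S) p" and p: "p \<in> S" and f: "\<And>x. x \<in> S \<Longrightarrow> f x = 0"
  shows "v f = 0"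
proof -
  let ?u = "\<lambda>x. if x \<in> S then 0 else 1 :: real"
  have 1: "f \<in> smooth_funs A S" "?u \<in> smooth_funs A S"
    using f by (auto intro: smooth_funs_const_on)
  have "f = (\<lambda>x. f x * ?u x)" using f by (auto simp: fun_eq_iff)
  then have "v f = v (\<lambda>x. f x * ?u x)" by simp
  also have "\<dots> = 0" using tangentD(4)[OF v 1] p f by simp
  finally show ?thesis .
qed

text \<open>Let \<open>\<beta>\<close> be a bump function that is 1 at \<open>p\<close>. The product
  of \<open>\<beta>\<close> and \<open>f - g\<close> vanishes on \<open>S\<close>, hence is
  annihilated by \<open>v\<close>; as \<open>f - g\<close> vanishes at \<open>p\<close>, the Leibniz
  rule identifies this value with \<open>v f - v g\<close>.\<close>

lemma tangent_local:
  assumes v: "v \<in> tangent (smooth_funs A S) p" and p: "p \<in> S"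
    and f: "f \<in> smooth_funs A S" and g: "g \<in> smooth_funs A S"
    and W: "open W" "p \<in> W" "\<And>x. x \<in> S \<Longrightarrow> x \<in> W \<Longrightarrow> f x = g x"
  shows "v f = v g"
proof -
  obtain \<beta> V K where b: "\<beta> \<in> cfuns A" "p \<in> V" "K \<subseteq> W" "\<And>x. x \<in> V \<Longrightarrow> \<beta> x = 1" "\<And>x. x \<notin> K \<Longrightarrow> \<beta> x = 0"
    using bump[OF A W(1,2)] by metis
  let ?h = "\<lambda>x. f x + - 1 * g x"
  have m: "(\<lambda>x. - 1 * g x) \<in> smooth_funs A S"
    by (rule smooth_funs_mult[OF smooth_funs_const_on[OF refl] g])
  then have h: "?h \<in> smooth_funs A S" by (rule smooth_funs_add[OF f])
  have "v (\<lambda>x. \<beta> x * ?h x) = 0"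
    by (rule tangent_vanishing[OF v p]) (use b(3,5) W(3) in force)
  moreover have "v (\<lambda>x. \<beta> x * ?h x) = v ?h"
    using tangentD(4)[OF v cfuns_subset[OF b(1)] h] b(2,4) W(3)[OF p W(2)] by simp
  ultimately show ?thesis
    using tangentD(2)[OF v f m] tangentD(3)[OF v g, of "- 1"] by simp
qed

lemma tangent_const: "v \<in> tangent (smooth_funs A S) p \<Longrightarrow> v (\<lambda>x. c) = 0"
proof -
  assume v: "v \<in> tangent (smooth_funs A S) p"
  have 1: "(\<lambda>x. 1) \<in> smooth_funs A S" by (auto intro: smooth_funs_const_on)
  have "v (\<lambda>x. 1) = 0" using tangentD(4)[OF v 1 1] by simp
  then show ?thesis using tangentD(3)[OF v 1, of c] by simp
qed

lemma tangent_diff_fun: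
  "v \<in> tangent (cfuns A) p \<Longrightarrow> f \<in> cfuns A \<Longrightarrow> g \<in> cfuns A \<Longrightarrow> v (\<lambda>x. f x - g x) = v f - v g"
  using tangentD(2)[of v "cfuns A" p f "\<lambda>x. - 1 * g x"] tangentD(3)[of v "cfuns A" p g "- 1"] cfuns_minus[OF A, of g] by simp

lemma tangent_sum_fun:
  "v \<in> tangent (cfuns A) p \<Longrightarrow> (\<And>i. i \<in> I \<Longrightarrow> f i \<in> cfuns A) \<Longrightarrow> v (\<lambda>x. \<Sum>i\<in>I. f i x) = (\<Sum>i\<in>I. v (f i))"
  by (induction I rule: infinite_finite_induct)
    (auto simp: tangent_const tangentD(2)[of v "cfuns A" p] cfuns_sum[OF A])

lemma tmap_tangent:
  assumes "v \<in> tangent C p" "\<And>g. g \<in> smooth_funs A S \<Longrightarrow> (\<lambda>x. g (F x)) \<in> C"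
  shows "tmap (smooth_funs A S) F v \<in> tangent (smooth_funs A S) (F p)"
proof (rule tangentI)
  fix f g c assume f: "f \<in> smooth_funs A S"
  note D = tangentD[OF assms(1)]
  have "(\<lambda>x. c * f x) \<in> smooth_funs A S"    by (rule smooth_funs_mult[OF smooth_funs_const_on[OF refl] f])
  then show "tmap (smooth_funs A S) F v (\<lambda>x. c * f x) = c * tmap (smooth_funs A S) F v f"
    using f by (simp add: tmap_apply D(3)[OF assms(2)[OF f]])
  assume g: "g \<in> smooth_funs A S"
  note fg = assms(2)[OF f] assms(2)[OF g]
  show "tmap (smooth_funs A S) F v (\<lambda>x. f x + g x) = tmap (smooth_funs A S) F v f + tmap (smooth_funs A S) F v g"
    using f g smooth_funs_add[OF f g] by (simp add: tmap_apply D(2)[OF fg])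
  show "tmap (smooth_funs A S) F v (\<lambda>x. f x * g x) =
      f (F p) * tmap (smooth_funs A S) F v g + g (F p) * tmap (smooth_funs A S) F v f"
    using f g smooth_funs_mult[OF f g] by (simp add: tmap_apply D(4)[OF fg])
qed (simp add: tmap_apply)

definition chart_vec :: "'a set \<Rightarrow> ('a \<Rightarrow> 'e) \<Rightarrow> 'e \<Rightarrow> 'a \<Rightarrow> 'a tvec"
  where "chart_vec U \<phi> V q =
    (\<lambda>f. if f \<in> cfuns A then frechet_derivative (\<lambda>y. f (inv_into U \<phi> y)) (at (\<phi> q)) V else 0)"

lemma chart_vec_has_derivative:
  assumes "f \<in> cfuns A" "(U, \<phi>) \<in> A" "q \<in> U"
  shows "((\<lambda>y. f (inv_into U \<phi> y)) has_derivative (\<lambda>V. chart_vec U \<phi> V q f)) (at (\<phi> q))"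
  using smooth_on_has_derivative[OF smooth_funs_chart[OF A assms(1,2)], of "\<phi> q"] assms by (simp add: chart_vec_def)

lemma chart_vec_eqI:
  assumes f: "f \<in> cfuns A" and U: "(U, \<phi>) \<in> A" "q \<in> U" and W: "open W" "q \<in> W"
    and g: "\<And>x. x \<in> W \<Longrightarrow> x \<in> U \<Longrightarrow> f x = g (\<phi> x)" and D: "(g has_derivative D) (at (\<phi> q))"
  shows "chart_vec U \<phi> V q f = D V"
proof -
  have o: "open (\<phi> ` (U \<inter> W))" 
    by (rule chart_open_image[OF A U(1)]) (use manifold_chart(1)[OF A U(1)] W in auto)
  have "((\<lambda>y. f (inv_into U \<phi> y)) has_derivative D) (at (\<phi> q))"
    by (rule has_derivative_transform_within_open[OF D o]) (use U W g in \<open>auto simp: chart_inv[OF A U(1)]\<close>)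
  from has_derivative_unique[OF this chart_vec_has_derivative[OF f U]] show ?thesis by metis
qed

lemma chart_vec_linear:
  assumes "(U, \<phi>) \<in> A" "q \<in> U"
  shows "linear (\<lambda>V. chart_vec U \<phi> V q f)"
proof (cases "f \<in> cfuns A")
  case True
  show ?thesis by (rule has_derivative_linear[OF chart_vec_has_derivative[OF True assms]])
qed (simp add: chart_vec_def linear_zero)

lemma chart_vec_tangent:
  assumes U: "(U, \<phi>) \<in> A" "q \<in> U"
  shows "chart_vec U \<phi> V q \<in> tangent (cfuns A) q"
proof (rule tangentI)
  fix f g c assume f: "f \<in> cfuns A"
  note df = chart_vec_has_derivative[OF f U]
  have c: "(\<lambda>x. c) \<in> cfuns A" by (rule cfuns_const[OF A])
  show "chart_vec U \<phi> V q (\<lambda>x. c * f x) = c * chart_vec U \<phi> V q f"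
    by (rule chart_vec_eqI[OF cfuns_mult[OF A c f] U open_UNIV UNIV_I _ has_derivative_mult_right[OF df]])
      (simp add: chart_inv[OF A U(1)])
  assume g: "g \<in> cfuns A"
  note dg = chart_vec_has_derivative[OF g U]
  show "chart_vec U \<phi> V q (\<lambda>x. f x + g x) = chart_vec U \<phi> V q f + chart_vec U \<phi> V q g"
    by (rule chart_vec_eqI[OF cfuns_add[OF A f g] U open_UNIV UNIV_I _ has_derivative_add[OF df dg]])
      (simp add: chart_inv[OF A U(1)])
  have "chart_vec U \<phi> V q (\<lambda>x. f x * g x) =
      f (inv_into U \<phi> (\<phi> q)) * chart_vec U \<phi> V q g + chart_vec U \<phi> V q f * g (inv_into U \<phi> (\<phi> q))"
    by (rule chart_vec_eqI[OF cfuns_mult[OF A f g] U open_UNIV UNIV_I _ has_derivative_mult[OF df dg]])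
      (simp add: chart_inv[OF A U(1)])
  then show "chart_vec U \<phi> V q (\<lambda>x. f x * g x) = f q * chart_vec U \<phi> V q g + g q * chart_vec U \<phi> V q f"
    using U by (simp add: chart_inv[OF A U(1)])
qed (simp add: chart_vec_def)

text \<open>Derivations act on globally smooth functions only, so the chart coordinates are replaced
  by cut-off functions that agree with them on a common neighbourhood.\<close>

lemma coordinate_functions:
  assumes U: "(U, \<phi>) \<in> A" "p \<in> U"
  obtains x :: "'e \<Rightarrow> 'a \<Rightarrow> real" and W where "open W" "p \<in> W" "W \<subseteq> U" "\<And>b. b \<in> fbasis \<Longrightarrow> x b \<in> cfuns A"
    "\<And>b q. b \<in> fbasis \<Longrightarrow> q \<in> W \<Longrightarrow> x b q = coord b (\<phi> q)"
proof -
  note fd = manifold_findim[OF A]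
  have "\<forall>b\<in>fbasis. \<exists>f V. f \<in> cfuns A \<and> open V \<and> p \<in> V \<and> V \<subseteq> U \<and> (\<forall>x\<in>V. f x = coord b (\<phi> x))"
  proof
    fix b :: 'e
    have "smooth_on (\<phi> ` U) (coord b)"
      by (rule smooth_on_bounded_linear[OF bounded_linear_coord[OF fd] manifold_chart(2)[OF A U(1)]])
    from smooth_funs_extend[OF A U(1) manifold_chart(1)[OF A U(1)] U(2) order_refl this] obtain f V K where
      "f \<in> cfuns A" "open V" "p \<in> V" "V \<subseteq> K" "K \<subseteq> U" "\<And>x. x \<in> V \<Longrightarrow> f x = coord b (\<phi> x)"
      by metis
    then show "\<exists>f V. f \<in> cfuns A \<and> open V \<and> p \<in> V \<and> V \<subseteq> U \<and> (\<forall>x\<in>V. f x = coord b (\<phi> x))"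
      by (intro exI[of _ f] exI[of _ V]) auto
  qed
  from bchoice[OF this] obtain x where "\<forall>b\<in>fbasis. \<exists>V. x b \<in> cfuns A \<and> open V \<and> p \<in> V \<and> V \<subseteq> U \<and> (\<forall>q\<in>V. x b q = coord b (\<phi> q))" ..
  from bchoice[OF this] obtain V where
    V: "\<And>b. b \<in> fbasis \<Longrightarrow> x b \<in> cfuns A \<and> open (V b) \<and> p \<in> V b \<and> V b \<subseteq> U \<and> (\<forall>q\<in>V b. x b q = coord b (\<phi> q))" by blast
  show thesis
    by (rule that[of "U \<inter> (\<Inter>b\<in>fbasis. V b)" x])
      (use V U manifold_chart(1)[OF A U(1)] fbasis(1)[OF fd] in auto)
qed

text \<open>Near \<open>p\<close>, Hadamard's lemma writes \<open>f\<close> as a constant plus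
  products of linear functions of \<open>\<phi> q - \<phi> p\<close> with smooth functions. The
  derivation kills the constant, and since the linear factors vanish at \<open>p\<close> it sees
  only their own derivatives, weighted by \<open>h i (\<phi> p)\<close>. So \<open>v\<close> is
  determined by its values on the coordinates, and these define the direction
  \<open>V\<close>.\<close>

lemma tangent_chart:
  assumes U: "(U, \<phi>) \<in> A" "p \<in> U" and v: "v \<in> tangent (cfuns A) p"
  obtains V where "v = chart_vec U \<phi> V p"
proof -
  note fd = manifold_findim[OF A] and oU = manifold_chart(1)[OF A U(1)]
  obtain x :: "'e \<Rightarrow> 'a \<Rightarrow> real" and W where x: "open W" "p \<in> W" "W \<subseteq> U" "\<And>b. b \<in> fbasis \<Longrightarrow> x b \<in> cfuns A"
    "\<And>b q. b \<in> fbasis \<Longrightarrow> q \<in> W \<Longrightarrow> x b q = coord b (\<phi> q)"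
    by (rule coordinate_functions[OF U]) (rule that)
  define V where "V = (\<Sum>b\<in>fbasis. v (x b) *\<^sub>R b)"
  have "v f = chart_vec U \<phi> V p f" if f: "f \<in> cfuns A" for f
  proof -
    let ?f = "\<lambda>y. f (inv_into U \<phi> y)" and ?B = "Basis :: (real ^ 'e idx) set"
    obtain Y h l where h: "open Y" "\<phi> p \<in> Y" "Y \<subseteq> \<phi> ` U" "\<And>i. i \<in> ?B \<Longrightarrow> smooth_on Y (h i)"
      "\<And>i. i \<in> ?B \<Longrightarrow> bounded_linear (l i)" "\<And>y. y \<in> Y \<Longrightarrow> ?f y = ?f (\<phi> p) + (\<Sum>i\<in>?B. l i (y - \<phi> p) * h i y)"
      by (rule hadamard[OF fd smooth_funs_chart[OF A f U(1)] manifold_chart(2)[OF A U(1)] imageI[OF U(2)]]) (rule that)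
    define W' where "W' = U \<inter> \<phi> -` Y"
    have W': "open W'" "p \<in> W'" "W' \<subseteq> U" "\<phi> ` W' \<subseteq> Y"
      unfolding W'_def using continuous_open_preimage[OF manifold_chart(4)[OF A U(1)] oU h(1)] U(2) h(2) by auto
    have "\<forall>i\<in>?B. \<exists>H N. H \<in> cfuns A \<and> open N \<and> p \<in> N \<and> N \<subseteq> W' \<and> (\<forall>q\<in>N. H q = h i (\<phi> q))"
    proof
      fix i assume i: "i \<in> ?B"
      from smooth_funs_extend[OF A U(1) W'(1-3) smooth_on_subset[OF h(4)[OF i] W'(4)]] obtain f V K where
        "f \<in> cfuns A" "open V" "p \<in> V" "V \<subseteq> K" "K \<subseteq> W'" "\<And>x. x \<in> V \<Longrightarrow> f x = h i (\<phi> x)"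
        by metis
      then show "\<exists>H N. H \<in> cfuns A \<and> open N \<and> p \<in> N \<and> N \<subseteq> W' \<and> (\<forall>q\<in>N. H q = h i (\<phi> q))"
        by (intro exI[of _ f] exI[of _ V]) auto
    qed
    from bchoice[OF this] obtain H where "\<forall>i\<in>?B. \<exists>N. H i \<in> cfuns A \<and> open N \<and> p \<in> N \<and> N \<subseteq> W' \<and> (\<forall>q\<in>N. H i q = h i (\<phi> q))" ..
    from bchoice[OF this] obtain N where
      N: "\<And>i. i \<in> ?B \<Longrightarrow> H i \<in> cfuns A \<and> open (N i) \<and> p \<in> N i \<and> N i \<subseteq> W' \<and> (\<forall>q\<in>N i. H i q = h i (\<phi> q))" by blast
    \<comment> \<open>A globally smooth replacement of \<open>l i (\<phi> q - \<phi> p)\<close>,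
      built from the cut-off coordinates and equal to it on \<open>W\<close>.\<close>
    define L where "L i q = (\<Sum>b\<in>fbasis. l i b * x b q) - l i (\<phi> p)" for i q
    have L: "L i \<in> cfuns A" for i
      unfolding L_def[abs_def] by (intro cfuns_diff[OF A] cfuns_sum[OF A] cfuns_mult[OF A] cfuns_const[OF A] x(4))
    have l_sum: "l i w = (\<Sum>b\<in>fbasis. l i b * coord b w)" if "i \<in> ?B" for i w
    proof -
      interpret bounded_linear "l i" using h(5)[OF that] .
      show ?thesis by (subst sum_representation[OF fd, symmetric]) (simp add: sum scaleR mult.commute)
    qed
    have Lq: "L i q = l i (\<phi> q - \<phi> p)" if "i \<in> ?B" "q \<in> W" for i q
      using l_sum[OF that(1), of "\<phi> q"] x(5)[OF _ that(2)] linear_diff[OF bounded_linear.linear[OF h(5)[OF that(1)]]]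
      by (simp add: L_def)
    have vL: "v (L i) = l i V" if "i \<in> ?B" for i
    proof -
      interpret bounded_linear "l i" using h(5)[OF that] .
      have "v (L i) = v (\<lambda>q. \<Sum>b\<in>fbasis. l i b * x b q) - v (\<lambda>q. l i (\<phi> p))"
        unfolding L_def[abs_def]
        by (intro tangent_diff_fun[OF v] cfuns_sum[OF A] cfuns_mult[OF A] cfuns_const[OF A] x(4))
      also have "\<dots> = (\<Sum>b\<in>fbasis. l i b * v (x b))"
        using tangent_const[of v UNIV p "l i (\<phi> p)"] v x(4) cfuns_mult[OF A cfuns_const[OF A] x(4)]
        by (simp add: tangent_sum_fun[OF v] tangentD(3)[OF v])
      also have "\<dots> = l i V" by (simp add: V_def sum scaleR mult.commute)
      finally show ?thesis .
    qed
    have fq: "f q = f p + (\<Sum>i\<in>?B. l i (\<phi> q - \<phi> p) * h i (\<phi> q))" if "q \<in> W'" for q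
      using h(6)[of "\<phi> q"] U W' that chart_inv[OF A U(1)] by (auto simp: W'_def)
    let ?g = "\<lambda>q. f p + (\<Sum>i\<in>?B. L i q * H i q)"
    have sg: "(\<lambda>q. \<Sum>i\<in>?B. L i q * H i q) \<in> cfuns A"
      by (intro cfuns_sum[OF A] cfuns_mult[OF A] L) (use N in auto)
    have g: "?g \<in> cfuns A" by (intro cfuns_add[OF A] cfuns_const[OF A] sg)
    have "v f = v ?g"
    proof (rule tangent_local[OF v UNIV_I f g, of "W \<inter> W' \<inter> (\<Inter>i\<in>?B. N i)"])
      fix q assume q: "q \<in> W \<inter> W' \<inter> (\<Inter>i\<in>?B. N i)"
      then show "f q = ?g q" using fq[of q] N Lq by (auto intro!: sum.cong)
    qed (use x(1,2) W' N in \<open>auto intro!: open_Int open_INT\<close>)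
    also have "\<dots> = (\<Sum>i\<in>?B. L i p * v (H i) + H i p * v (L i))"
      using tangentD(2)[OF v cfuns_const[OF A] sg] tangent_const[OF v] cfuns_mult[OF A L] N
      by (simp add: tangent_sum_fun[OF v] tangentD(4)[OF v L])
    also have "\<dots> = (\<Sum>i\<in>?B. h i (\<phi> p) * l i V)"
      by (rule sum.cong) (use x(2) N vL Lq linear_0[OF bounded_linear.linear[OF h(5)]] in auto)
    also have "\<dots> = chart_vec U \<phi> V p f"
    proof -
      have "((\<lambda>y. \<Sum>i\<in>?B. l i (y - \<phi> p) * h i y) has_derivative
          (\<lambda>w. \<Sum>i\<in>?B. l i (\<phi> p - \<phi> p) * frechet_derivative (h i) (at (\<phi> p)) w + l i w * h i (\<phi> p))) (at (\<phi> p))"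
      proof (intro has_derivative_sum has_derivative_mult)
        fix i assume i: "i \<in> ?B"
        show "(h i has_derivative frechet_derivative (h i) (at (\<phi> p))) (at (\<phi> p))"
          by (rule smooth_on_has_derivative[OF h(4)[OF i] h(2)])
        have "((\<lambda>y. y - \<phi> p) has_derivative (\<lambda>w. w)) (at (\<phi> p))" by (auto intro!: derivative_eq_intros)
        from bounded_linear.has_derivative[OF h(5)[OF i] this]
        show "((\<lambda>y. l i (y - \<phi> p)) has_derivative l i) (at (\<phi> p))" by (simp add: o_def)
      qed
      from has_derivative_add[OF has_derivative_const[of "f p"] this]
      have "chart_vec U \<phi> V p f = 0 + (\<Sum>i\<in>?B. l i (\<phi> p - \<phi> p) * frechet_derivative (h i) (at (\<phi> p)) V + l i V * h i (\<phi> p))"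
        by (rule chart_vec_eqI[OF f U W'(1,2), rotated])
          (use fq in auto)
      then show ?thesis
        using linear_0[OF bounded_linear.linear[OF h(5)]] by (simp add: mult.commute)
    qed
    finally show ?thesis .
  qed
  then have "v = chart_vec U \<phi> V p"
    using tangentD(1)[OF v] by (auto simp: fun_eq_iff chart_vec_def)
  then show thesis by (rule that)
qed

end

section \<open>Local frames\<close>

lemma vector_fieldsI:
  "(\<And>p. X p \<in> tangent C p) \<Longrightarrow> (\<And>f. f \<in> C \<Longrightarrow> (\<lambda>p. X p f) \<in> C) \<Longrightarrow> X \<in> vector_fields C"
  unfolding vector_fields_def by simp

lemma vector_fieldsD:
  assumes "X \<in> vector_fields C"
  shows "X p \<in> tangent C p" "f \<in> C \<Longrightarrow> (\<lambda>p. X p f) \<in> C"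
  using assms unfolding vector_fields_def by auto

text \<open>The functions \<open>x\<close> are coordinates near \<open>p\<close>, and \<open>Z\<close> are the coordinate vector fields, cut off
  by the bump function \<open>\<rho>\<close>.\<close>

definition frame ::
  "('a::topological_space \<Rightarrow> real) set \<Rightarrow> 'a \<Rightarrow> 'i set \<Rightarrow> ('i \<Rightarrow> 'a \<Rightarrow> real) \<Rightarrow> ('i \<Rightarrow> 'a \<Rightarrow> 'a tvec) \<Rightarrow> ('a \<Rightarrow> real) \<Rightarrow> bool"
  where "frame C p I x Z \<rho> \<longleftrightarrow>
    finite I \<and> \<rho> \<in> C \<and> \<rho> p = 1 \<and>
    (\<forall>b\<in>I. x b \<in> C \<and> Z b \<in> vector_fields C) \<and>
    (\<forall>q. \<forall>v\<in>tangent C q. \<forall>f\<in>C. \<rho> q * v f = (\<Sum>b\<in>I. v (x b) * Z b q f)) \<and>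
    (\<forall>a\<in>I. \<forall>b\<in>I. Z a p (x b) = (if a = b then 1 else 0)) \<and>
    (\<exists>W. open W \<and> p \<in> W \<and> (\<forall>q\<in>W. \<forall>q'\<in>W. (\<forall>b\<in>I. x b q = x b q') \<longrightarrow> q = q'))"

lemma frameD:
  assumes "frame C p I x Z \<rho>"
  shows "finite I" "\<rho> \<in> C" "\<rho> p = 1" "b \<in> I \<Longrightarrow> x b \<in> C" "b \<in> I \<Longrightarrow> Z b \<in> vector_fields C"
    "v \<in> tangent C q \<Longrightarrow> f \<in> C \<Longrightarrow> \<rho> q * v f = (\<Sum>b\<in>I. v (x b) * Z b q f)"
    "a \<in> I \<Longrightarrow> b \<in> I \<Longrightarrow> Z a p (x b) = (if a = b then 1 else 0)"
  using assms unfolding frame_def by auto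

lemma frame_injective:
  assumes "frame C p I x Z \<rho>"
  obtains W where "open W" "p \<in> W" "\<forall>q\<in>W. \<forall>q'\<in>W. (\<forall>b\<in>I. x b q = x b q') \<longrightarrow> q = q'"
  using assms unfolding frame_def by metis

lemma frame_exists:
  fixes A :: "('a::{t2_space,second_countable_topology}, 'e::real_normed_vector) atlas"
  assumes A: "manifold A"
  obtains x Z \<rho> where "frame (cfuns A) p (fbasis :: 'e set) x Z \<rho>"
proof -
  note fd = manifold_findim[OF A]
  obtain U \<phi> where U: "(U, \<phi>) \<in> A" "p \<in> U" using manifold_cover[OF A] .
  note oU = manifold_chart(1)[OF A U(1)]
  obtain x :: "'e \<Rightarrow> 'a \<Rightarrow> real" and W where x: "open W" "p \<in> W" "W \<subseteq> U" "\<And>b. b \<in> fbasis \<Longrightarrow> x b \<in> cfuns A"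
    "\<And>b q. b \<in> fbasis \<Longrightarrow> q \<in> W \<Longrightarrow> x b q = coord b (\<phi> q)"
    by (rule coordinate_functions[OF A U]) (rule that)
  obtain \<rho> V K where r: "\<rho> \<in> cfuns A" "open V" "p \<in> V" "V \<subseteq> K" "closed K" "K \<subseteq> W"
    "\<And>x. x \<in> V \<Longrightarrow> \<rho> x = 1" "\<And>x. x \<notin> K \<Longrightarrow> \<rho> x = 0"
    by (rule bump[OF A x(1,2)]) (rule that)
  \<comment> \<open>The value 0 outside \<open>U\<close> is only a default: \<open>\<rho>\<close>
    already vanishes off the closed set \<open>K\<close> inside \<open>U\<close>, so the field is
    smooth across the boundary of \<open>U\<close> and the expansion with factor
    \<open>\<rho> q\<close> holds at every \<open>q\<close>, trivially off \<open>K\<close>.\<close>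
  define Z where "Z b q = vscale (\<rho> q) (if q \<in> U then chart_vec A U \<phi> b q else 0)" for b q
  have xb: "chart_vec A U \<phi> w q (x b) = coord b w" if "q \<in> W" "b \<in> fbasis" for w q b
    by (rule chart_vec_eqI[OF A x(4) U(1) _ x(1), where g="coord b"])
      (use that x(3,5) bounded_linear_imp_has_derivative[OF bounded_linear_coord[OF fd]] in auto)
  have "frame (cfuns A) p (fbasis :: 'e set) x Z \<rho>"
    unfolding frame_def
  proof (intro conjI ballI allI)
    fix b :: 'e assume b: "b \<in> fbasis"
    show "Z b \<in> vector_fields (cfuns A)"
    proof (rule vector_fieldsI)
      show "Z b q \<in> tangent (cfuns A) q" for q
        unfolding Z_def using chart_vec_tangent[OF A U(1)] by auto
      fix f assume f: "f \<in> cfuns A"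
      show "(\<lambda>q. Z b q f) \<in> cfuns A"
      proof (rule cfuns_local[OF A])
        fix q
        show "\<exists>F\<in>cfuns A. \<exists>W. open W \<and> q \<in> W \<and> (\<forall>x\<in>W. Z b x f = F x)"
        proof (cases "q \<in> U")
          case True
          have "smooth_on (\<phi> ` U) (\<lambda>y. frechet_derivative (\<lambda>y. f (inv_into U \<phi> y)) (at y) b)"
            by (rule smooth_on_frechet_derivative[OF smooth_funs_chart[OF A f U(1)]])
          from smooth_funs_extend[OF A U(1) oU True order_refl this] obtain F V K where
            F: "F \<in> cfuns A" "open V" "q \<in> V" "V \<subseteq> K" "K \<subseteq> U" "\<And>x. x \<in> V \<Longrightarrow> F x = frechet_derivative (\<lambda>y. f (inv_into U \<phi> y)) (at (\<phi> x)) b"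
            by metis
          then show ?thesis
            by (intro bexI[of _ "\<lambda>x. \<rho> x * F x"] exI[of _ V] cfuns_mult[OF A r(1)])
              (use F f in \<open>auto simp: Z_def chart_vec_def[OF A]\<close>)
        next
          case False
          then show ?thesis
            by (intro bexI[of _ "\<lambda>x. 0"] exI[of _ "- K"] cfuns_const[OF A])
              (use r x in \<open>auto simp: Z_def\<close>)
        qed
      qed
    qed
  next
    fix q v f assume v: "v \<in> tangent (cfuns A) q" and f: "f \<in> cfuns A"
    show "\<rho> q * v f = (\<Sum>b\<in>fbasis. v (x b) * Z b q f)"
    proof (cases "q \<in> K")
      case True
      then have q: "q \<in> U" "q \<in> W" using r(6) x(3) by auto
      obtain w where w: "v = chart_vec A U \<phi> w q" using tangent_chart[OF A U(1) q(1) v] .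
      interpret linear "\<lambda>w. chart_vec A U \<phi> w q f" by (rule chart_vec_linear[OF A U(1) q(1)])
      have "v f = chart_vec A U \<phi> (\<Sum>b\<in>fbasis. coord b w *\<^sub>R b) q f" by (simp add: w sum_representation[OF fd])
      also have "\<dots> = (\<Sum>b\<in>fbasis. coord b w * chart_vec A U \<phi> b q f)" by (simp add: sum scale)
      also have "\<dots> = (\<Sum>b\<in>fbasis. v (x b) * chart_vec A U \<phi> b q f)" using q by (simp add: w xb)
      finally show ?thesis using q by (simp add: Z_def sum_distrib_left mult.left_commute)
    qed (simp add: Z_def r(8))
  next
    fix a b :: 'e assume "a \<in> fbasis" "b \<in> fbasis"
    then show "Z a p (x b) = (if a = b then 1 else 0)"
      using r(3,7) U(2) x(2) representation_basis[OF fbasis(2)[OF fd]] by (simp add: Z_def xb)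
  next
    have "q = q'" if "q \<in> W" "q' \<in> W" "\<And>b. b \<in> fbasis \<Longrightarrow> x b q = x b q'" for q q'
    proof -
      have "\<phi> q = \<phi> q'"
        using sum_representation[OF fd, of "\<phi> q"] sum_representation[OF fd, of "\<phi> q'"] that x(5)
        by (metis (no_types, lifting) sum.cong)
      then show ?thesis using inj_onD[OF manifold_chart(3)[OF A U(1)]] that x(3) by blast
    qed
    then show "\<exists>W. open W \<and> p \<in> W \<and> (\<forall>q\<in>W. \<forall>q'\<in>W. (\<forall>b\<in>fbasis. x b q = x b q') \<longrightarrow> q = q')"
      using x(1,2) by blast
  qed (use r x fbasis(1)[OF fd] in auto)
  then show thesis by (rule that)
qed

context
  fixes A :: "('a::{t2_space,second_countable_topology}, 'e::real_normed_vector) atlas"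
  assumes A: "manifold A"
begin

lemma vector_fields_add: "X \<in> vector_fields (cfuns A) \<Longrightarrow> Y \<in> vector_fields (cfuns A) \<Longrightarrow> (\<lambda>p. X p + Y p) \<in> vector_fields (cfuns A)"
  by (rule vector_fieldsI) (simp_all add: vector_fieldsD tangent_add cfuns_add[OF A])

lemma vector_fields_scale:
  "c \<in> cfuns A \<Longrightarrow> X \<in> vector_fields (cfuns A) \<Longrightarrow> (\<lambda>p. vscale (c p) (X p)) \<in> vector_fields (cfuns A)"
  by (rule vector_fieldsI) (simp_all add: vector_fieldsD tangent_vscale cfuns_mult[OF A])

lemma vector_fields_minus: "X \<in> vector_fields (cfuns A) \<Longrightarrow> (\<lambda>p. - X p) \<in> vector_fields (cfuns A)"
  using vector_fields_scale[OF cfuns_const[OF A, of "- 1"]] by (simp add: vscale_minus_1)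

lemma vector_fields_diff:
  "X \<in> vector_fields (cfuns A) \<Longrightarrow> Y \<in> vector_fields (cfuns A) \<Longrightarrow> (\<lambda>p. X p - Y p) \<in> vector_fields (cfuns A)"
  using vector_fields_add[OF _ vector_fields_minus] by simp

lemma vector_fields_sum:
  "(\<And>i. i \<in> I \<Longrightarrow> X i \<in> vector_fields (cfuns A)) \<Longrightarrow> (\<lambda>p f. \<Sum>i\<in>I. X i p f) \<in> vector_fields (cfuns A)"
  by (rule vector_fieldsI) (simp_all add: vector_fieldsD tangent_sum cfuns_sum[OF A])

text \<open>The choice behind \<open>extend_vec\<close> is never vacuous: the combination of the
  frame fields at \<open>p\<close> with the constant coefficients \<open>v (x b)\<close> extends
  \<open>v\<close>, because \<open>\<rho> p = 1\<close>.\<close>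

lemma extend_vec:
  assumes v: "v \<in> tangent (cfuns A) p"
  shows "extend_vec (cfuns A) p v \<in> vector_fields (cfuns A)" "extend_vec (cfuns A) p v p = v"
proof -
  obtain x Z \<rho> where F: "frame (cfuns A) p (fbasis :: 'e set) x Z \<rho>" using frame_exists[OF A] .
  let ?X = "\<lambda>q f. \<Sum>b\<in>(fbasis :: 'e set). vscale (v (x b)) (Z b q) f"
  have "?X \<in> vector_fields (cfuns A)"
    by (intro vector_fields_sum vector_fields_scale cfuns_const[OF A] frameD(5)[OF F])
  moreover have "?X p = v"
  proof
    fix f show "?X p f = v f"
    proof (cases "f \<in> cfuns A")
      case True
      then show ?thesis using frameD(6)[OF F v True] frameD(3)[OF F] by simp
    next
      case False
      then show ?thesis
        using tangentD(1)[OF v] tangentD(1)[OF vector_fieldsD(1)[OF frameD(5)[OF F]]] by simp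
    qed
  qed
  ultimately have "\<exists>X. X \<in> vector_fields (cfuns A) \<and> X p = v" by blast
  from someI_ex[OF this] show "extend_vec (cfuns A) p v \<in> vector_fields (cfuns A)" "extend_vec (cfuns A) p v p = v"
    unfolding extend_vec_def by auto
qed

end

section \<open>Tangent vectors of products\<close>

context
  fixes A :: "('a::{t2_space,second_countable_topology}, 'e::real_normed_vector) atlas"
    and B :: "('b::{t2_space,second_countable_topology}, 'f::real_normed_vector) atlas"
  assumes A: "manifold A" and B: "manifold B"
begin

lemma slice:
  assumes "F \<in> cfuns (prod_atlas A B)"
  shows "(\<lambda>x. F (x, y)) \<in> cfuns A" "(\<lambda>y. F (x, y)) \<in> cfuns B"
  using smooth_funs_compose[OF A manifold_prod[OF A B] smooth_map_Pair[OF A A B smooth_map_ident[OF A] smooth_map_const[OF A B]] assms]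
    smooth_funs_compose[OF B manifold_prod[OF A B] smooth_map_Pair[OF B A B smooth_map_const[OF B A] smooth_map_ident[OF B]] assms]
  by auto

lemma cfuns_fst: "f \<in> cfuns A \<Longrightarrow> (\<lambda>z. f (fst z)) \<in> cfuns (prod_atlas A B)"
  using smooth_funs_compose[OF manifold_prod[OF A B] A smooth_map_fst[OF A B]] by auto

lemma cfuns_snd: "f \<in> cfuns B \<Longrightarrow> (\<lambda>z. f (snd z)) \<in> cfuns (prod_atlas A B)"
  using smooth_funs_compose[OF manifold_prod[OF A B] B smooth_map_snd[OF A B]] by auto

lemma prod_chart_has_derivative:
  assumes F: "F \<in> cfuns (prod_atlas A B)" and U: "(U, \<phi>) \<in> A" "x \<in> U" and V: "(V, \<psi>) \<in> B" "y \<in> V"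
  shows "((\<lambda>z. F (inv_into U \<phi> (fst z), inv_into V \<psi> (snd z))) has_derivative
    (\<lambda>w. chart_vec (prod_atlas A B) (U \<times> V) (map_prod \<phi> \<psi>) w (x, y) F)) (at (\<phi> x, \<psi> y))"
proof (rule has_derivative_transform_within_open)
  note UV = prod_atlasI[OF U(1) V(1)]
  show "((\<lambda>z. F (inv_into (U \<times> V) (map_prod \<phi> \<psi>) z)) has_derivative
    (\<lambda>w. chart_vec (prod_atlas A B) (U \<times> V) (map_prod \<phi> \<psi>) w (x, y) F)) (at (\<phi> x, \<psi> y))"
    using chart_vec_has_derivative[OF manifold_prod[OF A B] F UV, of "(x, y)"] U V by simp
  show "open (map_prod \<phi> \<psi> ` (U \<times> V))" by (rule manifold_chart(2)[OF manifold_prod[OF A B] UV])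
  show "(\<phi> x, \<psi> y) \<in> map_prod \<phi> \<psi> ` (U \<times> V)" using U V by force
  show "F (inv_into (U \<times> V) (map_prod \<phi> \<psi>) z) = F (inv_into U \<phi> (fst z), inv_into V \<psi> (snd z))"
    if "z \<in> map_prod \<phi> \<psi> ` (U \<times> V)" for z
    using inv_into_map_prod[OF manifold_chart(3)[OF A U(1)] manifold_chart(3)[OF B V(1)] that] by simp
qed

lemma chart_vec_slice:
  assumes F: "F \<in> cfuns (prod_atlas A B)" and U: "(U, \<phi>) \<in> A" "x \<in> U" and V: "(V, \<psi>) \<in> B" "y \<in> V"
  shows "chart_vec A U \<phi> u x (\<lambda>x. F (x, y)) = chart_vec (prod_atlas A B) (U \<times> V) (map_prod \<phi> \<psi>) (u, 0) (x, y) F"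
    and "chart_vec B V \<psi> v y (\<lambda>y. F (x, y)) = chart_vec (prod_atlas A B) (U \<times> V) (map_prod \<phi> \<psi>) (0, v) (x, y) F"
proof -
  note d = prod_chart_has_derivative[OF F U V]
  have 1: "((\<lambda>a. (a, \<psi> y)) has_derivative (\<lambda>u. (u, 0))) (at (\<phi> x))"
    and 2: "((\<lambda>b. (\<phi> x, b)) has_derivative (\<lambda>v. (0, v))) (at (\<psi> y))"
    by (auto intro!: derivative_eq_intros)
  show "chart_vec A U \<phi> u x (\<lambda>x. F (x, y)) = chart_vec (prod_atlas A B) (U \<times> V) (map_prod \<phi> \<psi>) (u, 0) (x, y) F"
    by (rule chart_vec_eqI[OF A slice(1)[OF F] U open_UNIV UNIV_I _ has_derivative_compose[OF 1 d]])
      (simp add: chart_inv[OF A U(1)] chart_inv[OF B V])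
  show "chart_vec B V \<psi> v y (\<lambda>y. F (x, y)) = chart_vec (prod_atlas A B) (U \<times> V) (map_prod \<phi> \<psi>) (0, v) (x, y) F"
    by (rule chart_vec_eqI[OF B slice(2)[OF F] V open_UNIV UNIV_I _ has_derivative_compose[OF 2 d]])
      (simp add: chart_inv[OF A U] chart_inv[OF B V(1)])
qed

text \<open>In a product chart the direction of \<open>z\<close> splits as
  \<open>(u, 0) + (0, w)\<close>, and each summand differentiates one slice of \<open>F\<close>. In
  particular \<open>z\<close> is determined by its two components.\<close>

lemma tangent_prod_eval:
  assumes z: "z \<in> tangent (cfuns (prod_atlas A B)) (x, y)" and F: "F \<in> cfuns (prod_atlas A B)"
  shows "z F = tmap (cfuns A) fst z (\<lambda>x. F (x, y)) + tmap (cfuns B) snd z (\<lambda>y. F (x, y))"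
proof -
  obtain U \<phi> V \<psi> where U: "(U, \<phi>) \<in> A" "x \<in> U" and V: "(V, \<psi>) \<in> B" "y \<in> V"
    using manifold_cover[OF A] manifold_cover[OF B] by metis
  note AB = manifold_prod[OF A B] and UV = prod_atlasI[OF U(1) V(1)]
  have xy: "(x, y) \<in> U \<times> V" using U V by simp
  obtain w where w: "z = chart_vec (prod_atlas A B) (U \<times> V) (map_prod \<phi> \<psi>) w (x, y)"
    using tangent_chart[OF AB UV xy z] .
  let ?c = "\<lambda>w. chart_vec (prod_atlas A B) (U \<times> V) (map_prod \<phi> \<psi>) w (x, y) F"
  interpret linear ?c by (rule chart_vec_linear[OF AB UV xy])
  have f: "((\<lambda>a. fst a) has_derivative (\<lambda>a. fst a)) (at (\<phi> x, \<psi> y))" "((\<lambda>a. snd a) has_derivative (\<lambda>a. snd a)) (at (\<phi> x, \<psi> y))"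
    by (auto intro!: derivative_eq_intros)
  have 1: "tmap (cfuns A) fst z g = chart_vec A U \<phi> (fst w) x g" for g
  proof (cases "g \<in> cfuns A")
    case True
    have "((\<lambda>a. g (inv_into U \<phi> (fst a))) has_derivative (\<lambda>w. chart_vec A U \<phi> (fst w) x g)) (at (\<phi> x, \<psi> y))"
      by (rule has_derivative_compose[OF f(1)]) (use chart_vec_has_derivative[OF A True U] in simp)
    then have "((\<lambda>a. g (inv_into U \<phi> (fst a))) has_derivative (\<lambda>w. chart_vec A U \<phi> (fst w) x g)) (at (map_prod \<phi> \<psi> (x, y)))" by simp
    from chart_vec_eqI[OF AB cfuns_fst[OF True] UV xy open_UNIV UNIV_I _ this]
    show ?thesis using True by (cases w) (auto simp: w tmap_apply chart_inv[OF A U(1)])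
  qed (simp add: tmap_apply chart_vec_def[OF A])
  have 2: "tmap (cfuns B) snd z g = chart_vec B V \<psi> (snd w) y g" for g
  proof (cases "g \<in> cfuns B")
    case True
    have "((\<lambda>a. g (inv_into V \<psi> (snd a))) has_derivative (\<lambda>w. chart_vec B V \<psi> (snd w) y g)) (at (\<phi> x, \<psi> y))"
      by (rule has_derivative_compose[OF f(2)]) (use chart_vec_has_derivative[OF B True V] in simp)
    then have "((\<lambda>a. g (inv_into V \<psi> (snd a))) has_derivative (\<lambda>w. chart_vec B V \<psi> (snd w) y g)) (at (map_prod \<phi> \<psi> (x, y)))" by simp
    from chart_vec_eqI[OF AB cfuns_snd[OF True] UV xy open_UNIV UNIV_I _ this]
    show ?thesis using True by (cases w) (auto simp: w tmap_apply chart_inv[OF B V(1)])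
  qed (simp add: tmap_apply chart_vec_def[OF B])
  have "z F = ?c ((fst w, 0) + (0, snd w))" by (simp add: w)
  also have "\<dots> = ?c (fst w, 0) + ?c (0, snd w)" by (rule add)
  finally show ?thesis by (simp only: 1 2 chart_vec_slice[OF F U V])
qed

definition prod_vec :: "'a tvec \<Rightarrow> 'b tvec \<Rightarrow> 'a \<times> 'b \<Rightarrow> ('a \<times> 'b) tvec"
  where "prod_vec v w = (\<lambda>(x, y) F. if F \<in> cfuns (prod_atlas A B) then v (\<lambda>x. F (x, y)) + w (\<lambda>y. F (x, y)) else 0)"

lemma prod_vec_tangent:
  assumes v: "v \<in> tangent (cfuns A) x" and w: "w \<in> tangent (cfuns B) y"
  shows "prod_vec v w (x, y) \<in> tangent (cfuns (prod_atlas A B)) (x, y)"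
  by (rule tangentI)
    (auto simp: prod_vec_def cfuns_add[OF manifold_prod[OF A B]] cfuns_mult[OF manifold_prod[OF A B]]
      cfuns_mult[OF manifold_prod[OF A B] cfuns_const[OF manifold_prod[OF A B]]]
      tangentD(2-4)[OF v] tangentD(2-4)[OF w] slice algebra_simps)

lemma tmap_prod_vec:
  assumes v: "v \<in> tangent (cfuns A) x" and w: "w \<in> tangent (cfuns B) y"
  shows "tmap (cfuns A) fst (prod_vec v w (x, y)) = v" "tmap (cfuns B) snd (prod_vec v w (x, y)) = w"
  by (auto simp: fun_eq_iff tmap_apply prod_vec_def cfuns_fst cfuns_snd tangentD(1)[OF v] tangentD(1)[OF w]
      tangent_const[OF A v] tangent_const[OF B w])

text \<open>Joint smoothness of a partial derivative. Near a point, \<open>Z\<close> acts on the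
  slice as a combination of the partial derivatives of \<open>F\<close> in the first chart variable,
  which are jointly smooth in the product chart, with coefficients \<open>Z m (x b)\<close> that
  depend on the first variable only.\<close>

lemma vector_field_slice:
  assumes Z: "Z \<in> vector_fields (cfuns A)" and F: "F \<in> cfuns (prod_atlas A B)"
  shows "(\<lambda>(x, y). Z x (\<lambda>x. F (x, y))) \<in> cfuns (prod_atlas A B)"
proof (rule cfuns_local[OF manifold_prod[OF A B]])
  fix p :: "'a \<times> 'b"
  note AB = manifold_prod[OF A B] and fd = manifold_findim[OF A]
  obtain U \<phi> V \<psi> where U: "(U, \<phi>) \<in> A" "fst p \<in> U" and V: "(V, \<psi>) \<in> B" "snd p \<in> V"
    using manifold_cover[OF A] manifold_cover[OF B] by metis
  note UV = prod_atlasI[OF U(1) V(1)]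
  obtain x :: "'e \<Rightarrow> 'a \<Rightarrow> real" and W where x: "open W" "fst p \<in> W" "W \<subseteq> U" "\<And>b. b \<in> fbasis \<Longrightarrow> x b \<in> cfuns A"
    "\<And>b q. b \<in> fbasis \<Longrightarrow> q \<in> W \<Longrightarrow> x b q = coord b (\<phi> q)"
    by (rule coordinate_functions[OF A U]) (rule that)
  have xb: "chart_vec A U \<phi> w q (x b) = coord b w" if "q \<in> W" "b \<in> fbasis" for w q b
    by (rule chart_vec_eqI[OF A x(4) U(1) _ x(1), where g="coord b"])
      (use that x(3,5) bounded_linear_imp_has_derivative[OF bounded_linear_coord[OF fd]] in auto)
  let ?c = "\<lambda>b z. chart_vec (prod_atlas A B) (U \<times> V) (map_prod \<phi> \<psi>) (b, 0) z F"
  have eq: "Z m (\<lambda>x. F (x, n)) = (\<Sum>b\<in>fbasis. Z m (x b) * ?c b (m, n))" if "m \<in> W" "n \<in> V" for m n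
  proof -
    have m: "m \<in> U" using that x(3) by blast
    obtain w where w: "Z m = chart_vec A U \<phi> w m"
      using tangent_chart[OF A U(1) m vector_fieldsD(1)[OF Z]] .
    interpret linear "\<lambda>w. chart_vec A U \<phi> w m (\<lambda>x. F (x, n))" by (rule chart_vec_linear[OF A U(1) m])
    have "Z m (\<lambda>x. F (x, n)) = chart_vec A U \<phi> (\<Sum>b\<in>fbasis. coord b w *\<^sub>R b) m (\<lambda>x. F (x, n))"
      by (simp add: w sum_representation[OF fd])
    also have "\<dots> = (\<Sum>b\<in>fbasis. coord b w * chart_vec A U \<phi> b m (\<lambda>x. F (x, n)))" by (simp add: sum scale)
    also have "\<dots> = (\<Sum>b\<in>fbasis. Z m (x b) * ?c b (m, n))"
      using that by (intro sum.cong) (auto simp: w xb chart_vec_slice(1)[OF F U(1) m V(1)])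
    finally show ?thesis .
  qed
  have "\<exists>G. G \<in> cfuns (prod_atlas A B) \<and> (\<exists>N. open N \<and> p \<in> N \<and> (\<forall>z\<in>N. ?c b z = G z))" for b
  proof -
    have "smooth_on (map_prod \<phi> \<psi> ` (U \<times> V)) (\<lambda>y. frechet_derivative (\<lambda>y. F (inv_into (U \<times> V) (map_prod \<phi> \<psi>) y)) (at y) (b, 0))"
      by (rule smooth_on_frechet_derivative[OF smooth_funs_chart[OF AB F UV]])
    from smooth_funs_extend[OF AB UV manifold_chart(1)[OF AB UV] _ order_refl this, of p] obtain G N K where
      G: "G \<in> cfuns (prod_atlas A B)" "open N" "p \<in> N" "\<And>z. z \<in> N \<Longrightarrow> G z = frechet_derivative (\<lambda>y. F (inv_into (U \<times> V) (map_prod \<phi> \<psi>) y)) (at (map_prod \<phi> \<psi> z)) (b, 0)"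
      using U V by (metis mem_Times_iff)
    then show ?thesis using F by (intro exI[of _ G]) (auto simp: chart_vec_def[OF AB])
  qed
  then obtain G where "\<forall>b. G b \<in> cfuns (prod_atlas A B) \<and> (\<exists>N. open N \<and> p \<in> N \<and> (\<forall>z\<in>N. ?c b z = G b z))"
    by metis
  then obtain N where G: "\<And>b. G b \<in> cfuns (prod_atlas A B)"
    and N: "\<And>b. open (N b) \<and> p \<in> N b \<and> (\<forall>z\<in>N b. ?c b z = G b z)"
    by metis
  let ?N = "(W \<times> V) \<inter> (\<Inter>b\<in>fbasis. N b)"
  show "\<exists>G\<in>cfuns (prod_atlas A B). \<exists>W. open W \<and> p \<in> W \<and> (\<forall>z\<in>W. (case z of (x, y) \<Rightarrow> Z x (\<lambda>x. F (x, y))) = G z)"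
  proof (intro bexI[of _ "\<lambda>z. \<Sum>b\<in>fbasis. Z (fst z) (x b) * G b z"] exI[of _ ?N] conjI ballI)
    show "open ?N" using x(1) manifold_chart(1)[OF B V(1)] N fbasis(1)[OF fd] by (auto intro!: open_Int open_Times open_INT)
    show "p \<in> ?N" using x(2) V(2) N by (auto simp: mem_Times_iff)
    show "(\<lambda>z. \<Sum>b\<in>fbasis. Z (fst z) (x b) * G b z) \<in> cfuns (prod_atlas A B)"
      by (intro cfuns_sum[OF AB] cfuns_mult[OF AB] G cfuns_fst vector_fieldsD(2)[OF Z] x(4))
    show "(case z of (x, y) \<Rightarrow> Z x (\<lambda>x. F (x, y))) = (\<Sum>b\<in>fbasis. Z (fst z) (x b) * G b z)" if "z \<in> ?N" for z
      using that N by (auto simp: eq split_beta intro!: sum.cong)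
  qed
qed

lemma tangent_slice:
  assumes v: "v \<in> tangent (cfuns A) a" and F: "F \<in> cfuns (prod_atlas A B)"
  shows "(\<lambda>y. v (\<lambda>x. F (x, y))) \<in> cfuns B"
proof -
  have "(\<lambda>y. (\<lambda>(x, y). extend_vec (cfuns A) a v x (\<lambda>x. F (x, y))) (a, y)) \<in> cfuns B"
    by (rule slice(2)[OF vector_field_slice[OF extend_vec(1)[OF A v] F]])
  then show ?thesis by (simp add: extend_vec(2)[OF A v])
qed

text \<open>The vectors vary with the parameter but stay at the one point \<open>a\<close>, so a
  frame at \<open>a\<close> separates the two dependences: the coefficients \<open>v y (x b)\<close>
  are smooth by assumption, and each fixed frame vector falls under \<open>tangent_slice\<close>.
  Applied at the identity of a Lie group, this gives smooth fundamental vector fields.\<close>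

lemma tangent_family_slice:
  assumes v: "\<And>y. v y \<in> tangent (cfuns A) a" "\<And>f. f \<in> cfuns A \<Longrightarrow> (\<lambda>y. v y f) \<in> cfuns B"
    and F: "F \<in> cfuns (prod_atlas A B)"
  shows "(\<lambda>y. v y (\<lambda>x. F (x, y))) \<in> cfuns B"
proof -
  obtain x Z \<rho> where fr: "frame (cfuns A) a (fbasis :: 'e set) x Z \<rho>" using frame_exists[OF A] .
  have "v y (\<lambda>x. F (x, y)) = (\<Sum>b\<in>fbasis. v y (x b) * Z b a (\<lambda>x. F (x, y)))" for y
    using frameD(6)[OF fr v(1) slice(1)[OF F]] frameD(3)[OF fr] by simp
  then show ?thesis
    by (simp only:) (intro cfuns_sum[OF B] cfuns_mult[OF B] v(2) frameD(4)[OF fr]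
        tangent_slice[OF vector_fieldsD(1)[OF frameD(5)[OF fr]] F])
qed

end

section \<open>Tangent vectors of level sets and fibre products\<close>

text \<open>Otherwise \<open>F\<close> and the functions \<open>h b\<close> together would form a submersion at \<open>p\<close>, and by Sussmann's
  open mapping theorem \<open>F\<close> would take nonzero values on the level set.\<close>

lemma tangent_level_set:
  fixes A :: "('a::{t2_space,second_countable_topology}, 'e::real_normed_vector) atlas"
    and h :: "'i::real_normed_vector \<Rightarrow> 'a \<Rightarrow> real"
  assumes A: "manifold A" and fd: "findim TYPE('i)"
    and h: "\<And>b. b \<in> fbasis \<Longrightarrow> h b \<in> cfuns A" and u: "\<And>b. b \<in> fbasis \<Longrightarrow> u b \<in> tangent (cfuns A) p"
    and uh: "\<And>a b. a \<in> fbasis \<Longrightarrow> b \<in> fbasis \<Longrightarrow> u a (h b) = (if a = b then 1 else 0)"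
    and v: "v \<in> tangent (cfuns A) p" and vh: "\<And>b. b \<in> fbasis \<Longrightarrow> v (h b) = 0"
    and F: "F \<in> cfuns A" and W: "open W" "p \<in> W"
    and F0: "\<And>q. q \<in> W \<Longrightarrow> (\<And>b. b \<in> fbasis \<Longrightarrow> h b q = h b p) \<Longrightarrow> F q = 0"
  shows "v F = 0"
proof (rule ccontr)
  assume c: "v F \<noteq> 0"
  let ?K = "fbasis :: 'i set"
  obtain U \<phi> where U: "(U, \<phi>) \<in> A" "p \<in> U" using manifold_cover[OF A] .
  obtain V where V: "v = chart_vec A U \<phi> V p" using tangent_chart[OF A U v] .
  have "\<forall>b\<in>?K. \<exists>w. u b = chart_vec A U \<phi> w p" using tangent_chart[OF A U u] by metis
  then obtain w where w: "\<And>b. b \<in> ?K \<Longrightarrow> u b = chart_vec A U \<phi> (w b) p" using bchoice by metis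
  \<comment> \<open>The redundant index of the Euclidean space gets the zero direction.\<close>
  define w' where "w' i = (if Rep_idx i \<in> ?K then w (Rep_idx i) else 0)" for i :: "'i idx"
  define L where "L z = (\<Sum>i\<in>UNIV. (fst z $ i) *\<^sub>R w' i) + snd z *\<^sub>R V" for z :: "(real ^ 'i idx) \<times> real"
  define \<gamma> where "\<gamma> z = \<phi> p + L z" for z
  have L: "bounded_linear L" unfolding L_def[abs_def]
    by (intro bounded_linear_add bounded_linear_sum bounded_linear_scaleR_left[THEN bounded_linear_compose]
        bounded_linear_vec_nth[THEN bounded_linear_compose] bounded_linear_fst bounded_linear_snd)
  have \<gamma>0: "\<gamma> 0 = \<phi> p" using linear_0[OF bounded_linear.linear[OF L]] by (simp add: \<gamma>_def)
  have d\<gamma>: "(\<gamma> has_derivative L) (at 0)" unfolding \<gamma>_def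
    using has_derivative_add[OF has_derivative_const bounded_linear_imp_has_derivative[OF L]] by simp
  have UW: "open (\<phi> ` (U \<inter> W))"
    by (rule chart_open_image[OF A U(1)]) (use manifold_chart(1)[OF A U(1)] W in auto)
  have c\<gamma>: "continuous_on UNIV \<gamma>" unfolding \<gamma>_def by (intro continuous_intros linear_continuous_on L)
  define T where "T = \<gamma> -` \<phi> ` (U \<inter> W)"
  have oT: "open T" unfolding T_def by (rule open_vimage[OF UW c\<gamma>])
  have T0: "0 \<in> T" using U W by (simp add: T_def \<gamma>0)
  define q where "q z = inv_into U \<phi> (\<gamma> z)" for z
  have q: "q z \<in> U \<inter> W" if "z \<in> T" for z
    using that chart_inv[OF A U(1)] by (auto simp: T_def q_def)
  have q0: "q 0 = p" using U by (simp add: q_def \<gamma>0 chart_inv[OF A U(1)])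
  have dfq: "((\<lambda>z. f (q z)) has_derivative
      (\<lambda>z. (\<Sum>i\<in>UNIV. (fst z $ i) * chart_vec A U \<phi> (w' i) p f) + snd z * v f)) (at 0)"
    and cfq: "continuous_on T (\<lambda>z. f (q z))" if f: "f \<in> cfuns A" for f
  proof -
    interpret linear "\<lambda>V. chart_vec A U \<phi> V p f" by (rule chart_vec_linear[OF A U])
    have "chart_vec A U \<phi> (L z) p f = (\<Sum>i\<in>UNIV. (fst z $ i) * chart_vec A U \<phi> (w' i) p f) + snd z * v f" for z
      by (simp add: L_def add sum scale V)
    then show "((\<lambda>z. f (q z)) has_derivative
        (\<lambda>z. (\<Sum>i\<in>UNIV. (fst z $ i) * chart_vec A U \<phi> (w' i) p f) + snd z * v f)) (at 0)"
      using has_derivative_compose[OF d\<gamma>, of "\<lambda>y. f (inv_into U \<phi> y)" "\<lambda>V. chart_vec A U \<phi> V p f"]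
        chart_vec_has_derivative[OF A f U] by (simp add: q_def \<gamma>0)
    show "continuous_on T (\<lambda>z. f (q z))" unfolding q_def
      by (rule continuous_on_compose2[OF smooth_on_continuous[OF smooth_funs_chart[OF A f U(1)]] continuous_on_subset[OF c\<gamma>]])
        (auto simp: T_def)
  qed
  define a where "a i = chart_vec A U \<phi> (w' i) p F" for i
  \<comment> \<open>A map between spaces of the same dimension: the values of the \<open>h b\<close>
    and of \<open>F\<close> along the affine family of points \<open>q z\<close>. At an index
    outside the basis the coordinate is just copied, so that the derivative at 0 is the identity in
    all coordinates but the last.\<close>
  define \<Phi> where "\<Phi> z = ((\<chi> i. if Rep_idx i \<in> ?K then h (Rep_idx i) (q z) else fst z $ i), F (q z))" for z
  have comp: "((\<lambda>z. if Rep_idx i \<in> ?K then h (Rep_idx i) (q z) else fst z $ i) has_derivative (\<lambda>z. fst z $ i)) (at 0)" for i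
  proof (cases "Rep_idx i \<in> ?K")
    case True
    have eq: "chart_vec A U \<phi> (w' j) p (h (Rep_idx i)) = (if j = i then 1 else 0)" for j
    proof (cases "Rep_idx j \<in> ?K")
      case 2: True
      then show ?thesis using uh[OF 2 True] w[OF 2] by (simp add: w'_def Rep_idx_inject)
    next
      case False
      then show ?thesis using True linear_0[OF chart_vec_linear[OF A U]] by (auto simp: w'_def)
    qed
    show ?thesis
      using dfq[OF h[OF True]] vh[OF True] True by (simp add: eq if_distrib sum.delta cong: if_cong)
  next
    case False
    have "bounded_linear (\<lambda>z :: (real ^ 'i idx) \<times> real. fst z $ i)"
      by (intro bounded_linear_vec_nth[THEN bounded_linear_compose] bounded_linear_fst)
    then show ?thesis using False by (simp add: bounded_linear_imp_has_derivative)
  qed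
  have "((\<lambda>z. \<chi> i. if Rep_idx i \<in> ?K then h (Rep_idx i) (q z) else fst z $ i) has_derivative (\<lambda>z. \<chi> i. fst z $ i)) (at 0)"
    unfolding has_derivative_componentwise_within[where f="\<lambda>z. \<chi> i. _ i z"]
    by (auto simp: Basis_vec_def inner_axis comp)
  then have d\<Phi>: "(\<Phi> has_derivative (\<lambda>z. ((\<chi> i. fst z $ i), (\<Sum>i\<in>UNIV. (fst z $ i) * a i) + snd z * v F))) (at 0)"
    unfolding \<Phi>_def[abs_def] a_def
    by (intro has_derivative_Pair dfq F)
  have "continuous_on T (\<lambda>z. if Rep_idx i \<in> ?K then h (Rep_idx i) (q z) else fst z $ i)" for i
    by (cases "Rep_idx i \<in> ?K") (auto intro!: cfq h continuous_intros)
  then have c\<Phi>: "continuous_on T \<Phi>"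
    unfolding \<Phi>_def[abs_def] by (intro continuous_on_Pair continuous_on_vec_lambda cfq F)
  \<comment> \<open>A right inverse of the derivative of \<open>\<Phi>\<close> at 0, solving the
    last equation for the second component of the argument; this is where
    \<open>v F \<noteq> 0\<close> enters.\<close>
  define g where "g z = (fst z, (snd z - (\<Sum>i\<in>UNIV. (fst z $ i) * a i)) / v F)" for z :: "(real ^ 'i idx) \<times> real"
  have g: "bounded_linear g" unfolding g_def[abs_def] divide_inverse
    by (intro bounded_linear_Pair bounded_linear_fst bounded_linear_snd bounded_linear_sub bounded_linear_sum
        bounded_linear_mult_left[THEN bounded_linear_compose] bounded_linear_vec_nth[THEN bounded_linear_compose])
  have "\<Phi> 0 \<in> interior (\<Phi> ` T)"
    by (rule sussmann_open_mapping[OF oT c\<Phi> T0 d\<Phi> g])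
      (use c oT T0 in \<open>auto simp: g_def fun_eq_iff interior_open\<close>)
  then obtain e where e: "e > 0" "ball (\<Phi> 0) e \<subseteq> \<Phi> ` T" using mem_interior by metis
  \<comment> \<open>A value near \<open>\<Phi> 0\<close> with the same \<open>h b\<close> and a
    nonzero last component. Being attained, it gives a point of the level set at which
    \<open>F\<close> is \<open>e / 2\<close> instead of 0.\<close>
  have "(fst (\<Phi> 0), e / 2) \<in> ball (\<Phi> 0) e"
    using F0[OF W(2)] e(1) by (simp add: dist_prod_def \<Phi>_def q0)
  then obtain z where z: "z \<in> T" "\<Phi> z = (fst (\<Phi> 0), e / 2)" using e(2) by (metis imageE subsetD)
  have "h b (q z) = h b p" if b: "b \<in> ?K" for b
  proof -
    have "b \<in> range Rep_idx"
      using type_definition.Rep_range[OF type_definition_idx, where ?'e1='i] fd b by simp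
    then obtain i where "b = Rep_idx i" by blast
    moreover have "fst (\<Phi> z) $ i = fst (\<Phi> 0) $ i" using z(2) by simp
    ultimately show ?thesis using b by (simp add: \<Phi>_def q0)
  qed
  then have "F (q z) = 0" using F0 q[OF z(1)] by blast
  then show False using z(2) e(1) by (simp add: \<Phi>_def)
qed

lemma tangent_restrict:
  assumes A: "manifold A" and z: "z \<in> tangent (smooth_funs A S) p"
  shows "(\<lambda>F. if F \<in> cfuns A then z F else 0) \<in> tangent (cfuns A) p"
proof (rule tangentI)
  fix f g c assume f: "f \<in> cfuns A"
  note D = tangentD[OF z] and s = cfuns_subset[OF A]
  show "(if (\<lambda>x. c * f x) \<in> cfuns A then z (\<lambda>x. c * f x) else 0) = c * (if f \<in> cfuns A then z f else 0)"
    using D(3)[OF s[OF f]] f cfuns_mult[OF A cfuns_const[OF A] f] by simp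
  assume g: "g \<in> cfuns A"
  show "(if (\<lambda>x. f x + g x) \<in> cfuns A then z (\<lambda>x. f x + g x) else 0) = (if f \<in> cfuns A then z f else 0) + (if g \<in> cfuns A then z g else 0)"
    using D(2)[OF s[OF f] s[OF g]] f g cfuns_add[OF A f g] by simp
  show "(if (\<lambda>x. f x * g x) \<in> cfuns A then z (\<lambda>x. f x * g x) else 0) =
      f p * (if g \<in> cfuns A then z g else 0) + g p * (if f \<in> cfuns A then z f else 0)"
    using D(4)[OF s[OF f] s[OF g]] f g cfuns_mult[OF A f g] by simp
qed simp

text \<open>A vector of the ambient manifold that annihilates every function vanishing on
  \<open>S\<close> near \<open>p\<close> is tangent to \<open>S\<close>: apply it to any global
  extension \<open>E f\<close> of the germ of \<open>f\<close>. The condition makes the result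
  independent of the extension, and the derivation rules follow from those of
  \<open>z\<close>.\<close>

lemma tangent_extend:
  assumes A: "manifold A" and p: "p \<in> S" and z: "z \<in> tangent (cfuns A) p"
    and z0: "\<And>F W. F \<in> cfuns A \<Longrightarrow> open W \<Longrightarrow> p \<in> W \<Longrightarrow> (\<And>q. q \<in> S \<Longrightarrow> q \<in> W \<Longrightarrow> F q = 0) \<Longrightarrow> z F = 0"
  obtains z' where "z' \<in> tangent (smooth_funs A S) p" "\<And>F. F \<in> cfuns A \<Longrightarrow> z' F = z F"
proof -
  let ?P = "\<lambda>f F. F \<in> cfuns A \<and> (\<exists>W. open W \<and> p \<in> W \<and> (\<forall>q. q \<in> S \<longrightarrow> q \<in> W \<longrightarrow> f q = F q))"
  have eq: "z F = z G" if "?P f F" "?P f G" for f F G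
  proof -
    obtain W W' where *: "F \<in> cfuns A" "G \<in> cfuns A" "open W" "p \<in> W" "open W'" "p \<in> W'"
      "\<And>q. q \<in> S \<Longrightarrow> q \<in> W \<Longrightarrow> f q = F q" "\<And>q. q \<in> S \<Longrightarrow> q \<in> W' \<Longrightarrow> f q = G q"
      using \<open>?P f F\<close> \<open>?P f G\<close> by blast
    have "z (\<lambda>q. F q - G q) = 0"
      by (rule z0[of _ "W \<inter> W'"]) (auto simp: *(1-6) cfuns_diff[OF A] simp flip: *(7,8))
    then show ?thesis using tangent_diff_fun[OF A z *(1,2)] by simp
  qed
  define E where "E f = (SOME F. ?P f F)" for f
  have E: "?P f (E f)" if f: "f \<in> smooth_funs A S" for f
  proof -
    obtain F W where "F \<in> cfuns A" "open W" "p \<in> W" "\<And>q. q \<in> S \<Longrightarrow> q \<in> W \<Longrightarrow> f q = F q"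
      by (rule smooth_funsE[OF A f p]) (rule that)
    then have "\<exists>F. ?P f F" by blast
    then show ?thesis unfolding E_def by (rule someI_ex)
  qed
  define z' where "z' f = (if f \<in> smooth_funs A S then z (E f) else 0)" for f
  have z': "z' f = z F" if "?P f F" "f \<in> smooth_funs A S" for f F
    using eq[OF E[OF that(2)] that(1)] that(2) by (simp add: z'_def)
  show thesis
  proof (rule that[of z'])
    show "z' F = z F" if "F \<in> cfuns A" for F
      by (rule z') (use that cfuns_subset[OF A] in \<open>auto intro: exI[of _ UNIV]\<close>)
    show "z' \<in> tangent (smooth_funs A S) p"
    proof (rule tangentI)
      fix f g c assume f: "f \<in> smooth_funs A S"
      obtain W where W: "open W" "p \<in> W" "\<And>q. q \<in> S \<Longrightarrow> q \<in> W \<Longrightarrow> f q = E f q" and Ef: "E f \<in> cfuns A" using E[OF f] by blast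
      have 1: "(\<lambda>x. c * f x) \<in> smooth_funs A S" by (rule smooth_funs_mult[OF A smooth_funs_const_on[OF A refl] f])
      have "z' (\<lambda>x. c * f x) = z (\<lambda>x. c * E f x)"
        by (rule z'[OF _ 1]) (use W Ef cfuns_mult[OF A cfuns_const[OF A]] in auto)
      then show "z' (\<lambda>x. c * f x) = c * z' f" using tangentD(3)[OF z Ef] f by (simp add: z'_def)
      assume g: "g \<in> smooth_funs A S"
      obtain W' where W': "open W'" "p \<in> W'" "\<And>q. q \<in> S \<Longrightarrow> q \<in> W' \<Longrightarrow> g q = E g q" and Eg: "E g \<in> cfuns A" using E[OF g] by blast
      have "z' (\<lambda>x. f x + g x) = z (\<lambda>x. E f x + E g x)"
        by (rule z'[OF _ smooth_funs_add[OF A f g]])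
          (use W W' Ef Eg cfuns_add[OF A] in \<open>auto intro!: exI[of _ "W \<inter> W'"]\<close>)
      then show "z' (\<lambda>x. f x + g x) = z' f + z' g" using tangentD(2)[OF z Ef Eg] f g by (simp add: z'_def)
      have "z' (\<lambda>x. f x * g x) = z (\<lambda>x. E f x * E g x)"
        by (rule z'[OF _ smooth_funs_mult[OF A f g]])
          (use W W' Ef Eg cfuns_mult[OF A] in \<open>auto intro!: exI[of _ "W \<inter> W'"]\<close>)
      then show "z' (\<lambda>x. f x * g x) = f p * z' g + g p * z' f"
        using tangentD(4)[OF z Ef Eg] f g W(2,3) W'(2,3) p by (simp add: z'_def)
    qed (simp add: z'_def)
  qed
qed

context
  fixes A :: "('a::{t2_space,second_countable_topology}, 'e::real_normed_vector) atlas"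
    and B :: "('b::{t2_space,second_countable_topology}, 'f::real_normed_vector) atlas"
  assumes A: "manifold A" and B: "manifold B"
begin

lemma tangent_subset_prod_eval:
  assumes z: "z \<in> tangent (smooth_funs (prod_atlas A B) S) (x, y)" and p: "(x, y) \<in> S"
    and f: "f \<in> smooth_funs (prod_atlas A B) S" and F: "F \<in> cfuns (prod_atlas A B)"
    and W: "open W" "(x, y) \<in> W" "\<And>q. q \<in> S \<Longrightarrow> q \<in> W \<Longrightarrow> f q = F q"
  shows "z f = tmap (cfuns A) fst z (\<lambda>x. F (x, y)) + tmap (cfuns B) snd z (\<lambda>y. F (x, y))"
proof -
  note AB = manifold_prod[OF A B]
  let ?z = "\<lambda>F. if F \<in> cfuns (prod_atlas A B) then z F else 0"
  have "z f = ?z F"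
    using tangent_local[OF AB z p f cfuns_subset[OF AB F] W] F by simp
  also have "\<dots> = tmap (cfuns A) fst ?z (\<lambda>x. F (x, y)) + tmap (cfuns B) snd ?z (\<lambda>y. F (x, y))"
    by (rule tangent_prod_eval[OF A B tangent_restrict[OF AB z] F])
  finally show ?thesis
    using cfuns_fst[OF A B slice(1)[OF A B F]] cfuns_snd[OF A B slice(2)[OF A B F]]
    by (simp add: tmap_apply slice[OF A B F])
qed

text \<open>Uniqueness for the definite description in \<open>Tcmp\<close>: a tangent vector of a
  subset of a product acts on local extensions through its two components only.\<close>

lemma tangent_subset_prod_unique:
  assumes z: "z \<in> tangent (smooth_funs (prod_atlas A B) S) (x, y)" "z' \<in> tangent (smooth_funs (prod_atlas A B) S) (x, y)"
    and p: "(x, y) \<in> S" and "tmap (cfuns A) fst z = tmap (cfuns A) fst z'" "tmap (cfuns B) snd z = tmap (cfuns B) snd z'"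
  shows "z = z'"
proof
  fix f show "z f = z' f"
  proof (cases "f \<in> smooth_funs (prod_atlas A B) S")
    case True
    obtain F W where "F \<in> cfuns (prod_atlas A B)" "open W" "(x, y) \<in> W" "\<And>q. q \<in> S \<Longrightarrow> q \<in> W \<Longrightarrow> f q = F q"
      by (rule smooth_funsE[OF manifold_prod[OF A B] True p]) (rule that)
    then show ?thesis
      using tangent_subset_prod_eval[OF z(1) p True] tangent_subset_prod_eval[OF z(2) p True] assms(4,5) by metis
  next
    case False
    then show ?thesis using tangentD(1)[OF z(1)] tangentD(1)[OF z(2)] by simp
  qed
qed

text \<open>Near \<open>(x, y)\<close> the fibre product is a common level set of differences of
  coordinates on the base. Lifting the frame at \<open>f x\<close> to vectors at \<open>x\<close>
  gives vectors dual to these differences, so \<open>tangent_level_set\<close> shows that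
  \<open>(v, w)\<close> annihilates the functions vanishing on the fibre product, and
  \<open>tangent_extend\<close> makes it a tangent vector there.\<close>

lemma fibre_product_tangent:
  fixes D :: "('d::{t2_space,second_countable_topology}, 'g::real_normed_vector) atlas"
  assumes D: "manifold D" and f: "smooth_map A UNIV D f" and g: "smooth_map B UNIV D g"
    and p: "f x = g y" and sub: "tangent (cfuns D) (f x) \<subseteq> tmap (cfuns D) f ` tangent (cfuns A) x"
    and v: "v \<in> tangent (cfuns A) x" and w: "w \<in> tangent (cfuns B) y" and vw: "tmap (cfuns D) f v = tmap (cfuns D) g w"
  obtains z where "z \<in> tangent (smooth_funs (prod_atlas A B) {(x, y). f x = g y}) (x, y)"
    "tmap (cfuns A) fst z = v" "tmap (cfuns B) snd z = w"
proof -
  note AB = manifold_prod[OF A B]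
  let ?S = "{(x, y). f x = g y}" and ?z = "prod_vec A B v w (x, y)"
  have pf: "(\<lambda>x. k (f x)) \<in> cfuns A" "(\<lambda>y. k (g y)) \<in> cfuns B" if "k \<in> cfuns D" for k
    using smooth_funs_compose[OF A D f that] smooth_funs_compose[OF B D g that] by auto
  have z: "?z \<in> tangent (cfuns (prod_atlas A B)) (x, y)" by (rule prod_vec_tangent[OF A B v w])
  obtain k Z \<rho> where fr: "frame (cfuns D) (f x) (fbasis :: 'g set) k Z \<rho>" using frame_exists[OF D] .
  obtain Y where Y: "open Y" "f x \<in> Y" "\<forall>q\<in>Y. \<forall>q'\<in>Y. (\<forall>b\<in>fbasis. k b q = k b q') \<longrightarrow> q = q'"
    by (rule frame_injective[OF fr]) (rule that)
  have "\<forall>b\<in>(fbasis :: 'g set). \<exists>u. u \<in> tangent (cfuns A) x \<and> tmap (cfuns D) f u = Z b (f x)"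
  proof
    fix b :: 'g assume "b \<in> fbasis"
    with sub have "Z b (f x) \<in> tmap (cfuns D) f ` tangent (cfuns A) x"
      using vector_fieldsD(1)[OF frameD(5)[OF fr]] by blast
    then show "\<exists>u. u \<in> tangent (cfuns A) x \<and> tmap (cfuns D) f u = Z b (f x)" by auto
  qed
  then obtain u where u: "\<And>b. b \<in> (fbasis :: 'g set) \<Longrightarrow> u b \<in> tangent (cfuns A) x"
    "\<And>b. b \<in> (fbasis :: 'g set) \<Longrightarrow> tmap (cfuns D) f (u b) = Z b (f x)" by metis
  \<comment> \<open>The coordinates \<open>k\<close> separate the points of \<open>Y\<close>, so
    near \<open>(x, y)\<close> the simultaneous zeros of these functions are exactly the points with
    \<open>f (fst q) = g (snd q)\<close>.\<close>
  let ?h = "\<lambda>b q. k b (f (fst q)) - k b (g (snd q))"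
  have h: "?h b \<in> cfuns (prod_atlas A B)" if "b \<in> fbasis" for b :: 'g
    by (intro cfuns_diff[OF AB] cfuns_fst[OF A B] cfuns_snd[OF A B] pf frameD(4)[OF fr that])
  have hv: "prod_vec A B v w (x, y) (?h b) = v (\<lambda>x. k b (f x)) - w (\<lambda>y. k b (g y))"
    if v: "v \<in> tangent (cfuns A) x" and w: "w \<in> tangent (cfuns B) y" and b: "b \<in> fbasis" for v w and b :: 'g
    using h[OF b] tangent_diff_fun[OF A v pf(1)[OF frameD(4)[OF fr b]] cfuns_const[OF A, of "k b (g y)"]]
      tangent_diff_fun[OF B w cfuns_const[OF B, of "k b (f x)"] pf(2)[OF frameD(4)[OF fr b]]]
      tangent_const[OF A v] tangent_const[OF B w]
    by (simp add: prod_vec_def[OF A B])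
  have z0: "?z F = 0" if F: "F \<in> cfuns (prod_atlas A B)" "open W" "(x, y) \<in> W" "\<And>q. q \<in> ?S \<Longrightarrow> q \<in> W \<Longrightarrow> F q = 0" for F W
  proof (rule tangent_level_set[OF AB manifold_findim[OF D], where h="?h" and u="\<lambda>b. prod_vec A B (u b) 0 (x, y)"
        and p="(x, y)" and W="W \<inter> (f -` Y \<times> g -` Y)" and v="?z" and F=F])
    show "prod_vec A B (u b) 0 (x, y) \<in> tangent (cfuns (prod_atlas A B)) (x, y)" if "b \<in> fbasis" for b
      by (rule prod_vec_tangent[OF A B u(1)[OF that] tangent_0])
    show "prod_vec A B (u a) 0 (x, y) (?h b) = (if a = b then 1 else 0)" if "a \<in> fbasis" "b \<in> fbasis" for a b
      using hv[OF u(1)[OF that(1)] tangent_0 that(2)] frameD(7)[OF fr that] fun_cong[OF u(2)[OF that(1)], of "k b"] frameD(4)[OF fr that(2)]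
      by (simp add: tmap_apply)
    show "?z (?h b) = 0" if "b \<in> fbasis" for b
      using hv[OF v w that] fun_cong[OF vw, of "k b"] frameD(4)[OF fr that] by (simp add: tmap_apply)
    show "open (W \<inter> (f -` Y \<times> g -` Y))"
      by (intro open_Int F open_Times open_vimage Y smooth_map_continuous[OF A D f] smooth_map_continuous[OF B D g])
    show "(x, y) \<in> W \<inter> (f -` Y \<times> g -` Y)" using F Y p by simp
    fix q assume q: "q \<in> W \<inter> (f -` Y \<times> g -` Y)" "\<And>b. b \<in> fbasis \<Longrightarrow> ?h b q = ?h b (x, y)"
    then have "f (fst q) = g (snd q)" using p by (intro Y(3)[rule_format]) auto
    then show "F q = 0" using q F(4) by (auto simp: split_beta)
  qed (use h z F in auto)
  have xy: "(x, y) \<in> ?S" using p by simp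
  obtain z' where z': "z' \<in> tangent (smooth_funs (prod_atlas A B) ?S) (x, y)"
    "\<And>F. F \<in> cfuns (prod_atlas A B) \<Longrightarrow> z' F = ?z F"
    by (rule tangent_extend[OF AB xy z], rule z0) (assumption+, rule that)
  show thesis
  proof (rule that[OF z'(1)])
    have "tmap (cfuns A) fst z' = tmap (cfuns A) fst ?z" "tmap (cfuns B) snd z' = tmap (cfuns B) snd ?z"
      by (auto simp: fun_eq_iff tmap_apply z'(2) cfuns_fst[OF A B] cfuns_snd[OF A B])
    then show "tmap (cfuns A) fst z' = v" "tmap (cfuns B) snd z' = w"
      by (simp_all only: tmap_prod_vec[OF A B v w])
  qed
qed

end

section \<open>Brackets and exterior derivatives\<close>

lemma is_form1D:
  assumes "is_form1 C D V \<omega>"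
  shows "v \<in> tangent C p \<Longrightarrow> \<omega> p v \<in> V"
    and "v \<in> tangent C p \<Longrightarrow> w \<in> tangent C p \<Longrightarrow> \<omega> p (v + w) = \<omega> p v + \<omega> p w"
    and "v \<in> tangent C p \<Longrightarrow> \<omega> p (vscale c v) = vscale c (\<omega> p v)"
    and "X \<in> vector_fields C \<Longrightarrow> \<phi> \<in> D \<Longrightarrow> (\<lambda>p. \<omega> p (X p) \<phi>) \<in> C"
  using assms unfolding is_form1_def by blast+

lemma is_form2D:
  assumes "is_form2 C D V \<omega>"
  shows "v \<in> tangent C p \<Longrightarrow> w \<in> tangent C p \<Longrightarrow> \<omega> p v w \<in> V"
    and "v \<in> tangent C p \<Longrightarrow> w \<in> tangent C p \<Longrightarrow> \<omega> p w v = - \<omega> p v w"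
    and "u \<in> tangent C p \<Longrightarrow> v \<in> tangent C p \<Longrightarrow> w \<in> tangent C p \<Longrightarrow> \<omega> p (u + v) w = \<omega> p u w + \<omega> p v w"
    and "v \<in> tangent C p \<Longrightarrow> w \<in> tangent C p \<Longrightarrow> \<omega> p (vscale c v) w = vscale c (\<omega> p v w)"
    and "X \<in> vector_fields C \<Longrightarrow> Y \<in> vector_fields C \<Longrightarrow> \<phi> \<in> D \<Longrightarrow> (\<lambda>p. \<omega> p (X p) (Y p) \<phi>) \<in> C"
  using assms unfolding is_form2_def by blast+

context
  fixes A :: "('a::{t2_space,second_countable_topology}, 'e::real_normed_vector) atlas"
  assumes A: "manifold A"
begin

lemma vf_bracket_apply: "f \<in> cfuns A \<Longrightarrow> vf_bracket (cfuns A) X Y p f = X p (\<lambda>q. Y q f) - Y p (\<lambda>q. X q f)"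
  by (simp add: vf_bracket_def)

lemma vector_field_derivation:
  assumes X: "X \<in> vector_fields (cfuns A)" and f: "f \<in> cfuns A"
  shows "X p (\<lambda>x. c * f x) = c * X p f" "g \<in> cfuns A \<Longrightarrow> X p (\<lambda>x. f x + g x) = X p f + X p g"
    "g \<in> cfuns A \<Longrightarrow> X p (\<lambda>x. f x * g x) = f p * X p g + g p * X p f"
    "g \<in> cfuns A \<Longrightarrow> X p (\<lambda>x. f x - g x) = X p f - X p g"
  using tangentD(2-4)[OF vector_fieldsD(1)[OF X, of p]] f tangent_diff_fun[OF A vector_fieldsD(1)[OF X, of p]] by auto

lemma vf_bracket_vector_field:
  assumes X: "X \<in> vector_fields (cfuns A)" and Y: "Y \<in> vector_fields (cfuns A)"
  shows "vf_bracket (cfuns A) X Y \<in> vector_fields (cfuns A)"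
proof (rule vector_fieldsI)
  note d = vector_field_derivation[OF X] vector_field_derivation[OF Y]
  note s = vector_fieldsD(2)[OF X] vector_fieldsD(2)[OF Y]
  note c = cfuns_add[OF A] cfuns_mult[OF A] cfuns_diff[OF A] cfuns_const[OF A]
  show "vf_bracket (cfuns A) X Y p \<in> tangent (cfuns A) p" for p
  proof (rule tangentI)
    fix f g k assume f: "f \<in> cfuns A"
    have kf: "(\<lambda>x. k * f x) \<in> cfuns A" by (intro c f)
    show "vf_bracket (cfuns A) X Y p (\<lambda>x. k * f x) = k * vf_bracket (cfuns A) X Y p f"
      by (simp add: vf_bracket_apply f kf d s algebra_simps)
    assume g: "g \<in> cfuns A"
    show "vf_bracket (cfuns A) X Y p (\<lambda>x. f x + g x) = vf_bracket (cfuns A) X Y p f + vf_bracket (cfuns A) X Y p g"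
      by (simp add: vf_bracket_apply f g c d s)
    show "vf_bracket (cfuns A) X Y p (\<lambda>x. f x * g x) = f p * vf_bracket (cfuns A) X Y p g + g p * vf_bracket (cfuns A) X Y p f"
      by (simp add: vf_bracket_apply f g c d s algebra_simps)
  qed (simp add: vf_bracket_def)
  show "(\<lambda>p. vf_bracket (cfuns A) X Y p f) \<in> cfuns A" if "f \<in> cfuns A" for f
    by (simp add: vf_bracket_apply that) (intro c s that)
qed

lemma vf_bracket_skew: "vf_bracket (cfuns A) Y X p = - vf_bracket (cfuns A) X Y p"
  by (auto simp: vf_bracket_def fun_eq_iff)

lemma vf_bracket_diff_left:
  assumes "X \<in> vector_fields (cfuns A)" "X' \<in> vector_fields (cfuns A)" "Y \<in> vector_fields (cfuns A)"
  shows "vf_bracket (cfuns A) (\<lambda>q. X q - X' q) Y p = vf_bracket (cfuns A) X Y p - vf_bracket (cfuns A) X' Y p"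
  using vector_field_derivation(4)[OF assms(3) vector_fieldsD(2)[OF assms(1)] vector_fieldsD(2)[OF assms(2)]]
  by (auto simp: vf_bracket_def fun_eq_iff)

text \<open>This makes exterior derivatives tensorial.\<close>

lemma tensor_leibniz_0:
  assumes T: "\<And>q v w. v \<in> tangent (cfuns A) q \<Longrightarrow> w \<in> tangent (cfuns A) q \<Longrightarrow> T q (v + w) = T q v + T q w"
    "\<And>q c v. v \<in> tangent (cfuns A) q \<Longrightarrow> T q (vscale c v) = c * T q v"
    and TX: "\<And>X. X \<in> vector_fields (cfuns A) \<Longrightarrow> (\<lambda>q. T q (X q)) \<in> cfuns A"
    and X: "X \<in> vector_fields (cfuns A)" "X p = 0" and Y: "Y \<in> vector_fields (cfuns A)"
  shows "Y p (\<lambda>q. T q (X q)) = - T p (vf_bracket (cfuns A) X Y p)"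
proof -
  obtain x Z \<rho> where fr: "frame (cfuns A) p (fbasis :: 'e set) x Z \<rho>" using frame_exists[OF A] .
  note Zt = vector_fieldsD(1)[OF frameD(5)[OF fr]]
  have T0: "T q 0 = 0" for q using T(2)[of 0 q 0] by (simp add: tangent_0)
  have Tsum: "T q (\<lambda>f. \<Sum>b\<in>I. c b * Z b q f) = (\<Sum>b\<in>I. c b * T q (Z b q))" if "I \<subseteq> fbasis" for c q and I :: "'e set"
    using finite_subset[OF that frameD(1)[OF fr]] that
  proof (induction I)
    case empty
    have "(\<lambda>f. 0) = (0 :: 'a tvec)" by auto
    then show ?case using T0 by simp
  next
    case (insert b I)
    then have b: "b \<in> fbasis" "I \<subseteq> fbasis" by auto
    have 1: "(\<lambda>f. \<Sum>b\<in>I. c b * Z b q f) \<in> tangent (cfuns A) q"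
      using tangent_sum[of I "\<lambda>b. vscale (c b) (Z b q)" "cfuns A" q] Zt b by auto
    have "(\<lambda>f. \<Sum>b\<in>insert b I. c b * Z b q f) = vscale (c b) (Z b q) + (\<lambda>f. \<Sum>b\<in>I. c b * Z b q f)"
      using insert by (auto simp: fun_eq_iff)
    then show ?case using insert b T(1)[OF tangent_vscale[OF Zt[OF b(1)]] 1] T(2)[OF Zt[OF b(1)]] by simp
  qed
  have xc: "(\<lambda>q. X q (x b)) \<in> cfuns A" if "b \<in> fbasis" for b
    by (rule vector_fieldsD(2)[OF X(1) frameD(4)[OF fr that]])
  \<comment> \<open>As \<open>k p = 0\<close> and \<open>\<rho> p = 1\<close>, the factor
    \<open>\<rho>\<close> does not change the derivative of \<open>k\<close> at \<open>p\<close>. On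
    the right the coefficients \<open>X q (x b)\<close> vanish at \<open>p\<close>, so only their
    derivatives survive. It is used for \<open>k q = T q (X q)\<close> and for
    \<open>k q = X q f\<close>, which have the same coefficients.\<close>
  have *: "Y p k = (\<Sum>b\<in>fbasis. Y p (\<lambda>q. X q (x b)) * m b p)"
    if k: "k \<in> cfuns A" "k p = 0" and m: "\<And>b. b \<in> fbasis \<Longrightarrow> m b \<in> cfuns A"
      and km: "\<And>q. \<rho> q * k q = (\<Sum>b\<in>fbasis. X q (x b) * m b q)" for k m
  proof -
    have "Y p k = Y p (\<lambda>q. \<rho> q * k q)"
      using vector_field_derivation(3)[OF Y frameD(2)[OF fr] k(1)] frameD(3)[OF fr] k(2) by simp
    also have "\<dots> = (\<Sum>b\<in>fbasis. Y p (\<lambda>q. X q (x b) * m b q))"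
      unfolding km by (rule tangent_sum_fun[OF A vector_fieldsD(1)[OF Y]]) (intro cfuns_mult[OF A] xc m)
    also have "\<dots> = (\<Sum>b\<in>fbasis. Y p (\<lambda>q. X q (x b)) * m b p)"
      by (rule sum.cong) (use vector_field_derivation(3)[OF Y xc m] X(2) in \<open>auto simp: mult.commute\<close>)
    finally show ?thesis .
  qed
  have "Y p (\<lambda>q. T q (X q)) = (\<Sum>b\<in>fbasis. Y p (\<lambda>q. X q (x b)) * T p (Z b p))"
  proof (rule *)
    fix q
    have "vscale (\<rho> q) (X q) = (\<lambda>f. \<Sum>b\<in>fbasis. X q (x b) * Z b q f)"
    proof
      fix f show "vscale (\<rho> q) (X q) f = (\<Sum>b\<in>fbasis. X q (x b) * Z b q f)"
        using frameD(6)[OF fr vector_fieldsD(1)[OF X(1)], of f q] tangentD(1)[OF vector_fieldsD(1)[OF X(1)], of f q] tangentD(1)[OF Zt, of _ f q]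
        by (cases "f \<in> cfuns A") auto
    qed
    then show "\<rho> q * T q (X q) = (\<Sum>b\<in>fbasis. X q (x b) * T q (Z b q))"
      using T(2)[OF vector_fieldsD(1)[OF X(1)], of q "\<rho> q"] Tsum[of fbasis q] by simp
  qed (use TX X frameD(5)[OF fr] T0 in auto)
  moreover have "vf_bracket (cfuns A) X Y p = vscale (- 1) (\<lambda>f. \<Sum>b\<in>fbasis. Y p (\<lambda>q. X q (x b)) * Z b p f)"
  proof
    fix f
    show "vf_bracket (cfuns A) X Y p f = vscale (- 1) (\<lambda>f. \<Sum>b\<in>fbasis. Y p (\<lambda>q. X q (x b)) * Z b p f) f"
    proof (cases "f \<in> cfuns A")
      case True
      have "Y p (\<lambda>q. X q f) = (\<Sum>b\<in>fbasis. Y p (\<lambda>q. X q (x b)) * Z b p f)"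
        by (rule *) (use X True vector_fieldsD(2)[OF X(1) True] vector_fieldsD(2)[OF frameD(5)[OF fr] True]
            frameD(6)[OF fr vector_fieldsD(1)[OF X(1)] True] in auto)
      then show ?thesis using X(2) by (simp add: vf_bracket_apply True)
    next
      case False
      then show ?thesis using tangentD(1)[OF Zt, of _ f p] by (simp add: vf_bracket_def)
    qed
  qed
  moreover have "(\<lambda>f. \<Sum>b\<in>fbasis. Y p (\<lambda>q. X q (x b)) * Z b p f) \<in> tangent (cfuns A) p"
    using tangent_sum[of fbasis "\<lambda>b. vscale (Y p (\<lambda>q. X q (x b))) (Z b p)" "cfuns A" p] Zt by auto
  ultimately show ?thesis using T(2)[of _ p "- 1"] Tsum[of fbasis p] by simp
qed

text \<open>By linearity this is the preceding lemma for \<open>X - X'\<close>, which vanishes at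
  \<open>p\<close>.\<close>

lemma tensor_leibniz:
  assumes T: "\<And>q v w. v \<in> tangent (cfuns A) q \<Longrightarrow> w \<in> tangent (cfuns A) q \<Longrightarrow> T q (v + w) = T q v + T q w"
    "\<And>q c v. v \<in> tangent (cfuns A) q \<Longrightarrow> T q (vscale c v) = c * T q v"
    and TX: "\<And>X. X \<in> vector_fields (cfuns A) \<Longrightarrow> (\<lambda>q. T q (X q)) \<in> cfuns A"
    and X: "X \<in> vector_fields (cfuns A)" "X' \<in> vector_fields (cfuns A)" "X p = X' p" and Y: "Y \<in> vector_fields (cfuns A)"
  shows "Y p (\<lambda>q. T q (X q)) + T p (vf_bracket (cfuns A) X Y p) = Y p (\<lambda>q. T q (X' q)) + T p (vf_bracket (cfuns A) X' Y p)"
proof -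
  have Td: "T q (v - w) = T q v - T q w" if "v \<in> tangent (cfuns A) q" "w \<in> tangent (cfuns A) q" for q v w
    using T(1)[of "v - w" q w] that by (auto simp: tangent_diff)
  have "Y p (\<lambda>q. T q (X q - X' q)) = - T p (vf_bracket (cfuns A) (\<lambda>q. X q - X' q) Y p)"
    by (rule tensor_leibniz_0[OF T TX vector_fields_diff[OF A X(1,2)] _ Y]) (use X(3) in auto)
  then have "Y p (\<lambda>q. T q (X q) - T q (X' q)) = - T p (vf_bracket (cfuns A) X Y p - vf_bracket (cfuns A) X' Y p)"
    using X(1,2) Y by (simp add: Td vector_fieldsD(1) vf_bracket_diff_left)
  then show ?thesis
    using X(1,2) Y vector_field_derivation(4)[OF Y TX[OF X(1)] TX[OF X(2)], of p]
    by (simp add: Td vector_fieldsD(1)[OF vf_bracket_vector_field])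
qed

text \<open>Frees the exterior derivative from the extensions chosen in its definition: the two
  fields are exchanged for the chosen ones one after the other by \<open>tensor_leibniz\<close>. The
  premise on \<open>V\<close> reduces test functions outside \<open>D\<close> to the zero
  function.\<close>

lemma ext_d1_eq:
  assumes \<omega>: "is_form1 (cfuns A) D V \<omega>" and V: "\<And>v \<phi>. v \<in> V \<Longrightarrow> \<phi> \<notin> D \<Longrightarrow> v \<phi> = 0"
    and X: "X \<in> vector_fields (cfuns A)" and Y: "Y \<in> vector_fields (cfuns A)"
  shows "ext_d1 (cfuns A) \<omega> p (X p) (Y p) \<phi> =
    X p (\<lambda>q. \<omega> q (Y q) \<phi>) - Y p (\<lambda>q. \<omega> q (X q) \<phi>) - \<omega> p (vf_bracket (cfuns A) X Y p) \<phi>"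
proof -
  let ?T = "\<lambda>q v. \<omega> q v \<phi>"
  have T: "\<And>q v w. v \<in> tangent (cfuns A) q \<Longrightarrow> w \<in> tangent (cfuns A) q \<Longrightarrow> ?T q (v + w) = ?T q v + ?T q w"
    "\<And>q c v. v \<in> tangent (cfuns A) q \<Longrightarrow> ?T q (vscale c v) = c * ?T q v"
    by (simp_all add: is_form1D(2,3)[OF \<omega>])
  have TX: "(\<lambda>q. ?T q (X q)) \<in> cfuns A" if "X \<in> vector_fields (cfuns A)" for X
  proof (cases "\<phi> \<in> D")
    case True
    then show ?thesis by (rule is_form1D(4)[OF \<omega> that])
  next
    case False
    then have "\<omega> q (X q) \<phi> = 0" for q using V[OF is_form1D(1)[OF \<omega> vector_fieldsD(1)[OF that]]] by blast
    then show ?thesis using cfuns_const[OF A] by simp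
  qed
  note X' = extend_vec[OF A vector_fieldsD(1)[OF X, of p]] and Y' = extend_vec[OF A vector_fieldsD(1)[OF Y, of p]]
  let ?X' = "extend_vec (cfuns A) p (X p)" and ?Y' = "extend_vec (cfuns A) p (Y p)"
  have neg: "?T p (vf_bracket (cfuns A) U W p) = - ?T p (vf_bracket (cfuns A) W U p)"
    if "U \<in> vector_fields (cfuns A)" "W \<in> vector_fields (cfuns A)" for U W
    using T(2)[OF vector_fieldsD(1)[OF vf_bracket_vector_field[OF that(2,1)], of p], of "- 1"] vf_bracket_skew[of W U p]
    by (simp add: vscale_minus_1)
  have 1: "Y p (\<lambda>q. ?T q (X q)) + ?T p (vf_bracket (cfuns A) X Y p) = Y p (\<lambda>q. ?T q (?X' q)) + ?T p (vf_bracket (cfuns A) ?X' Y p)"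
    by (rule tensor_leibniz[OF T TX X X'(1) _ Y]) (auto simp: X')
  have 2: "?X' p (\<lambda>q. ?T q (Y q)) + ?T p (vf_bracket (cfuns A) Y ?X' p) = ?X' p (\<lambda>q. ?T q (?Y' q)) + ?T p (vf_bracket (cfuns A) ?Y' ?X' p)"
    by (rule tensor_leibniz[OF T TX Y Y'(1) _ X'(1)]) (auto simp: Y')
  show ?thesis
    unfolding ext_d1_def Let_def
    using 1 2 neg[OF Y X'(1)] neg[OF Y'(1) X'(1)] by (simp add: X'(2) Y'(2))
qed

lemma ext_d2_eq:
  assumes \<omega>: "is_form2 (cfuns A) D V \<omega>" and V: "\<And>v \<phi>. v \<in> V \<Longrightarrow> \<phi> \<notin> D \<Longrightarrow> v \<phi> = 0"
    and X: "X \<in> vector_fields (cfuns A)" and Y: "Y \<in> vector_fields (cfuns A)" and Z: "Z \<in> vector_fields (cfuns A)"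
  shows "ext_d2 (cfuns A) \<omega> p (X p) (Y p) (Z p) \<phi> =
    X p (\<lambda>q. \<omega> q (Y q) (Z q) \<phi>) + Y p (\<lambda>q. \<omega> q (Z q) (X q) \<phi>) + Z p (\<lambda>q. \<omega> q (X q) (Y q) \<phi>)
    - \<omega> p (vf_bracket (cfuns A) X Y p) (Z p) \<phi> - \<omega> p (vf_bracket (cfuns A) Y Z p) (X p) \<phi>
    - \<omega> p (vf_bracket (cfuns A) Z X p) (Y p) \<phi>"
proof -
  have skew: "\<omega> q v u \<phi> = - \<omega> q u v \<phi>" if "u \<in> tangent (cfuns A) q" "v \<in> tangent (cfuns A) q" for q u v
  proof -
    have "\<omega> q v u = - \<omega> q u v" by (rule is_form2D(2)[OF \<omega> that])
    then show ?thesis by simp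
  qed
  have T: "\<And>q u v w. u \<in> tangent (cfuns A) q \<Longrightarrow> v \<in> tangent (cfuns A) q \<Longrightarrow> w \<in> tangent (cfuns A) q \<Longrightarrow> \<omega> q (u + v) w \<phi> = \<omega> q u w \<phi> + \<omega> q v w \<phi>"
    "\<And>q c v w. v \<in> tangent (cfuns A) q \<Longrightarrow> w \<in> tangent (cfuns A) q \<Longrightarrow> \<omega> q (vscale c v) w \<phi> = c * \<omega> q v w \<phi>"
    by (simp_all add: is_form2D(3,4)[OF \<omega>])
  have TX: "(\<lambda>q. \<omega> q (X q) (Y q) \<phi>) \<in> cfuns A" if "X \<in> vector_fields (cfuns A)" "Y \<in> vector_fields (cfuns A)" for X Y
  proof (cases "\<phi> \<in> D")
    case True
    then show ?thesis by (rule is_form2D(5)[OF \<omega> that])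
  next
    case False
    then have "\<omega> q (X q) (Y q) \<phi> = 0" for q
      using V[OF is_form2D(1)[OF \<omega> vector_fieldsD(1)[OF that(1)] vector_fieldsD(1)[OF that(2)]]] by blast
    then show ?thesis using cfuns_const[OF A] by simp
  qed
  \<comment> \<open>This arrangement of the invariant formula is cyclically symmetric, so
    independence of the extension has to be shown in the first argument only.\<close>
  define E where "E X Y Z = X p (\<lambda>q. \<omega> q (Y q) (Z q) \<phi>) + Y p (\<lambda>q. \<omega> q (Z q) (X q) \<phi>) + Z p (\<lambda>q. \<omega> q (X q) (Y q) \<phi>)
    - \<omega> p (vf_bracket (cfuns A) X Y p) (Z p) \<phi> - \<omega> p (vf_bracket (cfuns A) Y Z p) (X p) \<phi>
    - \<omega> p (vf_bracket (cfuns A) Z X p) (Y p) \<phi>" for X Y Z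
  have cyc: "E X Y Z = E Y Z X" for X Y Z by (simp add: E_def)
  have negB: "\<omega> p (vf_bracket (cfuns A) U W p) (Q p) \<phi> = - \<omega> p (vf_bracket (cfuns A) W U p) (Q p) \<phi>"
    if "U \<in> vector_fields (cfuns A)" "W \<in> vector_fields (cfuns A)" "Q \<in> vector_fields (cfuns A)" for U W Q
    using T(2)[OF vector_fieldsD(1)[OF vf_bracket_vector_field[OF that(2,1)], of p] vector_fieldsD(1)[OF that(3)], of "- 1"] vf_bracket_skew[of W U p]
    by (simp add: vscale_minus_1)
  have negf: "Q p (\<lambda>q. \<omega> q (U q) (W q) \<phi>) = - Q p (\<lambda>q. \<omega> q (W q) (U q) \<phi>)"
    if "U \<in> vector_fields (cfuns A)" "W \<in> vector_fields (cfuns A)" "Q \<in> vector_fields (cfuns A)" for U W Q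
    using vector_field_derivation(1)[OF that(3) TX[OF that(2,1)], of p "- 1"] skew[OF vector_fieldsD(1)[OF that(2)] vector_fieldsD(1)[OF that(1)]]
    by simp
  have E: "E X Y Z = E X' Y Z" if X: "X \<in> vector_fields (cfuns A)" "X' \<in> vector_fields (cfuns A)" "X p = X' p"
    and Y: "Y \<in> vector_fields (cfuns A)" and Z: "Z \<in> vector_fields (cfuns A)" for X X' Y Z
  proof -
    note t = vector_fieldsD(1)
    have 1: "Y p (\<lambda>q. \<omega> q (X q) (Z q) \<phi>) + \<omega> p (vf_bracket (cfuns A) X Y p) (Z p) \<phi> =
        Y p (\<lambda>q. \<omega> q (X' q) (Z q) \<phi>) + \<omega> p (vf_bracket (cfuns A) X' Y p) (Z p) \<phi>"
      by (rule tensor_leibniz[where T="\<lambda>q v. \<omega> q v (Z q) \<phi>", OF T(1)[OF _ _ t[OF Z]] T(2)[OF _ t[OF Z]] TX[OF _ Z] X Y])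
    have 2: "Z p (\<lambda>q. \<omega> q (X q) (Y q) \<phi>) + \<omega> p (vf_bracket (cfuns A) X Z p) (Y p) \<phi> =
        Z p (\<lambda>q. \<omega> q (X' q) (Y q) \<phi>) + \<omega> p (vf_bracket (cfuns A) X' Z p) (Y p) \<phi>"
      by (rule tensor_leibniz[where T="\<lambda>q v. \<omega> q v (Y q) \<phi>", OF T(1)[OF _ _ t[OF Y]] T(2)[OF _ t[OF Y]] TX[OF _ Y] X Z])
    show ?thesis
      unfolding E_def using 1 2 X(3) negf[OF Z X(1) Y] negf[OF Z X(2) Y] negB[OF Z X(1) Y] negB[OF Z X(2) Y] by simp
  qed
  let ?X' = "extend_vec (cfuns A) p (X p)" and ?Y' = "extend_vec (cfuns A) p (Y p)" and ?Z' = "extend_vec (cfuns A) p (Z p)"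
  note X' = extend_vec[OF A vector_fieldsD(1)[OF X, of p]] and Y' = extend_vec[OF A vector_fieldsD(1)[OF Y, of p]]
    and Z' = extend_vec[OF A vector_fieldsD(1)[OF Z, of p]]
  have "E X Y Z = E ?X' Y Z" by (rule E[OF X X'(1) _ Y Z]) (simp add: X')
  also have "\<dots> = E ?X' ?Y' Z" unfolding cyc[of ?X'] by (rule E[OF Y Y'(1) _ Z X'(1)]) (simp add: Y')
  also have "\<dots> = E ?X' ?Y' ?Z'" unfolding cyc[of _ _ Z] cyc[of _ _ ?Z'] cyc[of ?Y' Z] cyc[of ?Y' ?Z']
    by (rule E[OF Z Z'(1) _ X'(1) Y'(1)]) (simp add: Z')
  also have "\<dots> = ext_d2 (cfuns A) \<omega> p (X p) (Y p) (Z p) \<phi>"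
    unfolding ext_d2_def Let_def E_def
    using negf[OF X'(1) Z'(1) Y'(1)] negB[OF X'(1) Z'(1) Y'(1)] by simp
  finally show ?thesis by (simp add: E_def)
qed

lemma vf_bracket_related:
  fixes B :: "('b::{t2_space,second_countable_topology}, 'f::real_normed_vector) atlas"
  assumes B: "manifold B" and F: "\<And>g. g \<in> cfuns B \<Longrightarrow> (\<lambda>x. g (F x)) \<in> cfuns A"
    and X': "X' \<in> vector_fields (cfuns B)" and Y': "Y' \<in> vector_fields (cfuns B)"
    and X: "\<And>p. tmap (cfuns B) F (X p) = X' (F p)" and Y: "\<And>p. tmap (cfuns B) F (Y p) = Y' (F p)"
  shows "tmap (cfuns B) F (vf_bracket (cfuns A) X Y p) = vf_bracket (cfuns B) X' Y' (F p)"
proof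
  fix g
  have e: "X p (\<lambda>x. g (F x)) = X' (F p) g" "Y p (\<lambda>x. g (F x)) = Y' (F p) g" if "g \<in> cfuns B" for g p
    using fun_cong[OF X, of p g] fun_cong[OF Y, of p g] that by (simp_all add: tmap_apply)
  show "tmap (cfuns B) F (vf_bracket (cfuns A) X Y p) g = vf_bracket (cfuns B) X' Y' (F p) g"
  proof (cases "g \<in> cfuns B")
    case True
    show ?thesis
      using e(1)[OF vector_fieldsD(2)[OF Y' True], of p] e(2)[OF vector_fieldsD(2)[OF X' True], of p]
      by (simp add: tmap_apply True vf_bracket_def F e[OF True])
  qed (simp add: tmap_apply vf_bracket_def)
qed

end

section \<open>The tangent groupoid\<close>

lemma tmap_compose: "(\<And>g. g \<in> E \<Longrightarrow> (\<lambda>x. g (G x)) \<in> D) \<Longrightarrow> tmap E G (tmap D F v) = tmap E (\<lambda>x. G (F x)) v"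
  by (auto simp: fun_eq_iff tmap_apply)

lemma tmap_ident: "v \<in> tangent D p \<Longrightarrow> tmap D (\<lambda>x. x) v = v"
  by (auto simp: fun_eq_iff tmap_apply tangentD(1))

lemma tmap_const: "manifold A \<Longrightarrow> v \<in> tangent (smooth_funs A S) p \<Longrightarrow> tmap D (\<lambda>x. c) v = 0"
  by (auto simp: fun_eq_iff tmap_apply tangent_const)

lemma tmap_cong_on:
  assumes A: "manifold A" and v: "v \<in> tangent (smooth_funs A S) p" "p \<in> S"
    and F: "\<And>x. x \<in> S \<Longrightarrow> F x = G x" and s: "\<And>g. g \<in> D \<Longrightarrow> (\<lambda>x. g (G x)) \<in> smooth_funs A S"
  shows "tmap D F v = tmap D G v"
proof
  fix g show "tmap D F v g = tmap D G v g"
  proof (cases "g \<in> D")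
    case True
    have "(\<lambda>x. g (F x)) \<in> smooth_funs A S"
      using s[OF True] F smooth_map_cong[of A S real_atlas "\<lambda>x. g (G x)" "\<lambda>x. g (F x)"] by (auto simp: smooth_funs_def)
    from tangent_local[OF A v this s[OF True] open_UNIV UNIV_I] F True
    show ?thesis by (simp add: tmap_apply)
  qed (simp add: tmap_apply)
qed

lemma algd_sectionsD:
  assumes "a \<in> algd_sections \<Y>"
  shows "a m \<in> tangent (arr_funs \<Y>) (ident \<Y> m)" "Tsrc \<Y> (a m) = 0" "f \<in> arr_funs \<Y> \<Longrightarrow> (\<lambda>m. a m f) \<in> obj_funs \<Y>"
  using assms unfolding algd_sections_def by auto

lemma mult_fieldsD:
  assumes "(\<xi>, u) \<in> mult_fields \<Y>"
  shows "\<xi> \<in> vector_fields (arr_funs \<Y>)" "u \<in> vector_fields (obj_funs \<Y>)"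
    "Tsrc \<Y> (\<xi> x) = u (src \<Y> x)" "Ttgt \<Y> (\<xi> x) = u (tgt \<Y> x)" "\<xi> (ident \<Y> m) = Tident \<Y> (u m)"
    "src \<Y> x = tgt \<Y> y \<Longrightarrow> \<xi> (cmp \<Y> x y) = Tcmp \<Y> x (\<xi> x) y (\<xi> y)"
  using assms unfolding mult_fields_def by auto

locale gpd =
  fixes \<X> :: "('a::{t2_space,second_countable_topology}, 'e::real_normed_vector,
    'b::{t2_space,second_countable_topology}, 'f::real_normed_vector, 'z) lie_gpd_scheme"
  assumes lie_gpd: "lie_groupoid \<X>"
begin

lemma arr: "manifold (arr_atlas \<X>)" and obj: "manifold (obj_atlas \<X>)"
  using lie_gpd unfolding lie_groupoid_def by blast+

lemma smooth_structure:
  "smooth_map (arr_atlas \<X>) UNIV (obj_atlas \<X>) (src \<X>)"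
  "smooth_map (arr_atlas \<X>) UNIV (obj_atlas \<X>) (tgt \<X>)"
  "smooth_map (obj_atlas \<X>) UNIV (arr_atlas \<X>) (ident \<X>)"
  "smooth_map (arr_atlas \<X>) UNIV (arr_atlas \<X>) (ginv \<X>)"
  "smooth_map (prod_atlas (arr_atlas \<X>) (arr_atlas \<X>)) (composable \<X>) (arr_atlas \<X>) (\<lambda>(x, y). cmp \<X> x y)"
  using lie_gpd unfolding lie_groupoid_def by blast+

lemma src_submersion: "tmap (obj_funs \<X>) (src \<X>) ` tangent (arr_funs \<X>) p = tangent (obj_funs \<X>) (src \<X> p)"
  using lie_gpd unfolding lie_groupoid_def submersion_def by blast

lemma laws:
  "src \<X> (ident \<X> u) = u" "tgt \<X> (ident \<X> u) = u"
  "src \<X> x = tgt \<X> y \<Longrightarrow> src \<X> (cmp \<X> x y) = src \<X> y"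
  "src \<X> x = tgt \<X> y \<Longrightarrow> tgt \<X> (cmp \<X> x y) = tgt \<X> x"
  "cmp \<X> (ident \<X> (tgt \<X> x)) x = x" "cmp \<X> x (ident \<X> (src \<X> x)) = x"
  "src \<X> (ginv \<X> x) = tgt \<X> x" "tgt \<X> (ginv \<X> x) = src \<X> x"
  "cmp \<X> x (ginv \<X> x) = ident \<X> (tgt \<X> x)" "cmp \<X> (ginv \<X> x) x = ident \<X> (src \<X> x)"
  using lie_gpd unfolding lie_groupoid_def by blast+

lemma ginv_ident: "ginv \<X> (ident \<X> u) = ident \<X> u"
  using laws(5)[of "ginv \<X> (ident \<X> u)"] laws(9)[of "ident \<X> u"] by (simp add: laws)

lemma pullback:
  "f \<in> obj_funs \<X> \<Longrightarrow> (\<lambda>x. f (src \<X> x)) \<in> arr_funs \<X>"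
  "f \<in> obj_funs \<X> \<Longrightarrow> (\<lambda>x. f (tgt \<X> x)) \<in> arr_funs \<X>"
  "g \<in> arr_funs \<X> \<Longrightarrow> (\<lambda>x. g (ident \<X> x)) \<in> obj_funs \<X>"
  "g \<in> arr_funs \<X> \<Longrightarrow> (\<lambda>x. g (ginv \<X> x)) \<in> arr_funs \<X>"
  using smooth_funs_compose[OF arr obj smooth_structure(1)] smooth_funs_compose[OF arr obj smooth_structure(2)]
    smooth_funs_compose[OF obj arr smooth_structure(3)] smooth_funs_compose[OF arr arr smooth_structure(4)]
  by (auto simp: arr_funs_def obj_funs_def)

lemma pullback_cmp:
  "g \<in> arr_funs \<X> \<Longrightarrow> (\<lambda>z. g (case z of (x, y) \<Rightarrow> cmp \<X> x y)) \<in> smooth_funs (prod_atlas (arr_atlas \<X>) (arr_atlas \<X>)) (composable \<X>)"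
  unfolding arr_funs_def by (rule smooth_funs_compose[OF manifold_prod[OF arr arr] arr smooth_structure(5)]) auto

lemma T_tangent:
  "v \<in> tangent (arr_funs \<X>) x \<Longrightarrow> Tsrc \<X> v \<in> tangent (obj_funs \<X>) (src \<X> x)"
  "v \<in> tangent (arr_funs \<X>) x \<Longrightarrow> Ttgt \<X> v \<in> tangent (obj_funs \<X>) (tgt \<X> x)"
  "u \<in> tangent (obj_funs \<X>) m \<Longrightarrow> Tident \<X> u \<in> tangent (arr_funs \<X>) (ident \<X> m)"
  "v \<in> tangent (arr_funs \<X>) x \<Longrightarrow> Tginv \<X> v \<in> tangent (arr_funs \<X>) (ginv \<X> x)"
  using tmap_tangent[OF obj, of v "arr_funs \<X>" x UNIV "src \<X>"] tmap_tangent[OF obj, of v "arr_funs \<X>" x UNIV "tgt \<X>"]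
    tmap_tangent[OF arr, of u "obj_funs \<X>" m UNIV "ident \<X>"] tmap_tangent[OF arr, of v "arr_funs \<X>" x UNIV "ginv \<X>"]
    pullback unfolding arr_funs_def obj_funs_def by auto

lemma Ttgt_Tident: "u \<in> tangent (obj_funs \<X>) m \<Longrightarrow> Ttgt \<X> (Tident \<X> u) = u"
  and Ttgt_Tginv: "Ttgt \<X> (Tginv \<X> v) = Tsrc \<X> v"
  by (simp_all add: tmap_compose pullback laws tmap_ident)

lemma composable_iff: "(x, y) \<in> composable \<X> \<longleftrightarrow> src \<X> x = tgt \<X> y"
  by (simp add: composable_def)

abbreviation "cmp_funs \<equiv> smooth_funs (prod_atlas (arr_atlas \<X>) (arr_atlas \<X>)) (composable \<X>)"

definition Tcomposable :: "'a \<Rightarrow> 'a tvec \<Rightarrow> 'a \<Rightarrow> 'a tvec \<Rightarrow> bool"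
  where "Tcomposable x v y w \<longleftrightarrow> src \<X> x = tgt \<X> y \<and> v \<in> tangent (arr_funs \<X>) x \<and> w \<in> tangent (arr_funs \<X>) y \<and>
    Tsrc \<X> v = Ttgt \<X> w"

lemma Tcmp_eq:
  assumes z: "z \<in> tangent cmp_funs (x, y)" and xy: "src \<X> x = tgt \<X> y"
    and c: "tmap (arr_funs \<X>) fst z = v" "tmap (arr_funs \<X>) snd z = w"
  shows "Tcmp \<X> x v y w = tmap (arr_funs \<X>) (\<lambda>(x, y). cmp \<X> x y) z"
proof -
  have "z' = z" if "z' \<in> tangent cmp_funs (x, y)" "tmap (arr_funs \<X>) fst z' = v" "tmap (arr_funs \<X>) snd z' = w" for z'
    by (rule tangent_subset_prod_unique[OF arr arr that(1) z])
      (use that c xy in \<open>auto simp: composable_iff arr_funs_def\<close>)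
  then show ?thesis
    unfolding Tcmp_def using z c by (intro the_equality) blast+
qed

text \<open>Existence for the definite description in \<open>Tcmp\<close>: since the source map is a
  submersion, a pair of vectors with matching source and target is tangent to the manifold of
  composable pairs. All computations with \<open>Tcmp\<close> go through this witness.\<close>

lemma Tcomposable_witness:
  assumes "Tcomposable x v y w"
  obtains z where "z \<in> tangent cmp_funs (x, y)" "tmap (arr_funs \<X>) fst z = v" "tmap (arr_funs \<X>) snd z = w"
    "Tcmp \<X> x v y w = tmap (arr_funs \<X>) (\<lambda>(x, y). cmp \<X> x y) z"
proof -
  note c = assms[unfolded Tcomposable_def arr_funs_def obj_funs_def]
  obtain z where z: "z \<in> tangent (smooth_funs (prod_atlas (arr_atlas \<X>) (arr_atlas \<X>)) {(x, y). src \<X> x = tgt \<X> y}) (x, y)"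
    "tmap (cfuns (arr_atlas \<X>)) fst z = v" "tmap (cfuns (arr_atlas \<X>)) snd z = w"
    by (rule fibre_product_tangent[OF arr arr obj smooth_structure(1,2), where x=x and y=y and v=v and w=w])
      (use c src_submersion[of x] in \<open>auto simp: arr_funs_def obj_funs_def\<close>)
  then have "z \<in> tangent cmp_funs (x, y)" "tmap (arr_funs \<X>) fst z = v" "tmap (arr_funs \<X>) snd z = w"
    by (simp_all add: composable_def arr_funs_def)
  moreover from Tcmp_eq[OF this(1) _ this(2,3)] c have "Tcmp \<X> x v y w = tmap (arr_funs \<X>) (\<lambda>(x, y). cmp \<X> x y) z" by blast
  ultimately show thesis by (rule that)
qed

lemma Tcmp_tangent:
  assumes "Tcomposable x v y w"
  shows "Tcmp \<X> x v y w \<in> tangent (arr_funs \<X>) (cmp \<X> x y)"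
proof -
  obtain z where z: "z \<in> tangent cmp_funs (x, y)" "Tcmp \<X> x v y w = tmap (arr_funs \<X>) (\<lambda>(x, y). cmp \<X> x y) z"
    using Tcomposable_witness[OF assms] by metis
  have "tmap (arr_funs \<X>) (\<lambda>(x, y). cmp \<X> x y) z \<in> tangent (arr_funs \<X>) ((\<lambda>(x, y). cmp \<X> x y) (x, y))"
    unfolding arr_funs_def by (rule tmap_tangent[OF arr z(1)]) (use pullback_cmp in \<open>simp add: arr_funs_def\<close>)
  then show ?thesis using z by simp
qed

lemma Tcmp_Tsrc: 
  assumes "Tcomposable x v y w"
  shows "Tsrc \<X> (Tcmp \<X> x v y w) = Tsrc \<X> w" "Ttgt \<X> (Tcmp \<X> x v y w) = Ttgt \<X> v"
proof -
  obtain z where z: "z \<in> tangent cmp_funs (x, y)" "tmap (arr_funs \<X>) fst z = v" "tmap (arr_funs \<X>) snd z = w"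
    "Tcmp \<X> x v y w = tmap (arr_funs \<X>) (\<lambda>(x, y). cmp \<X> x y) z"
    using Tcomposable_witness[OF assms] by metis
  have xy: "(x, y) \<in> composable \<X>" using assms by (simp add: Tcomposable_def composable_iff)
  note m = manifold_prod[OF arr arr]
  have f: "(\<lambda>z. g (fst z)) \<in> cmp_funs" "(\<lambda>z. g (snd z)) \<in> cmp_funs" if "g \<in> arr_funs \<X>" for g
    using that cfuns_subset[OF m cfuns_fst[OF arr arr]] cfuns_subset[OF m cfuns_snd[OF arr arr]] by (auto simp: arr_funs_def)
  have "Tsrc \<X> (Tcmp \<X> x v y w) = tmap (obj_funs \<X>) (\<lambda>z. src \<X> (case z of (x, y) \<Rightarrow> cmp \<X> x y)) z"
    unfolding z(4) by (rule tmap_compose[OF pullback(1)])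
  also have "\<dots> = tmap (obj_funs \<X>) (\<lambda>z. src \<X> (snd z)) z"
    by (rule tmap_cong_on[OF m z(1) xy]) (auto simp: composable_iff laws intro!: f(2) pullback(1))
  also have "\<dots> = Tsrc \<X> w" unfolding z(3)[symmetric] by (rule tmap_compose[OF pullback(1), symmetric])
  finally show "Tsrc \<X> (Tcmp \<X> x v y w) = Tsrc \<X> w" .
  have "Ttgt \<X> (Tcmp \<X> x v y w) = tmap (obj_funs \<X>) (\<lambda>z. tgt \<X> (case z of (x, y) \<Rightarrow> cmp \<X> x y)) z"
    unfolding z(4) by (rule tmap_compose[OF pullback(2)])
  also have "\<dots> = tmap (obj_funs \<X>) (\<lambda>z. tgt \<X> (fst z)) z"
    by (rule tmap_cong_on[OF m z(1) xy]) (auto simp: composable_iff laws intro!: f(1) pullback(2))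
  also have "\<dots> = Ttgt \<X> v" unfolding z(2)[symmetric] by (rule tmap_compose[OF pullback(2), symmetric])
  finally show "Ttgt \<X> (Tcmp \<X> x v y w) = Ttgt \<X> v" .
qed

lemma Tcmp_add:
  assumes "Tcomposable x v y w" "Tcomposable x v' y w'"
  shows "Tcmp \<X> x (v + v') y (w + w') = Tcmp \<X> x v y w + Tcmp \<X> x v' y w'"
proof -
  obtain z where z: "z \<in> tangent cmp_funs (x, y)" "tmap (arr_funs \<X>) fst z = v" "tmap (arr_funs \<X>) snd z = w"
    "Tcmp \<X> x v y w = tmap (arr_funs \<X>) (\<lambda>(x, y). cmp \<X> x y) z"
    using Tcomposable_witness[OF assms(1)] by metis
  obtain z' where z': "z' \<in> tangent cmp_funs (x, y)" "tmap (arr_funs \<X>) fst z' = v'" "tmap (arr_funs \<X>) snd z' = w'"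
    "Tcmp \<X> x v' y w' = tmap (arr_funs \<X>) (\<lambda>(x, y). cmp \<X> x y) z'"
    using Tcomposable_witness[OF assms(2)] by metis
  have "Tcmp \<X> x (v + v') y (w + w') = tmap (arr_funs \<X>) (\<lambda>(x, y). cmp \<X> x y) (z + z')"
    by (rule Tcmp_eq[OF tangent_add[OF z(1) z'(1)]]) (use assms z z' in \<open>auto simp: Tcomposable_def\<close>)
  then show ?thesis using z z' by simp
qed

lemma Tcmp_vscale:
  assumes "Tcomposable x v y w"
  shows "Tcmp \<X> x (vscale c v) y (vscale c w) = vscale c (Tcmp \<X> x v y w)"
proof -
  obtain z where z: "z \<in> tangent cmp_funs (x, y)" "tmap (arr_funs \<X>) fst z = v" "tmap (arr_funs \<X>) snd z = w"
    "Tcmp \<X> x v y w = tmap (arr_funs \<X>) (\<lambda>(x, y). cmp \<X> x y) z"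
    using Tcomposable_witness[OF assms(1)] by metis
  have "Tcmp \<X> x (vscale c v) y (vscale c w) = tmap (arr_funs \<X>) (\<lambda>(x, y). cmp \<X> x y) (vscale c z)"
    by (rule Tcmp_eq[OF tangent_vscale[OF z(1)]]) (use assms z in \<open>auto simp: Tcomposable_def\<close>)
  then show ?thesis using z by simp
qed

lemma Tcmp_0: "src \<X> x = tgt \<X> y \<Longrightarrow> Tcmp \<X> x 0 y 0 = 0"
  using Tcmp_vscale[of x 0 y 0 0] by (simp add: Tcomposable_def tangent_0)

text \<open>The pushforward of \<open>u\<close> under \<open>m \<mapsto> (F m, G m)\<close> is the
  witness. With units or inverses for \<open>F\<close> and \<open>G\<close>, groupoid laws become
  laws of the tangent groupoid.\<close>

lemma Tcmp_tmap:
  assumes A: "manifold A" and F: "smooth_map A UNIV (arr_atlas \<X>) F" and G: "smooth_map A UNIV (arr_atlas \<X>) G"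
    and FG: "\<And>m. src \<X> (F m) = tgt \<X> (G m)" and u: "u \<in> tangent (cfuns A) m"
  shows "Tcmp \<X> (F m) (tmap (arr_funs \<X>) F u) (G m) (tmap (arr_funs \<X>) G u) = tmap (arr_funs \<X>) (\<lambda>m. cmp \<X> (F m) (G m)) u"
proof -
  note m = manifold_prod[OF arr arr]
  let ?z = "tmap cmp_funs (\<lambda>m. (F m, G m)) u"
  have s: "(\<lambda>m. g (F m, G m)) \<in> cfuns A" if "g \<in> cmp_funs" for g
    by (rule smooth_funs_compose[OF A m smooth_map_Pair[OF A arr arr F G] that]) (auto simp: composable_iff FG)
  have z: "?z \<in> tangent cmp_funs (F m, G m)"
    by (rule tmap_tangent[OF m u s])
  have f: "(\<lambda>z. g (fst z)) \<in> cmp_funs" "(\<lambda>z. g (snd z)) \<in> cmp_funs" if "g \<in> arr_funs \<X>" for g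
    using that cfuns_subset[OF m cfuns_fst[OF arr arr]] cfuns_subset[OF m cfuns_snd[OF arr arr]] by (auto simp: arr_funs_def)
  have "Tcmp \<X> (F m) (tmap (arr_funs \<X>) F u) (G m) (tmap (arr_funs \<X>) G u) = tmap (arr_funs \<X>) (\<lambda>(x, y). cmp \<X> x y) ?z"
    by (rule Tcmp_eq[OF z FG]) (simp_all add: tmap_compose f)
  also have "\<dots> = tmap (arr_funs \<X>) (\<lambda>m. cmp \<X> (F m) (G m)) u"
    using tmap_compose[OF pullback_cmp, where F="\<lambda>m. (F m, G m)" and v=u] by simp
  finally show ?thesis .
qed

lemma Tcmp_unit_right:
  assumes v: "v \<in> tangent (arr_funs \<X>) x"
  shows "Tcmp \<X> x v (ident \<X> (src \<X> x)) (Tident \<X> (Tsrc \<X> v)) = v"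
  using Tcmp_tmap[OF arr smooth_map_ident[OF arr] smooth_map_compose[OF arr obj smooth_structure(1,3)], of v x] v
  by (simp add: tmap_compose pullback laws tmap_ident[OF v] arr_funs_def[symmetric])

lemma Tcmp_unit_left:
  assumes v: "v \<in> tangent (arr_funs \<X>) x"
  shows "Tcmp \<X> (ident \<X> (tgt \<X> x)) (Tident \<X> (Ttgt \<X> v)) x v = v"
  using Tcmp_tmap[OF arr smooth_map_compose[OF arr obj smooth_structure(2,3)] smooth_map_ident[OF arr], of v x] v
  by (simp add: tmap_compose pullback laws tmap_ident[OF v] arr_funs_def[symmetric])

lemma Tcmp_inverse:
  assumes v: "v \<in> tangent (arr_funs \<X>) x"
  shows "Tcmp \<X> x v (ginv \<X> x) (Tginv \<X> v) = Tident \<X> (Ttgt \<X> v)"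
  using Tcmp_tmap[OF arr smooth_map_ident[OF arr] smooth_structure(4), of v x] v
  by (simp add: tmap_compose pullback laws tmap_ident[OF v] arr_funs_def[symmetric])

text \<open>\<open>Tcmp\<close> is linear on composable pairs of vectors. Split
  \<open>(v, w)\<close> into \<open>v\<close> times the unit at its source plus 0 times the rest of
  \<open>w\<close>; the latter has target part 0, and both products are instances of the unit
  laws.\<close>

lemma Tcmp_at_ident:
  assumes "Tcomposable (ident \<X> m) v (ident \<X> m) w"
  shows "Tcmp \<X> (ident \<X> m) v (ident \<X> m) w = v + w - Tident \<X> (Tsrc \<X> v)"
proof -
  note c = assms[unfolded Tcomposable_def]
  let ?w = "w - Tident \<X> (Ttgt \<X> w)"
  have t: "Ttgt \<X> w \<in> tangent (obj_funs \<X>) m" using T_tangent(2)[of w "ident \<X> m"] c by (simp add: laws)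
  have w: "?w \<in> tangent (arr_funs \<X>) (ident \<X> m)" "Ttgt \<X> ?w = 0"
    using c T_tangent(3)[OF t] Ttgt_Tident[OF t] by (auto simp del: tmap_linear(2) simp: tmap_linear(2))
  have 1: "Tcomposable (ident \<X> m) v (ident \<X> m) (Tident \<X> (Tsrc \<X> v))"
    using c T_tangent(3)[OF t] Ttgt_Tident[OF t] by (auto simp: Tcomposable_def)
  have 2: "Tcomposable (ident \<X> m) 0 (ident \<X> m) ?w"
    using c w by (auto simp: Tcomposable_def)
  have "Tcmp \<X> (ident \<X> m) v (ident \<X> m) w = Tcmp \<X> (ident \<X> m) (v + 0) (ident \<X> m) (Tident \<X> (Tsrc \<X> v) + ?w)"
    using c by simp
  also have "\<dots> = v + ?w"
    unfolding Tcmp_add[OF 1 2]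
    using Tcmp_unit_right[of v "ident \<X> m"] Tcmp_unit_left[OF w(1)] c w(2) by (simp add: laws)
  finally show ?thesis using c by simp
qed

lemma right_inv_Tcomposable:
  assumes "a \<in> algd_sections \<X>"
  shows "Tcomposable (ident \<X> (tgt \<X> x)) (a (tgt \<X> x)) x 0"
  using assms by (auto simp: Tcomposable_def algd_sections_def laws)

lemma left_inv_Tcomposable:
  assumes "a \<in> algd_sections \<X>"
  shows "Tcomposable x 0 (ident \<X> (src \<X> x)) (Tginv \<X> (a (src \<X> x)))"
proof -
  have a: "a (src \<X> x) \<in> tangent (arr_funs \<X>) (ident \<X> (src \<X> x))" "Tsrc \<X> (a (src \<X> x)) = 0"
    using assms by (auto simp: algd_sections_def)
  then show ?thesis
    using T_tangent(4)[OF a(1)] by (auto simp: Tcomposable_def laws ginv_ident Ttgt_Tginv)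
qed

lemma right_inv_field_T:
  assumes a: "a \<in> algd_sections \<X>"
  shows "right_inv_field \<X> a x \<in> tangent (arr_funs \<X>) x" "Tsrc \<X> (right_inv_field \<X> a x) = 0"
    "Ttgt \<X> (right_inv_field \<X> a x) = Ttgt \<X> (a (tgt \<X> x))" "right_inv_field \<X> a (ident \<X> m) = a m"
proof -
  note c = right_inv_Tcomposable[OF a, of x]
  show "right_inv_field \<X> a x \<in> tangent (arr_funs \<X>) x"
    using Tcmp_tangent[OF c] by (simp add: right_inv_field_def laws)
  show "Tsrc \<X> (right_inv_field \<X> a x) = 0" "Ttgt \<X> (right_inv_field \<X> a x) = Ttgt \<X> (a (tgt \<X> x))"
    using Tcmp_Tsrc[OF c] by (simp_all add: right_inv_field_def)
  show "right_inv_field \<X> a (ident \<X> m) = a m"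
    using Tcmp_unit_right[of "a m" "ident \<X> m"] a by (simp add: right_inv_field_def laws algd_sections_def)
qed

text \<open>Applied to \<open>f\<close>, the field is \<open>a (tgt \<X> x)\<close> acting on the
  first variable of a local extension \<open>F\<close> of \<open>f\<close> composed with the
  multiplication. The vector sits at the moving unit of \<open>tgt \<X> x\<close>, so it is expanded
  in a frame around the unit of \<open>tgt \<X> p\<close>: the coefficients are smooth because
  \<open>a\<close> is a smooth section, and the frame fields act on slices of \<open>F\<close>
  smoothly in both variables.\<close>

lemma right_inv_vector_field:
  assumes a: "a \<in> algd_sections \<X>"
  shows "right_inv_field \<X> a \<in> vector_fields (arr_funs \<X>)"
proof (rule vector_fieldsI[OF right_inv_field_T(1)[OF a]])
  fix f assume f: "f \<in> arr_funs \<X>"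
  note m = manifold_prod[OF arr arr]
  have sj: "smooth_map (arr_atlas \<X>) UNIV (prod_atlas (arr_atlas \<X>) (arr_atlas \<X>)) (\<lambda>x. (ident \<X> (tgt \<X> x), x))"
    by (intro smooth_map_Pair[OF arr arr arr] smooth_map_compose[OF arr obj smooth_structure(2,3)] smooth_map_ident[OF arr]) auto
  show "(\<lambda>x. right_inv_field \<X> a x f) \<in> arr_funs \<X>"
    unfolding arr_funs_def
  proof (rule cfuns_divide_local[OF arr])
    fix p
    let ?j = "\<lambda>x. (ident \<X> (tgt \<X> x), x)"
    have S: "?j x \<in> composable \<X>" for x by (simp add: composable_iff laws)
    obtain F W where F: "F \<in> cfuns (prod_atlas (arr_atlas \<X>) (arr_atlas \<X>))" "open W" "?j p \<in> W"
      "\<And>z. z \<in> composable \<X> \<Longrightarrow> z \<in> W \<Longrightarrow> f (case z of (x, y) \<Rightarrow> cmp \<X> x y) = F z"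
      by (rule smooth_funsE[OF m pullback_cmp[OF f] S[of p]]) (rule that)
    have eq: "right_inv_field \<X> a x f = a (tgt \<X> x) (\<lambda>y. F (y, x))" if x: "?j x \<in> W" for x
    proof -
      obtain z where z: "z \<in> tangent cmp_funs (?j x)" "tmap (arr_funs \<X>) fst z = a (tgt \<X> x)" "tmap (arr_funs \<X>) snd z = 0"
        "right_inv_field \<X> a x = tmap (arr_funs \<X>) (\<lambda>(x, y). cmp \<X> x y) z"
        by (rule Tcomposable_witness[OF right_inv_Tcomposable[OF a, of x]]) (rule that, simp_all add: right_inv_field_def)
      have "z (\<lambda>z. f (case z of (x, y) \<Rightarrow> cmp \<X> x y)) = tmap (arr_funs \<X>) fst z (\<lambda>y. F (y, x)) + tmap (arr_funs \<X>) snd z (\<lambda>y. F (ident \<X> (tgt \<X> x), y))"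
        unfolding arr_funs_def
        by (rule tangent_subset_prod_eval[OF arr arr z(1) S pullback_cmp[OF f] F(1,2) x F(4)])
      then show ?thesis by (simp add: z(2-4) tmap_apply f)
    qed
    obtain x Z \<rho> where fr: "frame (cfuns (arr_atlas \<X>)) (ident \<X> (tgt \<X> p)) (fbasis :: 'e set) x Z \<rho>"
      using frame_exists[OF arr] .
    have oj: "open (?j -` W)" by (rule open_vimage[OF F(2) smooth_map_continuous[OF arr m sj]])
    obtain \<beta> V K where b: "\<beta> \<in> cfuns (arr_atlas \<X>)" "p \<in> V" "K \<subseteq> ?j -` W"
      "\<And>x. x \<in> V \<Longrightarrow> \<beta> x = 1" "\<And>x. x \<notin> K \<Longrightarrow> \<beta> x = 0"
      by (rule bump[OF arr oj vimageI2[where f="?j" and a=p, OF F(3)]]) (rule that)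
    \<comment> \<open>\<open>\<beta>\<close> keeps the argument where the extension \<open>F\<close>
      is valid, and the factor \<open>\<rho>\<close> is the one of the frame expansion; the product
      is 1 at \<open>p\<close>.\<close>
    let ?c = "\<lambda>y. \<beta> y * \<rho> (ident \<X> (tgt \<X> y))"
    have ra: "\<rho> (ident \<X> (tgt \<X> y)) * a (tgt \<X> y) (\<lambda>z. F (z, y)) =
        (\<Sum>b\<in>fbasis. a (tgt \<X> y) (x b) * Z b (ident \<X> (tgt \<X> y)) (\<lambda>z. F (z, y)))" for y
      by (rule frameD(6)[OF fr _ slice(1)[OF arr arr F(1)]]) (use a in \<open>auto simp: algd_sections_def arr_funs_def\<close>)
    have "(\<lambda>y. \<rho> (ident \<X> (tgt \<X> y))) \<in> arr_funs \<X>"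
      using pullback(2)[OF pullback(3)] frameD(2)[OF fr] by (simp add: arr_funs_def)
    then have c: "?c \<in> cfuns (arr_atlas \<X>)" by (intro cfuns_mult[OF arr] b(1)) (simp add: arr_funs_def)
    have "(\<lambda>y. ?c y * right_inv_field \<X> a y f) = (\<lambda>y. \<beta> y * (\<Sum>b\<in>fbasis. a (tgt \<X> y) (x b) * Z b (ident \<X> (tgt \<X> y)) (\<lambda>z. F (z, y))))"
    proof
      fix y show "?c y * right_inv_field \<X> a y f = \<beta> y * (\<Sum>b\<in>fbasis. a (tgt \<X> y) (x b) * Z b (ident \<X> (tgt \<X> y)) (\<lambda>z. F (z, y)))"
        using b(3,5) eq[of y] by (cases "y \<in> K") (auto simp: ra[symmetric])
    qed
    moreover have "(\<lambda>y. Z b (ident \<X> (tgt \<X> y)) (\<lambda>z. F (z, y))) \<in> cfuns (arr_atlas \<X>)" if "b \<in> fbasis" for b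
      using smooth_funs_compose[OF arr m sj vector_field_slice[OF arr arr frameD(5)[OF fr that] F(1)]] by simp
    moreover have "(\<lambda>y. a (tgt \<X> y) (x b)) \<in> cfuns (arr_atlas \<X>)" if "b \<in> fbasis" for b
      using a frameD(4)[OF fr that] pullback(2)[of "\<lambda>m. a m (x b)"] by (simp add: algd_sections_def arr_funs_def)
    ultimately have "(\<lambda>y. ?c y * right_inv_field \<X> a y f) \<in> cfuns (arr_atlas \<X>)"
      by (simp only:) (intro cfuns_mult[OF arr] cfuns_sum[OF arr] b(1), auto)
    then show "\<exists>c\<in>cfuns (arr_atlas \<X>). c p \<noteq> 0 \<and> (\<lambda>x. c x * right_inv_field \<X> a x f) \<in> cfuns (arr_atlas \<X>)"
      by (intro bexI[OF _ c] conjI) (use b(2,4) frameD(3)[OF fr] in auto)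
  qed
qed

end

text \<open>The differential of \<open>F1\<close> on each factor carries a witness for the first
  product to a witness for the second; the morphism law, which holds on composable pairs only, then
  compares the differentials of the two multiplications there.\<close>

lemma Tcmp_morphism:
  assumes "gpd \<X>" "gpd \<Y>" and F: "lie_gpd_morphism \<X> \<Y> F1 F0" and c: "gpd.Tcomposable \<X> x v y w"
  shows "gpd.Tcomposable \<Y> (F1 x) (tmap (arr_funs \<Y>) F1 v) (F1 y) (tmap (arr_funs \<Y>) F1 w)"
    and "tmap (arr_funs \<Y>) F1 (Tcmp \<X> x v y w) = Tcmp \<Y> (F1 x) (tmap (arr_funs \<Y>) F1 v) (F1 y) (tmap (arr_funs \<Y>) F1 w)"
proof -
  interpret X: gpd \<X> by fact
  interpret Y: gpd \<Y> by fact
  note F = F[unfolded lie_gpd_morphism_def]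
  have pf: "(\<lambda>x. g (F1 x)) \<in> arr_funs \<X>" if "g \<in> arr_funs \<Y>" for g
    using smooth_funs_compose[OF X.arr Y.arr conjunct1[OF F]] that by (simp add: arr_funs_def)
  have F0: "smooth_map (obj_atlas \<X>) UNIV (obj_atlas \<Y>) F0" using F by blast
  have pf0: "(\<lambda>x. g (F0 x)) \<in> obj_funs \<X>" if "g \<in> obj_funs \<Y>" for g
    using smooth_funs_compose[OF X.obj Y.obj F0] that by (simp add: obj_funs_def)
  have t: "tmap (arr_funs \<Y>) F1 v \<in> tangent (arr_funs \<Y>) (F1 x)" if "v \<in> tangent (arr_funs \<X>) x" for v x
    unfolding arr_funs_def by (rule tmap_tangent[OF Y.arr that]) (use pf in \<open>simp add: arr_funs_def\<close>)
  note c' = c[unfolded X.Tcomposable_def]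
  have "Tsrc \<Y> (tmap (arr_funs \<Y>) F1 v) = tmap (obj_funs \<Y>) F0 (Tsrc \<X> v)"
    "Ttgt \<Y> (tmap (arr_funs \<Y>) F1 w) = tmap (obj_funs \<Y>) F0 (Ttgt \<X> w)"
    using F by (simp_all add: tmap_compose Y.pullback pf0)
  then show "Y.Tcomposable (F1 x) (tmap (arr_funs \<Y>) F1 v) (F1 y) (tmap (arr_funs \<Y>) F1 w)"
    using c' F t unfolding Y.Tcomposable_def by auto
  obtain z where z: "z \<in> tangent X.cmp_funs (x, y)" "tmap (arr_funs \<X>) fst z = v" "tmap (arr_funs \<X>) snd z = w"
    "Tcmp \<X> x v y w = tmap (arr_funs \<X>) (\<lambda>(x, y). cmp \<X> x y) z"
    by (rule X.Tcomposable_witness[OF c]) (rule that)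
  note mX = manifold_prod[OF X.arr X.arr] and mY = manifold_prod[OF Y.arr Y.arr]
  have xy: "(x, y) \<in> composable \<X>" using c' by (simp add: X.composable_iff)
  let ?F = "\<lambda>z. (F1 (fst z), F1 (snd z))" 
  have sF: "smooth_map (prod_atlas (arr_atlas \<X>) (arr_atlas \<X>)) (composable \<X>) (prod_atlas (arr_atlas \<Y>) (arr_atlas \<Y>)) ?F"
    by (intro smooth_map_Pair[OF mX Y.arr Y.arr] smooth_map_compose[OF mX X.arr _ conjunct1[OF F]]
        smooth_map_fst[OF X.arr X.arr] smooth_map_snd[OF X.arr X.arr]) auto
  have s: "(\<lambda>z. g (?F z)) \<in> X.cmp_funs" if "g \<in> Y.cmp_funs" for g
    by (rule smooth_funs_compose[OF mX mY sF that]) (use F in \<open>auto simp: X.composable_iff Y.composable_iff\<close>)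
  have fst_snd: "(\<lambda>z. g (fst z)) \<in> Y.cmp_funs" "(\<lambda>z. g (snd z)) \<in> Y.cmp_funs" if "g \<in> arr_funs \<Y>" for g
    using that cfuns_subset[OF mY cfuns_fst[OF Y.arr Y.arr]] cfuns_subset[OF mY cfuns_snd[OF Y.arr Y.arr]] by (auto simp: arr_funs_def)
  let ?z = "tmap Y.cmp_funs ?F z"
  have "?z \<in> tangent Y.cmp_funs (?F (x, y))" by (rule tmap_tangent[OF mY z(1) s])
  then have "Tcmp \<Y> (F1 x) (tmap (arr_funs \<Y>) F1 v) (F1 y) (tmap (arr_funs \<Y>) F1 w) = tmap (arr_funs \<Y>) (\<lambda>(x, y). cmp \<Y> x y) ?z"
    by (intro Y.Tcmp_eq) (use c' F in \<open>auto simp: tmap_compose fst_snd pf simp flip: z(2,3)\<close>)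
  also have "\<dots> = tmap (arr_funs \<Y>) (\<lambda>z. case ?F z of (x, y) \<Rightarrow> cmp \<Y> x y) z"
    by (rule tmap_compose[OF Y.pullback_cmp])
  also have "\<dots> = tmap (arr_funs \<Y>) (\<lambda>z. F1 (case z of (x, y) \<Rightarrow> cmp \<X> x y)) z"
    by (rule tmap_cong_on[OF mX z(1) xy]) (use F X.pullback_cmp[OF pf] in \<open>auto simp: X.composable_iff\<close>)
  also have "\<dots> = tmap (arr_funs \<Y>) F1 (Tcmp \<X> x v y w)"
    unfolding z(4) by (rule tmap_compose[OF pf, symmetric])
  finally show "tmap (arr_funs \<Y>) F1 (Tcmp \<X> x v y w) = Tcmp \<Y> (F1 x) (tmap (arr_funs \<Y>) F1 v) (F1 y) (tmap (arr_funs \<Y>) F1 w)" ..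
qed

section \<open>Principal bundles with connection\<close>

text \<open>Gaussian elimination without division, as \<open>C\<close> is only an algebra.
  Cross-multiplication by the pivot keeps all entries in \<open>C\<close>, and the pivots collect in
  the multiplier \<open>c\<close>, which is 1 at \<open>p\<close> because the matrix is the identity
  there.\<close>

lemma linear_system_solvable:
  fixes C :: "('a \<Rightarrow> real) set" and K :: "'i set"
  assumes C: "\<And>f g. f \<in> C \<Longrightarrow> g \<in> C \<Longrightarrow> (\<lambda>x. f x + g x) \<in> C" "\<And>f g. f \<in> C \<Longrightarrow> g \<in> C \<Longrightarrow> (\<lambda>x. f x * g x) \<in> C"
    "\<And>c. (\<lambda>x. c) \<in> C"
    and K: "finite K"
    and M: "\<And>i j. i \<in> K \<Longrightarrow> j \<in> K \<Longrightarrow> M i j \<in> C" "\<And>i j. i \<in> K \<Longrightarrow> j \<in> K \<Longrightarrow> M i j p = (if i = j then 1 else 0)"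
    and b: "\<And>i. i \<in> K \<Longrightarrow> b i \<in> C"
  shows "\<exists>x c. c \<in> C \<and> c p = 1 \<and> (\<forall>j\<in>K. x j \<in> C) \<and> (\<forall>i\<in>K. \<forall>q. (\<Sum>j\<in>K. M i j q * x j q) = c q * b i q)"
  using K M b
proof (induction K arbitrary: M b)
  case empty
  then show ?case using C(3)[of 1] by auto
next
  case (insert a K)
  have minus: "(\<lambda>x. f x - g x) \<in> C" if "f \<in> C" "g \<in> C" for f g
    using C(1)[OF that(1) C(2)[OF C(3)[of "- 1"] that(2)]] by simp
  have sum: "(\<lambda>x. \<Sum>i\<in>I. f i x) \<in> C" if "\<And>i. i \<in> I \<Longrightarrow> f i \<in> C" for I :: "'i set" and f
    using that by (induction I rule: infinite_finite_induct) (auto intro: C)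
  \<comment> \<open>The row \<open>a\<close> is eliminated with pivot \<open>M a a\<close>. At
    \<open>p\<close> the pivot is 1 and the other entries of row and column \<open>a\<close> are 0,
    so the reduced matrix is again the identity.\<close>
  let ?M = "\<lambda>i j q. M a a q * M i j q - M i a q * M a j q" and ?b = "\<lambda>i q. M a a q * b i q - M i a q * b a q"
  have "\<exists>x c. c \<in> C \<and> c p = 1 \<and> (\<forall>j\<in>K. x j \<in> C) \<and> (\<forall>i\<in>K. \<forall>q. (\<Sum>j\<in>K. ?M i j q * x j q) = c q * ?b i q)"
    by (rule insert.IH) (use insert.hyps insert.prems in \<open>auto intro!: minus C(2)\<close>)
  then obtain x c where x: "c \<in> C" "c p = 1" "\<And>j. j \<in> K \<Longrightarrow> x j \<in> C"
    "\<And>i q. i \<in> K \<Longrightarrow> (\<Sum>j\<in>K. ?M i j q * x j q) = c q * ?b i q"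
    by (elim exE conjE) (rule that, assumption, assumption, erule (1) bspec, drule (1) bspec, erule spec)
  \<comment> \<open>Back substitution, with the whole solution multiplied by the pivot so that the
    unknown at \<open>a\<close> needs no division.\<close>
  define y where "y j = (if j = a then (\<lambda>q. c q * b a q - (\<Sum>j\<in>K. M a j q * x j q)) else (\<lambda>q. M a a q * x j q))" for j
  have sumy: "(\<Sum>j\<in>insert a K. M i j q * y j q) = M i a q * (c q * b a q - (\<Sum>j\<in>K. M a j q * x j q)) + (\<Sum>j\<in>K. M i j q * (M a a q * x j q))" for i q
  proof -
    have "(\<Sum>j\<in>K. M i j q * y j q) = (\<Sum>j\<in>K. M i j q * (M a a q * x j q))"
      by (rule sum.cong) (use insert.hyps in \<open>auto simp: y_def\<close>)
    then show ?thesis using insert.hyps by (simp add: y_def)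
  qed
  have "(\<Sum>j\<in>insert a K. M i j q * y j q) = M a a q * c q * b i q" if i: "i \<in> insert a K" for i q
  proof (cases "i = a")
    case True
    then show ?thesis unfolding sumy by (simp add: algebra_simps sum_distrib_left)
  next
    case False
    then have "i \<in> K" using i by blast
    from x(4)[OF this, of q] show ?thesis
      unfolding sumy by (simp add: algebra_simps sum_distrib_left sum_subtractf)
  qed
  moreover have "y j \<in> C" if "j \<in> insert a K" for j
    using that insert.hyps insert.prems by (auto simp: y_def intro!: minus C(2) sum x(1,3))
  moreover have "(\<lambda>q. M a a q * c q) \<in> C" "M a a p * c p = 1" using insert.prems x by (auto intro!: C(2))
  ultimately show ?case by (intro exI[of _ y] exI[of _ "\<lambda>q. M a a q * c q"]) auto
qed

text \<open>One level of a principal 2-bundle with connection; it is instantiated once for arrows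
  and once for objects.\<close>

locale principal_connection =
  fixes P :: "('p::{t2_space,second_countable_topology}, 'ep::real_normed_vector) atlas"
    and X :: "('x::{t2_space,second_countable_topology}, 'ex::real_normed_vector) atlas"
    and G :: "('g::{t2_space,second_countable_topology}, 'eg::real_normed_vector) atlas"
    and \<pi> :: "'p \<Rightarrow> 'x" and act :: "'p \<Rightarrow> 'g \<Rightarrow> 'p" and mul :: "'g \<Rightarrow> 'g \<Rightarrow> 'g" and one :: 'g and inv :: "'g \<Rightarrow> 'g"
    and \<theta> :: "'p \<Rightarrow> 'p tvec \<Rightarrow> 'g tvec"
  assumes P: "manifold P" and X: "manifold X" and G: "manifold G"
    and \<pi>: "smooth_map P UNIV X \<pi>"
    and \<pi>_submersion: "\<And>p. tangent (cfuns X) (\<pi> p) \<subseteq> tmap (cfuns X) \<pi> ` tangent (cfuns P) p"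
    and act: "smooth_map (prod_atlas P G) UNIV P (\<lambda>(p, g). act p g)"
    and act_one: "\<And>p. act p one = p"
    and diffeo: "diffeo_onto_subset (prod_atlas P G) (prod_atlas P P) {(p, q). \<pi> p = \<pi> q} (\<lambda>(p, g). (p, act p g))"
    and form: "is_form1 (cfuns P) (cfuns G) (tangent (cfuns G) one) \<theta>"
    and equivariant: "\<And>p g v. v \<in> tangent (cfuns P) p \<Longrightarrow>
      \<theta> (act p g) (tmap (cfuns P) (\<lambda>q. act q g) v) = adj (cfuns G) mul inv (inv g) (\<theta> p v)"
    and reproducing: "\<And>p a. a \<in> tangent (cfuns G) one \<Longrightarrow> \<theta> p (tmap (cfuns P) (act p) a) = a"
begin

abbreviation "TP \<equiv> tangent (cfuns P)"
abbreviation "TX \<equiv> tangent (cfuns X)"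
abbreviation "\<gg> \<equiv> tangent (cfuns G) one"
abbreviation "T\<pi> \<equiv> tmap (cfuns X) \<pi>"
abbreviation "fund p \<equiv> tmap (cfuns P) (act p)"

lemma pullback_pi: "f \<in> cfuns X \<Longrightarrow> (\<lambda>p. f (\<pi> p)) \<in> cfuns P"
  using smooth_funs_compose[OF P X \<pi>] by auto

lemma pi_act: "\<pi> (act p g) = \<pi> p"
proof -
  have "bij_betw (\<lambda>(p, g). (p, act p g)) UNIV {(p, q). \<pi> p = \<pi> q}"
    using diffeo unfolding diffeo_onto_subset_def by blast
  from bij_betw_apply[OF this UNIV_I, of "(p, g)"] show ?thesis by simp
qed

lemma pullback_act:
  assumes "f \<in> cfuns P"
  shows "(\<lambda>z. f (act (fst z) (snd z))) \<in> cfuns (prod_atlas P G)" "(\<lambda>g. f (act p g)) \<in> cfuns G" "(\<lambda>p. f (act p g)) \<in> cfuns P"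
proof -
  show 1: "(\<lambda>z. f (act (fst z) (snd z))) \<in> cfuns (prod_atlas P G)"
    using smooth_funs_compose[OF manifold_prod[OF P G] P act assms] by (simp add: split_beta)
  show "(\<lambda>g. f (act p g)) \<in> cfuns G" "(\<lambda>p. f (act p g)) \<in> cfuns P"
    using slice[OF P G 1] by auto
qed

lemma Tpi_tangent: "v \<in> TP p \<Longrightarrow> T\<pi> v \<in> TX (\<pi> p)"
  by (rule tmap_tangent[OF X _ pullback_pi])

lemma fund_tangent: "a \<in> \<gg> \<Longrightarrow> fund p a \<in> TP p"
  using tmap_tangent[OF P _ pullback_act(2), where v=a and p=one and F="act p"] by (simp add: act_one)

lemma Tpi_fund: "a \<in> \<gg> \<Longrightarrow> T\<pi> (fund p a) = 0"
  using tmap_const[OF G] by (simp add: tmap_compose pullback_pi pi_act)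

lemma theta_in: "v \<in> TP p \<Longrightarrow> \<theta> p v \<in> \<gg>"
  by (rule is_form1D(1)[OF form])

lemma theta_linear:
  "v \<in> TP p \<Longrightarrow> w \<in> TP p \<Longrightarrow> \<theta> p (v + w) = \<theta> p v + \<theta> p w"
  "v \<in> TP p \<Longrightarrow> \<theta> p (vscale c v) = vscale c (\<theta> p v)"
  "\<theta> p 0 = 0"
  "v \<in> TP p \<Longrightarrow> \<theta> p (- v) = - \<theta> p v"
  "v \<in> TP p \<Longrightarrow> w \<in> TP p \<Longrightarrow> \<theta> p (v - w) = \<theta> p v - \<theta> p w"
proof -
  show 1: "v \<in> TP p \<Longrightarrow> w \<in> TP p \<Longrightarrow> \<theta> p (v + w) = \<theta> p v + \<theta> p w" for v w
    by (rule is_form1D(2)[OF form])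
  show 2: "v \<in> TP p \<Longrightarrow> \<theta> p (vscale c v) = vscale c (\<theta> p v)" for v c
    by (rule is_form1D(3)[OF form])
  show "\<theta> p 0 = 0" using 2[of 0 0] by (simp add: tangent_0)
  show 3: "v \<in> TP p \<Longrightarrow> \<theta> p (- v) = - \<theta> p v" for v
    using 2[of v "- 1"] by (simp add: vscale_minus_1)
  show "v \<in> TP p \<Longrightarrow> w \<in> TP p \<Longrightarrow> \<theta> p (v - w) = \<theta> p v - \<theta> p w"
    using 1[of v "- w"] 3[of w] by (auto simp: tangent_uminus)
qed

text \<open>The tangent vector \<open>(0, v)\<close> of \<open>P \<times>\<^bsub>X\<^esub> P\<close> is the image of some \<open>(0, a)\<close> under the differential
  of \<open>(p, g) \<mapsto> (p, pg)\<close>.\<close>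

lemma vertical:
  assumes v: "v \<in> TP p" "T\<pi> v = 0"
  shows "v = fund p (\<theta> p v)"
proof -
  let ?S = "{(p, q). \<pi> p = \<pi> q}" and ?I = "inv_into UNIV (\<lambda>(p, g). (p, act p g))"
  note PP = manifold_prod[OF P P] and PG = manifold_prod[OF P G]
  obtain z where z: "z \<in> tangent (smooth_funs (prod_atlas P P) ?S) (p, p)" "tmap (cfuns P) fst z = 0" "tmap (cfuns P) snd z = v"
    by (rule fibre_product_tangent[OF P P X \<pi> \<pi>, of p p 0 v]) (use v \<pi>_submersion in auto)
  have bij: "bij_betw (\<lambda>(p, g). (p, act p g)) UNIV ?S" and sI: "smooth_map (prod_atlas P P) ?S (prod_atlas P G) ?I"
    using diffeo unfolding diffeo_onto_subset_def by blast+
  have I: "(fst (?I q), act (fst (?I q)) (snd (?I q))) = q" if "q \<in> ?S" for q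
    using bij_betw_inv_into_right[OF bij that] by (simp add: split_beta)
  have I1: "fst (?I q) = fst q" and I2: "act (fst q) (snd (?I q)) = snd q" if "q \<in> ?S" for q
    using arg_cong[OF I[OF that], of fst] arg_cong[OF I[OF that], of snd] by simp_all
  have Ip: "?I (p, p) = (p, one)"
    using bij_betw_inv_into_left[OF bij, of "(p, one)"] by (simp add: act_one)
  have s: "(\<lambda>q. F (?I q)) \<in> smooth_funs (prod_atlas P P) ?S" if "F \<in> cfuns (prod_atlas P G)" for F
    by (rule smooth_funs_compose[OF PP PG sI that]) auto
  let ?y = "tmap (cfuns (prod_atlas P G)) ?I z"
  have y: "?y \<in> tangent (cfuns (prod_atlas P G)) (p, one)"
    using tmap_tangent[OF PG z(1) s] by (simp add: Ip)
  have pp: "(p, p) \<in> ?S" by simp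
  have sf: "(\<lambda>q. f (fst q)) \<in> smooth_funs (prod_atlas P P) ?S" "(\<lambda>q. f (snd q)) \<in> smooth_funs (prod_atlas P P) ?S" if "f \<in> cfuns P" for f
    using cfuns_subset[OF PP cfuns_fst[OF P P that]] cfuns_subset[OF PP cfuns_snd[OF P P that]] by auto
  have "tmap (cfuns P) fst ?y = tmap (cfuns P) (\<lambda>q. fst (?I q)) z"
    by (rule tmap_compose[OF cfuns_fst[OF P G]])
  also have "\<dots> = tmap (cfuns P) fst z"
    by (rule tmap_cong_on[OF PP z(1) pp]) (simp_all add: I1 sf(1))
  finally have y1: "tmap (cfuns P) fst ?y = 0" using z(2) by simp
  let ?a = "tmap (cfuns G) snd ?y"
  have a: "?a \<in> \<gg>" using tmap_tangent[OF G y cfuns_snd[OF P G]] by simp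
  have "v = fund p ?a"
  proof
    fix f show "v f = fund p ?a f"
    proof (cases "f \<in> cfuns P")
      case True
      let ?F = "\<lambda>z. f (act (fst z) (snd z))"
      have "v f = z (\<lambda>q. f (snd q))" using True by (simp add: z(3)[symmetric] tmap_apply)
      also have "\<dots> = z (\<lambda>q. ?F (?I q))"
        by (rule tangent_local[OF PP z(1) pp sf(2)[OF True] s[OF pullback_act(1)[OF True]] open_UNIV UNIV_I])
          (simp add: I1 I2)
      also have "\<dots> = ?y ?F" using pullback_act(1)[OF True] by (simp add: tmap_apply)
      also have "\<dots> = ?a (\<lambda>g. f (act p g))"
        using tangent_prod_eval[OF P G y pullback_act(1)[OF True]] y1 by simp
      finally show ?thesis using True by (simp add: tmap_apply[of "cfuns P"])
    next
      case False
      then show ?thesis using tangentD(1)[OF v(1)] by (simp add: tmap_apply)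
    qed
  qed
  then show ?thesis using reproducing[OF a] by simp
qed

definition lift :: "'p \<Rightarrow> 'x tvec \<Rightarrow> 'p tvec"
  where "lift p v = (THE w. w \<in> TP p \<and> T\<pi> w = v \<and> \<theta> p w = 0)"

text \<open>Two candidates differ by a vertical vector, which is the fundamental vector of its own
  value under \<open>\<theta>\<close>, and this value is 0. Most later compatibilities of the lift
  are instances of this uniqueness.\<close>

lemma lift_eqI:
  assumes w: "w \<in> TP p" "T\<pi> w = v" "\<theta> p w = 0"
  shows "lift p v = w"
  unfolding lift_def
proof (rule the_equality)
  fix w' assume w': "w' \<in> TP p \<and> T\<pi> w' = v \<and> \<theta> p w' = 0"
  then have "w' - w = fund p (\<theta> p (w' - w))" using w by (intro vertical) auto
  then show "w' = w" using w w' by (simp add: theta_linear)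
qed (use w in auto)

lemma horizontal_part: "w \<in> TP p \<Longrightarrow> lift p (T\<pi> w) = w - fund p (\<theta> p w)"
  by (rule lift_eqI) (auto simp: theta_in fund_tangent Tpi_fund theta_linear reproducing tangent_diff)

lemma lift:
  assumes "v \<in> TX (\<pi> p)"
  shows "lift p v \<in> TP p" "T\<pi> (lift p v) = v" "\<theta> p (lift p v) = 0"
proof -
  obtain w where w: "w \<in> TP p" "v = T\<pi> w" using \<pi>_submersion assms by blast
  show "lift p v \<in> TP p" "T\<pi> (lift p v) = v" "\<theta> p (lift p v) = 0"
    using w by (auto simp: horizontal_part theta_in fund_tangent Tpi_fund theta_linear reproducing tangent_diff)
qed

lemma lift_linear:
  "v \<in> TX (\<pi> p) \<Longrightarrow> w \<in> TX (\<pi> p) \<Longrightarrow> lift p (v + w) = lift p v + lift p w"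
  "v \<in> TX (\<pi> p) \<Longrightarrow> lift p (vscale c v) = vscale c (lift p v)"
  by (auto intro!: lift_eqI simp: lift theta_linear)

lemma lift_equivariant:
  assumes v: "v \<in> TX (\<pi> p)"
  shows "lift (act p g) v = tmap (cfuns P) (\<lambda>q. act q g) (lift p v)"
proof (rule lift_eqI)
  show "tmap (cfuns P) (\<lambda>q. act q g) (lift p v) \<in> TP (act p g)"
    by (rule tmap_tangent[OF P lift(1)[OF v] pullback_act(3)])
  show "T\<pi> (tmap (cfuns P) (\<lambda>q. act q g) (lift p v)) = v"
    using lift(2)[OF v] by (simp add: tmap_compose pullback_pi pi_act)
  show "\<theta> (act p g) (tmap (cfuns P) (\<lambda>q. act q g) (lift p v)) = 0"
    by (simp add: equivariant[OF lift(1)[OF v]] lift(3)[OF v] adj_def)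
qed

text \<open>All \<open>v m\<close> sit at the identity, so \<open>tangent_family_slice\<close>
  applies to \<open>f (act (j m) g)\<close> as a function of \<open>g\<close> and \<open>m\<close>.
  The map \<open>j\<close> is general because the lemma serves fundamental fields on the bundle
  itself and fundamental vectors along the units of a groupoid.\<close>

lemma fund_family:
  assumes M: "manifold M" and j: "smooth_map M UNIV P j"
    and v: "\<And>m. v m \<in> \<gg>" "\<And>\<phi>. \<phi> \<in> cfuns G \<Longrightarrow> (\<lambda>m. v m \<phi>) \<in> cfuns M" and f: "f \<in> cfuns P"
  shows "(\<lambda>m. fund (j m) (v m) f) \<in> cfuns M"
proof -
  note GM = manifold_prod[OF G M] and PG = manifold_prod[OF P G]
  have "smooth_map (prod_atlas G M) UNIV (prod_atlas P G) (\<lambda>z. (j (snd z), fst z))"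
    by (intro smooth_map_Pair[OF GM P G] smooth_map_compose[OF GM M smooth_map_snd[OF G M] j] smooth_map_fst[OF G M]) auto
  from smooth_funs_compose[OF GM PG this pullback_act(1)[OF f]]
  have "(\<lambda>z. f (act (j (snd z)) (fst z))) \<in> cfuns (prod_atlas G M)" by auto
  from tangent_family_slice[OF G M v this] show ?thesis using f by (simp add: tmap_apply)
qed

lemma fund_vector_field:
  assumes v: "\<And>p. v p \<in> \<gg>" "\<And>\<phi>. \<phi> \<in> cfuns G \<Longrightarrow> (\<lambda>p. v p \<phi>) \<in> cfuns P"
  shows "(\<lambda>p. fund p (v p)) \<in> vector_fields (cfuns P)"
  by (rule vector_fieldsI) (auto intro!: fund_tangent v fund_family[OF P smooth_map_ident[OF P]])

text \<open>Near \<open>p\<close>, a lift of a multiple of \<open>\<xi>\<close> is a combination of fields that lift a frame at \<open>p\<close>; its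
  coefficients solve a linear system with the identity matrix at \<open>p\<close>. Subtracting the vertical
  part makes the lift horizontal.\<close>

lemma lift_vector_field:
  assumes \<xi>: "\<xi> \<in> vector_fields (cfuns X)"
  shows "(\<lambda>p. lift p (\<xi> (\<pi> p))) \<in> vector_fields (cfuns P)"
proof (rule vector_fieldsI)
  show "lift p (\<xi> (\<pi> p)) \<in> TP p" for p by (rule lift(1)[OF vector_fieldsD(1)[OF \<xi>]])
  fix f assume f: "f \<in> cfuns P"
  show "(\<lambda>p. lift p (\<xi> (\<pi> p)) f) \<in> cfuns P"
  proof (rule cfuns_divide_local[OF P])
    fix p
    let ?K = "fbasis :: 'ex set"
    obtain k Z \<rho> where fr: "frame (cfuns X) (\<pi> p) ?K k Z \<rho>" using frame_exists[OF X] .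
    have "\<forall>b\<in>?K. \<exists>u. u \<in> TP p \<and> T\<pi> u = Z b (\<pi> p)"
    proof
      fix b assume "b \<in> ?K"
      with \<pi>_submersion have "Z b (\<pi> p) \<in> T\<pi> ` TP p" using vector_fieldsD(1)[OF frameD(5)[OF fr]] by blast
      then show "\<exists>u. u \<in> TP p \<and> T\<pi> u = Z b (\<pi> p)" by auto
    qed
    then obtain u where u: "\<And>b. b \<in> ?K \<Longrightarrow> u b \<in> TP p" "\<And>b. b \<in> ?K \<Longrightarrow> T\<pi> (u b) = Z b (\<pi> p)" by metis
    define W where "W b = extend_vec (cfuns P) p (u b)" for b
    have W: "W b \<in> vector_fields (cfuns P)" "W b p = u b" if "b \<in> ?K" for b
      using extend_vec[OF P u(1)[OF that]] by (auto simp: W_def)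
    let ?k = "\<lambda>i q. k i (\<pi> q)"
    have k: "?k i \<in> cfuns P" if "i \<in> ?K" for i by (rule pullback_pi[OF frameD(4)[OF fr that]])
    let ?M = "\<lambda>i j q. W j q (?k i)" and ?b = "\<lambda>i q. \<xi> (\<pi> q) (k i)"
    have "\<exists>x c. c \<in> cfuns P \<and> c p = 1 \<and> (\<forall>j\<in>?K. x j \<in> cfuns P) \<and> (\<forall>i\<in>?K. \<forall>q. (\<Sum>j\<in>?K. ?M i j q * x j q) = c q * ?b i q)"
    proof (rule linear_system_solvable[OF cfuns_add[OF P] cfuns_mult[OF P] cfuns_const[OF P] frameD(1)[OF fr]])
      fix i j assume ij: "i \<in> ?K" "j \<in> ?K"
      show "?M i j \<in> cfuns P" by (rule vector_fieldsD(2)[OF W(1)[OF ij(2)] k[OF ij(1)]])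
      show "?M i j p = (if i = j then 1 else 0)"
        using fun_cong[OF u(2)[OF ij(2)], of "k i"] frameD(4)[OF fr ij(1)] frameD(7)[OF fr ij(2,1)] W(2)[OF ij(2)]
        by (auto simp: tmap_apply)
    next
      fix i assume "i \<in> ?K"
      then show "?b i \<in> cfuns P" by (intro pullback_pi vector_fieldsD(2)[OF \<xi>] frameD(4)[OF fr])
    qed
    then obtain x c where x: "c \<in> cfuns P" "c p = 1" "\<And>j. j \<in> ?K \<Longrightarrow> x j \<in> cfuns P"
      "\<And>i q. i \<in> ?K \<Longrightarrow> (\<Sum>j\<in>?K. ?M i j q * x j q) = c q * ?b i q"
      by (elim exE conjE) (rule that, assumption, assumption, erule (1) bspec, drule (1) bspec, erule spec)
    define V where "V q = vscale (\<rho> (\<pi> q)) (\<lambda>f. \<Sum>j\<in>?K. vscale (x j q) (W j q) f)" for q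
    have \<rho>: "(\<lambda>q. \<rho> (\<pi> q)) \<in> cfuns P" by (rule pullback_pi[OF frameD(2)[OF fr]])
    have V: "V \<in> vector_fields (cfuns P)" unfolding V_def[abs_def]
      by (intro vector_fields_scale[OF P] vector_fields_sum[OF P] \<rho> x(3) W(1))
    \<comment> \<open>The linear system matches the two sides on the coordinates \<open>k i\<close>
      only; the frame expansion carries this over to all functions, at the price of the factor
      \<open>\<rho>\<close>.\<close>
    have TV: "T\<pi> (V q) = vscale (c q * \<rho> (\<pi> q)) (\<xi> (\<pi> q))" for q
    proof
      fix g show "T\<pi> (V q) g = vscale (c q * \<rho> (\<pi> q)) (\<xi> (\<pi> q)) g"
      proof (cases "g \<in> cfuns X")
        case True
        let ?w = "\<lambda>f. \<Sum>j\<in>?K. vscale (x j q) (W j q) f"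
        have w: "?w \<in> TP q" by (intro tangent_sum tangent_vscale vector_fieldsD(1)[OF W(1)])
        have "T\<pi> ?w (k i) = c q * \<xi> (\<pi> q) (k i)" if "i \<in> ?K" for i
          using x(4)[OF that, of q] frameD(4)[OF fr that] by (simp add: tmap_apply mult.commute)
        then have "\<rho> (\<pi> q) * T\<pi> ?w g = c q * (\<Sum>b\<in>?K. \<xi> (\<pi> q) (k b) * Z b (\<pi> q) g)"
          using frameD(6)[OF fr Tpi_tangent[OF w] True] by (simp add: sum_distrib_left mult.assoc)
        also have "\<dots> = c q * \<rho> (\<pi> q) * \<xi> (\<pi> q) g"
          using frameD(6)[OF fr vector_fieldsD(1)[OF \<xi>] True] by simp
        finally show ?thesis unfolding V_def by (simp add: tmap_linear(5))
      next
        case False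
        then show ?thesis using tangentD(1)[OF vector_fieldsD(1)[OF \<xi>]] by (simp add: tmap_apply)
      qed
    qed
    \<comment> \<open>The horizontal part of \<open>V\<close> is the lift of its projection, so a
      multiple of the wanted field is smooth; the factor is 1 at \<open>p\<close>.\<close>
    have "vscale (c q * \<rho> (\<pi> q)) (lift q (\<xi> (\<pi> q))) = V q - fund q (\<theta> q (V q))" for q
      unfolding lift_linear(2)[OF vector_fieldsD(1)[OF \<xi>], symmetric] TV[symmetric]
      by (rule horizontal_part[OF vector_fieldsD(1)[OF V]])
    then have eq: "c q * \<rho> (\<pi> q) * lift q (\<xi> (\<pi> q)) f = (V q - fund q (\<theta> q (V q))) f" for q
      by (metis vscale_apply)
    have "(\<lambda>q. V q - fund q (\<theta> q (V q))) \<in> vector_fields (cfuns P)"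
      by (intro vector_fields_diff[OF P] V fund_vector_field theta_in vector_fieldsD(1)[OF V] is_form1D(4)[OF form V])
    from vector_fieldsD(2)[OF this f] have "(\<lambda>q. c q * \<rho> (\<pi> q) * lift q (\<xi> (\<pi> q)) f) \<in> cfuns P"
      by (simp only: eq)
    then show "\<exists>c\<in>cfuns P. c p \<noteq> 0 \<and> (\<lambda>x. c x * lift x (\<xi> (\<pi> x)) f) \<in> cfuns P"
      by (intro bexI[of _ "\<lambda>q. c q * \<rho> (\<pi> q)"]) (use x(1,2) frameD(3)[OF fr] \<rho> in \<open>auto intro: cfuns_mult[OF P]\<close>)
  qed
qed

section \<open>Curvature and brackets of horizontal lifts\<close>

definition curvature :: "'p \<Rightarrow> 'p tvec \<Rightarrow> 'p tvec \<Rightarrow> 'g tvec"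
  where "curvature p v w = ext_d1 (cfuns P) \<theta> p v w + lie_bracket (cfuns G) mul (\<theta> p v) (\<theta> p w)"

lemma lie_bracket_0: "a \<in> \<gg> \<Longrightarrow> lie_bracket (cfuns G) mul 0 a = 0"
  using tangent_const[OF G] by (auto simp: lie_bracket_def fun_eq_iff)

text \<open>One horizontal field is enough to remove the bracket of \<open>\<theta>\<close>-values
  and one derivative term. \<open>Z\<close> stays arbitrary because the formula is also applied to
  fundamental fields.\<close>

lemma curvature_horizontal:
  assumes Y: "Y \<in> vector_fields (cfuns P)" "\<And>p. \<theta> p (Y p) = 0" and Z: "Z \<in> vector_fields (cfuns P)"
  shows "curvature p (Y p) (Z p) \<phi> = Y p (\<lambda>q. \<theta> q (Z q) \<phi>) - \<theta> p (vf_bracket (cfuns P) Y Z p) \<phi>"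
proof -
  have "ext_d1 (cfuns P) \<theta> p (Y p) (Z p) \<phi> =
      Y p (\<lambda>q. \<theta> q (Z q) \<phi>) - Z p (\<lambda>q. \<theta> q (Y q) \<phi>) - \<theta> p (vf_bracket (cfuns P) Y Z p) \<phi>"
    by (rule ext_d1_eq[OF P form _ Y(1) Z]) (rule tangentD(1))
  then show ?thesis
    using tangent_const[OF P vector_fieldsD(1)[OF Z]] lie_bracket_0[OF theta_in[OF vector_fieldsD(1)[OF Z]]]
    by (simp add: curvature_def Y(2))
qed

text \<open>The bracket of the lifts projects to the bracket on the base, so its horizontal part is
  the lift of that bracket and the difference is the vertical part. Both lifts being horizontal,
  \<open>curvature_horizontal\<close> identifies the \<open>\<theta>\<close>-value of the bracket of
  the lifts with minus the curvature.\<close>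

lemma lift_vf_bracket:
  assumes \<xi>: "\<xi> \<in> vector_fields (cfuns X)" and \<eta>: "\<eta> \<in> vector_fields (cfuns X)"
  shows "lift p (vf_bracket (cfuns X) \<xi> \<eta> (\<pi> p)) - vf_bracket (cfuns P) (\<lambda>p. lift p (\<xi> (\<pi> p))) (\<lambda>p. lift p (\<eta> (\<pi> p))) p =
    fund p (curvature p (lift p (\<xi> (\<pi> p))) (lift p (\<eta> (\<pi> p))))"
proof -
  let ?Y = "\<lambda>p. lift p (\<xi> (\<pi> p))" and ?Z = "\<lambda>p. lift p (\<eta> (\<pi> p))"
  note Y = lift_vector_field[OF \<xi>] and Z = lift_vector_field[OF \<eta>]
  note t = vector_fieldsD(1)[OF \<xi>] vector_fieldsD(1)[OF \<eta>]
  note b = vector_fieldsD(1)[OF vf_bracket_vector_field[OF P Y Z]]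
  have Tb: "T\<pi> (vf_bracket (cfuns P) ?Y ?Z p) = vf_bracket (cfuns X) \<xi> \<eta> (\<pi> p)"
    by (rule vf_bracket_related[OF P X pullback_pi \<xi> \<eta>]) (assumption, rule lift(2)[OF t(1)], rule lift(2)[OF t(2)])
  have "lift p (vf_bracket (cfuns X) \<xi> \<eta> (\<pi> p)) = vf_bracket (cfuns P) ?Y ?Z p - fund p (\<theta> p (vf_bracket (cfuns P) ?Y ?Z p))"
    by (rule horizontal_part[OF b[of p], unfolded Tb])
  moreover have "curvature p (?Y p) (?Z p) = - \<theta> p (vf_bracket (cfuns P) ?Y ?Z p)"
  proof
    fix \<phi>
    show "curvature p (?Y p) (?Z p) \<phi> = (- \<theta> p (vf_bracket (cfuns P) ?Y ?Z p)) \<phi>"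
      using curvature_horizontal[OF Y _ Z, of p \<phi>] lift(3)[OF t(1)] lift(3)[OF t(2)]
        tangent_const[OF P vector_fieldsD(1)[OF Y, of p]] by simp
  qed
  ultimately show ?thesis by simp
qed

end

section \<open>The multiplicative horizontal lift\<close>

text \<open>Compatibility with inverses is not among the clauses of \<open>lie_gpd_morphism\<close>;
  it follows from the others by uniqueness of inverses.\<close>

lemma morphism_ginv:
  assumes "gpd \<X>" "gpd \<Y>" and F: "lie_gpd_morphism \<X> \<Y> F1 F0"
  shows "F1 (ginv \<X> x) = ginv \<Y> (F1 x)"
proof -
  interpret X: gpd \<X> by fact
  interpret Y: gpd \<Y> by fact
  note m = F[unfolded lie_gpd_morphism_def]
  have s: "src \<Y> (F1 x) = F0 (src \<X> x)" "tgt \<Y> (F1 x) = F0 (tgt \<X> x)" for x using m by auto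
  have a: "cmp \<Y> (cmp \<Y> x y) z = cmp \<Y> x (cmp \<Y> y z)" if "src \<Y> x = tgt \<Y> y" "src \<Y> y = tgt \<Y> z" for x y z
    using Y.lie_gpd that unfolding lie_groupoid_def by blast
  have 1: "cmp \<Y> (F1 x) (F1 (ginv \<X> x)) = ident \<Y> (F0 (tgt \<X> x))"
    using m X.laws(7-10)[of x] by metis
  have "F1 (ginv \<X> x) = cmp \<Y> (ident \<Y> (tgt \<Y> (F1 (ginv \<X> x)))) (F1 (ginv \<X> x))" by (simp add: Y.laws)
  also have "\<dots> = cmp \<Y> (cmp \<Y> (ginv \<Y> (F1 x)) (F1 x)) (F1 (ginv \<X> x))" by (simp add: Y.laws X.laws s)
  also have "\<dots> = cmp \<Y> (ginv \<Y> (F1 x)) (ident \<Y> (F0 (tgt \<X> x)))" by (subst a) (simp_all add: Y.laws X.laws s 1)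
  also have "\<dots> = ginv \<Y> (F1 x)" using Y.laws(6)[of "ginv \<Y> (F1 x)"] by (simp add: Y.laws s)
  finally show ?thesis .
qed

locale connective =
  fixes Q :: "('p1::{t2_space,second_countable_topology}, 'ep1::real_normed_vector,
    'p0::{t2_space,second_countable_topology}, 'ep0::real_normed_vector,
    'x1::{t2_space,second_countable_topology}, 'ex1::real_normed_vector,
    'x0::{t2_space,second_countable_topology}, 'ex0::real_normed_vector,
    'g1::{t2_space,second_countable_topology}, 'eg1::real_normed_vector,
    'g0::{t2_space,second_countable_topology}, 'eg0::real_normed_vector) bundle2"
    and \<theta>1 :: "'p1 \<Rightarrow> 'p1 tvec \<Rightarrow> 'g1 tvec"
    and \<theta>0 :: "'p0 \<Rightarrow> 'p0 tvec \<Rightarrow> 'g0 tvec"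
    and B :: "'p0 \<Rightarrow> 'p0 tvec \<Rightarrow> 'p0 tvec \<Rightarrow> 'g1 tvec"
  assumes principal: "principal_2bundle Q"
    and connective: "connective_structure Q \<theta>1 \<theta>0 B"
begin

abbreviation "\<P> \<equiv> tot Q"
abbreviation "\<X> \<equiv> base Q"
abbreviation "\<G> \<equiv> grp Q"
abbreviation "TP1 \<equiv> tangent (arr_funs \<P>)"
abbreviation "TP0 \<equiv> tangent (obj_funs \<P>)"
abbreviation "TX1 \<equiv> tangent (arr_funs \<X>)"
abbreviation "TX0 \<equiv> tangent (obj_funs \<X>)"

sublocale P: gpd \<P> using principal by unfold_locales (simp add: principal_2bundle_def)
sublocale X: gpd \<X> using principal by unfold_locales (simp add: principal_2bundle_def)
sublocale G: gpd \<G> using principal by unfold_locales (simp add: principal_2bundle_def lie_2group_def)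

lemma projection: "lie_gpd_morphism \<P> \<X> (pr1 Q) (pr0 Q)"
  using principal by (simp add: principal_2bundle_def gpd_fibration_def)

lemma action: "lie_gpd_morphism (prod_gpd \<P> \<G>) \<P> (\<lambda>(p, g). act1 Q p g) (\<lambda>(p, g). act0 Q p g)"
  using principal by (simp add: principal_2bundle_def)

lemma action_laws:
  "act1 Q p (one1 \<G>) = p" "act1 Q (act1 Q p g) h = act1 Q p (mul1 \<G> g h)" "act0 Q q (one0 \<G>) = q"
  using principal by (simp_all add: principal_2bundle_def right_action_laws_def)

lemma action_morphism:
  "src \<P> (act1 Q p g) = act0 Q (src \<P> p) (src \<G> g)" "tgt \<P> (act1 Q p g) = act0 Q (tgt \<P> p) (tgt \<G> g)"
  "act1 Q (ident \<P> q) (ident \<G> h) = ident \<P> (act0 Q q h)"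
  using action by (auto simp: lie_gpd_morphism_def prod_gpd_def)

lemma projection_morphism:
  "src \<X> (pr1 Q p) = pr0 Q (src \<P> p)" "tgt \<X> (pr1 Q p) = pr0 Q (tgt \<P> p)" "pr1 Q (ident \<P> q) = ident \<X> (pr0 Q q)"
  "pr1 Q (ginv \<P> p) = ginv \<X> (pr1 Q p)"
  using projection morphism_ginv[OF P.gpd_axioms X.gpd_axioms projection] by (auto simp: lie_gpd_morphism_def)

lemma one1: "one1 \<G> = ident \<G> (one0 \<G>)"
  using principal by (simp add: principal_2bundle_def lie_2group_def)

lemma inv_ident: "inv1 \<G> (ident \<G> (inv0 \<G> g)) = ident \<G> g" "mul1 \<G> (ident \<G> g) (ident \<G> (inv0 \<G> g)) = one1 \<G>"
proof -
  have g: "group_laws (mul0 \<G>) (one0 \<G>) (inv0 \<G>)" "lie_gpd_morphism \<G> \<G> (inv1 \<G>) (inv0 \<G>)"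
    "lie_gpd_morphism (prod_gpd \<G> \<G>) \<G> (\<lambda>(g, h). mul1 \<G> g h) (\<lambda>(g, h). mul0 \<G> g h)"
    using principal by (simp_all add: principal_2bundle_def lie_2group_def)
  have "inv0 \<G> (inv0 \<G> g) = g" using g(1) unfolding group_laws_def by metis
  then show "inv1 \<G> (ident \<G> (inv0 \<G> g)) = ident \<G> g"
    using g(2) by (simp add: lie_gpd_morphism_def)
  show "mul1 \<G> (ident \<G> g) (ident \<G> (inv0 \<G> g)) = one1 \<G>"
    using g(1,3) by (simp add: lie_gpd_morphism_def prod_gpd_def group_laws_def one1)
qed

text \<open>The fibration condition gives surjectivity on tangent vectors of the fibre product of
  arrows of the base with objects of the total space. As \<open>pr0\<close> is a submersion, the
  source of \<open>v\<close> lifts to some \<open>w\<close>, and \<open>(v, w)\<close> is such a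
  tangent vector.\<close>

lemma pr1_submersion: "tangent (cfuns (arr_atlas \<X>)) (pr1 Q p) \<subseteq> tmap (cfuns (arr_atlas \<X>)) (pr1 Q) ` tangent (cfuns (arr_atlas \<P>)) p"
proof
  fix v assume v: "v \<in> tangent (cfuns (arr_atlas \<X>)) (pr1 Q p)"
  let ?S = "{(x, p). src \<X> x = pr0 Q p}" and ?F = "\<lambda>p. (pr1 Q p, src \<P> p)"
  let ?D = "smooth_funs (prod_atlas (arr_atlas \<X>) (obj_atlas \<P>)) ?S"
  have s0: "tmap (obj_funs \<X>) (pr0 Q) ` tangent (obj_funs \<P>) q = tangent (obj_funs \<X>) (pr0 Q q)"
    and s1: "tmap ?D ?F ` tangent (arr_funs \<P>) p = tangent ?D (?F p)" for q
    using principal by (auto simp: principal_2bundle_def gpd_fibration_def submersion_def Let_def)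
  have "Tsrc \<X> v \<in> tangent (obj_funs \<X>) (pr0 Q (src \<P> p))"
    using X.T_tangent(1)[of v "pr1 Q p"] v by (simp add: arr_funs_def projection_morphism)
  then obtain w where w: "w \<in> tangent (obj_funs \<P>) (src \<P> p)" "Tsrc \<X> v = tmap (obj_funs \<X>) (pr0 Q) w"
    unfolding s0[symmetric] by blast
  have pr0: "smooth_map (obj_atlas \<P>) UNIV (obj_atlas \<X>) (pr0 Q)"
    using projection by (simp add: lie_gpd_morphism_def)
  obtain z where z: "z \<in> tangent ?D (?F p)" "tmap (cfuns (arr_atlas \<X>)) fst z = v" "tmap (cfuns (obj_atlas \<P>)) snd z = w"
    by (rule fibre_product_tangent[OF X.arr P.obj X.obj X.smooth_structure(1) pr0, where x="pr1 Q p" and y="src \<P> p" and v=v and w=w])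
      (use v w X.src_submersion[of "pr1 Q p"] in \<open>auto simp: projection_morphism arr_funs_def obj_funs_def\<close>)
  then obtain y where y: "y \<in> tangent (arr_funs \<P>) p" "z = tmap ?D ?F y" unfolding s1[symmetric] by blast
  have "v = tmap (cfuns (arr_atlas \<X>)) (pr1 Q) y"
    unfolding z(2)[symmetric] y(2)
    by (subst tmap_compose) (auto intro: cfuns_subset[OF manifold_prod[OF X.arr P.obj]] cfuns_fst[OF X.arr P.obj])
  then show "v \<in> tmap (cfuns (arr_atlas \<X>)) (pr1 Q) ` tangent (cfuns (arr_atlas \<P>)) p"
    using y(1) by (simp add: arr_funs_def)
qed

lemma two_connection: "two_connection Q \<theta>1 \<theta>0" and curving: "curving Q \<theta>1 \<theta>0 B"
  using connective by (simp_all add: connective_structure_def)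

sublocale L1: principal_connection "arr_atlas \<P>" "arr_atlas \<X>" "arr_atlas \<G>" "pr1 Q" "act1 Q" "mul1 \<G>" "one1 \<G>" "inv1 \<G>" \<theta>1
proof
  show "smooth_map (prod_atlas (arr_atlas \<P>) (arr_atlas \<G>)) UNIV (arr_atlas \<P>) (\<lambda>(p, g). act1 Q p g)"
    using action by (simp add: lie_gpd_morphism_def prod_gpd_def)
  show "smooth_map (arr_atlas \<P>) UNIV (arr_atlas \<X>) (pr1 Q)" using projection by (simp add: lie_gpd_morphism_def)
  show "diffeo_onto_subset (prod_atlas (arr_atlas \<P>) (arr_atlas \<G>)) (prod_atlas (arr_atlas \<P>) (arr_atlas \<P>))
      {(p, q). pr1 Q p = pr1 Q q} (\<lambda>(p, g). (p, act1 Q p g))"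
    using principal by (simp add: principal_2bundle_def)
  have c: "connection_form1 Q \<theta>1" using two_connection by (simp add: two_connection_def)
  then show "is_form1 (cfuns (arr_atlas \<P>)) (cfuns (arr_atlas \<G>)) (tangent (cfuns (arr_atlas \<G>)) (one1 \<G>)) \<theta>1"
    by (simp add: connection_form1_def arr_funs_def g1_alg_def)
  show "\<theta>1 (act1 Q p g) (tmap (cfuns (arr_atlas \<P>)) (\<lambda>q. act1 Q q g) v) = adj (cfuns (arr_atlas \<G>)) (mul1 \<G>) (inv1 \<G>) (inv1 \<G> g) (\<theta>1 p v)"
    if "v \<in> tangent (cfuns (arr_atlas \<P>)) p" for p g v
    using c that by (simp add: connection_form1_def arr_funs_def Tright1_def Ad1_def)
  show "\<theta>1 p (tmap (cfuns (arr_atlas \<P>)) (act1 Q p) a) = a" if "a \<in> tangent (cfuns (arr_atlas \<G>)) (one1 \<G>)" for p a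
    using c that by (simp add: connection_form1_def arr_funs_def fund1_def g1_alg_def)
qed (rule P.arr X.arr G.arr pr1_submersion action_laws)+

sublocale L0: principal_connection "obj_atlas \<P>" "obj_atlas \<X>" "obj_atlas \<G>" "pr0 Q" "act0 Q" "mul0 \<G>" "one0 \<G>" "inv0 \<G>" \<theta>0
proof
  show "smooth_map (prod_atlas (obj_atlas \<P>) (obj_atlas \<G>)) UNIV (obj_atlas \<P>) (\<lambda>(p, g). act0 Q p g)"
    using action by (simp add: lie_gpd_morphism_def prod_gpd_def)
  show "smooth_map (obj_atlas \<P>) UNIV (obj_atlas \<X>) (pr0 Q)" using projection by (simp add: lie_gpd_morphism_def)
  show "diffeo_onto_subset (prod_atlas (obj_atlas \<P>) (obj_atlas \<G>)) (prod_atlas (obj_atlas \<P>) (obj_atlas \<P>))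
      {(p, q). pr0 Q p = pr0 Q q} (\<lambda>(p, g). (p, act0 Q p g))"
    using principal by (simp add: principal_2bundle_def)
  have c: "connection_form0 Q \<theta>0" using two_connection by (simp add: two_connection_def)
  then show "is_form1 (cfuns (obj_atlas \<P>)) (cfuns (obj_atlas \<G>)) (tangent (cfuns (obj_atlas \<G>)) (one0 \<G>)) \<theta>0"
    by (simp add: connection_form0_def obj_funs_def g0_alg_def)
  show "\<theta>0 (act0 Q p g) (tmap (cfuns (obj_atlas \<P>)) (\<lambda>q. act0 Q q g) v) = adj (cfuns (obj_atlas \<G>)) (mul0 \<G>) (inv0 \<G>) (inv0 \<G> g) (\<theta>0 p v)"
    if "v \<in> tangent (cfuns (obj_atlas \<P>)) p" for p g v
    using c that by (simp add: connection_form0_def obj_funs_def Tright0_def Ad0_def)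
  show "\<theta>0 p (tmap (cfuns (obj_atlas \<P>)) (act0 Q p) a) = a" if "a \<in> tangent (cfuns (obj_atlas \<G>)) (one0 \<G>)" for p a
    using c that by (simp add: connection_form0_def obj_funs_def fund0_def g0_alg_def)
  show "tangent (cfuns (obj_atlas \<X>)) (pr0 Q p) \<subseteq> tmap (cfuns (obj_atlas \<X>)) (pr0 Q) ` tangent (cfuns (obj_atlas \<P>)) p" for p
    using principal by (simp add: principal_2bundle_def gpd_fibration_def submersion_def obj_funs_def)
qed (rule P.obj X.obj G.obj action_laws)+

abbreviation "Tpr1 \<equiv> tmap (arr_funs \<X>) (pr1 Q)"
abbreviation "Tpr0 \<equiv> tmap (obj_funs \<X>) (pr0 Q)"
abbreviation "lft1 \<equiv> lift1 Q \<theta>1"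
abbreviation "lft0 \<equiv> lift0 Q \<theta>0"

text \<open>The two locale instances speak of \<open>cfuns\<close> and of their own constants. These
  equations, stated as meta-equalities for rewriting, bring the imported facts back to the
  vocabulary of the statement.\<close>

lemma fund1_fold: "tmap (arr_funs \<P>) (act1 Q p) \<equiv> fund1 Q p"
  and fund0_fold: "tmap (obj_funs \<P>) (act0 Q q) \<equiv> fund0 Q q"
  by (auto simp: fund1_def fund0_def fun_eq_iff intro!: eq_reflection)

lemma g1_fold: "tangent (arr_funs \<G>) (one1 \<G>) \<equiv> g1_alg \<G>"
  and g0_fold: "tangent (obj_funs \<G>) (one0 \<G>) \<equiv> g0_alg \<G>"
  by (auto simp: g1_alg_def g0_alg_def)

lemma lift1_fold: "L1.lift \<equiv> lft1" and lift0_fold: "L0.lift \<equiv> lft0"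
  by (auto simp: L1.lift_def L0.lift_def lift1_def lift0_def fun_eq_iff arr_funs_def obj_funs_def intro!: eq_reflection)

lemma curv1_fold: "L1.curvature \<equiv> curv1 Q \<theta>1" and curv0_fold: "L0.curvature \<equiv> curv0 Q \<theta>0"
  by (auto simp: L1.curvature_def L0.curvature_def curv1_def curv0_def fun_eq_iff arr_funs_def obj_funs_def bracket1_def bracket0_def intro!: eq_reflection)

lemmas folds = arr_funs_def[symmetric] obj_funs_def[symmetric] fund1_fold fund0_fold g1_fold g0_fold
  lift1_fold lift0_fold curv1_fold curv0_fold

lemmas fund_tangent = L1.fund_tangent[unfolded folds] L0.fund_tangent[unfolded folds]
lemmas Tpr_fund = L1.Tpi_fund[unfolded folds] L0.Tpi_fund[unfolded folds]
lemmas theta1_linear = L1.theta_linear[unfolded folds]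
lemmas theta_in = L1.theta_in[unfolded folds] L0.theta_in[unfolded folds]
lemmas vertical = L1.vertical[unfolded folds] L0.vertical[unfolded folds]
lemmas lift1_eqI = L1.lift_eqI[unfolded folds]
lemmas lift0_eqI = L0.lift_eqI[unfolded folds]
lemmas lift1 = L1.lift[unfolded folds]
lemmas lift0 = L0.lift[unfolded folds]
lemmas lift1_linear = L1.lift_linear[unfolded folds]
lemmas lift0_linear = L0.lift_linear[unfolded folds]
lemmas lift_equivariant = L1.lift_equivariant[unfolded folds] L0.lift_equivariant[unfolded folds]
lemmas fund1_family = L1.fund_family[unfolded folds]
lemmas fund1_vector_field = L1.fund_vector_field[unfolded folds]
lemmas lift_vector_field = L1.lift_vector_field[unfolded folds] L0.lift_vector_field[unfolded folds]
lemmas curv1_horizontal = L1.curvature_horizontal[unfolded folds]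
lemmas lift1_vf_bracket = L1.lift_vf_bracket[unfolded folds]
lemmas lift0_vf_bracket = L0.lift_vf_bracket[unfolded folds]
lemmas pr_act = L1.pi_act L0.pi_act
lemmas pullback_act1 = L1.pullback_act(2,3)[unfolded folds]
lemmas pullback_act0 = L0.pullback_act(2,3)[unfolded folds]
lemmas pullback_pr = L1.pullback_pi[unfolded folds] L0.pullback_pi[unfolded folds]
lemmas reproducing = L1.reproducing[unfolded folds] L0.reproducing[unfolded folds]

lemma fund_linear [simp]:
  "fund1 Q p (a + b) = fund1 Q p a + fund1 Q p b" "fund1 Q p (a - b) = fund1 Q p a - fund1 Q p b"
  "fund1 Q p (- a) = - fund1 Q p a" "fund1 Q p 0 = 0" "fund1 Q p (vscale c a) = vscale c (fund1 Q p a)"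
  "fund0 Q q (x + y) = fund0 Q q x + fund0 Q q y" "fund0 Q q (x - y) = fund0 Q q x - fund0 Q q y"
  "fund0 Q q (- x) = - fund0 Q q x" "fund0 Q q 0 = 0" "fund0 Q q (vscale c x) = vscale c (fund0 Q q x)"
  by (simp_all add: fund1_def fund0_def)

lemma g1_T: "a \<in> g1_alg \<G> \<Longrightarrow> Tsrc \<G> a \<in> g0_alg \<G>" "a \<in> g1_alg \<G> \<Longrightarrow> Ttgt \<G> a \<in> g0_alg \<G>"
  "x \<in> g0_alg \<G> \<Longrightarrow> Tident \<G> x \<in> g1_alg \<G>"
  using G.T_tangent(1,2)[of a "one1 \<G>"] G.T_tangent(3)[of x "one0 \<G>"] by (auto simp: g1_alg_def g0_alg_def one1 G.laws)

lemma g1_closed: "a \<in> g1_alg \<G> \<Longrightarrow> b \<in> g1_alg \<G> \<Longrightarrow> a + b \<in> g1_alg \<G>"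
  "a \<in> g1_alg \<G> \<Longrightarrow> b \<in> g1_alg \<G> \<Longrightarrow> a - b \<in> g1_alg \<G>" "a \<in> g1_alg \<G> \<Longrightarrow> - a \<in> g1_alg \<G>" "0 \<in> g1_alg \<G>"
  by (auto simp: g1_alg_def)

lemma theta_structure:
  "v \<in> TP1 p \<Longrightarrow> Tsrc \<G> (\<theta>1 p v) = \<theta>0 (src \<P> p) (Tsrc \<P> v)"
  "v \<in> TP1 p \<Longrightarrow> Ttgt \<G> (\<theta>1 p v) = \<theta>0 (tgt \<P> p) (Ttgt \<P> v)"
  "u \<in> TP0 m \<Longrightarrow> \<theta>1 (ident \<P> m) (Tident \<P> u) = Tident \<G> (\<theta>0 m u)"
  using two_connection unfolding two_connection_def by auto

text \<open>The product in the Lie 2-algebra is taken at the identity of the group of arrows, which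
  is a unit of the groupoid, so \<open>Tcmp_at_ident\<close> makes it additive.\<close>

lemma theta1_Tcmp:
  assumes c: "P.Tcomposable p v q w"
  shows "\<theta>1 (cmp \<P> p q) (Tcmp \<P> p v q w) = \<theta>1 p v + \<theta>1 q w - Tident \<G> (Tsrc \<G> (\<theta>1 p v))"
proof -
  note c' = c[unfolded P.Tcomposable_def]
  have "\<theta>1 (cmp \<P> p q) (Tcmp \<P> p v q w) = Tcmp \<G> (one1 \<G>) (\<theta>1 p v) (one1 \<G>) (\<theta>1 q w)"
    using two_connection c' unfolding two_connection_def by blast
  moreover have "G.Tcomposable (one1 \<G>) (\<theta>1 p v) (one1 \<G>) (\<theta>1 q w)"
    using c' theta_in(1)[of v p] theta_in(1)[of w q]
    by (simp add: G.Tcomposable_def one1 G.laws theta_structure g1_alg_def)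
  ultimately show ?thesis using G.Tcmp_at_ident[of "one0 \<G>"] by (simp add: one1)
qed

text \<open>Apply the preceding formula to the product of \<open>v\<close> with its inverse, which
  is a unit, and solve.\<close>

lemma theta1_Tginv:
  assumes v: "v \<in> TP1 p"
  shows "\<theta>1 (ginv \<P> p) (Tginv \<P> v) = Tident \<G> (Ttgt \<G> (\<theta>1 p v)) + Tident \<G> (Tsrc \<G> (\<theta>1 p v)) - \<theta>1 p v"
proof -
  have c: "P.Tcomposable p v (ginv \<P> p) (Tginv \<P> v)"
    using v P.T_tangent(4)[OF v] by (simp add: P.Tcomposable_def P.laws P.Ttgt_Tginv)
  have "\<theta>1 (ident \<P> (tgt \<P> p)) (Tident \<P> (Ttgt \<P> v)) = \<theta>1 p v + \<theta>1 (ginv \<P> p) (Tginv \<P> v) - Tident \<G> (Tsrc \<G> (\<theta>1 p v))"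
    using theta1_Tcmp[OF c] P.Tcmp_inverse[OF v] by (simp add: P.laws)
  then have "Tident \<G> (Ttgt \<G> (\<theta>1 p v)) = \<theta>1 p v + \<theta>1 (ginv \<P> p) (Tginv \<P> v) - Tident \<G> (Tsrc \<G> (\<theta>1 p v))"
    using theta_structure(3)[OF P.T_tangent(2)[OF v]] theta_structure(2)[OF v] by simp
  then show ?thesis by (simp only: algebra_simps)
qed

lemma Tpr_structure:
  "Tsrc \<X> (Tpr1 v) = Tpr0 (Tsrc \<P> v)" "Ttgt \<X> (Tpr1 v) = Tpr0 (Ttgt \<P> v)"
  "Tpr1 (Tident \<P> u) = Tident \<X> (Tpr0 u)" "Tpr1 (Tginv \<P> v) = Tginv \<X> (Tpr1 v)"
  by (simp_all add: tmap_compose X.pullback P.pullback pullback_pr projection_morphism)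

lemma Tfund1:
  "Tsrc \<P> (fund1 Q p a) = fund0 Q (src \<P> p) (Tsrc \<G> a)" "Ttgt \<P> (fund1 Q p a) = fund0 Q (tgt \<P> p) (Ttgt \<G> a)"
  by (simp_all add: fund1_def fund0_def tmap_compose P.pullback pullback_act0 action_morphism)

lemmas Tpr1_Tcmp = Tcmp_morphism[OF P.gpd_axioms X.gpd_axioms projection]

subsection \<open>Compatibility of the lift with the groupoid structure\<close>

lemma lift_0: "lft1 p 0 = 0" "lft0 q 0 = 0"
  using lift1_linear(2)[of 0 p 0] lift0_linear(2)[of 0 q 0] by (simp_all add: tangent_0)

text \<open>Since \<open>\<theta>1\<close> lies over \<open>\<theta>0\<close>, the image of a
  horizontal vector is horizontal; since \<open>\<pi>\<close> is a morphism, it projects correctly.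
  Uniqueness of the lift does the rest, here and for units, inverses and products.\<close>

lemma lift_Tsrc:
  assumes v: "v \<in> TX1 (pr1 Q p)"
  shows "Tsrc \<P> (lft1 p v) = lft0 (src \<P> p) (Tsrc \<X> v)" "Ttgt \<P> (lft1 p v) = lft0 (tgt \<P> p) (Ttgt \<X> v)"
proof -
  note l = lift1[OF v]
  show "Tsrc \<P> (lft1 p v) = lft0 (src \<P> p) (Tsrc \<X> v)"
    by (rule lift0_eqI[symmetric])
      (use l theta_structure(1)[OF l(1)] in \<open>simp_all add: P.T_tangent(1) Tpr_structure(1)[symmetric]\<close>)
  show "Ttgt \<P> (lft1 p v) = lft0 (tgt \<P> p) (Ttgt \<X> v)"
    by (rule lift0_eqI[symmetric])
      (use l theta_structure(2)[OF l(1)] in \<open>simp_all add: P.T_tangent(2) Tpr_structure(2)[symmetric]\<close>)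
qed

lemma lift_ident:
  assumes u: "u \<in> TX0 (pr0 Q m)"
  shows "lft1 (ident \<P> m) (Tident \<X> u) = Tident \<P> (lft0 m u)"
  by (rule lift1_eqI)
    (use lift0[OF u] theta_structure(3)[OF lift0(1)[OF u]] in \<open>simp_all add: P.T_tangent(3) Tpr_structure(3)\<close>)

lemma lift_ginv:
  assumes v: "v \<in> TX1 (pr1 Q p)"
  shows "lft1 (ginv \<P> p) (Tginv \<X> v) = Tginv \<P> (lft1 p v)"
  by (rule lift1_eqI)
    (use lift1[OF v] theta1_Tginv[OF lift1(1)[OF v]] in \<open>simp_all add: P.T_tangent(4) Tpr_structure(4)\<close>)

lemma lift_cmp:
  assumes pq: "src \<P> p = tgt \<P> q" and c: "X.Tcomposable (pr1 Q p) v (pr1 Q q) w"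
  shows "P.Tcomposable p (lft1 p v) q (lft1 q w)"
    and "lft1 (cmp \<P> p q) (Tcmp \<X> (pr1 Q p) v (pr1 Q q) w) = Tcmp \<P> p (lft1 p v) q (lft1 q w)"
proof -
  note c' = c[unfolded X.Tcomposable_def]
  have v: "v \<in> TX1 (pr1 Q p)" and w: "w \<in> TX1 (pr1 Q q)" using c' by auto
  show P: "P.Tcomposable p (lft1 p v) q (lft1 q w)"
    using c' pq lift1(1)[OF v] lift1(1)[OF w] by (simp add: P.Tcomposable_def lift_Tsrc[OF v] lift_Tsrc[OF w])
  show "lft1 (cmp \<P> p q) (Tcmp \<X> (pr1 Q p) v (pr1 Q q) w) = Tcmp \<P> p (lft1 p v) q (lft1 q w)"
    by (rule lift1_eqI)
      (use P.Tcmp_tangent[OF P] Tpr1_Tcmp(2)[OF P] theta1_Tcmp[OF P] lift1[OF v] lift1[OF w] in simp_all)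
qed

abbreviation "hfield1 \<xi> \<equiv> \<lambda>p. lft1 p (\<xi> (pr1 Q p))"
abbreviation "hfield0 u \<equiv> \<lambda>p. lft0 p (u (pr0 Q p))"

lemma hlift_m_apply: "hlift_m Q \<theta>1 \<theta>0 (\<xi>, u) = (hfield1 \<xi>, hfield0 u)"
  by (simp add: hlift_m_def)

lemma hlift_m_mult:
  assumes m: "(\<xi>, u) \<in> mult_fields \<X>"
  shows "(hfield1 \<xi>, hfield0 u) \<in> mult_fields \<P>"
proof -
  note D = mult_fieldsD[OF m] and t = vector_fieldsD(1)[OF mult_fieldsD(1)[OF m]] vector_fieldsD(1)[OF mult_fieldsD(2)[OF m]]
  have "hfield1 \<xi> (cmp \<P> p q) = Tcmp \<P> p (hfield1 \<xi> p) q (hfield1 \<xi> q)" if pq: "src \<P> p = tgt \<P> q" for p q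
  proof -
    have s: "src \<X> (pr1 Q p) = tgt \<X> (pr1 Q q)" using pq by (simp add: projection_morphism)
    have "pr1 Q (cmp \<P> p q) = cmp \<X> (pr1 Q p) (pr1 Q q)" using projection pq by (simp add: lie_gpd_morphism_def)
    moreover have "X.Tcomposable (pr1 Q p) (\<xi> (pr1 Q p)) (pr1 Q q) (\<xi> (pr1 Q q))"
      using s t by (simp add: X.Tcomposable_def D(3,4))
    ultimately show ?thesis using lift_cmp(2)[OF pq] D(6)[OF s] by simp
  qed
  then show ?thesis
    unfolding mult_fields_def using lift_vector_field(1)[OF D(1)] lift_vector_field(2)[OF D(2)] t
    by (simp add: lift_Tsrc[OF t(1)] projection_morphism D(3,4,5) lift_ident[OF t(2)])
qed

text \<open>A right invariant field is a product with a zero vector. The lift preserves products and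
  sends 0 to 0, hence commutes with right translation.\<close>

lemma hlift_right_inv:
  assumes a: "a \<in> algd_sections \<X>"
  shows "right_inv_field \<P> (hlift_c Q \<theta>1 a) = hfield1 (right_inv_field \<X> a)"
proof
  fix p
  have "right_inv_field \<X> a (pr1 Q p) = Tcmp \<X> (pr1 Q (ident \<P> (tgt \<P> p))) (a (pr0 Q (tgt \<P> p))) (pr1 Q p) 0"
    by (simp add: right_inv_field_def projection_morphism)
  moreover have "X.Tcomposable (pr1 Q (ident \<P> (tgt \<P> p))) (a (pr0 Q (tgt \<P> p))) (pr1 Q p) 0"
    using X.right_inv_Tcomposable[OF a, of "pr1 Q p"] by (simp add: projection_morphism)
  ultimately show "right_inv_field \<P> (hlift_c Q \<theta>1 a) p = hfield1 (right_inv_field \<X> a) p"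
    using lift_cmp(2)[of "ident \<P> (tgt \<P> p)" p] by (simp add: P.laws lift_0 right_inv_field_def[of \<P>] hlift_c_def)
qed

lemma hlift_left_inv:
  assumes a: "a \<in> algd_sections \<X>"
  shows "left_inv_field \<X> a (pr1 Q p) \<in> TX1 (pr1 Q p)"
    and "left_inv_field \<P> (hlift_c Q \<theta>1 a) p = lft1 p (left_inv_field \<X> a (pr1 Q p))"
proof -
  let ?m = "src \<P> p"
  note at = algd_sectionsD(1)[OF a, of "pr0 Q ?m", folded projection_morphism(3)]
  let ?w = "Tcmp \<X> (pr1 Q p) 0 (pr1 Q (ident \<P> ?m)) (Tginv \<X> (a (pr0 Q ?m)))"
  have l: "left_inv_field \<X> a (pr1 Q p) = - ?w"
    by (simp add: left_inv_field_def projection_morphism)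
  have c: "X.Tcomposable (pr1 Q p) 0 (pr1 Q (ident \<P> ?m)) (Tginv \<X> (a (pr0 Q ?m)))"
    using X.left_inv_Tcomposable[OF a, of "pr1 Q p"] by (simp add: projection_morphism)
  have w: "?w \<in> TX1 (pr1 Q p)"
    using X.Tcmp_tangent[OF c] X.laws(6)[of "pr1 Q p"] by (simp add: projection_morphism)
  then show "left_inv_field \<X> a (pr1 Q p) \<in> TX1 (pr1 Q p)" unfolding l by (rule tangent_uminus)
  have "lft1 (ident \<P> ?m) (Tginv \<X> (a (pr0 Q ?m))) = Tginv \<P> (lft1 (ident \<P> ?m) (a (pr0 Q ?m)))"
    using lift_ginv[OF at] by (simp add: P.ginv_ident)
  then have "lft1 p ?w = Tcmp \<P> p 0 (ident \<P> ?m) (Tginv \<P> (lft1 (ident \<P> ?m) (a (pr0 Q ?m))))"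
    using lift_cmp(2)[OF _ c] by (simp add: P.laws lift_0)
  moreover have "lft1 p (- ?w) = - lft1 p ?w"
    using lift1_linear(2)[OF w, of "- 1"] by (simp add: vscale_minus_1)
  ultimately show "left_inv_field \<P> (hlift_c Q \<theta>1 a) p = lft1 p (left_inv_field \<X> a (pr1 Q p))"
    unfolding l by (simp add: left_inv_field_def hlift_c_def)
qed

lemma hlift_c_section:
  assumes a: "a \<in> algd_sections \<X>"
  shows "hlift_c Q \<theta>1 a \<in> xc (LAt Q)"
proof -
  have at: "a (pr0 Q m) \<in> TX1 (pr1 Q (ident \<P> m))" for m
    using algd_sectionsD(1)[OF a, of "pr0 Q m"] by (simp add: projection_morphism)
  \<comment> \<open>Smoothness along the units is inherited from the lifted right invariant field on
    arrows, since that field restricts to the lift of \<open>a\<close> there.\<close>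
  have "(\<lambda>m. hlift_c Q \<theta>1 a m f) \<in> obj_funs \<P>" if f: "f \<in> arr_funs \<P>" for f
    using P.pullback(3)[OF vector_fieldsD(2)[OF lift_vector_field(1)[OF X.right_inv_vector_field[OF a]] f]]
    by (simp add: hlift_c_def projection_morphism X.right_inv_field_T(4)[OF a])
  moreover have "Tsrc \<P> (hlift_c Q \<theta>1 a m) = 0" for m
    using lift_Tsrc(1)[OF at] algd_sectionsD(2)[OF a] by (simp add: hlift_c_def lift_0)
  moreover have "hlift_c Q \<theta>1 a (act0 Q p g) = Tright1 Q (ident \<G> g) (hlift_c Q \<theta>1 a p)" for p g
    using lift_equivariant(1)[OF at, of p "ident \<G> g"] by (simp add: hlift_c_def Tright1_def action_morphism pr_act)
  ultimately show ?thesis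
    using lift1(1)[OF at] by (simp add: LAt_def LTan_def algd_sections_def hlift_c_def)
qed

lemma chain_map_hlift: "chain_map (LTan \<X>) (LAt Q) (hlift_c Q \<theta>1) (hlift_m Q \<theta>1 \<theta>0)"
  unfolding chain_map_def
proof (intro conjI ballI)
  have at: "a (pr0 Q m) \<in> TX1 (pr1 Q (ident \<P> m))" if "a \<in> algd_sections \<X>" for a m
    using algd_sectionsD(1)[OF that, of "pr0 Q m"] by (simp add: projection_morphism)
  show "linear_map_on (xc (LTan \<X>)) (scale_c (LTan \<X>)) (xc (LAt Q)) (scale_c (LAt Q)) (hlift_c Q \<theta>1)"
    unfolding linear_map_on_def using hlift_c_section at
    by (simp add: LTan_def LAt_def hlift_c_def section_scale_def fun_eq_iff lift1_linear)
  have mt: "\<xi> (pr1 Q p) \<in> TX1 (pr1 Q p)" "u (pr0 Q q) \<in> TX0 (pr0 Q q)" if "(\<xi>, u) \<in> mult_fields \<X>" for \<xi> u p q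
    using that by (auto intro: vector_fieldsD(1) dest: mult_fieldsD(1,2))
  have eq: "Tright1 Q g (hfield1 \<xi> p) = hfield1 \<xi> (act1 Q p g)" "Tright0 Q h (hfield0 u q) = hfield0 u (act0 Q q h)"
    if "(\<xi>, u) \<in> mult_fields \<X>" for \<xi> u p q g h
    using lift_equivariant(1)[OF mt(1)[OF that]] lift_equivariant(2)[OF mt(2)[OF that]]
    by (simp_all add: Tright1_def Tright0_def pr_act)
  show "linear_map_on (xm (LTan \<X>)) (scale_m (LTan \<X>)) (xm (LAt Q)) (scale_m (LAt Q)) (hlift_m Q \<theta>1 \<theta>0)"
    unfolding linear_map_on_def
  proof (intro conjI ballI allI)
    fix x y c assume x: "x \<in> xm (LTan \<X>)"
    obtain \<xi> u where x': "x = (\<xi>, u)" "(\<xi>, u) \<in> mult_fields \<X>" using x by (cases x) (auto simp: LTan_def)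
    show "hlift_m Q \<theta>1 \<theta>0 x \<in> xm (LAt Q)"
      using hlift_m_mult[OF x'(2)] eq[OF x'(2)] by (simp add: x' hlift_m_apply LAt_def LTan_def)
    show "hlift_m Q \<theta>1 \<theta>0 (scale_m (LTan \<X>) c x) = scale_m (LAt Q) c (hlift_m Q \<theta>1 \<theta>0 x)"
      using mt[OF x'(2)] by (simp add: x' hlift_m_apply LAt_def LTan_def section_scale_def lift1_linear lift0_linear)
    assume "y \<in> xm (LTan \<X>)"
    then obtain \<eta> w where y': "y = (\<eta>, w)" "(\<eta>, w) \<in> mult_fields \<X>" by (cases y) (auto simp: LTan_def)
    show "hlift_m Q \<theta>1 \<theta>0 (x + y) = hlift_m Q \<theta>1 \<theta>0 x + hlift_m Q \<theta>1 \<theta>0 y"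
      using mt[OF x'(2)] mt[OF y'(2)] by (simp add: x' y' hlift_m_apply fun_eq_iff lift1_linear lift0_linear)
  qed
  fix a assume "a \<in> xc (LTan \<X>)"
  then have a: "a \<in> algd_sections \<X>" by (simp add: LTan_def)
  have "lft1 p (right_inv_field \<X> a (pr1 Q p) - left_inv_field \<X> a (pr1 Q p)) =
      right_inv_field \<P> (hlift_c Q \<theta>1 a) p - left_inv_field \<P> (hlift_c Q \<theta>1 a) p" for p
    using X.right_inv_field_T(1)[OF a] hlift_left_inv[OF a]
      lift1_linear(1)[of "right_inv_field \<X> a (pr1 Q p)" p "- left_inv_field \<X> a (pr1 Q p)"]
      lift1_linear(2)[of "left_inv_field \<X> a (pr1 Q p)" p "- 1"]
    by (auto simp: hlift_right_inv[OF a] vscale_minus_1)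
  moreover have "lft0 m (Ttgt \<X> (a (pr0 Q m))) = Ttgt \<P> (hlift_c Q \<theta>1 a m)" for m
    using lift_Tsrc(2)[OF at[OF a]] by (simp add: hlift_c_def P.laws)
  ultimately show "hlift_m Q \<theta>1 \<theta>0 (xdelta (LTan \<X>) a) = xdelta (LAt Q) (hlift_c Q \<theta>1 a)"
    by (simp add: LTan_def LAt_def gpd_delta_def hlift_m_apply)
qed

subsection \<open>The curvature of the lift\<close>

lemma B_form: "is_form2 (obj_funs \<P>) (arr_funs \<G>) (h_alg \<G>) B"
  using curving by (simp add: curving_def)

lemma B_h_alg:
  assumes "v \<in> TP0 p" "w \<in> TP0 p"
  shows "B p v w \<in> g1_alg \<G>" "Tsrc \<G> (B p v w) = 0" "B p v w \<in> h_alg \<G>"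
  using is_form2D(1)[OF B_form assms] by (auto simp: h_alg_def)

lemma B_vertical:
  assumes "v \<in> TP0 p" "w \<in> TP0 p" "Tpr0 v = 0"
  shows "B p v w = 0" "B p w v = 0"
proof -
  show 1: "B p v w = 0" using curving assms by (simp add: curving_def)
  show "B p w v = 0" using is_form2D(2)[OF B_form assms(1,2)] 1 by simp
qed

lemma B_linear:
  assumes "u \<in> TP0 p" "v \<in> TP0 p" "w \<in> TP0 p"
  shows "B p w (u + v) = B p w u + B p w v" "B p w (vscale c u) = vscale c (B p w u)"
    "B p (u + v) w = B p u w + B p v w"
proof -
  show 1: "B p (u + v) w = B p u w + B p v w" by (rule is_form2D(3)[OF B_form assms])
  have s: "B p w x = - B p x w" if "x \<in> TP0 p" for x by (rule is_form2D(2)[OF B_form that assms(3)])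
  show "B p w (u + v) = B p w u + B p w v"
    using 1 assms by (simp add: s tangent_add)
  show "B p w (vscale c u) = vscale c (B p w u)"
    using is_form2D(4)[OF B_form assms(1,3), of c] assms by (auto simp: s tangent_vscale fun_eq_iff)
qed

lemma curv0_eq: "v \<in> TP0 p \<Longrightarrow> w \<in> TP0 p \<Longrightarrow> curv0 Q \<theta>0 p v w = - Ttgt \<G> (B p v w)"
  using curving by (simp add: curving_def eq_neg_iff_add_eq_0)

lemma curv1_eq:
  assumes v: "v \<in> TP1 p" and w: "w \<in> TP1 p"
  shows "curv1 Q \<theta>1 p v w = - B (tgt \<P> p) (Ttgt \<P> v) (Ttgt \<P> w) + B (src \<P> p) (Tsrc \<P> v) (Tsrc \<P> w)
    - Tident \<G> (Ttgt \<G> (B (src \<P> p) (Tsrc \<P> v) (Tsrc \<P> w)))"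
proof -
  have "curv_h Q \<theta>1 \<theta>0 p v w + B (tgt \<P> p) (Ttgt \<P> v) (Ttgt \<P> w) - B (src \<P> p) (Tsrc \<P> v) (Tsrc \<P> w) = 0"
    using curving v w by (simp add: curving_def)
  then show ?thesis
    unfolding curv_h_def curv0_eq[OF P.T_tangent(1)[OF v] P.T_tangent(1)[OF w]] tmap_linear
    by (simp add: algebra_simps eq_neg_iff_add_eq_0)
qed

section \<open>Sections of the Lie algebroid of the total space given by functions with values in
  the Lie algebra of the source kernel\<close>

abbreviation vsec :: "('p0 \<Rightarrow> 'g1 tvec) \<Rightarrow> 'p0 \<Rightarrow> 'p1 tvec"
  where "vsec f \<equiv> \<lambda>m. fund1 Q (ident \<P> m) (f m)"

context
  fixes f :: "'p0 \<Rightarrow> 'g1 tvec"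
  assumes f: "\<And>m. f m \<in> g1_alg \<G>" and f0: "\<And>m. Tsrc \<G> (f m) = 0"
begin

lemma vsec_T: "vsec f m \<in> TP1 (ident \<P> m)" "Tsrc \<P> (vsec f m) = 0" "Ttgt \<P> (vsec f m) = fund0 Q m (Ttgt \<G> (f m))"
  using fund_tangent(1)[OF f] by (simp_all add: Tfund1 f0 P.laws)

text \<open>The product of a vertical vector with a zero vector is vertical, so it is the
  fundamental vector of its \<open>\<theta>1\<close>-value, which \<open>theta1_Tcmp\<close>
  computes; the correction term vanishes because \<open>f\<close> has source 0.\<close>

lemma vsec_right_inv: "right_inv_field \<P> (vsec f) p = fund1 Q p (f (tgt \<P> p))"
proof -
  let ?m = "ident \<P> (tgt \<P> p)" and ?v = "vsec f (tgt \<P> p)"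
  have c: "P.Tcomposable ?m ?v p 0"
    using vsec_T by (auto simp: P.Tcomposable_def P.laws)
  let ?w = "Tcmp \<P> ?m ?v p 0"
  have w: "?w \<in> TP1 p" using P.Tcmp_tangent[OF c] by (simp add: P.laws)
  have "Tpr1 ?w = 0"
    using Tpr1_Tcmp(2)[OF c] Tpr_fund(1)[OF f] by (simp add: X.Tcmp_0 projection_morphism X.laws)
  moreover have "\<theta>1 p ?w = f (tgt \<P> p)"
    using theta1_Tcmp[OF c] reproducing(1)[OF f] by (simp add: P.laws theta1_linear f0)
  ultimately show ?thesis using vertical(1)[OF w] by (simp add: right_inv_field_def)
qed

text \<open>The same argument, with the value of \<open>\<theta>1\<close> on the inverse vector
  taken from \<open>theta1_Tginv\<close>; the unit of \<open>Ttgt \<G> (f (src \<P> p))\<close>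
  comes from there.\<close>

lemma vsec_left_inv:
  "left_inv_field \<P> (vsec f) p = - fund1 Q p (Tident \<G> (Ttgt \<G> (f (src \<P> p))) - f (src \<P> p))"
proof -
  let ?m = "ident \<P> (src \<P> p)" and ?v = "Tginv \<P> (vsec f (src \<P> p))"
  have v: "?v \<in> TP1 ?m" using P.T_tangent(4)[OF vsec_T(1)] by (simp add: P.ginv_ident)
  have c: "P.Tcomposable p 0 ?m ?v"
    using v vsec_T by (auto simp: P.Tcomposable_def P.laws P.Ttgt_Tginv)
  let ?w = "Tcmp \<P> p 0 ?m ?v"
  have w: "?w \<in> TP1 p" using P.Tcmp_tangent[OF c] by (simp add: P.laws)
  have "Tpr1 ?w = 0"
    using Tpr1_Tcmp(2)[OF c] Tpr_fund(1)[OF f] by (simp add: Tpr_structure(4) X.Tcmp_0 projection_morphism X.laws)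
  moreover have "\<theta>1 p ?w = Tident \<G> (Ttgt \<G> (f (src \<P> p))) - f (src \<P> p)"
    using theta1_Tcmp[OF c] theta1_Tginv[OF vsec_T(1)] reproducing(1)[OF f]
    by (simp add: P.laws theta1_linear f0 P.ginv_ident)
  ultimately show ?thesis using vertical(1)[OF w] by (simp add: left_inv_field_def)
qed

text \<open>The value is the structure map
  \<open>f \<mapsto> (t^* f - s^* f) + s^* (\<partial> f)\<close> of the kernel of the projection to
  the base, with the Lie algebra of objects embedded by units. The curving equations give the
  curvature in exactly this form.\<close>

lemma vsec_delta:
  "gpd_delta \<P> (vsec f) = (\<lambda>p. fund1 Q p (f (tgt \<P> p) - f (src \<P> p) + Tident \<G> (Ttgt \<G> (f (src \<P> p)))), \<lambda>m. fund0 Q m (Ttgt \<G> (f m)))"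
  by (simp add: gpd_delta_def vsec_right_inv vsec_left_inv vsec_T(3) fun_eq_iff)

end

text \<open>The infinitesimal form of \<open>(p g) (g^{-1} h g) = (p h) g\<close> at a unit
  \<open>p\<close>. It makes the section of an equivariant function invariant.\<close>

lemma tau_vsec:
  assumes a: "a \<in> g1_alg \<G>"
  shows "fund1 Q (ident \<P> (act0 Q p g)) (tau \<G> (inv0 \<G> g) a) = Tright1 Q (ident \<G> g) (fund1 Q (ident \<P> p) a)"
proof
  fix \<phi>
  have "act1 Q (ident \<P> (act0 Q p g)) (mul1 \<G> (mul1 \<G> (ident \<G> (inv0 \<G> g)) h) (ident \<G> g)) =
      act1 Q (act1 Q (ident \<P> p) h) (ident \<G> g)" for h
    using inv_ident(2)[of g] by (simp flip: action_morphism(3) action_laws(2)) (simp add: action_laws)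
  then show "fund1 Q (ident \<P> (act0 Q p g)) (tau \<G> (inv0 \<G> g) a) \<phi> = Tright1 Q (ident \<G> g) (fund1 Q (ident \<P> p) a) \<phi>"
    using pullback_act1(1)[of \<phi>] pullback_act1(2)[of \<phi>]
    by (simp add: fund1_def tau_def Ad1_def adj_def Tright1_def tmap_apply inv_ident(1))
qed

lemma vsec_section:
  assumes f: "f \<in> equiv_h_funs Q"
  shows "vsec f \<in> xc (LAt Q)" "vsec f \<in> vertical_sections Q"
proof -
  have h: "f m \<in> g1_alg \<G>" "Tsrc \<G> (f m) = 0" for m using f by (auto simp: equiv_h_funs_def h_alg_def)
  have "(\<lambda>m. vsec f m \<phi>) \<in> obj_funs \<P>" if "\<phi> \<in> arr_funs \<P>" for \<phi>
    unfolding obj_funs_def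
    by (rule fund1_family[OF P.obj P.smooth_structure(3) h(1) _ that]) (use f in \<open>simp add: equiv_h_funs_def obj_funs_def\<close>)
  then show "vsec f \<in> xc (LAt Q)"
    using vsec_T[of f, OF h] f by (simp add: LAt_def LTan_def algd_sections_def equiv_h_funs_def tau_vsec[OF h(1)])
  show "vsec f \<in> vertical_sections Q" unfolding vertical_sections_def using f by blast
qed

section \<open>The homotopy and the equations of a weak morphism\<close>

definition B_lift :: "('x0 \<Rightarrow> 'x0 tvec) \<Rightarrow> ('x0 \<Rightarrow> 'x0 tvec) \<Rightarrow> 'p0 \<Rightarrow> 'g1 tvec"
  where "B_lift u w = (\<lambda>m. - B m (hfield0 u m) (hfield0 w m))"

lemma hfield0_T: "(\<And>x. u x \<in> TX0 x) \<Longrightarrow> hfield0 u m \<in> TP0 m"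
  by (rule lift0(1))

lemma B_lift_h_alg:
  assumes "\<And>x. u x \<in> TX0 x" "\<And>x. w x \<in> TX0 x"
  shows "B_lift u w m \<in> g1_alg \<G>" "Tsrc \<G> (B_lift u w m) = 0" "B_lift u w m \<in> h_alg \<G>"
  using B_h_alg[OF hfield0_T[OF assms(1), of m] hfield0_T[OF assms(2), of m]]
  by (simp_all add: B_lift_def g1_closed h_alg_def)

lemma B_lift_equivariant:
  assumes u: "u \<in> vector_fields (obj_funs \<X>)" and w: "w \<in> vector_fields (obj_funs \<X>)"
  shows "B_lift u w \<in> equiv_h_funs Q"
proof -
  note t = vector_fieldsD(1)[OF u] vector_fieldsD(1)[OF w]
  have "(\<lambda>m. B_lift u w m \<phi>) \<in> obj_funs \<P>" if "\<phi> \<in> arr_funs \<G>" for \<phi>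
    using cfuns_minus[OF P.obj] is_form2D(5)[OF B_form lift_vector_field(2)[OF u] lift_vector_field(2)[OF w] that]
    by (simp add: B_lift_def obj_funs_def)
  moreover have "B_lift u w (act0 Q p g) = tau \<G> (inv0 \<G> g) (B_lift u w p)" for p g
  proof -
    have e: "hfield0 u (act0 Q p g) = Tright0 Q g (hfield0 u p)" "hfield0 w (act0 Q p g) = Tright0 Q g (hfield0 w p)"
      using lift_equivariant(2)[OF t(1)] lift_equivariant(2)[OF t(2)] by (simp_all add: Tright0_def pr_act)
    have "B (act0 Q p g) (Tright0 Q g (hfield0 u p)) (Tright0 Q g (hfield0 w p)) = tau \<G> (inv0 \<G> g) (B p (hfield0 u p) (hfield0 w p))"
      using curving hfield0_T[OF t(1), of p] hfield0_T[OF t(2), of p] by (simp add: curving_def)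
    then show ?thesis unfolding B_lift_def e by (simp add: tau_def Ad1_def adj_def)
  qed
  ultimately show ?thesis using B_lift_h_alg(3)[OF t] by (simp add: equiv_h_funs_def)
qed

text \<open>The arrow components are dropped because the curving is a form on the objects.\<close>

definition hlift_homotopy :: "('x1, 'x0) fields \<Rightarrow> ('x1, 'x0) fields \<Rightarrow> 'p0 \<Rightarrow> 'p1 tvec"
  where "hlift_homotopy \<xi> \<eta> = vsec (B_lift (snd \<xi>) (snd \<eta>))"

lemma hlift_homotopy_skew_bilinear: "skew_bilinear (LTan \<X>) (LAt Q) hlift_homotopy"
  unfolding skew_bilinear_def linear_map_on_def
proof (intro conjI ballI allI)
  fix x y c assume x: "x \<in> xm (LTan \<X>)" and y: "y \<in> xm (LTan \<X>)"
  obtain \<xi> u \<eta> w where e: "x = (\<xi>, u)" "y = (\<eta>, w)" "(\<xi>, u) \<in> mult_fields \<X>" "(\<eta>, w) \<in> mult_fields \<X>"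
    using x y by (cases x, cases y) (auto simp: LTan_def)
  note v = mult_fieldsD(2)[OF e(3)] mult_fieldsD(2)[OF e(4)]
  note t = vector_fieldsD(1)[OF v(1)] vector_fieldsD(1)[OF v(2)]
  note h = hfield0_T[OF t(1)] hfield0_T[OF t(2)]
  show "hlift_homotopy x y \<in> xc (LAt Q)"
    unfolding hlift_homotopy_def by (rule vsec_section(1)[OF B_lift_equivariant]) (use e v in auto)
  show "hlift_homotopy y x = - hlift_homotopy x y"
  proof
    fix m show "hlift_homotopy y x m = (- hlift_homotopy x y) m"
      using is_form2D(2)[OF B_form h(1)[of m] h(2)] by (simp add: hlift_homotopy_def B_lift_def e)
  qed
  show "hlift_homotopy x (scale_m (LTan \<X>) c y) = scale_c (LAt Q) c (hlift_homotopy x y)"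
  proof
    fix m show "hlift_homotopy x (scale_m (LTan \<X>) c y) m = scale_c (LAt Q) c (hlift_homotopy x y) m"
      using B_linear(2)[OF h(2)[of m] h(2) h(1)] lift0_linear(2)[OF t(2)]
      by (simp add: hlift_homotopy_def B_lift_def e LTan_def LAt_def section_scale_def vscale_uminus)
  qed
  fix z assume z: "z \<in> xm (LTan \<X>)"
  obtain \<zeta> k where z: "z = (\<zeta>, k)" "(\<zeta>, k) \<in> mult_fields \<X>" using z by (cases z) (auto simp: LTan_def)
  note tk = vector_fieldsD(1)[OF mult_fieldsD(2)[OF z(2)]]
  show "hlift_homotopy x (y + z) = hlift_homotopy x y + hlift_homotopy x z"
  proof
    fix m show "hlift_homotopy x (y + z) m = (hlift_homotopy x y + hlift_homotopy x z) m"
      using B_linear(1)[OF h(2)[of m] hfield0_T[OF tk] h(1)] lift0_linear(1)[OF t(2) tk]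
      by (simp add: hlift_homotopy_def B_lift_def e z)
  qed
qed

text \<open>Source and target map the lift of a multiplicative field to the lift of its object
  component, so the curvature at an arrow involves only the values of \<open>B_lift u w\<close> at
  its two ends; their combination in \<open>curv1_eq\<close> is that of
  \<open>vsec_delta\<close>.\<close>

lemma hlift_bracket:
  assumes x: "(\<xi>, u) \<in> mult_fields \<X>" and y: "(\<eta>, w) \<in> mult_fields \<X>"
  shows "hlift_m Q \<theta>1 \<theta>0 (fields_bracket \<X> (\<xi>, u) (\<eta>, w))
      - fields_bracket \<P> (hlift_m Q \<theta>1 \<theta>0 (\<xi>, u)) (hlift_m Q \<theta>1 \<theta>0 (\<eta>, w)) = gpd_delta \<P> (vsec (B_lift u w))"
proof -
  note dx = mult_fieldsD[OF x] and dy = mult_fieldsD[OF y]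
  note t1 = vector_fieldsD(1)[OF dx(1)] vector_fieldsD(1)[OF dy(1)]
  note t0 = vector_fieldsD(1)[OF dx(2)] vector_fieldsD(1)[OF dy(2)]
  have T: "Tsrc \<P> (hfield1 \<xi> p) = hfield0 u (src \<P> p)" "Ttgt \<P> (hfield1 \<xi> p) = hfield0 u (tgt \<P> p)"
    "Tsrc \<P> (hfield1 \<eta> p) = hfield0 w (src \<P> p)" "Ttgt \<P> (hfield1 \<eta> p) = hfield0 w (tgt \<P> p)" for p
    by (simp_all add: lift_Tsrc[OF t1(1)] lift_Tsrc[OF t1(2)] dx dy projection_morphism)
  have "lft1 p (vf_bracket (arr_funs \<X>) \<xi> \<eta> (pr1 Q p)) - vf_bracket (arr_funs \<P>) (hfield1 \<xi>) (hfield1 \<eta>) p =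
      fund1 Q p (B_lift u w (tgt \<P> p) - B_lift u w (src \<P> p) + Tident \<G> (Ttgt \<G> (B_lift u w (src \<P> p))))" for p
    unfolding lift1_vf_bracket[OF dx(1) dy(1)] curv1_eq[OF lift1(1)[OF t1(1)] lift1(1)[OF t1(2)]] T
    by (simp add: B_lift_def)
  moreover have "lft0 m (vf_bracket (obj_funs \<X>) u w (pr0 Q m)) - vf_bracket (obj_funs \<P>) (hfield0 u) (hfield0 w) m =
      fund0 Q m (Ttgt \<G> (B_lift u w m))" for m
    unfolding lift0_vf_bracket[OF dx(2) dy(2)] curv0_eq[OF lift0(1)[OF t0(1)] lift0(1)[OF t0(2)]]
    by (simp add: B_lift_def)
  ultimately show ?thesis
    by (simp add: vsec_delta[OF B_lift_h_alg(1,2)[OF t0]] fields_bracket_def hlift_m_apply fun_eq_iff)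
qed

text \<open>The action is a bracket with a right invariant field, evaluated at units. The lifted
  right invariant field has source part 0, so of the curvature only the target term remains, and its
  target part is the lift of the anchor of \<open>a\<close>.\<close>

lemma hlift_act:
  assumes x: "(\<xi>, u) \<in> mult_fields \<X>" and a: "a \<in> algd_sections \<X>"
  shows "hlift_c Q \<theta>1 (fields_act \<X> (\<xi>, u) a) - fields_act \<P> (hlift_m Q \<theta>1 \<theta>0 (\<xi>, u)) (hlift_c Q \<theta>1 a) =
    vsec (B_lift u (\<lambda>m. Ttgt \<X> (a m)))"
proof
  fix m
  note dx = mult_fieldsD[OF x] and r = X.right_inv_vector_field[OF a] and R = X.right_inv_field_T[OF a]
  note t1 = vector_fieldsD(1)[OF dx(1)] vector_fieldsD(1)[OF r]
  let ?i = "ident \<P> m"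
  have T: "Tsrc \<P> (hfield1 (right_inv_field \<X> a) ?i) = 0" "Ttgt \<P> (hfield1 (right_inv_field \<X> a) ?i) = lft0 m (Ttgt \<X> (a (pr0 Q m)))"
    "Tsrc \<P> (hfield1 \<xi> ?i) = hfield0 u m" "Ttgt \<P> (hfield1 \<xi> ?i) = hfield0 u m"
    using lift_Tsrc[OF t1(1)[of "pr1 Q ?i"]] lift_Tsrc[OF t1(2)[of "pr1 Q ?i"]]
    by (simp_all add: dx(3,4) projection_morphism R(2,3) lift_0 P.laws X.laws)
  have B0: "B m (hfield0 u m) 0 = 0"
    by (rule B_vertical(2)) (auto intro: tangent_0 hfield0_T vector_fieldsD(1)[OF dx(2)])
  have "lft1 ?i (vf_bracket (arr_funs \<X>) \<xi> (right_inv_field \<X> a) (pr1 Q ?i)) -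
      vf_bracket (arr_funs \<P>) (hfield1 \<xi>) (hfield1 (right_inv_field \<X> a)) ?i =
      fund1 Q ?i (B_lift u (\<lambda>m. Ttgt \<X> (a m)) m)"
    unfolding lift1_vf_bracket[OF dx(1) r] curv1_eq[OF lift1(1)[OF t1(1)] lift1(1)[OF t1(2)]] T
    by (simp add: B_lift_def P.laws B0)
  then show "(hlift_c Q \<theta>1 (fields_act \<X> (\<xi>, u) a) - fields_act \<P> (hlift_m Q \<theta>1 \<theta>0 (\<xi>, u)) (hlift_c Q \<theta>1 a)) m =
      vsec (B_lift u (\<lambda>m. Ttgt \<X> (a m))) m"
    by (simp only: fields_act_def hlift_m_apply hlift_right_inv[OF a] fst_conv minus_apply)
      (simp add: projection_morphism hlift_c_def)
qed

text \<open>The right invariant field of \<open>vsec f\<close> is the fundamental field of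
  \<open>f\<close> pulled back by the target map. Its bracket with a horizontal lift is vertical,
  and the curvature formula reduces the \<open>\<theta>1\<close>-value of this bracket to the
  derivative of \<open>f\<close> along the lift of \<open>u\<close>, componentwise.\<close>

lemma act_vsec:
  assumes x: "(\<xi>, u) \<in> mult_fields \<X>" and f: "f \<in> equiv_h_funs Q"
  shows "fields_act \<P> (hlift_m Q \<theta>1 \<theta>0 (\<xi>, u)) (vsec f) = vsec (\<lambda>m \<phi>. hfield0 u m (\<lambda>q. f q \<phi>))"
proof
  fix m
  note dx = mult_fieldsD[OF x] and t1 = vector_fieldsD(1)[OF mult_fieldsD(1)[OF x]]
  have h: "f m \<in> g1_alg \<G>" "Tsrc \<G> (f m) = 0" and sm: "\<phi> \<in> arr_funs \<G> \<Longrightarrow> (\<lambda>q. f q \<phi>) \<in> obj_funs \<P>" for m \<phi>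
    using f by (auto simp: equiv_h_funs_def h_alg_def)
  let ?Y = "hfield1 \<xi>" and ?V = "\<lambda>p. fund1 Q p (f (tgt \<P> p))" and ?i = "ident \<P> m"
  have Y: "?Y \<in> vector_fields (arr_funs \<P>)" "\<And>p. \<theta>1 p (?Y p) = 0"
    by (rule lift_vector_field(1)[OF dx(1)], rule lift1(3)[OF t1])
  have V: "?V \<in> vector_fields (arr_funs \<P>)"
    by (rule fund1_vector_field[OF h(1)]) (rule P.pullback(2)[OF sm])
  let ?b = "vf_bracket (arr_funs \<P>) ?Y ?V"
  have b: "?b p \<in> TP1 p" for p
    using vector_fieldsD(1)[OF vf_bracket_vector_field[OF P.arr]] Y(1) V unfolding arr_funs_def by blast
  have 0: "(\<lambda>_. 0) \<in> vector_fields (cfuns (arr_atlas \<X>))"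
    by (rule vector_fieldsI) (auto intro: cfuns_const[OF X.arr])
  \<comment> \<open>The fundamental field is related to the zero field on the base, so the bracket
    is vertical.\<close>
  have "Tpr1 (?b ?i) = vf_bracket (arr_funs \<X>) \<xi> (\<lambda>_. 0) (pr1 Q ?i)"
    unfolding arr_funs_def
    by (rule vf_bracket_related[OF P.arr X.arr _ _ 0])
      (use dx(1) pullback_pr(1) lift1(2)[OF t1] Tpr_fund(1)[OF h(1)] in \<open>auto simp: arr_funs_def\<close>)
  also have "\<dots> = 0"
    using tangent_const[OF X.arr, of _ UNIV] t1[of "pr1 Q ?i"] by (auto simp: vf_bracket_def fun_eq_iff arr_funs_def)
  finally have "?b ?i = fund1 Q ?i (\<theta>1 ?i (?b ?i))" by (rule vertical(1)[OF b])
  moreover have "\<theta>1 ?i (?b ?i) = (\<lambda>\<phi>. hfield0 u m (\<lambda>q. f q \<phi>))"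
  proof
    fix \<phi>
    have s: "(\<lambda>q. f q \<phi>) \<in> obj_funs \<P>"
    proof (cases "\<phi> \<in> arr_funs \<G>")
      case False
      then have "f q \<phi> = 0" for q using tangentD(1)[of "f q"] h(1)[of q] by (auto simp: g1_alg_def)
      then show ?thesis using cfuns_const[OF P.obj] by (simp add: obj_funs_def)
    qed (rule sm)
    have TV: "Tsrc \<P> (?V ?i) = 0" "Ttgt \<P> (?V ?i) = fund0 Q m (Ttgt \<G> (f m))"
      by (simp_all add: Tfund1 h P.laws)
    \<comment> \<open>By the curving equation the curvature is expressed through \<open>B\<close>.
      The target part of \<open>?V\<close> is vertical and its source part is 0, and
      \<open>B\<close> vanishes on both.\<close>
    have "curv1 Q \<theta>1 ?i (?Y ?i) (?V ?i) = 0"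
      using B_vertical(2)[OF fund_tangent(2)[OF g1_T(2)[OF h(1)]] P.T_tangent(2)[OF vector_fieldsD(1)[OF Y(1)], of ?i, unfolded P.laws] Tpr_fund(2)[OF g1_T(2)[OF h(1)]]]
        B_vertical(2)[OF tangent_0 P.T_tangent(1)[OF vector_fieldsD(1)[OF Y(1)], of ?i, unfolded P.laws]]
      unfolding curv1_eq[OF vector_fieldsD(1)[OF Y(1)] vector_fieldsD(1)[OF V]] TV by (simp add: P.laws)
    then have "\<theta>1 ?i (?b ?i) \<phi> = ?Y ?i (\<lambda>q. f (tgt \<P> q) \<phi>)"
      using curv1_horizontal[OF Y V, of ?i \<phi>] by (simp add: reproducing(1)[OF h(1)])
    also have "\<dots> = Ttgt \<P> (?Y ?i) (\<lambda>q. f q \<phi>)" using s by (simp add: tmap_apply)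
    also have "Ttgt \<P> (?Y ?i) = hfield0 u m"
      using lift_Tsrc(2)[OF t1[of "pr1 Q ?i"]] by (simp add: dx(4) projection_morphism P.laws X.laws)
    finally show "\<theta>1 ?i (?b ?i) \<phi> = hfield0 u m (\<lambda>q. f q \<phi>)" .
  qed
  ultimately show "fields_act \<P> (hlift_m Q \<theta>1 \<theta>0 (\<xi>, u)) (vsec f) m = vsec (\<lambda>m \<phi>. hfield0 u m (\<lambda>q. f q \<phi>)) m"
    unfolding fields_act_def hlift_m_apply fst_conv ext[of "right_inv_field \<P> (vsec f)" ?V, OF vsec_right_inv[of f, OF h]]
    by simp
qed

text \<open>The lift of a bracket differs from the bracket of the lifts by a fundamental vector,
  which the horizontal form \<open>B\<close> does not see. This matches the homotopy of a bracket
  with the bracket terms of the exterior derivative of \<open>B\<close>.\<close>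

lemma B_lift_bracket:
  assumes u: "u \<in> vector_fields (obj_funs \<X>)" and v: "v \<in> vector_fields (obj_funs \<X>)" and w: "w \<in> vector_fields (obj_funs \<X>)"
  shows "B_lift (vf_bracket (obj_funs \<X>) u v) w m = - B m (vf_bracket (obj_funs \<P>) (hfield0 u) (hfield0 v) m) (hfield0 w m)"
proof -
  note l = lift_vector_field(2)[OF u] lift_vector_field(2)[OF v]
  let ?c = "curv0 Q \<theta>0 m (hfield0 u m) (hfield0 v m)"
  have b: "vf_bracket (obj_funs \<P>) (hfield0 u) (hfield0 v) m \<in> TP0 m"
    using vector_fieldsD(1)[OF vf_bracket_vector_field[OF P.obj]] l unfolding obj_funs_def by blast
  have c: "?c \<in> g0_alg \<G>"
    using curv0_eq[OF vector_fieldsD(1)[OF l(1)] vector_fieldsD(1)[OF l(2)], of m]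
      g1_T(2)[OF B_h_alg(1)[OF vector_fieldsD(1)[OF l(1)] vector_fieldsD(1)[OF l(2)], of m]]
    by (auto simp: g0_alg_def)
  have "lft0 m (vf_bracket (obj_funs \<X>) u v (pr0 Q m)) = vf_bracket (obj_funs \<P>) (hfield0 u) (hfield0 v) m + fund0 Q m ?c"
    using lift0_vf_bracket[OF u v, of m] by (simp add: algebra_simps)
  then show ?thesis
    using B_linear(3)[OF b fund_tangent(2)[OF c] hfield0_T[OF vector_fieldsD(1)[OF w]]]
      B_vertical(1)[OF fund_tangent(2)[OF c] hfield0_T[OF vector_fieldsD(1)[OF w]] Tpr_fund(2)[OF c]]
    by (simp add: B_lift_def)
qed

text \<open>Weak flatness enters only here: the cyclic sum is the fundamental vector of the curvature 3-form.\<close>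

lemma hlift_coherence:
  assumes wf: "weakly_flat Q \<theta>0 B"
    and m: "(\<xi>1, u1) \<in> mult_fields \<X>" "(\<xi>2, u2) \<in> mult_fields \<X>" "(\<xi>3, u3) \<in> mult_fields \<X>"
  shows "(vsec (B_lift (vf_bracket (obj_funs \<X>) u1 u2) u3) - fields_act \<P> (hlift_m Q \<theta>1 \<theta>0 (\<xi>1, u1)) (vsec (B_lift u2 u3))) +
    (vsec (B_lift (vf_bracket (obj_funs \<X>) u2 u3) u1) - fields_act \<P> (hlift_m Q \<theta>1 \<theta>0 (\<xi>2, u2)) (vsec (B_lift u3 u1))) +
    (vsec (B_lift (vf_bracket (obj_funs \<X>) u3 u1) u2) - fields_act \<P> (hlift_m Q \<theta>1 \<theta>0 (\<xi>3, u3)) (vsec (B_lift u1 u2))) = 0"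
proof -
  note v = mult_fieldsD(2)[OF m(1)] mult_fieldsD(2)[OF m(2)] mult_fieldsD(2)[OF m(3)]
  note l = lift_vector_field(2)[OF v(1)] lift_vector_field(2)[OF v(2)] lift_vector_field(2)[OF v(3)]
  let ?b = "vf_bracket (obj_funs \<P>)" and ?C = "obj_funs \<P>"
  define D where "D u f = (\<lambda>m \<phi>. hfield0 u m (\<lambda>q. f q \<phi>))" for u and f :: "'p0 \<Rightarrow> 'g1 tvec"
  have act: "fields_act \<P> (hlift_m Q \<theta>1 \<theta>0 (\<xi>, u)) (vsec (B_lift w w')) = vsec (D u (B_lift w w'))"
    if "(\<xi>, u) \<in> mult_fields \<X>" "w \<in> vector_fields (obj_funs \<X>)" "w' \<in> vector_fields (obj_funs \<X>)" for \<xi> u w w'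
    unfolding D_def by (rule act_vsec[OF that(1) B_lift_equivariant[OF that(2,3)]])
  have D: "D u (B_lift w w') q \<phi> = - hfield0 u q (\<lambda>q. B q (hfield0 w q) (hfield0 w' q) \<phi>)"
    if u: "u \<in> vector_fields (obj_funs \<X>)" and w: "w \<in> vector_fields (obj_funs \<X>)" "w' \<in> vector_fields (obj_funs \<X>)" for u w w' q \<phi>
  proof -
    note lw = lift_vector_field(2)[OF w(1)] lift_vector_field(2)[OF w(2)]
    have s: "(\<lambda>q. B q (hfield0 w q) (hfield0 w' q) \<phi>) \<in> cfuns (obj_atlas \<P>)"
    proof (cases "\<phi> \<in> arr_funs \<G>")
      case True
      then show ?thesis using is_form2D(5)[OF B_form lw] by (simp add: obj_funs_def)
    next
      case False
      then have "B q (hfield0 w q) (hfield0 w' q) \<phi> = 0" for q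
        using tangentD(1)[OF B_h_alg(1)[OF vector_fieldsD(1)[OF lw(1)] vector_fieldsD(1)[OF lw(2)], unfolded g1_alg_def]] by blast
      then show ?thesis using cfuns_const[OF P.obj] by simp
    qed
    have lu: "hfield0 u q \<in> tangent (cfuns (obj_atlas \<P>)) q"
      using vector_fieldsD(1)[OF lift_vector_field(2)[OF u]] by (simp add: obj_funs_def)
    show ?thesis using tangentD(3)[OF lu s, of "- 1"] by (simp add: D_def B_lift_def)
  qed
  have "fund1 Q p (
      (B_lift (vf_bracket (obj_funs \<X>) u1 u2) u3 q - D u1 (B_lift u2 u3) q) +
      (B_lift (vf_bracket (obj_funs \<X>) u2 u3) u1 q - D u2 (B_lift u3 u1) q) +
      (B_lift (vf_bracket (obj_funs \<X>) u3 u1) u2 q - D u3 (B_lift u1 u2) q)) = 0" (is "fund1 Q p ?s = 0") for p q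
  proof -
    \<comment> \<open>Lifts are already horizontal, so on them the curvature 3-form is the plain
      exterior derivative of \<open>B\<close>, to which the invariant formula applies with the
      lifted fields.\<close>
    have hor: "hor0 Q \<theta>0 q (hfield0 u q) = hfield0 u q" if "u \<in> vector_fields (obj_funs \<X>)" for u
      using lift0(3)[OF vector_fieldsD(1)[OF that]] by (simp add: hor0_def)
    have E0: "ext_d2 ?C B q (hfield0 u1 q) (hfield0 u2 q) (hfield0 u3 q) = 0"
      using wf vector_fieldsD(1)[OF l(1), of q] vector_fieldsD(1)[OF l(2), of q] vector_fieldsD(1)[OF l(3), of q]
      unfolding weakly_flat_def curv_3form_def by (metis hor[OF v(1)] hor[OF v(2)] hor[OF v(3)])
    have E: "ext_d2 ?C B q (hfield0 u1 q) (hfield0 u2 q) (hfield0 u3 q) \<phi> = ?s \<phi>" for \<phi>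
    proof -
      have "ext_d2 ?C B q (hfield0 u1 q) (hfield0 u2 q) (hfield0 u3 q) \<phi> =
          hfield0 u1 q (\<lambda>q. B q (hfield0 u2 q) (hfield0 u3 q) \<phi>) + hfield0 u2 q (\<lambda>q. B q (hfield0 u3 q) (hfield0 u1 q) \<phi>)
          + hfield0 u3 q (\<lambda>q. B q (hfield0 u1 q) (hfield0 u2 q) \<phi>)
          - B q (?b (hfield0 u1) (hfield0 u2) q) (hfield0 u3 q) \<phi> - B q (?b (hfield0 u2) (hfield0 u3) q) (hfield0 u1 q) \<phi>
          - B q (?b (hfield0 u3) (hfield0 u1) q) (hfield0 u2 q) \<phi>"
        unfolding obj_funs_def
        by (rule ext_d2_eq[OF P.obj B_form[unfolded obj_funs_def]])
          (use l in \<open>auto simp: obj_funs_def h_alg_def g1_alg_def tangentD(1)\<close>)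
      then show ?thesis
        by (simp add: B_lift_bracket[OF v(1,2,3)] B_lift_bracket[OF v(2,3,1)] B_lift_bracket[OF v(3,1,2)]
            D[OF v(1,2,3)] D[OF v(2,3,1)] D[OF v(3,1,2)])
    qed
    have "?s = 0" by (rule ext) (simp only: E[symmetric] E0)
    then show ?thesis by (simp only: fund_linear(4))
  qed
  then show ?thesis
    unfolding act[OF m(1) v(2,3)] act[OF m(2) v(3,1)] act[OF m(3) v(1,2)] by (simp add: fun_eq_iff)
qed

text \<open>Every term of the invariant formula is a value of \<open>B\<close> or a derivative of a
  function that vanishes identically. The strict case can thus reuse the equations of the weak
  one.\<close>

lemma flat_weakly_flat:
  assumes "flat Q B"
  shows "weakly_flat Q \<theta>0 B"
proof -
  have B0: "B p v w = 0" if "v \<in> TP0 p" "w \<in> TP0 p" for p v w using assms that by (simp add: flat_def)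
  have "curv_3form Q \<theta>0 B p u v w = 0" if "u \<in> TP0 p" "v \<in> TP0 p" "w \<in> TP0 p" for p u v w
  proof -
    have h: "hor0 Q \<theta>0 p x \<in> tangent (cfuns (obj_atlas \<P>)) p" if "x \<in> TP0 p" for x
      using tangent_diff[OF that fund_tangent(2)[OF theta_in(2)[OF that]]] by (simp add: hor0_def obj_funs_def)
    define X where "X x = extend_vec (cfuns (obj_atlas \<P>)) p (hor0 Q \<theta>0 p x)" for x
    have X: "X x \<in> vector_fields (obj_funs \<P>)" if "x \<in> TP0 p" for x
      using extend_vec(1)[OF P.obj h[OF that]] by (simp add: X_def obj_funs_def)
    have b: "vf_bracket (obj_funs \<P>) (X x) (X y) p \<in> TP0 p" if "x \<in> TP0 p" "y \<in> TP0 p" for x y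
      using vector_fieldsD(1)[OF vf_bracket_vector_field[OF P.obj]] X that unfolding obj_funs_def by blast
    have c: "X x p (\<lambda>q. 0) = 0" if "x \<in> TP0 p" for x
      using tangent_const[OF P.obj, of "X x p" UNIV p 0] vector_fieldsD(1)[OF X[OF that], of p] by (simp add: obj_funs_def)
    show ?thesis
      unfolding curv_3form_def ext_d2_def Let_def obj_funs_def X_def[symmetric]
      using that b[folded obj_funs_def] vector_fieldsD(1)[OF X] c by (simp add: B0 fun_eq_iff flip: obj_funs_def)
  qed
  then show ?thesis unfolding weakly_flat_def by blast
qed

section \<open>The horizontal lift as a morphism of strict Lie 2-algebras\<close>

lemma LAt_simps: "xdelta (LAt Q) = gpd_delta \<P>" "xbr (LAt Q) = fields_bracket \<P>" "xact (LAt Q) = fields_act \<P>"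
  "xdelta (LTan \<X>) = gpd_delta \<X>" "xbr (LTan \<X>) = fields_bracket \<X>" "xact (LTan \<X>) = fields_act \<X>"
  "xm (LTan \<X>) = mult_fields \<X>" "xc (LTan \<X>) = algd_sections \<X>"
  by (simp_all add: LAt_def LTan_def)

lemma morphism_eqs_hlift:
  assumes "weakly_flat Q \<theta>0 B"
  shows "morphism_eqs (LTan \<X>) (LAt Q) (hlift_c Q \<theta>1) (hlift_m Q \<theta>1 \<theta>0) hlift_homotopy"
  unfolding morphism_eqs_def LAt_simps
proof (intro conjI ballI)
  fix x assume x: "x \<in> mult_fields \<X>"
  show "hlift_c Q \<theta>1 (fields_act \<X> x a) - fields_act \<P> (hlift_m Q \<theta>1 \<theta>0 x) (hlift_c Q \<theta>1 a) = hlift_homotopy x (gpd_delta \<X> a)"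
    if "a \<in> algd_sections \<X>" for a
    using hlift_act[of "fst x" "snd x" a] x that by (simp add: hlift_homotopy_def gpd_delta_def)
  fix y assume y: "y \<in> mult_fields \<X>"
  show "hlift_m Q \<theta>1 \<theta>0 (fields_bracket \<X> x y) - fields_bracket \<P> (hlift_m Q \<theta>1 \<theta>0 x) (hlift_m Q \<theta>1 \<theta>0 y) =
      gpd_delta \<P> (hlift_homotopy x y)"
    using hlift_bracket[of "fst x" "snd x" "fst y" "snd y"] x y by (simp add: hlift_homotopy_def)
  fix z assume z: "z \<in> mult_fields \<X>"
  show "hlift_homotopy (fields_bracket \<X> x y) z - fields_act \<P> (hlift_m Q \<theta>1 \<theta>0 x) (hlift_homotopy y z) +
      (hlift_homotopy (fields_bracket \<X> y z) x - fields_act \<P> (hlift_m Q \<theta>1 \<theta>0 y) (hlift_homotopy z x)) +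
      (hlift_homotopy (fields_bracket \<X> z x) y - fields_act \<P> (hlift_m Q \<theta>1 \<theta>0 z) (hlift_homotopy x y)) = 0"
    using hlift_coherence[OF assms, of "fst x" "snd x" "fst y" "snd y" "fst z" "snd z"] x y z
    by (simp add: hlift_homotopy_def fields_bracket_def)
qed

lemma weak_morphism_hlift:
  assumes "weakly_flat Q \<theta>0 B"
  shows "weak_morphism (LTan \<X>) (LAt Q) (vertical_sections Q) (hlift_c Q \<theta>1) (hlift_m Q \<theta>1 \<theta>0)"
proof -
  have "hlift_homotopy x y \<in> vertical_sections Q" if "x \<in> xm (LTan \<X>)" "y \<in> xm (LTan \<X>)" for x y
    unfolding hlift_homotopy_def
    by (rule vsec_section(2)[OF B_lift_equivariant])
      (use that mult_fieldsD(2)[of "fst x" "snd x" \<X>] mult_fieldsD(2)[of "fst y" "snd y" \<X>] in \<open>simp_all add: LAt_simps\<close>)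
  then show ?thesis
    unfolding weak_morphism_def using chain_map_hlift hlift_homotopy_skew_bilinear morphism_eqs_hlift[OF assms] by blast
qed

lemma strict_morphism_hlift:
  assumes "flat Q B"
  shows "strict_morphism (LTan \<X>) (LAt Q) (hlift_c Q \<theta>1) (hlift_m Q \<theta>1 \<theta>0)"
proof -
  \<comment> \<open>Flatness speaks of tangent vectors only, so the homotopy is known to vanish once
    the object components of its arguments are tangent. The facts \<open>m\<close>, \<open>s\<close>
    and \<open>b\<close> check this for the three kinds of arguments in the equations: given fields,
    images of sections under \<open>gpd_delta\<close>, and brackets.\<close>
  have 0: "hlift_homotopy x y = 0" if "\<And>p. snd x p \<in> TX0 p" "\<And>p. snd y p \<in> TX0 p" for x y
  proof
    fix m show "hlift_homotopy x y m = 0 m"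
      using assms hfield0_T[of "snd x" m, OF that(1)] hfield0_T[of "snd y" m, OF that(2)]
      by (simp add: hlift_homotopy_def B_lift_def flat_def)
  qed
  have m: "snd x p \<in> TX0 p" if "x \<in> mult_fields \<X>" for x p
    using vector_fieldsD(1)[OF mult_fieldsD(2)[of "fst x" "snd x" \<X>]] that by simp
  have s: "snd (gpd_delta \<X> a) p \<in> TX0 p" if "a \<in> algd_sections \<X>" for a p
    using X.T_tangent(2)[OF algd_sectionsD(1)[OF that]] by (simp add: gpd_delta_def X.laws)
  have b: "snd (fields_bracket \<X> x y) p \<in> TX0 p" if "x \<in> mult_fields \<X>" "y \<in> mult_fields \<X>" for x y p
    using vector_fieldsD(1)[OF vf_bracket_vector_field[OF X.obj], of "snd x" "snd y" p]
      mult_fieldsD(2)[of "fst x" "snd x" \<X>] mult_fieldsD(2)[of "fst y" "snd y" \<X>] that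
    by (simp add: fields_bracket_def obj_funs_def)
  have "morphism_eqs (LTan \<X>) (LAt Q) (hlift_c Q \<theta>1) (hlift_m Q \<theta>1 \<theta>0) (\<lambda>_ _. 0)"
    using morphism_eqs_hlift[OF flat_weakly_flat[OF assms]]
    unfolding morphism_eqs_def LAt_simps by (simp add: 0 m s b)
  then show ?thesis unfolding strict_morphism_def using chain_map_hlift by blast
qed

end

theorem theorem5p43:
  fixes Q :: "('p1::{t2_space,second_countable_topology}, 'ep1::real_normed_vector,
    'p0::{t2_space,second_countable_topology}, 'ep0::real_normed_vector,
    'x1::{t2_space,second_countable_topology}, 'ex1::real_normed_vector,
    'x0::{t2_space,second_countable_topology}, 'ex0::real_normed_vector,
    'g1::{t2_space,second_countable_topology}, 'eg1::real_normed_vector,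
    'g0::{t2_space,second_countable_topology}, 'eg0::real_normed_vector) bundle2"
    and \<theta>1 :: "'p1 \<Rightarrow> 'p1 tvec \<Rightarrow> 'g1 tvec"
    and \<theta>0 :: "'p0 \<Rightarrow> 'p0 tvec \<Rightarrow> 'g0 tvec"
    and B :: "'p0 \<Rightarrow> 'p0 tvec \<Rightarrow> 'p0 tvec \<Rightarrow> 'g1 tvec"
  assumes "principal_2bundle Q"
    and "connective_structure Q \<theta>1 \<theta>0 B"
  shows "(weakly_flat Q \<theta>0 B \<longrightarrow>
      weak_morphism (LTan (base Q)) (LAt Q) (vertical_sections Q) (hlift_c Q \<theta>1) (hlift_m Q \<theta>1 \<theta>0)) \<and>
    (flat Q B \<longrightarrow>
      strict_morphism (LTan (base Q)) (LAt Q) (hlift_c Q \<theta>1) (hlift_m Q \<theta>1 \<theta>0))"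
proof -
  interpret connective Q \<theta>1 \<theta>0 B using assms by unfold_locales
  show ?thesis using weak_morphism_hlift strict_morphism_hlift by blast
qed

end
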